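(* Let $1<p<\infty$, let $X$ be a Banach space, let $A:D(A)\subset X\to X$ generate a $C_0$-semigroup $(\mathbb{T}(t))_{t\ge 0}$ on $X$, let $b\in W^{1,p}(\mathbb{R}_+,\mathbb{C})$, and let $L,K\in\mathcal{L}(W^{1,p}([-1,0],X),X)$. Suppose that either both $L$ and $K$ satisfy condition $(M_1)$, or both $L$ and $K$ satisfy condition $(M_p)$. Then the retarded integro-differential equation $$\dot x(t)=Ax(t)+\int_0^t b(t-\tau)Lx_\tau\,d\tau+Kx_t\quad(t\ge 0),\qquad x(0)=x,\quad x_0=\varphi,$$ is well-posed, and its solution is given by $$x(t)=\mathbb{T}(t)x+\int_0^t\mathbb{T}(t-s)\int_0^s b(s-\tau)Lx_\tau\,d\tau\,ds+\int_0^t\mathbb{T}(t-s)Kx_s\,ds$$ for $\begin{pmatrix}x\\ \varphi\end{pmatrix}\in D(A)\times W^{1,p}([-1,0],X)$.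
   Context: For a function $x:[-1,\infty)\to X$ and $t\ge0$, the history function $x_t:[-1,0]\to X$ is $x_t(\theta)=x(t+\theta)$. In general the initial condition $(x,\varphi)$ of the equation is taken in $X\times L^p([-1,0],X)$. Let $\mathcal{X}=X\times L^p([-1,0],X)\times L^p(\mathbb{R}_+,X)$ with the sum norm $\|\chi\|+\|\psi\|_{L^p}+\|h\|_{L^p}$, where $\mathbb{R}_+=[0,\infty)$. Define the operator $\mathcal{A}$ on $\mathcal{X}$ by $$D(\mathcal{A})=\{(\chi,\psi,h)\in D(A)\times W^{1,p}([-1,0],X)\times W^{1,p}(\mathbb{R}_+,X):\ \psi(0)=\chi\},$$ $$\mathcal{A}(\chi,\psi,h)=\big(A\chi+K\psi+h(0),\ \psi',\ b(\cdot)L\psi+h'\big).$$ Well-posedness: the equation is rewritten as the Cauchy problem $\dot\Upsilon(t)=\mathcal{A}\Upsilon(t)$, $\Upsilon(0)=(x,\varphi,0)$, in $\mathcal{X}$ for $\Upsilon(t)=(x(t),x_t,g(t))$, where $g(t)(s)=\int_0^t b(t+s-\tau)Lx_\tau\,d\tau$; it is well-posed if $\mathcal{A}$ generates a $C_0$-semigroup $(\mathcal{T}(t))_{t\ge0}$ on $\mathcal{X}$. In that case the solution $x(t)$ of the equation is the first component of $\mathcal{T}(t)(x,\varphi,0)$. Notation for the conditions: $(\mathbb{S}^0(t))_{t\ge0}$ is the nilpotent left shift semigroup on $L^p([-1,0],X)$, i.e. $(\mathbb{S}^0(t)\varphi)(\theta)=\varphi(t+\theta)$ if $t+\theta\le 0$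 and $0$ otherwise. For $t\geq 0$, $\mathbb{T}_t:X\to L^p([-1,0],X)$ is given by $(\mathbb{T}_tx)(\tau)=\mathbb{T}(t+\tau)x$ for $-t<\tau\le0$ and $0$ for $-1\le\tau\le -t$. Let $D(\boldsymbol{A})=\{(x,\varphi)\in D(A)\times W^{1,p}([-1,0],X):\varphi(0)=x\}$. Condition $(M_q)$, $q\ge1$: an operator $\Xi\in\mathcal{L}(W^{1,p}([-1,0],X),X)$ satisfies $(M_q)$ if there exist $\alpha>0$ and $\gamma_\Xi(\alpha)\ge0$ such that $$\int_0^\alpha\|\Xi(\mathbb{T}_\tau x+\mathbb{S}^0(\tau)\varphi)\|^q\,d\tau\le\gamma_\Xi(\alpha)^q\,\big(\|x\|+\|\varphi\|_{L^p}\big)^q\quad\text{for all }(x,\varphi)\in D(\boldsymbol{A}).$$ When $q=1$ it is additionally required that this holds for all sufficiently small $\alpha>0$ with constants such that $\lim_{\alpha\to0}\gamma_\Xi(\alpha)=0$.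
   Formalization: The solution formula is stated for initial data with φ(0)=x (x_0=φ read pointwise); if φ(0)≠x, the history x_t jumps inside [-1,0] for 0<t<1, so it is not in W^{1,p} and Lx_t, Kx_t are undefined. *)

theory Defs
  imports "HOL-Analysis.Analysis"
begin

section \<open>Complex Banach spaces\<close>

class complex_vector = real_vector +
  fixes scaleC :: "complex \<Rightarrow> 'a \<Rightarrow> 'a"  (infixr \<open>*\<^sub>C\<close> 75)
  assumes scaleC_add_right: "a *\<^sub>C (x + y) = a *\<^sub>C x + a *\<^sub>C y"
    and scaleC_add_left: "(a + b) *\<^sub>C x = a *\<^sub>C x + b *\<^sub>C x"
    and scaleC_scaleC: "a *\<^sub>C (b *\<^sub>C x) = (a * b) *\<^sub>C x"
    and scaleC_of_real: "complex_of_real r *\<^sub>C x = r *\<^sub>R x"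

class complex_banach = complex_vector + banach +
  assumes norm_scaleC: "norm (a *\<^sub>C x) = cmod a * norm x"

instantiation prod :: (complex_vector, complex_vector) complex_vector
begin

definition scaleC_prod :: "complex \<Rightarrow> 'a \<times> 'b \<Rightarrow> 'a \<times> 'b"
  where "scaleC_prod c z = (c *\<^sub>C fst z, c *\<^sub>C snd z)"

instance
  by standard
    (simp_all add: scaleC_prod_def scaleC_add_right scaleC_add_left scaleC_scaleC
      scaleC_of_real scaleR_prod_def)

end


section \<open>Strong measurability and the Bochner integral\<close>

text \<open>The Bochner integral of \<^theory>\<open>HOL-Analysis.Bochner_Integration\<close> is restricted to
  second countable (i.e. separable) range spaces. The following is the same construction for an
  arbitrary normed space, with Borel measurability replaced by strong measurability.\<close>

definition strongly_measurable :: "'m measure \<Rightarrow> ('m \<Rightarrow> 'a::real_normed_vector) \<Rightarrow> bool"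
  where "strongly_measurable M f \<longleftrightarrow>
    (\<exists>s. (\<forall>i. simple_function M (s i)) \<and> (AE x in M. (\<lambda>i::nat. s i x) \<longlonglongrightarrow> f x))"

definition has_strong_integral :: "'m measure \<Rightarrow> ('m \<Rightarrow> 'a::real_normed_vector) \<Rightarrow> 'a \<Rightarrow> bool"
  where "has_strong_integral M f I \<longleftrightarrow> strongly_measurable M f \<and>
    (\<exists>s. (\<forall>i::nat. Bochner_Integration.simple_bochner_integrable M (s i)) \<and>
      (\<lambda>i. \<integral>\<^sup>+x. ennreal (norm (f x - s i x)) \<partial>M) \<longlonglongrightarrow> 0 \<and>
      (\<lambda>i. Bochner_Integration.simple_bochner_integral M (s i)) \<longlonglongrightarrow> I)"

definition strong_integrable :: "'m measure \<Rightarrow> ('m \<Rightarrow> 'a::real_normed_vector) \<Rightarrow> bool"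
  where "strong_integrable M f \<longleftrightarrow> (\<exists>I. has_strong_integral M f I)"

definition strong_integral :: "'m measure \<Rightarrow> ('m \<Rightarrow> 'a::real_normed_vector) \<Rightarrow> 'a"
  where "strong_integral M f = (THE I. has_strong_integral M f I)"


section \<open>Functions modulo equality almost everywhere\<close>

quotient_type 'a aefun = "real \<Rightarrow> 'a" / "\<lambda>f g. AE x in lebesgue. f x = g x"
proof (rule equivpI)
  show "reflp (\<lambda>f g :: real \<Rightarrow> 'a. AE x in lebesgue. f x = g x)"
    by (simp add: reflp_def)
  show "symp (\<lambda>f g :: real \<Rightarrow> 'a. AE x in lebesgue. f x = g x)"
    by (auto simp: symp_def elim: eventually_mono)
  show "transp (\<lambda>f g :: real \<Rightarrow> 'a. AE x in lebesgue. f x = g x)"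
  proof (rule transpI)
    fix f g h :: "real \<Rightarrow> 'a"
    assume "AE x in lebesgue. f x = g x" "AE x in lebesgue. g x = h x"
    then show "AE x in lebesgue. f x = h x"
      by eventually_elim simp
  qed
qed

instantiation aefun :: (real_vector) real_vector
begin

lift_definition zero_aefun :: "'a aefun" is "\<lambda>_. 0" .

lift_definition plus_aefun :: "'a aefun \<Rightarrow> 'a aefun \<Rightarrow> 'a aefun"
  is "\<lambda>f g x. f x + g x" by (erule (1) eventually_elim2) simp

lift_definition minus_aefun :: "'a aefun \<Rightarrow> 'a aefun \<Rightarrow> 'a aefun"
  is "\<lambda>f g x. f x - g x" by (erule (1) eventually_elim2) simp

lift_definition uminus_aefun :: "'a aefun \<Rightarrow> 'a aefun"
  is "\<lambda>f x. - f x" by (erule eventually_mono) simp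

lift_definition scaleR_aefun :: "real \<Rightarrow> 'a aefun \<Rightarrow> 'a aefun"
  is "\<lambda>c f x. c *\<^sub>R f x" by (erule eventually_mono) simp

instance
  by standard (transfer; simp add: algebra_simps)+

end

instantiation aefun :: (complex_vector) complex_vector
begin

lift_definition scaleC_aefun :: "complex \<Rightarrow> 'a aefun \<Rightarrow> 'a aefun"
  is "\<lambda>c f x. c *\<^sub>C f x" by (erule eventually_mono) simp

instance
  by standard
    (transfer; simp add: scaleC_add_right scaleC_add_left scaleC_scaleC scaleC_of_real)+

end


section \<open>The spaces \<open>L\<^sup>p(S, X)\<close> and \<open>W\<^sup>1\<^sup>,\<^sup>p(S, X)\<close>\<close>

text \<open>A function on \<open>S\<close> is identified with its extension by zero to the real line.\<close>

definition class_on :: "real set \<Rightarrow> (real \<Rightarrow> 'a::zero) \<Rightarrow> 'a aefun"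
  where "class_on S f = abs_aefun (\<lambda>s. if s \<in> S then f s else 0)"

definition Lp :: "real \<Rightarrow> real set \<Rightarrow> 'a::real_normed_vector aefun set"
  where "Lp p S = {class_on S f | f. strongly_measurable (lebesgue_on S) f \<and>
    (\<integral>\<^sup>+s. ennreal (norm (f s) powr p) \<partial>lebesgue_on S) < \<infinity>}"

definition Lp_norm :: "real \<Rightarrow> 'a::real_normed_vector aefun \<Rightarrow> real"
  where "Lp_norm p F = (\<integral>s. norm (rep_aefun F s) powr p \<partial>lebesgue) powr (1 / p)"

text \<open>\<open>S\<close> is an interval below. \<open>W\<^sup>1\<^sup>,\<^sup>p(S, X)\<close> consists of the classes \<open>F\<close> in \<open>L\<^sup>p(S, X)\<close> having a
  representative \<open>f\<close> that is an indefinite Bochner integral of some \<open>G\<close> in \<open>L\<^sup>p(S, X)\<close>. Then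
  \<open>f\<close> is the continuous representative of \<open>F\<close>, and \<open>G\<close> is its weak derivative. (As \<open>X\<close> need not
  have the Radon-Nikodym property, absolute continuity of \<open>f\<close> alone would not suffice.)\<close>

definition W1p_rep ::
    "real \<Rightarrow> real set \<Rightarrow> 'a::banach aefun \<Rightarrow> (real \<Rightarrow> 'a) \<Rightarrow> 'a aefun \<Rightarrow> bool"
  where "W1p_rep p S F f G \<longleftrightarrow> F = class_on S f \<and> G \<in> Lp p S \<and>
    (\<forall>s\<in>S. \<forall>t\<in>S. s \<le> t \<longrightarrow> f t - f s = strong_integral (lebesgue_on {s..t}) (rep_aefun G))"

definition W1p :: "real \<Rightarrow> real set \<Rightarrow> 'a::banach aefun set"
  where "W1p p S = {F \<in> Lp p S. \<exists>f G. W1p_rep p S F f G}"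

definition W1p_eval :: "real \<Rightarrow> real set \<Rightarrow> 'a::banach aefun \<Rightarrow> real \<Rightarrow> 'a"
  where "W1p_eval p S F t = (THE y. \<exists>f G. W1p_rep p S F f G \<and> y = f t)"

definition W1p_deriv :: "real \<Rightarrow> real set \<Rightarrow> 'a::banach aefun \<Rightarrow> 'a aefun"
  where "W1p_deriv p S F = (THE G. \<exists>f. W1p_rep p S F f G)"

definition W1p_norm :: "real \<Rightarrow> real set \<Rightarrow> 'a::banach aefun \<Rightarrow> real"
  where "W1p_norm p S F = (Lp_norm p F powr p + Lp_norm p (W1p_deriv p S F) powr p) powr (1 / p)"


section \<open>Bounded operators and generators of \<open>C\<^sub>0\<close>-semigroups\<close>

text \<open>A normed space is given by its carrier \<open>V\<close>, a subspace of the ambient type, and its norm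
  \<open>nV\<close>. Nothing is assumed about operators outside the carrier, or about \<open>T t\<close> for \<open>t < 0\<close>.\<close>

definition bounded_op ::
    "'v::complex_vector set \<Rightarrow> ('v \<Rightarrow> real) \<Rightarrow> 'w::complex_vector set \<Rightarrow> ('w \<Rightarrow> real) \<Rightarrow>
      ('v \<Rightarrow> 'w) \<Rightarrow> bool"
  where "bounded_op V nV W nW T \<longleftrightarrow>
    (\<forall>v\<in>V. T v \<in> W) \<and>
    (\<forall>u\<in>V. \<forall>v\<in>V. T (u + v) = T u + T v) \<and>
    (\<forall>c. \<forall>v\<in>V. T (c *\<^sub>C v) = c *\<^sub>C T v) \<and>
    (\<exists>C. \<forall>v\<in>V. nW (T v) \<le> C * nV v)"

definition C0_semigroup ::
    "'v::complex_vector set \<Rightarrow> ('v \<Rightarrow> real) \<Rightarrow> (real \<Rightarrow> 'v \<Rightarrow> 'v) \<Rightarrow> bool"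
  where "C0_semigroup V nV T \<longleftrightarrow>
    (\<forall>t\<ge>0. bounded_op V nV V nV (T t)) \<and>
    (\<forall>v\<in>V. T 0 v = v) \<and>
    (\<forall>s\<ge>0. \<forall>t\<ge>0. \<forall>v\<in>V. T (s + t) v = T s (T t v)) \<and>
    (\<forall>v\<in>V. ((\<lambda>t. nV (T t v - v)) \<longlongrightarrow> 0) (at_right 0))"

definition generator_graph ::
    "'v::complex_vector set \<Rightarrow> ('v \<Rightarrow> real) \<Rightarrow> (real \<Rightarrow> 'v \<Rightarrow> 'v) \<Rightarrow> ('v \<times> 'v) set"
  where "generator_graph V nV T =
    {(v, w). v \<in> V \<and> w \<in> V \<and>
      ((\<lambda>t. nV ((1 / t) *\<^sub>R (T t v - v) - w)) \<longlongrightarrow> 0) (at_right 0)}"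

definition generates ::
    "'v::complex_vector set \<Rightarrow> ('v \<Rightarrow> real) \<Rightarrow> 'v set \<Rightarrow> ('v \<Rightarrow> 'v) \<Rightarrow>
      (real \<Rightarrow> 'v \<Rightarrow> 'v) \<Rightarrow> bool"
  where "generates V nV D A T \<longleftrightarrow>
    C0_semigroup V nV T \<and> generator_graph V nV T = {(v, A v) | v. v \<in> D}"


section \<open>The delay equation\<close>

definition history :: "(real \<Rightarrow> 'a::zero) \<Rightarrow> real \<Rightarrow> 'a aefun"
  where "history u t = class_on {-1..0} (\<lambda>\<theta>. u (t + \<theta>))"

definition nilpotent_shift :: "real \<Rightarrow> 'a::zero aefun \<Rightarrow> 'a aefun"
  where "nilpotent_shift t \<phi> =
    class_on {-1..0} (\<lambda>\<theta>. if t + \<theta> \<le> 0 then rep_aefun \<phi> (t + \<theta>) else 0)"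

definition semigroup_history :: "(real \<Rightarrow> 'a \<Rightarrow> 'a) \<Rightarrow> real \<Rightarrow> 'a \<Rightarrow> 'a::zero aefun"
  where "semigroup_history T t x = class_on {-1..0} (\<lambda>\<tau>. if - t < \<tau> then T (t + \<tau>) x else 0)"

definition delay_dom :: "real \<Rightarrow> 'a::banach set \<Rightarrow> ('a \<times> 'a aefun) set"
  where "delay_dom p DA =
    {(x, \<phi>). x \<in> DA \<and> \<phi> \<in> W1p p {-1..0} \<and> W1p_eval p {-1..0} \<phi> 0 = x}"

definition M_estimate ::
    "real \<Rightarrow> 'a::banach set \<Rightarrow> (real \<Rightarrow> 'a \<Rightarrow> 'a) \<Rightarrow> real \<Rightarrow> ('a aefun \<Rightarrow> 'a) \<Rightarrow>
      real \<Rightarrow> real \<Rightarrow> bool"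
  where "M_estimate p DA T q \<Xi> \<alpha> \<gamma> \<longleftrightarrow>
    (\<forall>(x, \<phi>) \<in> delay_dom p DA.
      (\<integral>\<^sup>+\<tau>\<in>{0..\<alpha>}. ennreal
          (norm (\<Xi> (semigroup_history T \<tau> x + nilpotent_shift \<tau> \<phi>)) powr q) \<partial>lebesgue)
        \<le> ennreal (\<gamma> powr q * (norm x + Lp_norm p \<phi>) powr q))"

definition M_condition ::
    "real \<Rightarrow> 'a::banach set \<Rightarrow> (real \<Rightarrow> 'a \<Rightarrow> 'a) \<Rightarrow> real \<Rightarrow> ('a aefun \<Rightarrow> 'a) \<Rightarrow> bool"
  where "M_condition p DA T q \<Xi> \<longleftrightarrow>
    (\<exists>\<alpha>>0. \<exists>\<gamma>\<ge>0. M_estimate p DA T q \<Xi> \<alpha> \<gamma>) \<and>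
    (q = 1 \<longrightarrow> (\<exists>\<gamma> :: real \<Rightarrow> real.
      (\<forall>\<^sub>F \<alpha> in at_right 0. \<gamma> \<alpha> \<ge> 0 \<and> M_estimate p DA T q \<Xi> \<alpha> (\<gamma> \<alpha>)) \<and>
      (\<gamma> \<longlongrightarrow> 0) (at_right 0)))"

definition state_space :: "real \<Rightarrow> ('a::banach \<times> 'a aefun \<times> 'a aefun) set"
  where "state_space p = UNIV \<times> Lp p {-1..0} \<times> Lp p {0..}"

definition state_norm :: "real \<Rightarrow> 'a::banach \<times> 'a aefun \<times> 'a aefun \<Rightarrow> real"
  where "state_norm p = (\<lambda>(y, \<psi>, h). norm y + Lp_norm p \<psi> + Lp_norm p h)"

definition state_dom :: "real \<Rightarrow> 'a::banach set \<Rightarrow> ('a \<times> 'a aefun \<times> 'a aefun) set"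
  where "state_dom p DA =
    {(y, \<psi>, h). y \<in> DA \<and> \<psi> \<in> W1p p {-1..0} \<and> h \<in> W1p p {0..} \<and>
      W1p_eval p {-1..0} \<psi> 0 = y}"

definition state_op ::
    "real \<Rightarrow> ('a \<Rightarrow> 'a) \<Rightarrow> (real \<Rightarrow> complex) \<Rightarrow> ('a aefun \<Rightarrow> 'a) \<Rightarrow> ('a aefun \<Rightarrow> 'a) \<Rightarrow>
      'a::complex_banach \<times> 'a aefun \<times> 'a aefun \<Rightarrow> 'a \<times> 'a aefun \<times> 'a aefun"
  where "state_op p A b L K = (\<lambda>(y, \<psi>, h).
    (A y + K \<psi> + W1p_eval p {0..} h 0,
     W1p_deriv p {-1..0} \<psi>,
     class_on {0..} (\<lambda>s. b s *\<^sub>C L \<psi>) + W1p_deriv p {0..} h))"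

definition state_semigroup ::
    "real \<Rightarrow> 'a set \<Rightarrow> ('a \<Rightarrow> 'a) \<Rightarrow> (real \<Rightarrow> complex) \<Rightarrow> ('a aefun \<Rightarrow> 'a) \<Rightarrow> ('a aefun \<Rightarrow> 'a) \<Rightarrow>
      (real \<Rightarrow> 'a::complex_banach \<times> 'a aefun \<times> 'a aefun \<Rightarrow> 'a \<times> 'a aefun \<times> 'a aefun) \<Rightarrow> bool"
  where "state_semigroup p DA A b L K \<T> \<longleftrightarrow>
    generates (state_space p) (state_norm p) (state_dom p DA) (state_op p A b L K) \<T>"

definition well_posed ::
    "real \<Rightarrow> 'a::complex_banach set \<Rightarrow> ('a \<Rightarrow> 'a) \<Rightarrow> (real \<Rightarrow> complex) \<Rightarrow>
      ('a aefun \<Rightarrow> 'a) \<Rightarrow> ('a aefun \<Rightarrow> 'a) \<Rightarrow> bool"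
  where "well_posed p DA A b L K \<longleftrightarrow> (\<exists>\<T>. state_semigroup p DA A b L K \<T>)"

text \<open>The solution on \<open>[-1, \<infinity>)\<close> for initial data with \<open>\<phi>\<close> in \<open>W\<^sup>1\<^sup>,\<^sup>p\<close>. The condition \<open>x\<^sub>0 = \<phi>\<close>
  is pointwise for the continuous representative of \<open>\<phi>\<close>, so at \<open>\<theta> = 0\<close> it says \<open>\<phi>(0) = x\<close>;
  otherwise \<open>x\<^sub>t\<close> would have a jump for \<open>0 < t < 1\<close> and \<open>L x\<^sub>t\<close>, \<open>K x\<^sub>t\<close> would be undefined.\<close>

definition delay_solution ::
    "real \<Rightarrow> (real \<Rightarrow> 'a::banach \<times> 'a aefun \<times> 'a aefun \<Rightarrow> 'a \<times> 'a aefun \<times> 'a aefun) \<Rightarrow>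
      'a \<Rightarrow> 'a aefun \<Rightarrow> (real \<Rightarrow> 'a) \<Rightarrow> bool"
  where "delay_solution p \<T> x \<phi> u \<longleftrightarrow>
    u 0 = x \<and>
    (\<forall>\<theta>\<in>{-1..0}. u \<theta> = W1p_eval p {-1..0} \<phi> \<theta>) \<and>
    (\<forall>t\<ge>0. u t = fst (\<T> t (x, \<phi>, 0)))"

end

(* The state operator is A0 + B, where A0 generates the explicit flow that continues the history by
   the orbit of A and shifts the third component to the left, and where
   B (y, psi, h) = (K psi + h(0), 0, b L psi).
   Either condition (M) makes the integral of |B (flow s v)| over [0, alpha] at most q |v| with
   q < 1 for small alpha (from (M_p) by Hoelder), so the perturbation theorem of Miyadera and
   Voigt yields the semigroup. The three components of Duhamel's formula
   T(t) v = flow(t) v + int_0^t flow(t - s) B T(s) v ds, tested by integrals over intervals, say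
   that the second component is the history of the first, that the third one has the value
   int_0^t b(t - s) L x_s ds at 0, and that the first one satisfies the variation of constants
   formula. *)

theory Submission
  imports Defs
begin

section \<open>Strongly continuous operator families\<close>

text \<open>\<open>A0\<close> keeps only what has an explicit flow; even the evaluation h(0), which
  is unbounded on L^p, goes into the perturbation. It is small for a reason of its own: along the
  flow it runs through h(s), and the integral of |h| over [0, alpha] is at most 2 alpha^(1 - 1/p)
  times the L^p norm. As X is an arbitrary Banach space, possibly not separable, strong integrals
  are reduced to Henstock-Kurzweil integrals, and identities in the state space are tested by
  functionals with values in X instead of evaluating L^p-valued integrals pointwise. The
  perturbation theorem is proved for real Banach spaces; complex linearity is recovered afterwards,
  because the perturbed semigroup commutes with every bounded operator that commutes with the
  unperturbed one and with B. The construction uses the Duhamel equation in which B acts on the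
  unperturbed orbit. The solution formula concerns every semigroup generated by the state operator,
  so the other Duhamel formula, with B on the perturbed orbit, is derived from the generators
  alone.\<close>

lemma uniform_boundedness:
  fixes A :: "nat \<Rightarrow> 'a::banach \<Rightarrow>\<^sub>L 'b::real_normed_vector"
  assumes "\<And>v. bounded (range (\<lambda>n. A n v))"
  shows "bounded (range A)"
proof -
  define T where "T k = {v. \<forall>n. norm (A n v) \<le> real k}" for k :: nat
  have clT: "closed (T k)" for k
  proof -
    have "T k = (\<Inter>n. {v. norm (A n v) \<le> real k})" by (auto simp: T_def)
    moreover have "closed {v. norm (A n v) \<le> real k}" for n
      by (intro closed_Collect_le continuous_intros)
    ultimately show ?thesis by auto
  qed
  have un: "\<Union>(range T) = UNIV"
  proof -
    have "\<exists>k. v \<in> T k" for v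
    proof -
      obtain C where "norm (A n v) \<le> C" for n
        using assms[of v] by (auto simp: bounded_iff)
      moreover obtain k where "C \<le> real k" using real_arch_simple by blast
      ultimately show ?thesis unfolding T_def by (auto intro: order_trans)
    qed
    then show ?thesis by auto
  qed
  \<comment> \<open>Baire: countably many closed sets without interior points cannot cover a
    complete space.\<close>
  have "\<exists>k. interior (T k) \<noteq> {}"
  proof (rule ccontr)
    assume "\<not> ?thesis"
    then have "euclidean interior_of \<Union>(range T) = {}"
      using clT by (intro Baire_category_alt)
        (auto simp: completely_metrizable_space_euclidean)
    then show False using un by simp
  qed
  then obtain k v0 where "v0 \<in> interior (T k)" by blast
  then obtain r where r: "r > 0" "ball v0 r \<subseteq> T k"
    by (meson mem_interior)
  \<comment> \<open>A vector \<open>v\<close> is scaled to length r/2, so that \<open>v0\<close> and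
    \<open>v0 + c *\<^sub>R v\<close> lie in the ball where all values are bounded by
    \<open>k\<close>. Their difference costs 2k, and dividing by \<open>c = r / (2 * norm v)\<close>
    gives the constant.\<close>
  have "norm (A n) \<le> 4 * real k / r" for n
  proof (rule norm_blinfun_bound)
    show "0 \<le> 4 * real k / r" using r by simp
    fix v
    show "norm (A n v) \<le> 4 * real k / r * norm v"
    proof (cases "v = 0")
      case False
      define c where "c = r / (2 * norm v)"
      have c: "c > 0" using r False by (simp add: c_def)
      have "v0 + c *\<^sub>R v \<in> ball v0 r" "v0 \<in> ball v0 r"
        using r False by (auto simp: dist_norm c_def)
      then have "norm (A n (v0 + c *\<^sub>R v)) \<le> k" "norm (A n v0) \<le> k"
        using r(2) unfolding T_def by blast+
      moreover have "c *\<^sub>R A n v = A n (v0 + c *\<^sub>R v) - A n v0"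
        by (simp add: blinfun.bilinear_simps)
      ultimately have "norm (c *\<^sub>R A n v) \<le> 2 * real k"
        using norm_triangle_ineq4[of "A n (v0 + c *\<^sub>R v)" "A n v0"] by simp
      then have "c * norm (A n v) \<le> 2 * real k" using c by simp
      then have "norm (A n v) \<le> 2 * real k / c" using c by (simp add: field_simps)
      also have "\<dots> = 4 * real k / r * norm v" using False r by (simp add: c_def field_simps)
      finally show ?thesis .
    qed (simp add: blinfun.bilinear_simps)
  qed
  then show ?thesis by (auto simp: bounded_iff)
qed

text \<open>Strong continuity alone does not tolerate a moving argument; the uniform bound controls
  the extra term \<open>U (\<tau> y) (f y - f x)\<close>, and what remains is an orbit of the fixed
  vector \<open>f x\<close>.\<close>

lemma continuous_on_strong_compose:
  fixes U :: "'t::metric_space \<Rightarrow> 'b::real_normed_vector \<Rightarrow>\<^sub>L 'c::real_normed_vector"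
  assumes U: "\<And>v. continuous_on T (\<lambda>t. U t v)" and bnd: "\<And>t. t \<in> T \<Longrightarrow> norm (U t) \<le> M"
    and \<tau>: "continuous_on X \<tau>" "\<tau> ` X \<subseteq> T" and f: "continuous_on X f"
  shows "continuous_on X (\<lambda>x. U (\<tau> x) (f x))"
  unfolding continuous_on
proof
  fix x assume x: "x \<in> X"
  have "continuous_on X (\<lambda>y. U (\<tau> y) (f x))"
    using continuous_on_compose2[OF U \<tau>] .
  then have 1: "((\<lambda>y. U (\<tau> y) (f x)) \<longlongrightarrow> U (\<tau> x) (f x)) (at x within X)"
    using x by (simp add: continuous_on)
  have 2: "((\<lambda>y. U (\<tau> y) (f y - f x)) \<longlongrightarrow> 0) (at x within X)"
  proof (rule Lim_null_comparison)
    show "\<forall>\<^sub>F y in at x within X. norm (U (\<tau> y) (f y - f x)) \<le> M * norm (f y - f x)"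
      unfolding eventually_at_filter
    proof (rule eventually_mono[OF eventually_True], intro impI)
      fix y assume "y \<in> X"
      then have "norm (U (\<tau> y)) \<le> M" using bnd \<tau> by auto
      then show "norm (U (\<tau> y) (f y - f x)) \<le> M * norm (f y - f x)"
        by (rule order_trans[OF norm_blinfun mult_right_mono]) simp
    qed
    have "(f \<longlongrightarrow> f x) (at x within X)" using f x by (simp add: continuous_on)
    then have "((\<lambda>y. M * norm (f y - f x)) \<longlongrightarrow> M * norm (f x - f x)) (at x within X)"
      by (intro tendsto_intros)
    then show "((\<lambda>y. M * norm (f y - f x)) \<longlongrightarrow> 0) (at x within X)" by simp
  qed
  show "((\<lambda>x. U (\<tau> x) (f x)) \<longlongrightarrow> U (\<tau> x) (f x)) (at x within X)"
    using tendsto_add[OF 1 2] by (simp add: blinfun.bilinear_simps)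
qed

text \<open>The integrand may itself depend on the endpoint \<open>t\<close>, as a Duhamel integrand
  does; it only has to be uniformly close to the limit on [0, t] for small \<open>t\<close>.\<close>

lemma tendsto_average:
  fixes F :: "real \<Rightarrow> real \<Rightarrow> 'b::banach"
  assumes cont: "\<And>t. 0 < t \<Longrightarrow> t < c \<Longrightarrow> continuous_on {0..t} (F t)" and "c > 0"
    and lim: "\<And>e. e > 0 \<Longrightarrow> \<exists>d>0. \<forall>t s. 0 \<le> s \<and> s \<le> t \<and> t < d \<longrightarrow> norm (F t s - L) \<le> e"
  shows "((\<lambda>t. (1 / t) *\<^sub>R integral {0..t} (F t)) \<longlongrightarrow> L) (at_right 0)"
proof (rule tendstoI)
  fix e :: real assume e: "e > 0"
  then obtain d where d: "d > 0" "\<And>t s. 0 \<le> s \<Longrightarrow> s \<le> t \<Longrightarrow> t < d \<Longrightarrow> norm (F t s - L) \<le> e / 2"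
    using lim[of "e / 2"] by auto
  have "dist ((1 / t) *\<^sub>R integral {0..t} (F t)) L < e" if t: "0 < t" "t < min c d" for t
  proof -
    have co: "continuous_on {0..t} (F t)" using cont t by simp
    have int: "F t integrable_on {0..t}" using co by (rule integrable_continuous_real)
    have "norm (integral {0..t} (\<lambda>s. F t s - L)) \<le> (e / 2) * (t - 0)"
      using t d by (intro integral_bound continuous_intros co) auto
    also have "integral {0..t} (\<lambda>s. F t s - L) = integral {0..t} (F t) - t *\<^sub>R L"
      using int t by (subst integral_diff) auto
    finally have "norm (integral {0..t} (F t) - t *\<^sub>R L) \<le> (e / 2) * t" by simp
    moreover have "(1 / t) *\<^sub>R integral {0..t} (F t) - L = (1 / t) *\<^sub>R (integral {0..t} (F t) - t *\<^sub>R L)"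
      using t by (simp add: scaleR_diff_right)
    ultimately have "norm ((1 / t) *\<^sub>R integral {0..t} (F t) - L) \<le> e / 2"
      using t by (simp add: divide_le_eq)
    then show ?thesis using e by (simp add: dist_norm)
  qed
  moreover have "eventually (\<lambda>t. 0 < t \<and> t < min c d) (at_right (0::real))"
    unfolding eventually_at_right_field using d \<open>c > 0\<close> by (intro exI[of _ "min c d"]) auto
  ultimately show "\<forall>\<^sub>F t in at_right 0. dist ((1 / t) *\<^sub>R integral {0..t} (F t)) L < e"
    by (auto elim: eventually_mono)
qed

lemma tendsto_average_continuous:
  fixes f :: "real \<Rightarrow> 'b::banach"
  assumes f: "continuous_on {0..c} f" and "c > 0"
  shows "((\<lambda>t. (1 / t) *\<^sub>R integral {0..t} f) \<longlongrightarrow> f 0) (at_right 0)"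
proof (rule tendsto_average[where c = c])
  show "continuous_on {0..t} f" if "t < c" for t
    using f by (rule continuous_on_subset) (use that in auto)
  fix e :: real assume "e > 0"
  then obtain d where d: "d > 0" "\<forall>x\<in>{0..c}. dist x 0 < d \<longrightarrow> dist (f x) (f 0) < e"
    using f[unfolded continuous_on_iff, rule_format, of 0] \<open>c > 0\<close> by auto
  show "\<exists>d>0. \<forall>t s. 0 \<le> s \<and> s \<le> t \<and> t < d \<longrightarrow> norm (f s - f 0) \<le> e"
    using d \<open>c > 0\<close> by (intro exI[of _ "min c d"]) (auto simp: dist_norm intro!: less_imp_le)
qed fact

lemma integral_unit_rescale:
  fixes f :: "real \<Rightarrow> 'b::banach"
  assumes "continuous_on {0..t} f" "0 \<le> t"
  shows "integral {0..t} f = t *\<^sub>R integral {0..1} (\<lambda>r. f (t * r))"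
proof (cases "t = 0")
  case False
  then have t: "t > 0" using assms by simp
  have "(f has_integral integral {0..t} f) {0..t}"
    using assms integrable_continuous_real by (auto simp: has_integral_integral)
  from has_integral_stretch_real[OF this, of t] t
  have "((\<lambda>x. f (t * x)) has_integral (1 / t) *\<^sub>R integral {0..t} f) ((\<lambda>x. x / t) ` {0..t})"
    by simp
  moreover have "(\<lambda>x. x / t) ` {0..t} = {0..1}" using t
    by (force simp: image_iff field_simps intro: exI[of _ "t * _"])
  ultimately have "integral {0..1} (\<lambda>r. f (t * r)) = (1 / t) *\<^sub>R integral {0..t} f"
    by (simp add: has_integral_iff)
  then show ?thesis using t by simp
qed simp

text \<open>Substituting s = t r moves the endpoint into the integrand, so that a parameter integral
  over the fixed interval [0, 1] remains.\<close>

lemma continuous_on_integral_triangle: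
  fixes h :: "real \<Rightarrow> real \<Rightarrow> 'b::banach"
  assumes h: "continuous_on {(t, s). 0 \<le> s \<and> s \<le> t} (\<lambda>(t, s). h t s)"
  shows "continuous_on {0..} (\<lambda>t. integral {0..t} (h t))"
proof -
  have "continuous_on ({0..} \<times> cbox 0 1) ((\<lambda>(t, s). h t s) \<circ> (\<lambda>(t, r). (t, t * r)))"
  proof (rule continuous_on_compose)
    show "continuous_on ({0..} \<times> cbox 0 1) (\<lambda>(t::real, r::real). (t, t * r))"
      by (auto simp: case_prod_unfold intro!: continuous_intros)
    show "continuous_on ((\<lambda>(t, r). (t, t * r)) ` ({0..} \<times> cbox 0 1)) (\<lambda>(t, s). h t s)"
      by (rule continuous_on_subset[OF h]) (auto simp: mult_left_le)
  qed
  then have "continuous_on ({0..} \<times> cbox 0 1) (\<lambda>(t, r). h t (t * r))"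
    by (simp add: o_def case_prod_unfold)
  then have "continuous_on {0..} (\<lambda>t. integral (cbox 0 1) (\<lambda>r. h t (t * r)))"
    by (rule integral_continuous_on_param)
  then have "continuous_on {0..} (\<lambda>t. t *\<^sub>R integral {0..1} (\<lambda>r. h t (t * r)))"
    by (auto intro!: continuous_intros)
  moreover have "integral {0..t} (h t) = t *\<^sub>R integral {0..1} (\<lambda>r. h t (t * r))" if "t \<in> {0..}" for t
  proof (rule integral_unit_rescale)
    have "continuous_on {0..t} ((\<lambda>(t, s). h t s) \<circ> (\<lambda>s. (t, s)))"
      by (intro continuous_on_compose continuous_intros continuous_on_subset[OF h]) auto
    then show "continuous_on {0..t} (h t)" by (simp add: o_def)
  qed (use that in auto)
  ultimately show ?thesis by (metis (no_types, lifting) continuous_on_cong)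
qed

lemma norm_blinfun_bound_dense:
  fixes f :: "'a::real_normed_vector \<Rightarrow>\<^sub>L 'b::real_normed_vector"
  assumes D: "closure D = UNIV" and bd: "\<And>v. v \<in> D \<Longrightarrow> norm (f v) \<le> c * norm v" and "0 \<le> c"
  shows "norm f \<le> c"
proof (rule norm_blinfun_bound)
  fix v
  have "closed {v. norm (f v) \<le> c * norm v}"
    by (intro closed_Collect_le continuous_intros)
  then have "closure D \<subseteq> {v. norm (f v) \<le> c * norm v}"
    using bd by (intro closure_minimal) auto
  then show "norm (f v) \<le> c * norm v" using D by auto
qed fact

text \<open>Lipschitz continuity on \<open>D\<close> gives a uniformly continuous extension, and
  linearity passes to limits. Only the values of \<open>f\<close> on \<open>D\<close> are
  constrained, so that a total function can stand for a densely defined operator.\<close>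

lemma blinfun_extend_dense:
  fixes f :: "'a::real_normed_vector \<Rightarrow> 'b::banach"
  assumes D: "subspace D" "closure D = UNIV"
    and add: "\<And>u v. u \<in> D \<Longrightarrow> v \<in> D \<Longrightarrow> f (u + v) = f u + f v"
    and sc: "\<And>c v. v \<in> D \<Longrightarrow> f (c *\<^sub>R v) = c *\<^sub>R f v"
    and bd: "\<And>v. v \<in> D \<Longrightarrow> norm (f v) \<le> c * norm v" and "0 \<le> c"
  obtains F :: "'a \<Rightarrow>\<^sub>L 'b" where "\<And>v. v \<in> D \<Longrightarrow> F v = f v" "norm F \<le> c"
proof -
  have fdiff: "f u - f v = f (u - v)" if "u \<in> D" "v \<in> D" for u v
    using add[of u "(-1) *\<^sub>R v"] sc[of v "-1"] that D(1)
    by (simp add: subspace_neg)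
  have "c-lipschitz_on D f"
    using bd D(1) \<open>0 \<le> c\<close> by (intro lipschitz_onI) (auto simp: dist_norm fdiff subspace_diff)
  then have "uniformly_continuous_on D f" by (rule lipschitz_on_uniformly_continuous)
  then obtain g where ucg: "uniformly_continuous_on (closure D) g" and g: "\<And>x. x \<in> D \<Longrightarrow> f x = g x"
    by (rule uniformly_continuous_on_extension_on_closure) auto
  then have cg: "continuous_on UNIV g" using D(2) uniformly_continuous_imp_continuous by fastforce
  have ex: "\<exists>x. (\<forall>n. x n \<in> D) \<and> x \<longlonglongrightarrow> u" for u
    using D(2) closure_sequential[of u D] by auto
  have lim: "(\<lambda>n. g (x n)) \<longlonglongrightarrow> g u" if "x \<longlonglongrightarrow> u" for x u
    using cg continuous_on_tendsto_compose[OF cg that] by auto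
  have gadd: "g (u + v) = g u + g v" for u v
  proof -
    obtain x y where x: "\<And>n. x n \<in> D" "x \<longlonglongrightarrow> u" and y: "\<And>n. y n \<in> D" "y \<longlonglongrightarrow> v"
      using ex[of u] ex[of v] by auto
    have "(\<lambda>n. g (x n + y n)) \<longlonglongrightarrow> g (u + v)" using x y by (intro lim tendsto_add)
    moreover have "g (x n + y n) = g (x n) + g (y n)" for n
      using x y add D(1) by (simp add: g[symmetric] subspace_add)
    moreover have "(\<lambda>n. g (x n) + g (y n)) \<longlonglongrightarrow> g u + g v" using x y by (intro lim tendsto_add)
    ultimately show ?thesis using LIMSEQ_unique by simp
  qed
  have gsc: "g (r *\<^sub>R u) = r *\<^sub>R g u" for r u
  proof -
    obtain x where x: "\<And>n. x n \<in> D" "x \<longlonglongrightarrow> u" using ex[of u] by auto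
    have "(\<lambda>n. g (r *\<^sub>R x n)) \<longlonglongrightarrow> g (r *\<^sub>R u)" using x by (intro lim tendsto_intros)
    moreover have "g (r *\<^sub>R x n) = r *\<^sub>R g (x n)" for n
      using x sc D(1) by (simp add: g[symmetric] subspace_scale)
    moreover have "(\<lambda>n. r *\<^sub>R g (x n)) \<longlonglongrightarrow> r *\<^sub>R g u" using x by (intro lim tendsto_intros)
    ultimately show ?thesis using LIMSEQ_unique by simp
  qed
  have gbd: "norm (g u) \<le> norm u * c" for u
  proof -
    have "closed {v. norm (g v) \<le> norm v * c}"
      by (intro closed_Collect_le continuous_intros cg)
    then have "closure D \<subseteq> {v. norm (g v) \<le> norm v * c}"
      using bd g by (intro closure_minimal) (auto simp: mult.commute)
    then show ?thesis using D by auto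
  qed
  have bl: "bounded_linear g" by (intro bounded_linear_intro[where K = c] gadd gsc gbd)
  then have "blinfun_apply (Blinfun g) = g" by (simp add: bounded_linear_Blinfun_apply)
  moreover have "norm (Blinfun g) \<le> c"
    using gbd \<open>0 \<le> c\<close> calculation by (intro norm_blinfun_bound) (auto simp: mult.commute)
  ultimately show thesis using that[of "Blinfun g"] g by simp
qed

section \<open>Semigroups on a Banach space\<close>

definition strong_semigroup :: "(real \<Rightarrow> 'b::banach \<Rightarrow>\<^sub>L 'b) \<Rightarrow> bool"
  where "strong_semigroup S \<longleftrightarrow> S 0 = id_blinfun \<and>
    (\<forall>s\<ge>0. \<forall>t\<ge>0. S (s + t) = S s o\<^sub>L S t) \<and> (\<forall>v. ((\<lambda>t. S t v) \<longlongrightarrow> v) (at_right 0))"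

text \<open>Kept as a graph: membership says both that a vector is in the domain and what its image
  is, and sums, differences and multiples of pairs can be formed directly.\<close>

definition gen :: "(real \<Rightarrow> 'b::banach \<Rightarrow>\<^sub>L 'b) \<Rightarrow> ('b \<times> 'b) set"
  where "gen S = {(v, w). ((\<lambda>t. (1 / t) *\<^sub>R (S t v - v)) \<longlongrightarrow> w) (at_right 0)}"

lemma subspace_Domain_gen: "subspace (Domain (gen S))"
  and gen_add: "(v, w) \<in> gen S \<Longrightarrow> (v', w') \<in> gen S \<Longrightarrow> (v + v', w + w') \<in> gen S"
  and gen_diff: "(v, w) \<in> gen S \<Longrightarrow> (v', w') \<in> gen S \<Longrightarrow> (v - v', w - w') \<in> gen S"
  and gen_scale: "(v, w) \<in> gen S \<Longrightarrow> (c *\<^sub>R v, c *\<^sub>R w) \<in> gen S"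
proof -
  show a: "(v, w) \<in> gen S \<Longrightarrow> (v', w') \<in> gen S \<Longrightarrow> (v + v', w + w') \<in> gen S" for v w v' w'
    unfolding gen_def mem_Collect_eq prod.case
    by (drule (1) tendsto_add) (simp add: algebra_simps blinfun.bilinear_simps)
  show "(v, w) \<in> gen S \<Longrightarrow> (v', w') \<in> gen S \<Longrightarrow> (v - v', w - w') \<in> gen S"
    unfolding gen_def mem_Collect_eq prod.case
    by (drule (1) tendsto_diff) (simp add: algebra_simps blinfun.bilinear_simps)
  show s: "(v, w) \<in> gen S \<Longrightarrow> (c *\<^sub>R v, c *\<^sub>R w) \<in> gen S" for v w c
    unfolding gen_def mem_Collect_eq prod.case
    by (drule tendsto_scaleR[OF tendsto_const[of c]]) (simp add: algebra_simps blinfun.bilinear_simps)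
  show "subspace (Domain (gen S))"
    unfolding subspace_def
  proof (intro conjI ballI allI)
    show "0 \<in> Domain (gen S)" by (rule DomainI[of 0 0]) (simp add: gen_def blinfun.bilinear_simps)
  qed (auto intro: a s)
qed

locale semigroup =
  fixes S :: "real \<Rightarrow> 'b::banach \<Rightarrow>\<^sub>L 'b"
  assumes strong_semigroup: "strong_semigroup S"
begin

lemma zero [simp]: "S 0 = id_blinfun"
  using strong_semigroup by (simp add: strong_semigroup_def)

lemma plus: "0 \<le> s \<Longrightarrow> 0 \<le> t \<Longrightarrow> S (s + t) = S s o\<^sub>L S t"
  using strong_semigroup by (simp add: strong_semigroup_def)

lemma plus_apply: "0 \<le> s \<Longrightarrow> 0 \<le> t \<Longrightarrow> S (s + t) v = S s (S t v)"
  by (simp add: plus)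

lemma tendsto_at_0: "((\<lambda>t. S t v) \<longlongrightarrow> v) (at_right 0)"
  using strong_semigroup by (simp add: strong_semigroup_def)

text \<open>Otherwise there are times \<open>t n\<close> tending to 0 with norms of
  \<open>S (t n)\<close> above \<open>n\<close>, although \<open>S (t n) v\<close> converges to
  \<open>v\<close> for every \<open>v\<close>; this contradicts uniform boundedness.\<close>

lemma local_bound: "\<exists>d>0. \<exists>M. \<forall>t\<in>{0..d}. norm (S t) \<le> M"
proof (rule ccontr)
  assume "\<not> ?thesis"
  then have "\<exists>t\<in>{0..1 / Suc n}. \<not> norm (S t) \<le> real n" for n
    using divide_pos_pos[OF zero_less_one, of "real (Suc n)"] by (metis of_nat_0_less_iff zero_less_Suc)
  then obtain t where t: "\<And>n. t n \<in> {0..1 / Suc n}" "\<And>n. \<not> norm (S (t n)) \<le> real n"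
    by metis
  have "(\<lambda>n. 1 / real (Suc n)) \<longlonglongrightarrow> 0"
    using LIMSEQ_inverse_real_of_nat by (simp add: inverse_eq_divide)
  from real_tendsto_sandwich[OF always_eventually always_eventually tendsto_const this]
  have t0: "t \<longlonglongrightarrow> 0" using t(1) by simp
  have "bounded (range (\<lambda>n. S (t n) v))" for v
  proof -
    have "continuous (at 0 within {0..}) (\<lambda>t. S t v)"
      using tendsto_at_0[of v] by (simp add: continuous_within at_within_Ici_at_right)
    then have "(\<lambda>n. S (t n) v) \<longlonglongrightarrow> S 0 v"
      by (rule continuous_within_tendsto_compose) (use t0 t(1) in auto)
    then show ?thesis by (rule convergent_imp_bounded)
  qed
  then have "bounded (range (\<lambda>n. S (t n)))" by (rule uniform_boundedness)
  then obtain C where C: "\<And>n. norm (S (t n)) \<le> C" by (auto simp: bounded_iff)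
  obtain k where "C \<le> real k" using real_arch_simple by blast
  then show False using C[of k] t(2)[of k] by simp
qed

text \<open>The interval [0, t] is cut into steps of length \<open>d\<close>. With n = floor (t / d)
  the product of the n + 1 bounds is M times M^n, which is at most M exp (ln M / d * t).\<close>

lemma growth: "\<exists>M\<ge>1. \<exists>w\<ge>0. \<forall>t\<ge>0. norm (S t) \<le> M * exp (w * t)"
proof -
  obtain d M0 where d: "d > 0" "\<forall>t\<in>{0..d}. norm (S t) \<le> M0" using local_bound by auto
  define M where "M = max 1 M0"
  have M: "M \<ge> 1" "\<And>t. t \<in> {0..d} \<Longrightarrow> norm (S t) \<le> M" using d by (auto simp: M_def le_max_iff_disj)
  have step: "0 \<le> t \<Longrightarrow> t \<le> real (Suc n) * d \<Longrightarrow> norm (S t) \<le> M ^ Suc n" for n t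
  proof (induction n arbitrary: t)
    case (Suc n)
    show ?case
    proof (cases "t \<le> d")
      case True
      then have "norm (S t) \<le> M" using M Suc by auto
      also have "\<dots> \<le> M ^ Suc (Suc n)" using M(1) power_increasing[of 1 "Suc (Suc n)" M] by simp
      finally show ?thesis .
    next
      case False
      then have "S t = S d o\<^sub>L S (t - d)" using plus[of d "t - d"] d by simp
      then have "norm (S t) \<le> norm (S d) * norm (S (t - d))" by (simp add: norm_blinfun_compose)
      also have "\<dots> \<le> M * M ^ Suc n"
        using Suc False d M by (intro mult_mono) (auto simp: algebra_simps)
      finally show ?thesis by simp
    qed
  qed (use M in auto)
  have "norm (S t) \<le> M * exp (ln M / d * t)" if t: "t \<ge> 0" for t
  proof -
    define n where "n = nat \<lfloor>t / d\<rfloor>"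
    have fl: "real n = of_int \<lfloor>t / d\<rfloor>" using t d by (simp add: n_def)
    then have n: "real n \<le> t / d" "t / d \<le> real n + 1" by linarith+
    then have "norm (S t) \<le> M ^ Suc n" using t d by (intro step) (auto simp: field_simps)
    also have "\<dots> = M * M powr real n" using M by (simp add: powr_realpow)
    also have "\<dots> \<le> M * M powr (t / d)" using M n by (intro mult_left_mono powr_mono) auto
    also have "M powr (t / d) = exp (ln M / d * t)" using M by (simp add: powr_def)
    finally show ?thesis .
  qed
  moreover have "ln M / d \<ge> 0" using M d by simp
  ultimately show ?thesis using M(1) by blast
qed

lemma bounded_on: "\<exists>M\<ge>1. \<forall>t\<in>{0..c}. norm (S t) \<le> M"
proof -
  obtain M w where M: "M \<ge> 1" "w \<ge> 0" "\<forall>t\<ge>0. norm (S t) \<le> M * exp (w * t)" using growth by auto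
  show ?thesis
  proof (intro exI conjI ballI)
    have "1 * 1 \<le> M * exp (w * max 0 c)" using M by (intro mult_mono) auto
    then show "1 \<le> M * exp (w * max 0 c)" by simp
    fix t assume t: "t \<in> {0..c}"
    then have "norm (S t) \<le> M * exp (w * t)" using M by simp
    also have "\<dots> \<le> M * exp (w * max 0 c)" using M t by (intro mult_left_mono) (auto intro!: mult_left_mono)
    finally show "norm (S t) \<le> M * exp (w * max 0 c)" .
  qed
qed

text \<open>The larger time factors through the smaller one, so that right continuity at 0 controls
  differences on both sides of any time.\<close>

lemma norm_diff_le:
  assumes "0 \<le> s" "0 \<le> t" "norm (S s) \<le> M" "norm (S t) \<le> M"
  shows "norm (S t v - S s v) \<le> M * norm (S \<bar>t - s\<bar> v - v)"
proof -
  have *: "norm (S (a + h) v - S a v) \<le> M * norm (S h v - v)"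
    if "0 \<le> a" "0 \<le> h" "norm (S a) \<le> M" for a h
  proof -
    have "S (a + h) v - S a v = S a (S h v - v)"
      using that by (simp add: plus_apply blinfun.bilinear_simps)
    also have "norm \<dots> \<le> norm (S a) * norm (S h v - v)" by (rule norm_blinfun)
    also have "\<dots> \<le> M * norm (S h v - v)" using that by (intro mult_right_mono) auto
    finally show ?thesis .
  qed
  show ?thesis
  proof (cases "s \<le> t")
    case True
    then show ?thesis using *[of s "t - s"] assms by simp
  next
    case False
    then show ?thesis using *[of t "s - t"] assms by (simp add: norm_minus_commute)
  qed
qed

lemma continuous_on_apply: "continuous_on {0..} (\<lambda>t. S t v)"
  unfolding continuous_on
proof
  fix s :: real assume s: "s \<in> {0..}"
  obtain M where M: "M \<ge> 1" "\<forall>t\<in>{0..s + 1}. norm (S t) \<le> M" using bounded_on by auto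
  have c0: "continuous (at 0 within {0..}) (\<lambda>t. S t v)"
    using tendsto_at_0[of v] by (simp add: continuous_within at_within_Ici_at_right)
  have "((\<lambda>t. S \<bar>t - s\<bar> v) \<longlongrightarrow> S 0 v) (at s within {0..})"
  proof (rule continuous_within_tendsto_compose[OF c0])
    have "((\<lambda>t. \<bar>t - s\<bar>) \<longlongrightarrow> \<bar>s - s\<bar>) (at s within {0..})" by (intro tendsto_intros)
    then show "((\<lambda>t. \<bar>t - s\<bar>) \<longlongrightarrow> 0) (at s within {0..})" by simp
  qed auto
  then have "((\<lambda>t. M * norm (S \<bar>t - s\<bar> v - v)) \<longlongrightarrow> M * norm (S 0 v - v)) (at s within {0..})"
    by (rule tendsto_mult[OF tendsto_const tendsto_norm[OF tendsto_diff[OF _ tendsto_const]]])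
  then have "((\<lambda>t. M * norm (S \<bar>t - s\<bar> v - v)) \<longlongrightarrow> 0) (at s within {0..})" by simp
  moreover have "\<forall>\<^sub>F t in at s within {0..}. norm (S t v - S s v) \<le> M * norm (S \<bar>t - s\<bar> v - v)"
    unfolding eventually_at
  proof (intro exI[of _ 1] conjI ballI impI)
    fix t assume t: "t \<in> {0..}" "t \<noteq> s \<and> dist t s < 1"
    then show "norm (S t v - S s v) \<le> M * norm (S \<bar>t - s\<bar> v - v)"
      using s M by (intro norm_diff_le) (auto simp: dist_real_def)
  qed simp
  ultimately have "((\<lambda>t. S t v - S s v) \<longlongrightarrow> 0) (at s within {0..})"
    by (rule Lim_null_comparison[rotated])
  then show "((\<lambda>t. S t v) \<longlongrightarrow> S s v) (at s within {0..})" by (rule LIM_zero_cancel)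
qed

text \<open>Continuity is local, and near \<open>x\<close> the times \<open>\<tau> y\<close> stay
  below \<open>\<tau> x + 1\<close>, where the semigroup is uniformly bounded.\<close>

lemma continuous_on_compose:
  fixes \<tau> :: "'t::metric_space \<Rightarrow> real"
  assumes \<tau>: "continuous_on X \<tau>" "\<And>x. x \<in> X \<Longrightarrow> 0 \<le> \<tau> x" and f: "continuous_on X f"
  shows "continuous_on X (\<lambda>x. S (\<tau> x) (f x))"
  unfolding continuous_on_eq_continuous_within
proof
  fix x assume x: "x \<in> X"
  obtain M where M: "\<forall>t\<in>{0..\<tau> x + 1}. norm (S t) \<le> M" using bounded_on by auto
  define Y where "Y = {y \<in> X. \<tau> y < \<tau> x + 1}"
  have "continuous_on Y (\<lambda>y. S (\<tau> y) (f y))"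
  proof (rule continuous_on_strong_compose[where T = "{0..\<tau> x + 1}" and M = M])
    show "continuous_on {0..\<tau> x + 1} (\<lambda>t. S t v)" for v
      by (rule continuous_on_subset[OF continuous_on_apply]) auto
    show "continuous_on Y \<tau>" by (rule continuous_on_subset[OF \<tau>(1)]) (simp add: Y_def)
    show "continuous_on Y f" by (rule continuous_on_subset[OF f]) (simp add: Y_def)
  qed (use \<tau>(2) M in \<open>auto simp: Y_def less_imp_le\<close>)
  then have c: "continuous (at x within Y) (\<lambda>y. S (\<tau> y) (f y))"
    using x by (auto simp: Y_def continuous_on_eq_continuous_within)
  obtain d where d: "d > 0" "\<forall>y\<in>X. dist y x < d \<longrightarrow> dist (\<tau> y) (\<tau> x) < 1"
    using \<tau>(1)[unfolded continuous_on_iff, rule_format, OF x zero_less_one] by auto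
  have "at x within X = at x within Y"
  proof (rule at_within_nhd[of _ "ball x d"])
    have "\<tau> y < \<tau> x + 1" if "y \<in> X" "y \<in> ball x d" for y
    proof -
      have "\<bar>\<tau> y - \<tau> x\<bar> < 1" using d that by (auto simp: dist_real_def dist_commute)
      then show ?thesis by linarith
    qed
    then show "X \<inter> ball x d - {x} = Y \<inter> ball x d - {x}" by (auto simp: Y_def)
  qed (use d in auto)
  then show "continuous (at x within X) (\<lambda>y. S (\<tau> y) (f y))" using c by simp
qed

lemma gen_apply:
  assumes "(v, w) \<in> gen S" "t \<ge> 0"
  shows "(S t v, S t w) \<in> gen S"
proof -
  have "((\<lambda>h. S t ((1 / h) *\<^sub>R (S h v - v))) \<longlongrightarrow> S t w) (at_right 0)"
    using assms(1) unfolding gen_def by (intro tendsto_intros) auto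
  moreover have "\<forall>\<^sub>F h in at_right 0. S t ((1 / h) *\<^sub>R (S h v - v)) = (1 / h) *\<^sub>R (S h (S t v) - S t v)"
    using eventually_at_right_less
  proof eventually_elim
    case (elim h)
    then have "S h (S t v) = S t (S h v)" using assms(2) plus_apply[of h t v] plus_apply[of t h v]
      by (simp add: add.commute)
    then show ?case by (simp add: blinfun.bilinear_simps)
  qed
  ultimately show ?thesis unfolding gen_def by (auto dest: tendsto_cong)
qed

text \<open>To the right of \<open>t\<close>, the difference quotient is \<open>S t\<close> applied
  to one at 0. To the left it is \<open>S s\<close> applied to one at 0, with \<open>s\<close>
  moving; the bound on [0, t + 1] and the strong continuity at \<open>w\<close> absorb this.\<close>

lemma has_vector_derivative_gen:
  assumes gen: "(v, w) \<in> gen S" and "t \<ge> 0"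
  shows "((\<lambda>t. S t v) has_vector_derivative S t w) (at t within {0..})"
  unfolding has_vector_derivative_def has_derivative_within_alt
proof (intro conjI allI impI)
  show "bounded_linear (\<lambda>x. x *\<^sub>R S t w)" by (rule bounded_linear_scaleR_left)
  fix e :: real assume e: "e > 0"
  obtain M where M: "M \<ge> 1" "\<forall>r\<in>{0..t + 1}. norm (S r) \<le> M" using bounded_on by auto
  \<comment> \<open>The error of the difference quotient at 0. Making it smaller than e / (2 M)
    leaves e / 2 for the continuity term that appears on the left side.\<close>
  define D where "D h = (1 / h) *\<^sub>R (S h v - v) - w" for h
  have "(D \<longlongrightarrow> 0) (at_right 0)" using gen unfolding gen_def D_def by (auto dest: LIM_zero)
  moreover have "e / (2 * M) > 0" using e M by simp
  ultimately have "\<forall>\<^sub>F h in at_right 0. norm (D h) < e / (2 * M)"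
    by (metis order_tendstoD(2) tendsto_norm_zero)
  then obtain d1 where d1: "d1 > 0" "\<And>h. 0 < h \<Longrightarrow> h < d1 \<Longrightarrow> norm (D h) < e / (2 * M)"
    unfolding eventually_at_right_field by auto
  obtain d2 where d2: "d2 > 0" "\<And>s. s \<ge> 0 \<Longrightarrow> dist s t < d2 \<Longrightarrow> dist (S s w) (S t w) < e / 2"
    using continuous_on_apply[of w] e \<open>t \<ge> 0\<close> unfolding continuous_on_iff
    by (metis atLeast_iff half_gt_zero)
  show "\<exists>d>0. \<forall>y\<in>{0..}. norm (y - t) < d \<longrightarrow>
     norm (S y v - S t v - (y - t) *\<^sub>R S t w) \<le> e * norm (y - t)"
  proof (intro exI[of _ "min 1 (min d1 d2)"] conjI ballI impI)
    show "0 < min 1 (min d1 d2)" using d1 d2 by simp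
    fix s assume s: "s \<in> {0..}" "norm (s - t) < min 1 (min d1 d2)"
    have SD: "norm (S r (D h)) \<le> e / 2" if "0 \<le> r" "r \<le> t + 1" "0 < h" "h < d1" for r h
    proof -
      have "norm (S r (D h)) \<le> norm (S r) * norm (D h)" by (rule norm_blinfun)
      also have "\<dots> \<le> M * (e / (2 * M))" using that M d1(2)[of h] by (intro mult_mono) auto
      finally show ?thesis using M by simp
    qed
    have hD: "S h v - v = h *\<^sub>R (D h + w)" if "h > 0" for h using that by (simp add: D_def)
    show "norm (S s v - S t v - (s - t) *\<^sub>R S t w) \<le> e * norm (s - t)"
    proof (cases s t rule: linorder_cases)
      case greater
      then have "S s v - S t v = S t (S (s - t) v - v)"
        using plus_apply[of t "s - t" v] \<open>t \<ge> 0\<close> by (simp add: blinfun.bilinear_simps)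
      then have "S s v - S t v - (s - t) *\<^sub>R S t w = (s - t) *\<^sub>R S t (D (s - t))"
        using hD[of "s - t"] greater by (simp add: blinfun.bilinear_simps scaleR_add_right)
      moreover have "norm (S t (D (s - t))) \<le> e" 
        using SD[of t "s - t"] s greater \<open>t \<ge> 0\<close> e by auto
      ultimately show ?thesis using mult_left_mono[of "norm (S t (D (s - t)))" e "\<bar>s - t\<bar>"] by (simp add: mult.commute)
    next
      case less
      then have "S s v - S t v = - S s (S (t - s) v - v)"
        using plus_apply[of s "t - s" v] s by (simp add: blinfun.bilinear_simps)
      then have "S s v - S t v - (s - t) *\<^sub>R S t w = (s - t) *\<^sub>R (S s (D (t - s)) + (S s w - S t w))"
        using hD[of "t - s"] less by (simp add: blinfun.bilinear_simps algebra_simps)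
      moreover have "norm (S s (D (t - s)) + (S s w - S t w)) \<le> e / 2 + e / 2"
        using SD[of s "t - s"] s less d2(2)[of s]
        by (intro norm_triangle_mono) (auto simp: dist_norm norm_minus_commute less_imp_le)
      ultimately show ?thesis
        using mult_left_mono[of "norm (S s (D (t - s)) + (S s w - S t w))" e "\<bar>s - t\<bar>"]
        by (simp add: mult.commute)
    qed simp
  qed
qed

lemma integral_gen:
  assumes "(v, w) \<in> gen S" "t \<ge> 0"
  shows "integral {0..t} (\<lambda>s. S s w) = S t v - v"
proof -
  have "((\<lambda>s. S s w) has_integral S t v - S 0 v) {0..t}"
  proof (rule fundamental_theorem_of_calculus)
    fix s assume "s \<in> {0..t}"
    then show "((\<lambda>t. S t v) has_vector_derivative S s w) (at s within {0..t})"
      using has_vector_derivative_within_subset[OF has_vector_derivative_gen[OF assms(1)]] by auto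
  qed fact
  then show ?thesis by (simp add: has_integral_iff)
qed

text \<open>Shifting the integral by \<open>h\<close> cancels the common part of [0, t] and
  [h, t + h]; what is left is an integral over [0, h] of the orbit of \<open>S t v - v\<close>,
  whose average converges.\<close>

lemma integral_apply_in_gen:
  assumes t: "t \<ge> 0"
  shows "(integral {0..t} (\<lambda>s. S s v), S t v - v) \<in> gen S"
proof -
  let ?I = "\<lambda>t. integral {0..t} (\<lambda>s. S s v)"
  have int: "(\<lambda>s. S s v) integrable_on {a..b}" if "0 \<le> a" for a b
    by (rule integrable_continuous_real, rule continuous_on_subset[OF continuous_on_apply]) (use that in auto)
  have *: "S h (?I t) - ?I t = integral {0..h} (\<lambda>s. S s (S t v - v))" if h: "h > 0" for h
  proof -
    have "S h (?I t) = integral {0..t} (\<lambda>s. S h (S s v))"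
      using integral_linear[OF int[of 0 t] blinfun.bounded_linear_right[of "S h"]] by (simp add: o_def)
    also have "\<dots> = integral {0..t} (\<lambda>s. S (s + h) v)"
      by (rule integral_cong) (use h in \<open>auto simp: plus_apply[symmetric] add.commute\<close>)
    also have "\<dots> = integral {h..t + h} (\<lambda>s. S s v)"
      using integral_shift_Icc_real[of 0 t "\<lambda>s. S s v" h] by (simp add: o_def add.commute)
    finally have 1: "S h (?I t) = integral {h..t + h} (\<lambda>s. S s v)" .
    have 2: "?I (t + h) = ?I h + integral {h..t + h} (\<lambda>s. S s v)"
      using t h Henstock_Kurzweil_Integration.integral_combine[where a = 0 and c = h and b = "t + h", OF _ _ int] by simp
    have 3: "?I (t + h) = ?I t + integral {t..t + h} (\<lambda>s. S s v)"
      using t h Henstock_Kurzweil_Integration.integral_combine[where a = 0 and c = t and b = "t + h", OF _ _ int] by simp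
    have 4: "integral {t..t + h} (\<lambda>s. S s v) = integral {0..h} (\<lambda>s. S s (S t v))"
    proof -
      have "integral {t..t + h} (\<lambda>s. S s v) = integral {0..h} (\<lambda>s. S (s + t) v)"
        using integral_shift_Icc_real[of 0 h "\<lambda>s. S s v" t] by (simp add: o_def add.commute)
      also have "\<dots> = integral {0..h} (\<lambda>s. S s (S t v))"
        by (rule integral_cong) (use t in \<open>auto simp: plus_apply\<close>)
      finally show ?thesis .
    qed
    have "integral {0..h} (\<lambda>s. S s (S t v - v)) = integral {0..h} (\<lambda>s. S s (S t v)) - ?I h"
      unfolding blinfun.bilinear_simps
      by (rule integral_diff) (rule integrable_continuous_real, rule continuous_on_subset[OF continuous_on_apply], force)+
    moreover have "integral {h..t + h} (\<lambda>s. S s v) = ?I (t + h) - ?I h" using 2 by simp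
    ultimately show ?thesis unfolding 1 by (simp add: 3 4)
  qed
  have "((\<lambda>h. (1 / h) *\<^sub>R integral {0..h} (\<lambda>s. S s (S t v - v))) \<longlongrightarrow> S 0 (S t v - v)) (at_right 0)"
    by (rule tendsto_average_continuous[of 1]) (auto intro: continuous_on_subset[OF continuous_on_apply])
  moreover have "\<forall>\<^sub>F h in at_right 0. (1 / h) *\<^sub>R integral {0..h} (\<lambda>s. S s (S t v - v)) = (1 / h) *\<^sub>R (S h (?I t) - ?I t)"
    using eventually_at_right_less by eventually_elim (simp add: *)
  ultimately show ?thesis unfolding gen_def by (simp add: tendsto_cong)
qed

text \<open>The averages of an orbit over [0, t] lie in the domain and tend to its starting
  point.\<close>

lemma closure_Domain_gen: "closure (Domain (gen S)) = UNIV"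
proof -
  have "v \<in> closure (Domain (gen S))" for v
  proof -
    have "((\<lambda>t. (1 / t) *\<^sub>R integral {0..t} (\<lambda>s. S s v)) \<longlongrightarrow> S 0 v) (at_right 0)"
      by (rule tendsto_average_continuous[of 1]) (auto intro: continuous_on_subset[OF continuous_on_apply])
    moreover have "\<forall>\<^sub>F t in at_right 0. (1 / t) *\<^sub>R integral {0..t} (\<lambda>s. S s v) \<in> Domain (gen S)"
      using eventually_at_right_less
    proof eventually_elim
      case (elim t)
      then show ?case using gen_scale[OF integral_apply_in_gen[of t v], of "1 / t"] by (auto intro: DomainI)
    qed
    ultimately show ?thesis
      by (intro Lim_in_closed_set[OF closed_closure _ trivial_limit_at_right_real, of _ "Domain (gen S)"])
        (auto elim!: eventually_mono intro: subsetD[OF closure_subset])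
  qed
  then show ?thesis by auto
qed

text \<open>The integrated equation determines the generator. In this form membership can be checked
  by applying bounded functionals, which is how the generator of the flow is found.\<close>

lemma gen_if_integral:
  assumes "\<And>t. 0 < t \<Longrightarrow> t < 1 \<Longrightarrow> integral {0..t} (\<lambda>s. S s w) = S t v - v"
  shows "(v, w) \<in> gen S"
proof -
  have "((\<lambda>t. (1 / t) *\<^sub>R integral {0..t} (\<lambda>s. S s w)) \<longlongrightarrow> S 0 w) (at_right 0)"
    by (rule tendsto_average_continuous[of 1]) (auto intro: continuous_on_subset[OF continuous_on_apply])
  moreover have "\<forall>\<^sub>F t in at_right 0. (1 / t) *\<^sub>R integral {0..t} (\<lambda>s. S s w) = (1 / t) *\<^sub>R (S t v - v)"
    unfolding eventually_at_right_field by (intro exI[of _ 1]) (simp add: assms)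
  ultimately show ?thesis unfolding gen_def by (simp add: tendsto_cong)
qed

end

section \<open>Miyadera perturbations\<close>

lemma strong_semigroup_rescale:
  assumes "strong_semigroup S"
  shows "strong_semigroup (\<lambda>t. exp (a * t) *\<^sub>R S t)"
proof -
  interpret semigroup S by unfold_locales fact
  have "((\<lambda>t. exp (a * t) *\<^sub>R S t v) \<longlongrightarrow> exp (a * 0) *\<^sub>R v) (at_right 0)" for v
    by (intro tendsto_scaleR tendsto_at_0 tendsto_intros)
  then show ?thesis
    unfolding strong_semigroup_def
    by (auto simp: plus distrib_left exp_add blinfun.bilinear_simps intro!: blinfun_eqI)
qed

lemma gen_rescale_imp:
  assumes S: "strong_semigroup S" and g: "(v, w) \<in> gen S"
  shows "(v, w + a *\<^sub>R v) \<in> gen (\<lambda>t. exp (a * t) *\<^sub>R S t)"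
proof -
  interpret semigroup S by unfold_locales fact
  have "((\<lambda>t. (exp (a * t) - 1) / t) \<longlongrightarrow> a) (at_right 0)"
  proof -
    have "((\<lambda>t. exp (a * t)) has_real_derivative a) (at 0 within {0<..})"
      by (auto intro!: derivative_eq_intros)
    then show ?thesis by (simp add: has_field_derivative_iff)
  qed
  then have "((\<lambda>t. exp (a * t) *\<^sub>R ((1 / t) *\<^sub>R (S t v - v)) + ((exp (a * t) - 1) / t) *\<^sub>R v)
      \<longlongrightarrow> exp (a * 0) *\<^sub>R w + a *\<^sub>R v) (at_right 0)"
  proof (intro tendsto_add tendsto_scaleR)
    show "((\<lambda>t. exp (a * t)) \<longlongrightarrow> exp (a * 0)) (at_right 0)" by (intro tendsto_intros)
  qed (use g in \<open>auto simp: gen_def\<close>)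
  moreover have "exp (a * t) *\<^sub>R ((1 / t) *\<^sub>R (S t v - v)) + ((exp (a * t) - 1) / t) *\<^sub>R v
     = (1 / t) *\<^sub>R ((exp (a * t) *\<^sub>R S t) v - v)" for t
    by (simp add: blinfun.bilinear_simps algebra_simps diff_divide_distrib)
  ultimately show ?thesis unfolding gen_def by simp
qed

text \<open>Damping makes a semigroup bounded at the price of shifting its generator by a multiple
  of the identity; a shift by 1 also turns the resolvent equation into one for the damped
  semigroup.\<close>

lemma gen_rescale:
  assumes S: "strong_semigroup S"
  shows "(v, w) \<in> gen (\<lambda>t. exp (a * t) *\<^sub>R S t) \<longleftrightarrow> (v, w - a *\<^sub>R v) \<in> gen S"
proof
  assume "(v, w) \<in> gen (\<lambda>t. exp (a * t) *\<^sub>R S t)"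
  from gen_rescale_imp[OF strong_semigroup_rescale[OF S] this, of "- a"]
  show "(v, w - a *\<^sub>R v) \<in> gen S" by (simp add: exp_add[symmetric])
next
  assume "(v, w - a *\<^sub>R v) \<in> gen S"
  from gen_rescale_imp[OF S this, of a] show "(v, w) \<in> gen (\<lambda>t. exp (a * t) *\<^sub>R S t)" by simp
qed

instance bcontfun :: (metric_space, banach) banach ..

section \<open>Perturbations that are bounded in the graph norm\<close>

locale graph_bounded = semigroup S for S :: "real \<Rightarrow> 'b::banach \<Rightarrow>\<^sub>L 'b" +
  fixes B :: "'b \<Rightarrow> 'b" and C :: real
  assumes B_add: "u \<in> Domain (gen S) \<Longrightarrow> v \<in> Domain (gen S) \<Longrightarrow> B (u + v) = B u + B v"
    and B_scale: "v \<in> Domain (gen S) \<Longrightarrow> B (c *\<^sub>R v) = c *\<^sub>R B v"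
    and B_bound: "(v, w) \<in> gen S \<Longrightarrow> norm (B v) \<le> C * (norm v + norm w)"
begin

lemma B_diff: "u \<in> Domain (gen S) \<Longrightarrow> v \<in> Domain (gen S) \<Longrightarrow> B (u - v) = B u - B v"
  using B_add[of u "(-1) *\<^sub>R v"] B_scale[of v "-1"] subspace_Domain_gen[of S]
  by (simp add: subspace_neg)

lemma Domain_apply: "v \<in> Domain (gen S) \<Longrightarrow> t \<ge> 0 \<Longrightarrow> S t v \<in> Domain (gen S)"
  using gen_apply by blast

lemma continuous_on_B:
  assumes "v \<in> Domain (gen S)"
  shows "continuous_on {0..} (\<lambda>t. B (S t v))"
  unfolding continuous_on
proof
  fix s :: real assume s: "s \<in> {0..}"
  obtain w where w: "(v, w) \<in> gen S" using assms by auto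
  have c: "((\<lambda>t. S t z) \<longlongrightarrow> S s z) (at s within {0..})" for z
    using continuous_on_apply[of z] s by (simp add: continuous_on)
  have "((\<lambda>t. B (S t v) - B (S s v)) \<longlongrightarrow> 0) (at s within {0..})"
  proof (rule Lim_null_comparison)
    show "\<forall>\<^sub>F t in at s within {0..}. norm (B (S t v) - B (S s v))
        \<le> C * (norm (S t v - S s v) + norm (S t w - S s w))"
      unfolding eventually_at_filter
    proof (rule always_eventually, intro allI impI)
      fix t assume "t \<noteq> s" "t \<in> {0..}"
      then have "(S t v, S t w) \<in> gen S" "(S s v, S s w) \<in> gen S" using w s gen_apply by auto
      then show "norm (B (S t v) - B (S s v)) \<le> C * (norm (S t v - S s v) + norm (S t w - S s w))"
        using B_bound[OF gen_diff] B_diff by (metis DomainI)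
    qed
    have "((\<lambda>t. C * (norm (S t v - S s v) + norm (S t w - S s w)))
        \<longlongrightarrow> C * (norm (S s v - S s v) + norm (S s w - S s w))) (at s within {0..})"
      by (intro tendsto_mult[OF tendsto_const] tendsto_add tendsto_norm tendsto_diff c tendsto_const)
    then show "((\<lambda>t. C * (norm (S t v - S s v) + norm (S t w - S s w))) \<longlongrightarrow> 0) (at s within {0..})" by simp
  qed
  then show "((\<lambda>t. B (S t v)) \<longlongrightarrow> B (S s v)) (at s within {0..})" by (rule LIM_zero_cancel)
qed

text \<open>\<open>B\<close> is not assumed to be closed, so it cannot be moved under the integral
  directly. But the generator maps \<open>?I v s\<close> to \<open>?I w s\<close>, so the integral
  of the orbit is differentiable in the graph norm; there \<open>B\<close> is bounded, and the
  fundamental theorem applies to \<open>B (?I v s)\<close>.\<close>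

lemma B_integral:
  assumes vw: "(v, w) \<in> gen S" and t: "t \<ge> 0"
  shows "B (integral {0..t} (\<lambda>s. S s v)) = integral {0..t} (\<lambda>s. B (S s v))"
proof -
  let ?I = "\<lambda>z t. integral {0..t} (\<lambda>s. S s z)"
  have gI: "(?I v s, ?I w s) \<in> gen S" if "s \<ge> 0" for s
    using integral_apply_in_gen[OF that, of v] integral_gen[OF vw that] by simp
  have dI: "((\<lambda>s. ?I z s) has_vector_derivative S s z) (at s within {0..t})" if "s \<in> {0..t}" for z s
    by (rule integral_has_vector_derivative) (use that in \<open>auto intro: continuous_on_subset[OF continuous_on_apply]\<close>)
  have "((\<lambda>s. B (?I v s)) has_vector_derivative B (S s v)) (at s within {0..t})" if s: "s \<in> {0..t}" for s
    unfolding has_vector_derivative_def has_derivative_within_alt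
  proof (intro conjI allI impI)
    show "bounded_linear (\<lambda>x. x *\<^sub>R B (S s v))" by (rule bounded_linear_scaleR_left)
    fix e :: real assume e: "e > 0"
    \<comment> \<open>Two error terms, one for \<open>v\<close> and one for \<open>w\<close>, are
      multiplied by at most |C| + 1; the summand 1 keeps the divisor positive.\<close>
    define e' where "e' = e / (2 * (\<bar>C\<bar> + 1))"
    have e': "e' > 0" using e by (simp add: e'_def)
    have ex: "\<exists>d>0. \<forall>y\<in>{0..t}. norm (y - s) < d \<longrightarrow> norm (?I z y - ?I z s - (y - s) *\<^sub>R S s z) \<le> e' * norm (y - s)" for z
      using dI[OF s, of z] e' unfolding has_vector_derivative_def has_derivative_within_alt by blast
    obtain d1 where d1: "d1 > 0" "\<forall>y\<in>{0..t}. norm (y - s) < d1 \<longrightarrow> norm (?I v y - ?I v s - (y - s) *\<^sub>R S s v) \<le> e' * norm (y - s)"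
      using ex[of v] by auto
    obtain d2 where d2: "d2 > 0" "\<forall>y\<in>{0..t}. norm (y - s) < d2 \<longrightarrow> norm (?I w y - ?I w s - (y - s) *\<^sub>R S s w) \<le> e' * norm (y - s)"
      using ex[of w] by auto
    show "\<exists>d>0. \<forall>y\<in>{0..t}. norm (y - s) < d \<longrightarrow>
        norm (B (?I v y) - B (?I v s) - (y - s) *\<^sub>R B (S s v)) \<le> e * norm (y - s)"
    proof (intro exI[of _ "min d1 d2"] conjI ballI impI)
      fix y assume y: "y \<in> {0..t}" "norm (y - s) < min d1 d2"
      have g: "(?I v y, ?I w y) \<in> gen S" "(?I v s, ?I w s) \<in> gen S" "(S s v, S s w) \<in> gen S"
        using gI gen_apply[OF vw] y s by auto
      then have g': "((y - s) *\<^sub>R S s v, (y - s) *\<^sub>R S s w) \<in> gen S" by (intro gen_scale)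
      note gd = gen_diff[OF gen_diff[OF g(1,2)] g']
      have "B (?I v y) - B (?I v s) - (y - s) *\<^sub>R B (S s v) = B (?I v y - ?I v s - (y - s) *\<^sub>R S s v)"
        using g g' gen_diff[OF g(1,2)] by (simp add: B_diff B_scale DomainI)
      also have "norm \<dots> \<le> C * (norm (?I v y - ?I v s - (y - s) *\<^sub>R S s v) + norm (?I w y - ?I w s - (y - s) *\<^sub>R S s w))"
        by (rule B_bound[OF gd])
      also have "\<dots> \<le> (\<bar>C\<bar> + 1) * (e' * norm (y - s) + e' * norm (y - s))"
        using d1 d2 y e' by (intro mult_mono add_mono) auto
      also have "\<dots> = e * norm (y - s)"
        using nonzero_mult_div_cancel_left[of "2 * (\<bar>C\<bar> + 1)" "e * norm (y - s)"] by (simp add: e'_def algebra_simps)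
      finally show "norm (B (?I v y) - B (?I v s) - (y - s) *\<^sub>R B (S s v)) \<le> e * norm (y - s)" .
    qed (use d1 d2 in auto)
  qed
  then have "((\<lambda>s. B (S s v)) has_integral B (?I v t) - B (?I v 0)) {0..t}"
    by (intro fundamental_theorem_of_calculus t) auto
  moreover have "B (?I v 0) = 0" using B_scale[of v 0] vw by (auto intro: DomainI)
  ultimately show ?thesis by (simp add: has_integral_iff)
qed

end

text \<open>The normalised case: with a bounded semigroup and an estimate uniform in
  \<open>t\<close>, one contraction on the bounded families yields the perturbed semigroup for all
  times at once.\<close>

locale miyadera = graph_bounded S B C for S :: "real \<Rightarrow> 'b::banach \<Rightarrow>\<^sub>L 'b" and B C +
  fixes M q :: real
  assumes bounded: "t \<ge> 0 \<Longrightarrow> norm (S t) \<le> M"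
    and B_int: "v \<in> Domain (gen S) \<Longrightarrow> t \<ge> 0 \<Longrightarrow> integral {0..t} (\<lambda>s. norm (B (S s v))) \<le> q * norm v"
    and q: "0 \<le> q" "q < 1"
begin

text \<open>\<open>B\<close> acts on the unperturbed orbit, which stays in the domain; so nothing
  has to be known about the range of the family \<open>\<Delta>\<close> that is still under
  construction.\<close>

definition conv :: "(real \<Rightarrow> 'b \<Rightarrow>\<^sub>L 'b) \<Rightarrow> 'b \<Rightarrow> real \<Rightarrow> 'b"
  where "conv \<Delta> v t = integral {0..t} (\<lambda>s. \<Delta> (t - s) (B (S s v)))"

definition strong_bounded :: "real \<Rightarrow> (real \<Rightarrow> 'b \<Rightarrow>\<^sub>L 'b) \<Rightarrow> bool"
  where "strong_bounded N \<Delta> \<longleftrightarrow> (\<forall>v. continuous_on {0..} (\<lambda>t. \<Delta> t v)) \<and> (\<forall>t\<ge>0. norm (\<Delta> t) \<le> N)"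

lemma continuous_on_kernel:
  assumes "strong_bounded N \<Delta>" "v \<in> Domain (gen S)"
  shows "continuous_on {(t, s). 0 \<le> s \<and> s \<le> t} (\<lambda>(t, s). \<Delta> (t - s) (B (S s v)))"
  unfolding case_prod_unfold
proof (rule continuous_on_strong_compose[where T = "{0..}" and M = N])
  show "continuous_on {p. 0 \<le> snd p \<and> snd p \<le> fst p} (\<lambda>x. B (S (snd x) v))"
    by (rule continuous_on_compose2[OF continuous_on_B[OF assms(2)]]) (auto intro!: continuous_intros)
qed (use assms in \<open>auto simp: strong_bounded_def intro!: continuous_intros\<close>)

lemma continuous_on_kernel2:
  assumes "strong_bounded N \<Delta>" "v \<in> Domain (gen S)" "0 \<le> a" "b \<le> t"
  shows "continuous_on {a..b} (\<lambda>s. \<Delta> (t - s) (B (S s v)))"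
proof -
  have "continuous_on {a..b} ((\<lambda>(t, s). \<Delta> (t - s) (B (S s v))) \<circ> (\<lambda>s. (t, s)))"
    by (rule continuous_on_compose continuous_on_subset[OF continuous_on_kernel[OF assms(1,2)]]
      continuous_intros)+ (use assms in auto)
  then show ?thesis by (simp add: o_def)
qed

lemma continuous_on_conv:
  assumes "strong_bounded N \<Delta>" "v \<in> Domain (gen S)"
  shows "continuous_on {0..} (conv \<Delta> v)"
  unfolding conv_def by (rule continuous_on_integral_triangle[OF continuous_on_kernel[OF assms]])

text \<open>The factor \<open>q\<close> serves three purposes: it lets \<open>conv\<close> extend
  from the dense domain, it makes the fixed point map a contraction, and it forces solutions of the
  homogeneous equation to vanish.\<close>

lemma norm_conv_le:
  assumes \<Delta>: "strong_bounded N \<Delta>" and v: "v \<in> Domain (gen S)" and t: "t \<ge> 0"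
  shows "norm (conv \<Delta> v t) \<le> N * q * norm v"
proof -
  have N: "norm (\<Delta> r) \<le> N" if "r \<ge> 0" for r using \<Delta> that by (simp add: strong_bounded_def)
  have cB: "continuous_on {0..t} (\<lambda>s. norm (B (S s v)))"
    by (intro continuous_on_norm continuous_on_subset[OF continuous_on_B[OF v]]) auto
  have "norm (conv \<Delta> v t) \<le> integral {0..t} (\<lambda>s. N * norm (B (S s v)))"
    unfolding conv_def
  proof (rule integral_norm_bound_integral)
    show "(\<lambda>s. \<Delta> (t - s) (B (S s v))) integrable_on {0..t}"
      by (rule integrable_continuous_real[OF continuous_on_kernel2[OF \<Delta> v]]) auto
    show "(\<lambda>s. N * norm (B (S s v))) integrable_on {0..t}"
      by (intro integrable_continuous_real continuous_intros cB)
    show "norm (\<Delta> (t - s) (B (S s v))) \<le> N * norm (B (S s v))" if "s \<in> {0..t}" for s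
      using that by (intro order_trans[OF norm_blinfun] mult_right_mono N) auto
  qed
  also have "\<dots> = N * integral {0..t} (\<lambda>s. norm (B (S s v)))" by simp
  also have "\<dots> \<le> N * (q * norm v)"
    using N[of 0] order_trans[OF norm_ge_zero N[of 0]] by (intro mult_left_mono B_int v t) auto
  finally show ?thesis by (simp add: mult.assoc)
qed

lemma conv_add:
  assumes "strong_bounded N \<Delta>" "u \<in> Domain (gen S)" "v \<in> Domain (gen S)" "t \<ge> 0"
  shows "conv \<Delta> (u + v) t = conv \<Delta> u t + conv \<Delta> v t"
proof -
  have "conv \<Delta> (u + v) t = integral {0..t} (\<lambda>s. \<Delta> (t - s) (B (S s u)) + \<Delta> (t - s) (B (S s v)))"
    unfolding conv_def using assms(2,3)
    by (intro integral_cong) (simp add: blinfun.bilinear_simps B_add Domain_apply)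
  then show ?thesis unfolding conv_def using assms
    by (simp add: Henstock_Kurzweil_Integration.integral_add integrable_continuous_real continuous_on_kernel2)
qed

lemma conv_scale:
  assumes "v \<in> Domain (gen S)" "t \<ge> 0"
  shows "conv \<Delta> (c *\<^sub>R v) t = c *\<^sub>R conv \<Delta> v t"
proof -
  have "conv \<Delta> (c *\<^sub>R v) t = integral {0..t} (\<lambda>s. c *\<^sub>R \<Delta> (t - s) (B (S s v)))"
    unfolding conv_def using assms
    by (intro integral_cong) (simp add: blinfun.bilinear_simps B_scale Domain_apply)
  then show ?thesis by (simp add: conv_def)
qed

lemma conv_diff_left:
  assumes "strong_bounded N \<Delta>" "strong_bounded N' \<Delta>'" "v \<in> Domain (gen S)"
  shows "conv (\<lambda>t. \<Delta> t - \<Delta>' t) v t = conv \<Delta> v t - conv \<Delta>' v t"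
  unfolding conv_def blinfun.diff_left using assms
  by (intro Henstock_Kurzweil_Integration.integral_diff integrable_continuous_real)
    (auto intro: continuous_on_kernel2)

text \<open>Each use of the equation improves the bound on \<open>\<Delta>\<close> by the factor
  \<open>q\<close>, first on the dense domain and then everywhere, and q^n N tends to 0. Algebraic
  identities for the solution are proved by applying this to the difference of their two
  sides.\<close>

lemma eq_zero_if_conv_eq:
  assumes \<Delta>: "strong_bounded N \<Delta>"
    and eq: "\<And>v t. v \<in> Domain (gen S) \<Longrightarrow> t \<ge> 0 \<Longrightarrow> \<Delta> t v = conv \<Delta> v t" and t: "t \<ge> 0"
  shows "\<Delta> t = 0"
proof -
  have N: "norm (\<Delta> r) \<le> N" if "r \<ge> 0" for r using \<Delta> that by (simp add: strong_bounded_def)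
  have N0: "N \<ge> 0" using order_trans[OF norm_ge_zero N[of 0]] by simp
  have bd: "\<forall>t\<ge>0. norm (\<Delta> t) \<le> q ^ n * N" for n
  proof (induction n)
    case (Suc n)
    then have sb: "strong_bounded (q ^ n * N) \<Delta>" using \<Delta> by (simp add: strong_bounded_def)
    show ?case
    proof (intro allI impI)
      fix t :: real assume t: "t \<ge> 0"
      show "norm (\<Delta> t) \<le> q ^ Suc n * N"
      proof (rule norm_blinfun_bound_dense[OF closure_Domain_gen])
        show "norm (\<Delta> t v) \<le> q ^ Suc n * N * norm v" if "v \<in> Domain (gen S)" for v
          using norm_conv_le[OF sb that t] eq[OF that t] by (simp add: mult_ac)
      qed (use q N0 in auto)
    qed
  qed (use N in auto)
  have "(\<lambda>n. q ^ n * N) \<longlonglongrightarrow> 0"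
    using q by (intro tendsto_mult_left_zero LIMSEQ_power_zero) auto
  then have "norm (\<Delta> t) \<le> 0" using bd t by (intro LIMSEQ_le_const) auto
  then show ?thesis by simp
qed

definition sol :: "(real \<Rightarrow> 'b \<Rightarrow>\<^sub>L 'b) \<Rightarrow> bool"
  where "sol u \<longleftrightarrow> (\<exists>N. strong_bounded N u) \<and>
    (\<forall>v\<in>Domain (gen S). \<forall>t\<ge>0. u t v = S t v + conv u v t)"

text \<open>A bounded strongly continuous family is encoded as one operator into the bounded
  continuous functions. The operator norm is the uniform bound of the family, and the space of such
  operators is complete.\<close>

definition fam :: "('b \<Rightarrow>\<^sub>L (real \<Rightarrow>\<^sub>C 'b)) \<Rightarrow> real \<Rightarrow> 'b \<Rightarrow>\<^sub>L 'b"
  where "fam U t = Blinfun (\<lambda>v. apply_bcontfun (blinfun_apply U v) t)"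

lemma norm_bcontfun_apply_le: "norm (apply_bcontfun (blinfun_apply U v) t) \<le> norm U * norm v"
  using norm_bounded[of "blinfun_apply U v" t] norm_blinfun[of U v] by linarith

lemma fam_apply: "fam U t v = apply_bcontfun (blinfun_apply U v) t"
proof -
  have "bounded_linear (\<lambda>v. apply_bcontfun (blinfun_apply U v) t)"
    by (rule bounded_linear_intro[where K = "norm U"])
      (auto simp: blinfun.bilinear_simps plus_bcontfun.rep_eq scaleR_bcontfun.rep_eq mult.commute
        intro: order_trans[OF norm_bcontfun_apply_le])
  then show ?thesis by (simp add: fam_def bounded_linear_Blinfun_apply)
qed

lemma strong_bounded_fam: "strong_bounded (norm U) (fam U)"
  unfolding strong_bounded_def
  by (auto simp: fam_apply norm_bcontfun_apply_le intro!: norm_blinfun_bound)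

lemma fam_diff: "fam (U - V) t = fam U t - fam V t"
  by (rule blinfun_eqI) (simp add: fam_apply blinfun.bilinear_simps minus_bcontfun.rep_eq)

text \<open>Elements of \<open>bcontfun\<close> live on the whole line, so negative times are frozen
  at 0.\<close>

lemma extend_max_bcontfun:
  fixes f :: "real \<Rightarrow> 'b"
  assumes "continuous_on {0..} f" "\<And>t. t \<ge> 0 \<Longrightarrow> norm (f t) \<le> K"
  shows "(\<lambda>t. f (max 0 t)) \<in> bcontfun"
proof (rule bcontfun_normI[where b = K])
  show "continuous_on UNIV (\<lambda>t. f (max 0 t))"
    by (rule continuous_on_compose2[OF assms(1)]) (auto intro!: continuous_intros)
qed (use assms in auto)

text \<open>\<open>conv\<close> makes sense on the domain only; the bound \<open>norm U * q\<close>
  extends it to all vectors by density.\<close>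

lemma ex_Phi:
  "\<exists>F :: 'b \<Rightarrow>\<^sub>L (real \<Rightarrow>\<^sub>C 'b). \<forall>v\<in>Domain (gen S). \<forall>t. apply_bcontfun (blinfun_apply F v) t = conv (fam U) v (max 0 t)"
proof -
  define f where "f v = Bcontfun (\<lambda>t. conv (fam U) v (max 0 t))" for v
  note sb = strong_bounded_fam[of U]
  have f: "apply_bcontfun (f v) t = conv (fam U) v (max 0 t)" if "v \<in> Domain (gen S)" for v t
    unfolding f_def
    by (subst Bcontfun_inverse[OF extend_max_bcontfun[OF continuous_on_conv[OF sb that] norm_conv_le[OF sb that]]]) auto
  obtain F :: "'b \<Rightarrow>\<^sub>L (real \<Rightarrow>\<^sub>C 'b)" where "\<And>v. v \<in> Domain (gen S) \<Longrightarrow> F v = f v" "norm F \<le> norm U * q"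
  proof (rule blinfun_extend_dense[OF subspace_Domain_gen closure_Domain_gen, where f = f and c = "norm U * q"])
    show "f (u + v) = f u + f v" if "u \<in> Domain (gen S)" "v \<in> Domain (gen S)" for u v
      using that subspace_add[OF subspace_Domain_gen that]
      by (intro bcontfun_eqI) (simp add: f plus_bcontfun.rep_eq conv_add[OF sb])
    show "f (c *\<^sub>R v) = c *\<^sub>R f v" if "v \<in> Domain (gen S)" for c v
      using that subspace_scale[OF subspace_Domain_gen that]
      by (intro bcontfun_eqI) (simp add: f scaleR_bcontfun.rep_eq conv_scale)
    show "norm (f v) \<le> norm U * q * norm v" if "v \<in> Domain (gen S)" for v
      using norm_conv_le[OF sb that] by (intro norm_bound) (simp add: f that)
  qed (use q in auto)
  then show ?thesis using f by metis
qed

lemma ex_sol: "\<exists>u. sol u"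
proof -
  obtain Phi where Phi: "\<And>U v t. v \<in> Domain (gen S) \<Longrightarrow>
      apply_bcontfun (blinfun_apply (Phi U) v) t = conv (fam U) v (max 0 t)"
    using ex_Phi by metis
  have SM: "norm (S t v) \<le> M * norm v" if "t \<ge> 0" for t v
    using that by (intro order_trans[OF norm_blinfun] mult_right_mono bounded) auto
  define E where "E v = Bcontfun (\<lambda>t. S (max 0 t) v)" for v
  have E: "apply_bcontfun (E v) t = S (max 0 t) v" for v t
    unfolding E_def
    by (subst Bcontfun_inverse[OF extend_max_bcontfun[OF continuous_on_apply SM]]) auto
  have "bounded_linear E"
  proof (rule bounded_linear_intro[where K = M])
    show "norm (E v) \<le> norm v * M" for v
      using SM by (intro norm_bound) (simp add: E mult.commute)
  qed (auto intro!: bcontfun_eqI simp: E blinfun.bilinear_simps plus_bcontfun.rep_eq scaleR_bcontfun.rep_eq)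
  then have BE: "blinfun_apply (Blinfun E) = E" by (simp add: bounded_linear_Blinfun_apply)
  \<comment> \<open>\<open>E\<close> is the unperturbed semigroup in this encoding, so a fixed point
    solves the Duhamel equation on the domain.\<close>
  have "\<exists>!U. Blinfun E + Phi U = U"
  proof (rule banach_fix_type[OF q, where f = "\<lambda>U. Blinfun E + Phi U"], intro allI)
    fix U V
    have "norm (Phi U - Phi V) \<le> q * norm (U - V)"
    proof (rule norm_blinfun_bound_dense[OF closure_Domain_gen])
      fix v assume v: "v \<in> Domain (gen S)"
      have "norm (conv (fam U) v (max 0 t) - conv (fam V) v (max 0 t)) \<le> norm (U - V) * q * norm v" for t
        using norm_conv_le[OF strong_bounded_fam[of "U - V"] v, of "max 0 t"]
          conv_diff_left[OF strong_bounded_fam strong_bounded_fam v, of U V]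
        by (simp add: fam_diff[abs_def])
      then show "norm ((Phi U - Phi V) v) \<le> q * norm (U - V) * norm v"
        using v by (intro norm_bound) (simp add: blinfun.bilinear_simps minus_bcontfun.rep_eq Phi mult_ac)
    qed (use q in auto)
    then show "dist (Blinfun E + Phi U) (Blinfun E + Phi V) \<le> q * dist U V" by (simp add: dist_norm)
  qed
  then obtain U where U: "Blinfun E + Phi U = U" by auto
  have "sol (fam U)"
    unfolding sol_def
  proof (intro conjI ballI allI impI exI)
    show "strong_bounded (norm U) (fam U)" by (rule strong_bounded_fam)
    fix v t assume v: "v \<in> Domain (gen S)" and t: "0 \<le> (t::real)"
    have "fam U t v = apply_bcontfun (blinfun_apply (Blinfun E + Phi U) v) t" by (simp add: fam_apply U)
    also have "\<dots> = S t v + conv (fam U) v t"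
      using t v by (simp add: blinfun.bilinear_simps plus_bcontfun.rep_eq BE E Phi)
    finally show "fam U t v = S t v + conv (fam U) v t" .
  qed
  then show ?thesis by blast
qed

lemma sol_0: assumes "sol u" shows "u 0 = id_blinfun"
proof -
  have "norm (u 0 - id_blinfun) \<le> 0"
  proof (rule norm_blinfun_bound_dense[OF closure_Domain_gen])
    show "norm ((u 0 - id_blinfun) v) \<le> 0 * norm v" if "v \<in> Domain (gen S)" for v
      using assms that by (simp add: sol_def blinfun.bilinear_simps conv_def)
  qed simp
  then show ?thesis by simp
qed

text \<open>For fixed \<open>s\<close> the defect of the semigroup law, as a function of the second
  time, is bounded, strongly continuous and a solution of the homogeneous equation; hence it
  vanishes.\<close>

lemma sol_plus:
  assumes u: "sol u" and s: "s \<ge> 0" and "t \<ge> 0"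
  shows "u (s + t) = u s o\<^sub>L u t"
proof -
  obtain N where N: "strong_bounded N u" using u by (auto simp: sol_def)
  have uN: "norm (u r) \<le> N" if "r \<ge> 0" for r using N that by (simp add: strong_bounded_def)
  have uc: "continuous_on {0..} (\<lambda>t. u t v)" for v using N by (simp add: strong_bounded_def)
  have eq: "u r v = S r v + conv u v r" if "v \<in> Domain (gen S)" "r \<ge> 0" for v r
    using u that by (simp add: sol_def)
  define \<Delta> where "\<Delta> r = u (s + r) - (u s o\<^sub>L u r)" for r
  have "norm (\<Delta> r) \<le> N + N * N" if "r \<ge> 0" for r
  proof -
    have "norm (u s o\<^sub>L u r) \<le> N * N"
      using that s order_trans[OF norm_ge_zero uN[OF s]] by (intro order_trans[OF norm_blinfun_compose] mult_mono uN) auto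
    then show ?thesis
      using uN[of "s + r"] that s norm_triangle_ineq4[of "u (s + r)" "u s o\<^sub>L u r"] by (simp add: \<Delta>_def)
  qed
  moreover have "continuous_on {0..} (\<lambda>r. \<Delta> r v)" for v
    unfolding \<Delta>_def blinfun.diff_left blinfun_apply_blinfun_compose
    by (intro continuous_intros uc continuous_on_compose2[OF uc]) (use s in auto)
  ultimately have sb: "strong_bounded (N + N * N) \<Delta>" by (simp add: strong_bounded_def)
  have "\<Delta> r v = conv \<Delta> v r" if v: "v \<in> Domain (gen S)" and r: "r \<ge> 0" for v r
  proof -
    let ?k = "\<lambda>x. u (s + r - x) (B (S x v))"
    have ck: "continuous_on {a..b} ?k" if "0 \<le> a" "b \<le> s + r" for a b
      by (rule continuous_on_kernel2[OF N v that])
    \<comment> \<open>Started at \<open>S r v\<close>, the integral up to time \<open>s\<close> is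
      the part over [r, s + r] of the integral for time s + r started at \<open>v\<close>.\<close>
    have "conv u (S r v) s = integral {0..s} (?k \<circ> (+) r)"
      unfolding conv_def by (rule integral_cong) (use r in \<open>auto simp: plus_apply[symmetric] add.commute\<close>)
    also have "\<dots> = integral {r..s + r} ?k" by (simp add: integral_shift_Icc_real)
    finally have 1: "u s (S r v) = S (s + r) v + integral {r..s + r} ?k"
      using eq[OF Domain_apply[OF v r] s] s r by (simp add: plus_apply)
    have "conv u v (s + r) = integral {0..r} ?k + integral {r..s + r} ?k"
      unfolding conv_def using r s
      by (intro Henstock_Kurzweil_Integration.integral_combine[symmetric] integrable_continuous_real ck) auto
    then have 2: "u (s + r) v = u s (S r v) + integral {0..r} ?k"
      using eq[OF v, of "s + r"] s r 1 by simp
    have k2: "continuous_on {0..r} (\<lambda>x. u (r - x) (B (S x v)))"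
      by (rule continuous_on_kernel2[OF N v]) auto
    have 3: "u s (conv u v r) = integral {0..r} (\<lambda>x. u s (u (r - x) (B (S x v))))"
      unfolding conv_def
      using integral_linear[OF integrable_continuous_real[OF k2] blinfun.bounded_linear_right[of "u s"]]
      by (simp add: o_def)
    have "conv \<Delta> v r = integral {0..r} (\<lambda>x. ?k x - u s (u (r - x) (B (S x v))))"
      unfolding conv_def by (rule integral_cong) (simp add: \<Delta>_def blinfun.bilinear_simps algebra_simps)
    also have "\<dots> = integral {0..r} ?k - u s (conv u v r)"
      unfolding 3 by (intro Henstock_Kurzweil_Integration.integral_diff integrable_continuous_real ck
          continuous_intros k2) (use s in auto)
    also have "\<dots> = \<Delta> r v"
      using 2 eq[OF v r] by (simp add: \<Delta>_def blinfun.bilinear_simps)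
    finally show ?thesis by simp
  qed
  from eq_zero_if_conv_eq[OF sb this \<open>t \<ge> 0\<close>] show ?thesis by (simp add: \<Delta>_def)
qed

lemma sol_strong_semigroup:
  assumes "sol u" shows "strong_semigroup u"
proof -
  have "continuous_on {0..} (\<lambda>t. u t v)" for v using assms by (auto simp: sol_def strong_bounded_def)
  then have "((\<lambda>t. u t v) \<longlongrightarrow> u 0 v) (at 0 within {0..})" for v by (simp add: continuous_on)
  then show ?thesis
    using assms by (auto simp: strong_semigroup_def sol_plus sol_0 at_within_Ici_at_right)
qed

text \<open>The commutator solves the homogeneous equation as well. This is what later carries
  complex linearity over to the perturbed semigroup.\<close>

lemma sol_commute:
  assumes u: "sol u" and P: "\<And>t. t \<ge> 0 \<Longrightarrow> S t o\<^sub>L P = P o\<^sub>L S t"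
    and BP: "\<And>v. v \<in> Domain (gen S) \<Longrightarrow> P v \<in> Domain (gen S) \<and> B (P v) = P (B v)" and "t \<ge> 0"
  shows "u t o\<^sub>L P = P o\<^sub>L u t"
proof -
  obtain N where N: "strong_bounded N u" using u by (auto simp: sol_def)
  have uN: "norm (u r) \<le> N" if "r \<ge> 0" for r using N that by (simp add: strong_bounded_def)
  have uc: "continuous_on {0..} (\<lambda>t. u t v)" for v using N by (simp add: strong_bounded_def)
  have eq: "u r v = S r v + conv u v r" if "v \<in> Domain (gen S)" "r \<ge> 0" for v r
    using u that by (simp add: sol_def)
  have SP: "S r (P v) = P (S r v)" if "r \<ge> 0" for r v
    using P[OF that] by (metis blinfun_apply_blinfun_compose)
  define \<Delta> where "\<Delta> r = (u r o\<^sub>L P) - (P o\<^sub>L u r)" for r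
  have "norm (\<Delta> r) \<le> N * norm P + norm P * N" if "r \<ge> 0" for r
  proof -
    have "norm (u r o\<^sub>L P) \<le> N * norm P" "norm (P o\<^sub>L u r) \<le> norm P * N"
      using uN[OF that] by (auto intro!: order_trans[OF norm_blinfun_compose] mult_left_mono mult_right_mono)
    then show ?thesis using norm_triangle_ineq4[of "u r o\<^sub>L P" "P o\<^sub>L u r"]
      unfolding \<Delta>_def by linarith
  qed
  moreover have "continuous_on {0..} (\<lambda>r. \<Delta> r v)" for v
    unfolding \<Delta>_def blinfun.diff_left blinfun_apply_blinfun_compose by (intro continuous_intros uc)
  ultimately have sb: "strong_bounded (N * norm P + norm P * N) \<Delta>" by (simp add: strong_bounded_def)
  have "\<Delta> r v = conv \<Delta> v r" if v: "v \<in> Domain (gen S)" and r: "r \<ge> 0" for v r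
  proof -
    have k: "continuous_on {0..r} (\<lambda>x. u (r - x) (B (S x v)))"
      "continuous_on {0..r} (\<lambda>x. u (r - x) (B (S x (P v))))"
      using BP[OF v] v by (auto intro: continuous_on_kernel2[OF N])
    have "conv \<Delta> v r = integral {0..r} (\<lambda>x. u (r - x) (B (S x (P v))) - P (u (r - x) (B (S x v))))"
      unfolding conv_def
      by (rule integral_cong) (use BP Domain_apply[OF v] in \<open>auto simp: \<Delta>_def blinfun.bilinear_simps SP\<close>)
    also have "\<dots> = conv u (P v) r - integral {0..r} (\<lambda>x. P (u (r - x) (B (S x v))))"
      unfolding conv_def
      by (intro Henstock_Kurzweil_Integration.integral_diff integrable_continuous_real k continuous_intros)
    also have "integral {0..r} (\<lambda>x. P (u (r - x) (B (S x v)))) = P (conv u v r)"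
      unfolding conv_def
      using integral_linear[OF integrable_continuous_real[OF k(1)] blinfun.bounded_linear_right[of P]]
      by (simp add: o_def)
    finally show ?thesis
      using eq[OF v r] eq[of "P v" r] BP[OF v] r
      by (simp add: \<Delta>_def[of r] blinfun.bilinear_simps SP)
  qed
  from eq_zero_if_conv_eq[OF sb this \<open>t \<ge> 0\<close>] show ?thesis by (simp add: \<Delta>_def)
qed

text \<open>The Duhamel integrand is jointly continuous on the triangle 0 <= s <= t and has the
  value \<open>B v\<close> at its corner, so its average over [0, t] adds exactly \<open>B v\<close>
  to the difference quotient.\<close>

lemma sol_gen_sub:
  assumes u: "sol u" and vw: "(v, w) \<in> gen S"
  shows "(v, w + B v) \<in> gen u"
proof -
  obtain N where N: "strong_bounded N u" using u by (auto simp: sol_def)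
  have v: "v \<in> Domain (gen S)" using vw by auto
  let ?h = "\<lambda>t s. u (t - s) (B (S s v))"
  have "((\<lambda>t. (1 / t) *\<^sub>R integral {0..t} (?h t)) \<longlongrightarrow> B v) (at_right 0)"
  proof (rule tendsto_average[where c = 1])
    show "continuous_on {0..t} (?h t)" for t
      by (rule continuous_on_kernel2[OF N v]) auto
    fix e :: real assume "e > 0"
    then obtain d where d: "d > 0" and D: "\<And>p. p \<in> {(t, s). 0 \<le> s \<and> s \<le> t} \<Longrightarrow> dist p (0, 0) < d \<Longrightarrow>
        dist ((\<lambda>(t, s). ?h t s) p) ((\<lambda>(t, s). ?h t s) (0, 0)) < e"
      using continuous_on_kernel[OF N v, unfolded continuous_on_iff, rule_format, of "(0, 0)" e] by auto
    have "norm (?h t s - B v) \<le> e" if ts: "0 \<le> s" "s \<le> t" "t < d / 2" for t s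
    proof -
      have "dist (t, s) (0, 0) \<le> \<bar>t\<bar> + \<bar>s\<bar>"
        using sqrt_sum_squares_le_sum_abs[of t s] by (simp add: dist_Pair_Pair)
      then have "dist (t, s) (0, 0) < d" using ts by simp
      then show ?thesis using D[of "(t, s)"] ts sol_0[OF u] by (simp add: dist_norm)
    qed
    then show "\<exists>d>0. \<forall>t s. 0 \<le> s \<and> s \<le> t \<and> t < d \<longrightarrow> norm (?h t s - B v) \<le> e"
      using d by (intro exI[of _ "d / 2"]) auto
  qed simp
  then have "((\<lambda>t. (1 / t) *\<^sub>R (S t v - v) + (1 / t) *\<^sub>R conv u v t) \<longlongrightarrow> w + B v) (at_right 0)"
    using vw unfolding gen_def conv_def by (intro tendsto_add) simp_all
  moreover have "\<forall>\<^sub>F t in at_right 0. (1 / t) *\<^sub>R (S t v - v) + (1 / t) *\<^sub>R conv u v t = (1 / t) *\<^sub>R (u t v - v)"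
    using eventually_at_right_less
  proof eventually_elim
    case (elim t)
    then have "u t v = S t v + conv u v t" using u v by (simp add: sol_def)
    then show ?case by (simp add: scaleR_add_right scaleR_diff_right)
  qed
  ultimately show ?thesis unfolding gen_def mem_Collect_eq prod.case by (rule Lim_transform_eventually)
qed

text \<open>Try v = J x, the integral over [0, \<tau>] of the orbit of \<open>x\<close> under the
  semigroup damped by exp (- t). Then v - w = x - R \<tau> x, and the equation becomes x = z + R
  \<tau> x + B (J x). For large \<tau> the middle term is small, while x |-> B (J x) has norm at
  most \<open>q\<close>; so the right-hand side is a contraction in \<open>x\<close>. Stopping at a
  finite \<tau> avoids improper integrals.\<close>

lemma resolvent_surj: "\<exists>v w. (v, w) \<in> gen S \<and> v - w - B v = z"
proof -
  define R where "R t = exp (- 1 * t) *\<^sub>R S t" for t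
  have R: "strong_semigroup R"
    unfolding R_def[abs_def] by (rule strong_semigroup_rescale[OF strong_semigroup])
  have gR: "(v, w) \<in> gen R \<longleftrightarrow> (v, w + v) \<in> gen S" for v w
    unfolding R_def[abs_def] gen_rescale[OF strong_semigroup] by simp
  have DR: "Domain (gen R) = Domain (gen S)"
  proof (intro set_eqI iffI)
    fix v assume "v \<in> Domain (gen S)"
    then obtain w where "(v, w) \<in> gen S" by auto
    then have "(v, w - v) \<in> gen R" by (simp add: gR)
    then show "v \<in> Domain (gen R)" by auto
  qed (auto simp: gR)
  have boundR: "norm (B v) \<le> 2 * \<bar>C\<bar> * (norm v + norm w)" if "(v, w) \<in> gen R" for v w
  proof -
    have "norm (B v) \<le> C * (norm v + norm (w + v))" using that by (intro B_bound) (simp add: gR)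
    also have "\<dots> \<le> \<bar>C\<bar> * (2 * (norm v + norm w))"
    proof (intro mult_mono)
      show "norm v + norm (w + v) \<le> 2 * (norm v + norm w)"
        using norm_triangle_ineq[of w v] norm_ge_zero[of w] by argo
    qed auto
    finally show ?thesis by (simp add: mult_ac)
  qed
  interpret R: graph_bounded R B "2 * \<bar>C\<bar>"
    by unfold_locales (auto simp: R DR B_add B_scale boundR)
  have Rt: "norm (R t) \<le> exp (- t) * M" if "t \<ge> 0" for t
    using bounded[OF that] by (simp add: R_def)
  have M0: "M \<ge> 0" using order_trans[OF norm_ge_zero bounded[of 0]] by simp
  \<comment> \<open>Chosen so that exp (- \<tau>) (M + 1) is at most (1 - q) / 2; together with the
    factor \<open>q\<close> this leaves (1 + q) / 2 < 1.\<close>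
  define \<tau> where "\<tau> = max 0 (- ln ((1 - q) / 2 / (M + 1)))"
  have \<tau>: "\<tau> \<ge> 0" "norm (R \<tau>) \<le> (1 - q) / 2"
  proof -
    show "\<tau> \<ge> 0" by (simp add: \<tau>_def)
    then have "norm (R \<tau>) \<le> exp (- \<tau>) * (M + 1)"
      by (intro order_trans[OF Rt] mult_left_mono) auto
    also have "\<dots> \<le> (1 - q) / 2 / (M + 1) * (M + 1)"
    proof (rule mult_right_mono)
      have "exp (- \<tau>) \<le> exp (ln ((1 - q) / 2 / (M + 1)))" by (simp add: \<tau>_def)
      also have "\<dots> = (1 - q) / 2 / (M + 1)" using q M0 by (intro exp_ln) auto
      finally show "exp (- \<tau>) \<le> (1 - q) / 2 / (M + 1)" .
    qed (use M0 in auto)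
    also have "\<dots> = (1 - q) / 2"
      by (subst times_divide_eq_left, rule nonzero_mult_div_cancel_right) (use M0 in auto)
    finally show "norm (R \<tau>) \<le> (1 - q) / 2" .
  qed
  define J where "J v = integral {0..\<tau>} (\<lambda>s. R s v)" for v
  have gJ: "(J v, R \<tau> v - v) \<in> gen R" for v
    unfolding J_def by (rule R.integral_apply_in_gen[OF \<tau>(1)])
  have int: "(\<lambda>s. R s v) integrable_on {0..\<tau>}" for v
    by (rule integrable_continuous_real, rule continuous_on_subset[OF R.continuous_on_apply]) auto
  have Jadd: "J (u + v) = J u + J v" for u v
    by (simp add: J_def blinfun.bilinear_simps Henstock_Kurzweil_Integration.integral_add int)
  have Jsc: "J (c *\<^sub>R v) = c *\<^sub>R J v" for c v
    by (simp add: J_def blinfun.bilinear_simps)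
  have Rb: "norm (R s v) \<le> M * norm v" if "s \<ge> 0" for s v
  proof -
    have "exp (- s) * M \<le> 1 * M" using M0 that by (intro mult_right_mono) auto
    then show ?thesis using Rt[OF that] by (intro order_trans[OF norm_blinfun] mult_right_mono) auto
  qed
  have Jb: "norm (J v) \<le> M * norm v * (\<tau> - 0)" for v
    unfolding J_def by (rule integral_bound)
      (use \<tau> Rb in \<open>auto intro: continuous_on_subset[OF R.continuous_on_apply]\<close>)
  have "bounded_linear (\<lambda>v. B (J v))"
  proof (rule bounded_linear_intro[where K = "2 * \<bar>C\<bar> * (M * \<tau> + (M + 1))"])
    show "B (J (u + v)) = B (J u) + B (J v)" for u v using gJ by (auto simp: Jadd intro!: R.B_add)
    show "B (J (c *\<^sub>R v)) = c *\<^sub>R B (J v)" for c v using gJ by (auto simp: Jsc intro!: R.B_scale)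
    fix v
    have "norm (B (J v)) \<le> 2 * \<bar>C\<bar> * (norm (J v) + norm (R \<tau> v - v))" by (rule R.B_bound[OF gJ])
    also have "\<dots> \<le> 2 * \<bar>C\<bar> * (M * \<tau> * norm v + (M * norm v + norm v))"
      using Jb[of v] Rb[OF \<tau>(1), of v] norm_triangle_ineq4[of "R \<tau> v" v]
      by (intro mult_left_mono add_mono) (auto simp: mult_ac)
    finally show "norm (B (J v)) \<le> norm v * (2 * \<bar>C\<bar> * (M * \<tau> + (M + 1)))"
      by (simp add: algebra_simps)
  qed
  then have P: "blinfun_apply (Blinfun (\<lambda>v. B (J v))) v = B (J v)" for v
    by (simp add: bounded_linear_Blinfun_apply)
  define P where "P = Blinfun (\<lambda>v. B (J v))"
  \<comment> \<open>On the domain \<open>B\<close> moves under the integral, and damping only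
    decreases the integrand, so the Miyadera estimate applies; density does the rest.\<close>
  have "norm P \<le> q"
  proof (rule norm_blinfun_bound_dense[OF closure_Domain_gen])
    fix v assume v: "v \<in> Domain (gen S)"
    have eq: "B (R s v) = exp (- s) *\<^sub>R B (S s v)" if "s \<ge> 0" for s
      using B_scale[OF Domain_apply[OF v that]] by (simp add: R_def blinfun.bilinear_simps)
    obtain w where "(v, w) \<in> gen R" using v DR by auto
    then have "B (J v) = integral {0..\<tau>} (\<lambda>s. B (R s v))"
      unfolding J_def by (rule R.B_integral[OF _ \<tau>(1)])
    then have "P v = integral {0..\<tau>} (\<lambda>s. B (R s v))" by (simp add: P_def P)
    also have "norm \<dots> \<le> integral {0..\<tau>} (\<lambda>s. norm (B (S s v)))"
    proof (rule integral_norm_bound_integral)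
      show "(\<lambda>s. B (R s v)) integrable_on {0..\<tau>}"
        by (rule integrable_continuous_real, rule continuous_on_subset[OF R.continuous_on_B]) (use v DR in auto)
      show "(\<lambda>s. norm (B (S s v))) integrable_on {0..\<tau>}"
        by (intro integrable_continuous_real continuous_on_norm continuous_on_subset[OF continuous_on_B[OF v]]) auto
      show "norm (B (R s v)) \<le> norm (B (S s v))" if "s \<in> {0..\<tau>}" for s
        using that by (simp add: eq mult_left_le_one_le)
    qed
    also have "\<dots> \<le> q * norm v" by (rule B_int[OF v \<tau>(1)])
    finally show "norm (P v) \<le> q * norm v" .
  qed (use q in auto)
  have "\<exists>!x. z + R \<tau> x + P x = x"
  proof (rule banach_fix_type[where c = "(1 + q) / 2" and f = "\<lambda>x. z + R \<tau> x + P x"], use q in simp, use q in simp, intro allI)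
    fix x y
    have "norm (R \<tau> (x - y) + P (x - y)) \<le> (1 - q) / 2 * norm (x - y) + q * norm (x - y)"
      by (intro order_trans[OF norm_triangle_ineq] add_mono order_trans[OF norm_blinfun] mult_right_mono)
        (use \<tau> \<open>norm P \<le> q\<close> in auto)
    also have "\<dots> = (1 + q) / 2 * dist x y" by (simp add: dist_norm field_simps)
    also have "R \<tau> (x - y) + P (x - y) = (z + R \<tau> x + P x) - (z + R \<tau> y + P y)"
      by (simp add: blinfun.bilinear_simps)
    finally show "dist (z + R \<tau> x + P x) (z + R \<tau> y + P y) \<le> (1 + q) / 2 * dist x y"
      by (simp only: dist_norm)
  qed
  then obtain x where "z + R \<tau> x + P x = x" by auto
  moreover have "(J x, R \<tau> x - x + J x) \<in> gen S" using gJ[of x] by (simp add: gR)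
  ultimately show ?thesis
    by (intro exI[of _ "J x"] exI[of _ "R \<tau> x - x + J x"]) (simp add: P_def P algebra_simps)
qed

text \<open>The damped orbit of \<open>d\<close> under exp (- t) u(t) is constant, since its
  generator maps \<open>d\<close> to 0; boundedness of \<open>u\<close> makes it tend to 0.\<close>

lemma bounded_eigenvector_zero:
  assumes u: "strong_semigroup u" and b: "\<And>t. t \<ge> 0 \<Longrightarrow> norm (u t) \<le> N" and d: "(d, d) \<in> gen u"
  shows "d = 0"
proof -
  have sR: "strong_semigroup (\<lambda>t. exp (- 1 * t) *\<^sub>R u t)" by (rule strong_semigroup_rescale[OF u])
  interpret R: semigroup "\<lambda>t. exp (- 1 * t) *\<^sub>R u t" by unfold_locales (rule sR)
  have "(d, 0) \<in> gen (\<lambda>t. exp (- 1 * t) *\<^sub>R u t)" using d unfolding gen_rescale[OF u] by simp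
  then have "exp (- t) *\<^sub>R u t d = d" if "t \<ge> 0" for t
    using R.integral_gen[of d 0 t] that by (simp add: blinfun.bilinear_simps)
  then have "norm d \<le> exp (- t) * (N * norm d)" if "t \<ge> 0" for t
    using that order_trans[OF norm_blinfun mult_right_mono[OF b[OF that]], of d]
    by (metis abs_exp_cancel mult_left_mono exp_ge_zero norm_ge_zero norm_scaleR)
  then have "norm d \<le> exp (- real n) * (N * norm d)" for n by simp
  moreover have "(\<lambda>n. exp (- real n) * (N * norm d)) \<longlonglongrightarrow> 0 * (N * norm d)"
    by (intro tendsto_mult tendsto_const filterlim_compose[OF exp_at_bot]
        filterlim_compose[OF filterlim_uminus_at_bot_at_top] filterlim_real_sequentially)
  ultimately have "norm d \<le> 0" by (intro LIMSEQ_le_const) auto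
  then show ?thesis by simp
qed

text \<open>One inclusion is known. For a pair (x, y) in \<open>gen u\<close>, solve the resolvent
  equation with right-hand side x - y inside the smaller graph; the difference of \<open>x\<close>
  and that solution is an eigenvector of \<open>gen u\<close> for the eigenvalue 1, hence 0.\<close>

lemma sol_gen:
  assumes u: "sol u"
  shows "gen u = {(v, w + B v) | v w. (v, w) \<in> gen S}"
proof (intro set_eqI iffI)
  fix p assume "p \<in> gen u"
  then obtain x y where p: "p = (x, y)" "(x, y) \<in> gen u" by (cases p) auto
  obtain v w where vw: "(v, w) \<in> gen S" "v - w - B v = x - y" using resolvent_surj by blast
  have "(x - v, y - (w + B v)) \<in> gen u" by (rule gen_diff[OF p(2) sol_gen_sub[OF u vw(1)]])
  also have "y - (w + B v) = x - v" using vw(2) by (simp add: algebra_simps)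
  finally have d: "(x - v, x - v) \<in> gen u" .
  obtain N where "strong_bounded N u" using u by (auto simp: sol_def)
  then have "x - v = 0"
    by (intro bounded_eigenvector_zero[OF sol_strong_semigroup[OF u] _ d]) (auto simp: strong_bounded_def)
  then show "p \<in> {(v, w + B v) | v w. (v, w) \<in> gen S}" using vw p by (auto simp: algebra_simps)
qed (use sol_gen_sub[OF u] in auto)

theorem perturbation:
  "\<exists>u. strong_semigroup u \<and> gen u = {(v, w + B v) | v w. (v, w) \<in> gen S} \<and>
    (\<forall>P. (\<forall>t\<ge>0. S t o\<^sub>L P = P o\<^sub>L S t) \<longrightarrow>
      (\<forall>v\<in>Domain (gen S). P v \<in> Domain (gen S) \<and> B (P v) = P (B v)) \<longrightarrow> (\<forall>t\<ge>0. u t o\<^sub>L P = P o\<^sub>L u t))"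
proof -
  obtain u where u: "sol u" using ex_sol by auto
  show ?thesis
    by (intro exI[of _ u] conjI sol_strong_semigroup[OF u] sol_gen[OF u] allI impI sol_commute[OF u]) auto
qed

end

text \<open>Damping by exp (- a t) shrinks what happens after time \<alpha>: if
  \<open>R \<alpha>\<close> has norm at most (1 - q') / 2, all later blocks of length \<alpha>
  together cost at most that much, so the integral over any [0, t] stays below Q = (1 + q') / 2. The
  damping is undone at the end.\<close>

theorem (in graph_bounded) miyadera_perturbation:
  assumes "\<alpha> > 0" "q < 1"
    and int: "\<And>v. v \<in> Domain (gen S) \<Longrightarrow> integral {0..\<alpha>} (\<lambda>s. norm (B (S s v))) \<le> q * norm v"
  shows "\<exists>u. strong_semigroup u \<and> gen u = {(v, w + B v) | v w. (v, w) \<in> gen S} \<and>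
    (\<forall>P. (\<forall>t\<ge>0. S t o\<^sub>L P = P o\<^sub>L S t) \<longrightarrow>
      (\<forall>v\<in>Domain (gen S). P v \<in> Domain (gen S) \<and> B (P v) = P (B v)) \<longrightarrow> (\<forall>t\<ge>0. u t o\<^sub>L P = P o\<^sub>L u t))"
proof -
  \<comment> \<open>\<open>q\<close> may be negative, while the normalised case works with a
    nonnegative factor.\<close>
  define q' where "q' = max 0 q"
  have q': "0 \<le> q'" "q' < 1" "q \<le> q'" using \<open>q < 1\<close> by (auto simp: q'_def)
  obtain M w0 where M: "M \<ge> 1" "w0 \<ge> 0" "\<And>t. t \<ge> 0 \<Longrightarrow> norm (S t) \<le> M * exp (w0 * t)" using growth by auto
  define Q where "Q = (1 + q') / 2"
  \<comment> \<open>The first entry bounds the damped semigroup by \<open>M\<close> for all times;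
    the second makes M exp ((w0 - a) \<alpha>) at most (1 - q') / 2.\<close>
  define a where "a = max w0 (w0 - ln ((1 - q') / 2 / M) / \<alpha>)"
  define R where "R t = exp (- a * t) *\<^sub>R S t" for t
  have R: "strong_semigroup R"
    unfolding R_def[abs_def] by (rule strong_semigroup_rescale[OF strong_semigroup])
  have gR: "(v, w) \<in> gen R \<longleftrightarrow> (v, w + a *\<^sub>R v) \<in> gen S" for v w
    unfolding R_def[abs_def] gen_rescale[OF strong_semigroup] by simp
  have DR: "Domain (gen R) = Domain (gen S)"
  proof (intro set_eqI iffI)
    fix v assume "v \<in> Domain (gen S)"
    then obtain w where "(v, w) \<in> gen S" by auto
    then have "(v, w - a *\<^sub>R v) \<in> gen R" by (simp add: gR)
    then show "v \<in> Domain (gen R)" by auto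
  qed (auto simp: gR)
  have a0: "a \<ge> w0" "a \<ge> 0" using M by (auto simp: a_def)
  have boundR: "norm (B v) \<le> \<bar>C\<bar> * (1 + a) * (norm v + norm w)" if "(v, w) \<in> gen R" for v w
  proof -
    have "norm (B v) \<le> C * (norm v + norm (w + a *\<^sub>R v))" using that by (intro B_bound) (simp add: gR)
    also have "\<dots> \<le> \<bar>C\<bar> * ((1 + a) * (norm v + norm w))"
    proof (intro mult_mono)
      have "norm v + norm (w + a *\<^sub>R v) \<le> norm v + (norm w + a * norm v)"
        using norm_triangle_ineq[of w "a *\<^sub>R v"] a0 by simp
      also have "\<dots> \<le> (1 + a) * (norm v + norm w)"
        using a0 mult_nonneg_nonneg[of a "norm w"] by (simp add: algebra_simps)
      finally show "norm v + norm (w + a *\<^sub>R v) \<le> (1 + a) * (norm v + norm w)" .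
    qed auto
    finally show ?thesis by (simp add: mult_ac)
  qed
  interpret R: graph_bounded R B "\<bar>C\<bar> * (1 + a)"
    by unfold_locales (auto simp: R DR B_add B_scale boundR)
  have Rt: "norm (R t) \<le> M * exp ((w0 - a) * t)" if "t \<ge> 0" for t
  proof -
    have "norm (R t) \<le> exp (- a * t) * (M * exp (w0 * t))"
      using M(3)[OF that] by (simp add: R_def)
    also have "\<dots> = M * exp ((w0 - a) * t)" by (simp add: exp_add[symmetric] algebra_simps)
    finally show ?thesis .
  qed
  have RM: "norm (R t) \<le> M" if "t \<ge> 0" for t
  proof -
    have "M * exp ((w0 - a) * t) \<le> M * 1"
      using that a0 M by (intro mult_left_mono) (auto intro: mult_nonpos_nonneg)
    then show ?thesis using Rt[OF that] by simp
  qed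
  have Ra: "norm (R \<alpha>) \<le> (1 - q') / 2"
  proof -
    have "(w0 - a) * \<alpha> \<le> ln ((1 - q') / 2 / M)"
    proof -
      have "w0 - ln ((1 - q') / 2 / M) / \<alpha> \<le> a" by (simp add: a_def)
      then have "(w0 - a) \<le> ln ((1 - q') / 2 / M) / \<alpha>" by simp
      then show ?thesis using \<open>\<alpha> > 0\<close> by (simp add: pos_le_divide_eq)
    qed
    then have "M * exp ((w0 - a) * \<alpha>) \<le> M * exp (ln ((1 - q') / 2 / M))"
      using M by (intro mult_left_mono) auto
    also have "\<dots> = M * ((1 - q') / 2 / M)" using M q' by (subst exp_ln) auto
    also have "\<dots> = (1 - q') / 2" using M by simp
    finally show ?thesis using Rt[of \<alpha>] \<open>\<alpha> > 0\<close> by simp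
  qed
  have inR: "(\<lambda>s. norm (B (R s v))) integrable_on {x..y}" if "v \<in> Domain (gen S)" "0 \<le> x" for v x y
    by (intro integrable_continuous_real continuous_on_norm continuous_on_subset[OF R.continuous_on_B])
      (use that DR in auto)
  have first: "integral {0..\<alpha>} (\<lambda>s. norm (B (R s v))) \<le> q' * norm v" if v: "v \<in> Domain (gen S)" for v
  proof -
    have "integral {0..\<alpha>} (\<lambda>s. norm (B (R s v))) \<le> integral {0..\<alpha>} (\<lambda>s. norm (B (S s v)))"
    proof (rule integral_le)
      show "(\<lambda>s. norm (B (S s v))) integrable_on {0..\<alpha>}"
        by (intro integrable_continuous_real continuous_on_norm continuous_on_subset[OF continuous_on_B[OF v]]) auto
      show "norm (B (R s v)) \<le> norm (B (S s v))" if s: "s \<in> {0..\<alpha>}" for s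
      proof -
        have "B (R s v) = exp (- a * s) *\<^sub>R B (S s v)"
          using B_scale[OF Domain_apply[OF v]] s by (simp add: R_def blinfun.bilinear_simps)
        moreover have "exp (- a * s) \<le> 1" using a0 s by simp
        ultimately show ?thesis by (simp add: mult_left_le_one_le)
      qed
    qed (use inR v in auto)
    also have "\<dots> \<le> q * norm v" by (rule int[OF v])
    also have "\<dots> \<le> q' * norm v" using q' by (intro mult_right_mono) auto
    finally show ?thesis .
  qed
  have Q: "Q < 1" "0 \<le> Q" using q' by (auto simp: Q_def)
  \<comment> \<open>The block [0, \<alpha>] is split off; the rest is the same integral with one
    block less for \<open>R \<alpha> v\<close>, and q' + (1 - q') / 2 = Q closes the
    induction.\<close>
  have step: "integral {0..real n * \<alpha>} (\<lambda>s. norm (B (R s v))) \<le> Q * norm v" if "v \<in> Domain (gen S)" for n v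
    using that
  proof (induction n arbitrary: v)
    case (Suc n)
    have v': "R \<alpha> v \<in> Domain (gen S)" using R.Domain_apply[of v \<alpha>] DR Suc.prems \<open>\<alpha> > 0\<close> by auto
    have "integral {0..real (Suc n) * \<alpha>} (\<lambda>s. norm (B (R s v))) =
        integral {0..\<alpha>} (\<lambda>s. norm (B (R s v))) + integral {\<alpha>..real (Suc n) * \<alpha>} (\<lambda>s. norm (B (R s v)))"
      using \<open>\<alpha> > 0\<close> by (intro Henstock_Kurzweil_Integration.integral_combine[symmetric] inR Suc.prems) auto
    also have "integral {\<alpha>..real (Suc n) * \<alpha>} (\<lambda>s. norm (B (R s v)))
        = integral {0..real n * \<alpha>} ((\<lambda>s. norm (B (R s v))) \<circ> (+) \<alpha>)"
      by (subst integral_shift_Icc_real) (simp add: algebra_simps)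
    also have "\<dots> = integral {0..real n * \<alpha>} (\<lambda>s. norm (B (R s (R \<alpha> v))))"
      by (rule integral_cong) (use \<open>\<alpha> > 0\<close> in \<open>auto simp: R.plus_apply[symmetric] add.commute\<close>)
    also have "\<dots> \<le> Q * norm (R \<alpha> v)" by (rule Suc.IH[OF v'])
    also have "\<dots> \<le> 1 * ((1 - q') / 2 * norm v)"
      using Q Ra by (intro mult_mono order_trans[OF norm_blinfun mult_right_mono]) auto
    finally have "integral {0..real (Suc n) * \<alpha>} (\<lambda>s. norm (B (R s v))) \<le> q' * norm v + (1 - q') / 2 * norm v"
      using first[OF Suc.prems] by simp
    then show ?case by (simp add: Q_def field_simps)
  qed (use Q in auto)
  interpret R: miyadera R B "\<bar>C\<bar> * (1 + a)" M Q
  proof unfold_locales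
    fix v t assume v: "v \<in> Domain (gen R)" and t: "0 \<le> (t::real)"
    obtain n where "t / \<alpha> \<le> real n" using real_arch_simple by blast
    then have n: "t \<le> real n * \<alpha>" using \<open>\<alpha> > 0\<close> by (simp add: pos_divide_le_eq)
    have "integral {0..t} (\<lambda>s. norm (B (R s v))) \<le> integral {0..real n * \<alpha>} (\<lambda>s. norm (B (R s v)))"
      using n t v DR by (intro integral_subset_le inR) auto
    then show "integral {0..t} (\<lambda>s. norm (B (R s v))) \<le> Q * norm v" using step v DR by (auto intro: order_trans)
  qed (use RM Q in auto)
  obtain u where u: "strong_semigroup u" "gen u = {(v, w + B v) | v w. (v, w) \<in> gen R}"
    and uP: "\<And>P. (\<forall>t\<ge>0. R t o\<^sub>L P = P o\<^sub>L R t) \<Longrightarrow>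
      (\<forall>v\<in>Domain (gen R). P v \<in> Domain (gen R) \<and> B (P v) = P (B v)) \<Longrightarrow> (\<forall>t\<ge>0. u t o\<^sub>L P = P o\<^sub>L u t)"
    using R.perturbation by auto
  show ?thesis
  proof (intro exI conjI allI impI)
    show "strong_semigroup (\<lambda>t. exp (a * t) *\<^sub>R u t)" by (rule strong_semigroup_rescale[OF u(1)])
    show "gen (\<lambda>t. exp (a * t) *\<^sub>R u t) = {(v, w + B v) | v w. (v, w) \<in> gen S}"
    proof (intro set_eqI)
      fix p :: "'b \<times> 'b"
      obtain x y where p: "p = (x, y)" by (cases p)
      have "p \<in> gen (\<lambda>t. exp (a * t) *\<^sub>R u t) \<longleftrightarrow> (\<exists>w. y - a *\<^sub>R x = w + B x \<and> (x, w) \<in> gen R)"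
        by (simp add: p gen_rescale[OF u(1)] u(2))
      also have "\<dots> \<longleftrightarrow> (\<exists>w. y = w + B x \<and> (x, w) \<in> gen S)"
      proof
        assume "\<exists>w. y - a *\<^sub>R x = w + B x \<and> (x, w) \<in> gen R"
        then obtain w where "y - a *\<^sub>R x = w + B x" "(x, w + a *\<^sub>R x) \<in> gen S" by (auto simp: gR)
        then show "\<exists>w. y = w + B x \<and> (x, w) \<in> gen S"
          by (intro exI[of _ "w + a *\<^sub>R x"]) (simp add: algebra_simps)
      next
        assume "\<exists>w. y = w + B x \<and> (x, w) \<in> gen S"
        then obtain w where "y = w + B x" "(x, w) \<in> gen S" by auto
        then show "\<exists>w. y - a *\<^sub>R x = w + B x \<and> (x, w) \<in> gen R"
          by (intro exI[of _ "w - a *\<^sub>R x"]) (simp add: gR algebra_simps)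
      qed
      finally show "p \<in> gen (\<lambda>t. exp (a * t) *\<^sub>R u t) \<longleftrightarrow> p \<in> {(v, w + B v) | v w. (v, w) \<in> gen S}"
        by (simp add: p)
    qed
    fix P and t :: real
    assume SP: "\<forall>t\<ge>0. S t o\<^sub>L P = P o\<^sub>L S t"
      and BP: "\<forall>v\<in>Domain (gen S). P v \<in> Domain (gen S) \<and> B (P v) = P (B v)" and t: "0 \<le> t"
    have sc: "(c *\<^sub>R X) o\<^sub>L Y = c *\<^sub>R (X o\<^sub>L Y)" "Y o\<^sub>L (c *\<^sub>R X) = c *\<^sub>R (Y o\<^sub>L X)"
      for c and X Y :: "'b \<Rightarrow>\<^sub>L 'b" by (auto intro!: blinfun_eqI simp: blinfun.bilinear_simps)
    have "u t o\<^sub>L P = P o\<^sub>L u t" using uP[of P] SP BP DR t by (simp add: R_def sc)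
    then show "(exp (a * t) *\<^sub>R u t) o\<^sub>L P = P o\<^sub>L (exp (a * t) *\<^sub>R u t)" by (simp add: sc)
  qed
qed

section \<open>Normed carriers as components of one Banach space\<close>

definition complete_norm :: "'v::real_vector set \<Rightarrow> ('v \<Rightarrow> real) \<Rightarrow> bool"
  where "complete_norm V n \<longleftrightarrow> subspace V \<and> (\<forall>v\<in>V. 0 \<le> n v) \<and> (\<forall>v\<in>V. n v = 0 \<longrightarrow> v = 0) \<and>
    (\<forall>u\<in>V. \<forall>v\<in>V. n (u + v) \<le> n u + n v) \<and> (\<forall>c. \<forall>v\<in>V. n (c *\<^sub>R v) = \<bar>c\<bar> * n v) \<and>
    (\<forall>x :: nat \<Rightarrow> 'v. (\<forall>i. x i \<in> V) \<longrightarrow> (\<forall>e>0. \<exists>N. \<forall>i\<ge>N. \<forall>j\<ge>N. n (x i - x j) < e) \<longrightarrow>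
      (\<exists>l\<in>V. (\<lambda>i. n (x i - l)) \<longlonglongrightarrow> 0))"

text \<open>A carrier is a set, not a type, whereas the operators of the perturbation theorem live on a
  type. The \<open>l\<^sup>\<infinity>\<close>-sum of all complete normed carriers of the ambient type is one Banach
  space containing each of them isometrically as a summand; an operator on a carrier is extended
  by the identity of the other summands. Pairs that are no complete normed carrier contribute \<open>{0}\<close>.\<close>

definition comp_carrier :: "'v::real_vector set \<times> ('v \<Rightarrow> real) \<Rightarrow> 'v set"
  where "comp_carrier i = (if complete_norm (fst i) (snd i) then fst i else {0})"

definition comp_norm :: "'v::real_vector set \<times> ('v \<Rightarrow> real) \<Rightarrow> 'v \<Rightarrow> real"
  where "comp_norm i = (if complete_norm (fst i) (snd i) then snd i else (\<lambda>_. 0))"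

lemma complete_norm_comp: "complete_norm (comp_carrier i) (comp_norm i)"
proof (cases "complete_norm (fst i) (snd i)")
  case True
  then show ?thesis by (simp add: comp_carrier_def comp_norm_def)
next
  case False
  then have "comp_carrier i = {0}" "comp_norm i = (\<lambda>_. 0)" by (auto simp: comp_carrier_def comp_norm_def)
  then show ?thesis by (simp add: complete_norm_def subspace_def)
qed

lemma comp_subspace: "subspace (comp_carrier i)"
  and comp_norm_nonneg: "v \<in> comp_carrier i \<Longrightarrow> 0 \<le> comp_norm i v"
  and comp_norm_eq_0: "v \<in> comp_carrier i \<Longrightarrow> comp_norm i v = 0 \<Longrightarrow> v = 0"
  and comp_norm_triangle: "u \<in> comp_carrier i \<Longrightarrow> v \<in> comp_carrier i \<Longrightarrow> comp_norm i (u + v) \<le> comp_norm i u + comp_norm i v"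
  and comp_norm_scale: "v \<in> comp_carrier i \<Longrightarrow> comp_norm i (c *\<^sub>R v) = \<bar>c\<bar> * comp_norm i v"
  using complete_norm_comp[of i] by (auto simp: complete_norm_def)

lemma comp_norm_0: "comp_norm i 0 = 0"
  using comp_norm_scale[OF subspace_0[OF comp_subspace], of i 0] by simp

lemma comp_complete:
  assumes "\<And>k. x k \<in> comp_carrier i" "\<And>e. e > 0 \<Longrightarrow> \<exists>N. \<forall>k\<ge>N. \<forall>j\<ge>N. comp_norm i (x k - x j) < e"
  shows "\<exists>l\<in>comp_carrier i. (\<lambda>k. comp_norm i (x k - l)) \<longlonglongrightarrow> 0"
  using complete_norm_comp[of i] assms unfolding complete_norm_def by blast

typedef (overloaded) ('v::real_vector) norm_sum =
  "{F :: 'v set \<times> ('v \<Rightarrow> real) \<Rightarrow> 'v. (\<forall>i. F i \<in> comp_carrier i) \<and> bdd_above (range (\<lambda>i. comp_norm i (F i)))}"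
  by (rule exI[of _ "\<lambda>_. 0"]) (auto simp: subspace_0 comp_subspace comp_norm_0)

setup_lifting type_definition_norm_sum

lemma norm_sum_carrier: "Rep_norm_sum F i \<in> comp_carrier i"
proof -
  from Rep_norm_sum[of F] have "\<forall>i. Rep_norm_sum F i \<in> comp_carrier i" unfolding mem_Collect_eq ..
  then show ?thesis ..
qed

lemma norm_sum_bdd: "bdd_above (range (\<lambda>i. comp_norm i (Rep_norm_sum F i)))"
  using Rep_norm_sum[of F] unfolding mem_Collect_eq ..

lemma bdd_above_norm_sum_add:
  assumes F: "\<And>i. F i \<in> comp_carrier i" "bdd_above (range (\<lambda>i. comp_norm i (F i)))"
    and G: "\<And>i. G i \<in> comp_carrier i" "bdd_above (range (\<lambda>i. comp_norm i (G i)))"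
  shows "bdd_above (range (\<lambda>i. comp_norm i (F i + G i)))"
proof -
  obtain a b where "\<And>i. comp_norm i (F i) \<le> a" "\<And>i. comp_norm i (G i) \<le> b"
    using F G by (auto simp: bdd_above_def)
  then have "comp_norm i (F i + G i) \<le> a + b" for i
    using comp_norm_triangle[OF F(1) G(1), of i] add_mono order_trans by blast
  then show ?thesis by (rule bdd_aboveI2)
qed

lemma bdd_above_norm_sum_scale:
  assumes F: "\<And>i. F i \<in> comp_carrier i" "bdd_above (range (\<lambda>i. comp_norm i (F i)))"
  shows "bdd_above (range (\<lambda>i. comp_norm i (c *\<^sub>R F i)))"
proof -
  obtain a where "\<And>i. comp_norm i (F i) \<le> a" using F by (auto simp: bdd_above_def)
  then have "comp_norm i (c *\<^sub>R F i) \<le> \<bar>c\<bar> * a" for i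
    unfolding comp_norm_scale[OF F(1)] by (rule mult_left_mono) simp
  then show ?thesis by (rule bdd_aboveI2)
qed

instantiation norm_sum :: (real_vector) real_vector
begin

lift_definition zero_norm_sum :: "'a norm_sum" is "\<lambda>_. 0"
  by (auto simp: subspace_0 comp_subspace comp_norm_0)

lift_definition plus_norm_sum :: "'a norm_sum \<Rightarrow> 'a norm_sum \<Rightarrow> 'a norm_sum" is "\<lambda>F G i. F i + G i"
  by (auto intro: subspace_add comp_subspace bdd_above_norm_sum_add)

lift_definition scaleR_norm_sum :: "real \<Rightarrow> 'a norm_sum \<Rightarrow> 'a norm_sum" is "\<lambda>c F i. c *\<^sub>R F i"
  by (auto intro: subspace_scale comp_subspace bdd_above_norm_sum_scale)

lift_definition uminus_norm_sum :: "'a norm_sum \<Rightarrow> 'a norm_sum" is "\<lambda>F i. - F i"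
  using bdd_above_norm_sum_scale[where c = "-1"] by (auto intro: subspace_neg comp_subspace)

definition minus_norm_sum :: "'a norm_sum \<Rightarrow> 'a norm_sum \<Rightarrow> 'a norm_sum"
  where "minus_norm_sum F G = F + (- G)"

instance
  by standard (unfold minus_norm_sum_def, (transfer; simp add: algebra_simps)+)

end

instantiation norm_sum :: (real_vector) real_normed_vector
begin

definition norm_norm_sum :: "'a norm_sum \<Rightarrow> real"
  where "norm_norm_sum F = (SUP i. comp_norm i (Rep_norm_sum F i))"

definition dist_norm_sum :: "'a norm_sum \<Rightarrow> 'a norm_sum \<Rightarrow> real"
  where "dist_norm_sum F G = norm (F - G)"

definition sgn_norm_sum :: "'a norm_sum \<Rightarrow> 'a norm_sum"
  where "sgn_norm_sum F = F /\<^sub>R norm F"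

definition uniformity_norm_sum :: "('a norm_sum \<times> 'a norm_sum) filter"
  where "uniformity_norm_sum = (INF e\<in>{0 <..}. principal {(x, y). dist x y < e})"

definition open_norm_sum :: "'a norm_sum set \<Rightarrow> bool"
  where "open_norm_sum S = (\<forall>x\<in>S. \<forall>\<^sub>F (x', y) in uniformity. x' = x \<longrightarrow> y \<in> S)"

lemma comp_norm_le_norm: "comp_norm i (Rep_norm_sum F i) \<le> norm F"
  unfolding norm_norm_sum_def by (intro cSUP_upper norm_sum_bdd) auto

lemma norm_sum_norm_le: "(\<And>i. comp_norm i (Rep_norm_sum F i) \<le> C) \<Longrightarrow> norm F \<le> C"
  unfolding norm_norm_sum_def by (intro cSUP_least) auto

instance
proof
  fix F G :: "'a norm_sum" and a :: real
  show "dist F G = norm (F - G)" by (rule dist_norm_sum_def)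
  show "sgn F = F /\<^sub>R norm F" by (rule sgn_norm_sum_def)
  show "uniformity = (INF e\<in>{0 <..}. principal {(x, y :: 'a norm_sum). dist x y < e})"
    by (rule uniformity_norm_sum_def)
  show "open U = (\<forall>x\<in>U. \<forall>\<^sub>F (x', y) in uniformity. x' = x \<longrightarrow> y \<in> U)" for U :: "'a norm_sum set"
    by (rule open_norm_sum_def)
  have nn: "0 \<le> norm F" for F :: "'a norm_sum"
    using comp_norm_le_norm[of undefined F] comp_norm_nonneg[OF norm_sum_carrier[of F undefined]] by linarith
  show "norm F = 0 \<longleftrightarrow> F = 0"
  proof
    assume "norm F = 0"
    then have "comp_norm i (Rep_norm_sum F i) = 0" for i
      using comp_norm_le_norm[of i F] comp_norm_nonneg[OF norm_sum_carrier[of F i]] by linarith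
    then have "Rep_norm_sum F i = 0" for i using comp_norm_eq_0[OF norm_sum_carrier[of F i]] by simp
    then show "F = 0" by (simp add: Rep_norm_sum_inject[symmetric] zero_norm_sum.rep_eq fun_eq_iff)
  next
    assume "F = 0"
    then show "norm F = 0" using norm_sum_norm_le[of F 0] nn[of F] by (simp add: zero_norm_sum.rep_eq comp_norm_0)
  qed
  show "norm (F + G) \<le> norm F + norm G"
  proof (rule norm_sum_norm_le)
    fix i
    show "comp_norm i (Rep_norm_sum (F + G) i) \<le> norm F + norm G"
      using comp_norm_triangle[OF norm_sum_carrier[of F i] norm_sum_carrier[of G i]]
        comp_norm_le_norm[of i F] comp_norm_le_norm[of i G] by (simp add: plus_norm_sum.rep_eq)
  qed
  have le: "norm (c *\<^sub>R F) \<le> \<bar>c\<bar> * norm F" for c and F :: "'a norm_sum"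
    by (rule norm_sum_norm_le)
      (simp add: scaleR_norm_sum.rep_eq comp_norm_scale norm_sum_carrier mult_left_mono comp_norm_le_norm)
  show "norm (a *\<^sub>R F) = \<bar>a\<bar> * norm F"
  proof (cases "a = 0")
    case True
    then show ?thesis using le[of a F] nn[of "a *\<^sub>R F"] by simp
  next
    case False
    have "inverse a *\<^sub>R a *\<^sub>R F = F" using False by transfer simp
    then have "norm F \<le> \<bar>inverse a\<bar> * norm (a *\<^sub>R F)" using le[of "inverse a" "a *\<^sub>R F"] by simp
    then have "\<bar>a\<bar> * norm F \<le> \<bar>a\<bar> * (\<bar>inverse a\<bar> * norm (a *\<^sub>R F))" by (rule mult_left_mono) simp
    also have "\<dots> = norm (a *\<^sub>R F)" using False by (simp add: mult.assoc[symmetric] abs_mult[symmetric])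
    finally have "\<bar>a\<bar> * norm F \<le> norm (a *\<^sub>R F)" .
    then show ?thesis using le[of a F] by simp
  qed
qed

end

lemma minus_norm_sum_rep: "Rep_norm_sum (F - G) i = Rep_norm_sum F i - Rep_norm_sum G i"
  unfolding minus_norm_sum_def plus_norm_sum.rep_eq uminus_norm_sum.rep_eq by simp

instance norm_sum :: (real_vector) banach
proof
  fix X :: "nat \<Rightarrow> 'a norm_sum"
  assume C: "Cauchy X"
  \<comment> \<open>The norm is a supremum, so the Cauchy condition is uniform over the summands.
    This is what makes the family of componentwise limits bounded and the convergence
    uniform.\<close>
  have small: "\<exists>N. \<forall>k\<ge>N. \<forall>j\<ge>N. \<forall>i. comp_norm i (Rep_norm_sum (X k) i - Rep_norm_sum (X j) i) < e" if "e > 0" for e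
  proof -
    obtain N where "\<And>k j. k \<ge> N \<Longrightarrow> j \<ge> N \<Longrightarrow> norm (X k - X j) < e"
      using C \<open>e > 0\<close> by (metis CauchyD)
    then show ?thesis using comp_norm_le_norm[of _ "X _ - X _"] by (metis minus_norm_sum_rep le_less_trans)
  qed
  have "\<exists>l\<in>comp_carrier i. (\<lambda>k. comp_norm i (Rep_norm_sum (X k) i - l)) \<longlonglongrightarrow> 0" for i
    by (rule comp_complete[OF norm_sum_carrier]) (use small in blast)
  then obtain l where l: "\<And>i. l i \<in> comp_carrier i" "\<And>i. (\<lambda>k. comp_norm i (Rep_norm_sum (X k) i - l i)) \<longlonglongrightarrow> 0"
    by metis
  have sub: "u - v \<in> comp_carrier i" if "u \<in> comp_carrier i" "v \<in> comp_carrier i" for u v i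
    using that comp_subspace by (rule subspace_diff[rotated])
  have lim: "comp_norm i (Rep_norm_sum (X k) i - l i) \<le> e"
    if N: "\<And>k j. k \<ge> N \<Longrightarrow> j \<ge> N \<Longrightarrow> comp_norm i (Rep_norm_sum (X k) i - Rep_norm_sum (X j) i) < e" and k: "k \<ge> N" for i e N k
  proof -
    have "comp_norm i (Rep_norm_sum (X k) i - l i) \<le> e + comp_norm i (Rep_norm_sum (X j) i - l i)" if "j \<ge> N" for j
      using N[OF k that] comp_norm_triangle[OF sub[OF norm_sum_carrier[of "X k" i] norm_sum_carrier[of "X j" i]] sub[OF norm_sum_carrier[of "X j" i] l(1)[of i]]]
      by simp
    moreover have "(\<lambda>j. e + comp_norm i (Rep_norm_sum (X j) i - l i)) \<longlonglongrightarrow> e + 0"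
      by (intro tendsto_intros l)
    ultimately have "comp_norm i (Rep_norm_sum (X k) i - l i) \<le> e + 0"
      by (intro LIMSEQ_le_const) auto
    then show ?thesis by simp
  qed
  obtain N1 where N1: "\<And>k j i. k \<ge> N1 \<Longrightarrow> j \<ge> N1 \<Longrightarrow> comp_norm i (Rep_norm_sum (X k) i - Rep_norm_sum (X j) i) < 1"
    using small[of 1] zero_less_one by blast
  have "comp_norm i (l i) \<le> 1 + norm (X N1)" for i
  proof -
    have "comp_norm i (l i - Rep_norm_sum (X N1) i) = comp_norm i ((-1) *\<^sub>R (Rep_norm_sum (X N1) i - l i))"
      by (simp add: algebra_simps)
    also have "\<dots> = comp_norm i (Rep_norm_sum (X N1) i - l i)"
      using comp_norm_scale[OF sub[OF norm_sum_carrier l(1)], of i "-1" "X N1"] by simp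
    also have "\<dots> \<le> 1" by (rule lim[OF N1 order_refl])
    finally show ?thesis
      using comp_norm_triangle[OF sub[OF l(1)[of i] norm_sum_carrier[of "X N1" i]] norm_sum_carrier[of "X N1" i]]
        comp_norm_le_norm[of i "X N1"] by simp
  qed
  then have mem: "l \<in> {F. (\<forall>i. F i \<in> comp_carrier i) \<and> bdd_above (range (\<lambda>i. comp_norm i (F i)))}"
    using l(1) by (intro CollectI conjI allI bdd_aboveI2)
  define Y where "Y = Abs_norm_sum l"
  have Y: "Rep_norm_sum Y = l" using Abs_norm_sum_inverse[OF mem] by (simp add: Y_def)
  have "X \<longlonglongrightarrow> Y"
  proof (rule LIMSEQ_I)
    fix e :: real assume "e > 0"
    then obtain N where N: "\<And>k j i. k \<ge> N \<Longrightarrow> j \<ge> N \<Longrightarrow> comp_norm i (Rep_norm_sum (X k) i - Rep_norm_sum (X j) i) < e / 2"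
      using small[of "e / 2"] half_gt_zero[OF \<open>e > 0\<close>] by blast
    have "norm (X k - Y) < e" if "k \<ge> N" for k
    proof -
      have "norm (X k - Y) \<le> e / 2"
        by (rule norm_sum_norm_le) (use lim[OF N that] in \<open>simp add: minus_norm_sum_rep Y\<close>)
      then show ?thesis using \<open>e > 0\<close> by simp
    qed
    then show "\<exists>N. \<forall>k\<ge>N. norm (X k - Y) < e" by blast
  qed
  then show "convergent X" by (auto simp: convergent_def)
qed

section \<open>Embedding a carrier into the sum and lifting its semigroups\<close>

definition emb :: "'v::real_vector set \<Rightarrow> ('v \<Rightarrow> real) \<Rightarrow> 'v \<Rightarrow> 'v norm_sum"
  where "emb V n v = Abs_norm_sum (\<lambda>i. if i = (V, n) then v else 0)"

definition prj :: "'v::real_vector set \<Rightarrow> ('v \<Rightarrow> real) \<Rightarrow> 'v norm_sum \<Rightarrow> 'v"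
  where "prj V n F = Rep_norm_sum F (V, n)"

locale complex_carrier =
  fixes V :: "'v::complex_vector set" and n :: "'v \<Rightarrow> real"
  assumes complete_norm: "complete_norm V n"
    and scaleC_closed: "v \<in> V \<Longrightarrow> c *\<^sub>C v \<in> V"
    and norm_scaleC_carrier: "v \<in> V \<Longrightarrow> n (c *\<^sub>C v) = cmod c * n v"
begin

lemma carrier_subspace: "subspace V"
  using complete_norm by (simp add: complete_norm_def)

lemmas add_closed = subspace_add[OF carrier_subspace]
lemmas diff_closed = subspace_diff[OF carrier_subspace]
lemmas scaleR_closed = subspace_scale[OF carrier_subspace]
lemmas zero_closed = subspace_0[OF carrier_subspace]

lemma comp: "comp_carrier (V, n) = V" "comp_norm (V, n) = n"
  using complete_norm by (auto simp: comp_carrier_def comp_norm_def)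

lemma rep_emb: "v \<in> V \<Longrightarrow> Rep_norm_sum (emb V n v) i = (if i = (V, n) then v else 0)"
  unfolding emb_def
proof (subst Abs_norm_sum_inverse)
  assume v: "v \<in> V"
  have "comp_norm i (if i = (V, n) then v else 0) \<le> max 0 (n v)" for i
    by (auto simp: comp comp_norm_0)
  then have "bdd_above (range (\<lambda>i. comp_norm i (if i = (V, n) then v else 0)))" by (rule bdd_aboveI2)
  then show "(\<lambda>i. if i = (V, n) then v else 0) \<in>
      {F. (\<forall>i. F i \<in> comp_carrier i) \<and> bdd_above (range (\<lambda>i. comp_norm i (F i)))}"
    using v by (auto simp: comp subspace_0 comp_subspace)
qed simp

lemma prj_emb: "v \<in> V \<Longrightarrow> prj V n (emb V n v) = v"
  by (simp add: prj_def rep_emb)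

lemma prj_in: "prj V n F \<in> V"
  using norm_sum_carrier[of F "(V, n)"] by (simp add: prj_def comp)

lemma prj_add: "prj V n (F + G) = prj V n F + prj V n G"
  and prj_diff: "prj V n (F - G) = prj V n F - prj V n G"
  and prj_scale: "prj V n (c *\<^sub>R F) = c *\<^sub>R prj V n F"
  by (simp_all add: prj_def plus_norm_sum.rep_eq minus_norm_sum_rep scaleR_norm_sum.rep_eq)

lemma norm_prj_le: "n (prj V n F) \<le> norm F"
  using comp_norm_le_norm[of "(V, n)" F] by (simp add: prj_def comp)

lemma emb_add: "u \<in> V \<Longrightarrow> v \<in> V \<Longrightarrow> emb V n (u + v) = emb V n u + emb V n v"
  by (simp add: Rep_norm_sum_inject[symmetric] fun_eq_iff plus_norm_sum.rep_eq rep_emb add_closed)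

lemma emb_diff: "u \<in> V \<Longrightarrow> v \<in> V \<Longrightarrow> emb V n (u - v) = emb V n u - emb V n v"
  by (simp add: Rep_norm_sum_inject[symmetric] fun_eq_iff minus_norm_sum_rep rep_emb diff_closed)

lemma emb_scale: "v \<in> V \<Longrightarrow> emb V n (c *\<^sub>R v) = c *\<^sub>R emb V n v"
  by (simp add: Rep_norm_sum_inject[symmetric] fun_eq_iff scaleR_norm_sum.rep_eq rep_emb scaleR_closed)

lemma norm_emb: "v \<in> V \<Longrightarrow> norm (emb V n v) = n v"
proof (rule antisym)
  assume v: "v \<in> V"
  have n0: "0 \<le> n v" using complete_norm v by (simp add: complete_norm_def)
  show "norm (emb V n v) \<le> n v"
    by (rule norm_sum_norm_le) (use n0 v in \<open>auto simp: rep_emb comp comp_norm_0\<close>)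
  show "n v \<le> norm (emb V n v)" using norm_prj_le[of "emb V n v"] v by (simp add: prj_emb)
qed

lemma emb_inject: "u \<in> V \<Longrightarrow> v \<in> V \<Longrightarrow> emb V n u = emb V n v \<longleftrightarrow> u = v"
  using prj_emb by metis

definition lift_op :: "('v \<Rightarrow> 'v) \<Rightarrow> 'v norm_sum \<Rightarrow>\<^sub>L 'v norm_sum"
  where "lift_op T = Blinfun (\<lambda>F. F - emb V n (prj V n F) + emb V n (T (prj V n F)))"

lemma scaleR_eq_scaleC: "c *\<^sub>R v = complex_of_real c *\<^sub>C (v :: 'v)"
  by (simp add: scaleC_of_real)

lemma bounded_opD:
  assumes "bounded_op V n V n T"
  shows "v \<in> V \<Longrightarrow> T v \<in> V" "u \<in> V \<Longrightarrow> v \<in> V \<Longrightarrow> T (u + v) = T u + T v"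
    "v \<in> V \<Longrightarrow> T (c *\<^sub>C v) = c *\<^sub>C T v" "v \<in> V \<Longrightarrow> T (r *\<^sub>R v) = r *\<^sub>R T v"
    "\<exists>C\<ge>0. \<forall>v\<in>V. n (T v) \<le> C * n v"
proof -
  show "v \<in> V \<Longrightarrow> T v \<in> V" "u \<in> V \<Longrightarrow> v \<in> V \<Longrightarrow> T (u + v) = T u + T v" "v \<in> V \<Longrightarrow> T (c *\<^sub>C v) = c *\<^sub>C T v"
    "v \<in> V \<Longrightarrow> T (r *\<^sub>R v) = r *\<^sub>R T v"
    using assms by (auto simp: bounded_op_def scaleR_eq_scaleC)
  obtain C where C: "\<forall>v\<in>V. n (T v) \<le> C * n v" using assms by (auto simp: bounded_op_def)
  have "C * n v \<le> \<bar>C\<bar> * n v" if "v \<in> V" for v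
    using complete_norm that by (intro mult_right_mono) (auto simp: complete_norm_def)
  then show "\<exists>C\<ge>0. \<forall>v\<in>V. n (T v) \<le> C * n v" using C by (intro exI[of _ "\<bar>C\<bar>"]) (auto intro: order_trans)
qed

lemma lift_op_apply:
  assumes T: "bounded_op V n V n T"
  shows "lift_op T F = F - emb V n (prj V n F) + emb V n (T (prj V n F))"
proof -
  note d = bounded_opD[OF T]
  obtain C where C: "C \<ge> 0" "\<And>v. v \<in> V \<Longrightarrow> n (T v) \<le> C * n v" using d(5) by auto
  have "bounded_linear (\<lambda>F. F - emb V n (prj V n F) + emb V n (T (prj V n F)))"
  proof (rule bounded_linear_intro[where K = "2 + C"])
    fix F
    have "norm (emb V n (T (prj V n F))) \<le> C * norm F"
      using C norm_prj_le[of F] by (simp add: norm_emb d prj_in) (meson mult_left_mono order_trans prj_in)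
    moreover have "norm (emb V n (prj V n F)) \<le> norm F" by (simp add: norm_emb prj_in norm_prj_le)
    ultimately show "norm (F - emb V n (prj V n F) + emb V n (T (prj V n F))) \<le> norm F * (2 + C)"
      using norm_triangle_ineq[of "F - emb V n (prj V n F)" "emb V n (T (prj V n F))"]
        norm_triangle_ineq4[of F "emb V n (prj V n F)"] by (simp add: algebra_simps)
  qed (simp_all add: prj_add prj_scale d prj_in emb_add emb_scale algebra_simps)
  then show ?thesis by (simp add: lift_op_def bounded_linear_Blinfun_apply)
qed

lemma prj_lift_op: "bounded_op V n V n T \<Longrightarrow> prj V n (lift_op T F) = T (prj V n F)"
  by (simp add: lift_op_apply prj_add prj_diff prj_emb prj_in bounded_opD)

lemma lift_op_emb: "bounded_op V n V n T \<Longrightarrow> v \<in> V \<Longrightarrow> lift_op T (emb V n v) = emb V n (T v)"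
  by (simp add: lift_op_apply prj_emb)

lemma strong_semigroup_lift:
  assumes T: "C0_semigroup V n T"
  shows "strong_semigroup (\<lambda>t. lift_op (T t))"
  unfolding strong_semigroup_def
proof (intro conjI allI impI)
  have b: "bounded_op V n V n (T t)" if "t \<ge> 0" for t using T that by (simp add: C0_semigroup_def)
  have T0: "T 0 v = v" if "v \<in> V" for v using T that by (simp add: C0_semigroup_def)
  show "lift_op (T 0) = id_blinfun"
    by (rule blinfun_eqI) (simp add: lift_op_apply[OF b] T0 prj_in)
  show "lift_op (T (s + t)) = lift_op (T s) o\<^sub>L lift_op (T t)" if st: "0 \<le> s" "0 \<le> t" for s t
  proof (rule blinfun_eqI)
    fix F
    have "T (s + t) (prj V n F) = T s (T t (prj V n F))"
      using T st prj_in by (auto simp: C0_semigroup_def)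
    then show "lift_op (T (s + t)) F = (lift_op (T s) o\<^sub>L lift_op (T t)) F"
      using st by (simp add: prj_lift_op[OF b] lift_op_apply[OF b, of "s + t"] lift_op_apply[OF b, of s])
        (simp add: lift_op_apply[OF b])
  qed
  fix F
  have "((\<lambda>t. n (T t (prj V n F) - prj V n F)) \<longlongrightarrow> 0) (at_right 0)"
    using T prj_in by (auto simp: C0_semigroup_def)
  moreover have "\<forall>\<^sub>F t in at_right 0. norm (lift_op (T t) F - F) = n (T t (prj V n F) - prj V n F)"
    using eventually_at_right_less
  proof eventually_elim
    case (elim t)
    then have t: "t \<ge> 0" by simp
    have "lift_op (T t) F - F = emb V n (T t (prj V n F) - prj V n F)"
      by (simp add: lift_op_apply[OF b[OF t]] emb_diff prj_in bounded_opD[OF b[OF t]])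
    then show ?case by (simp add: norm_emb diff_closed prj_in bounded_opD[OF b[OF t]])
  qed
  ultimately have "((\<lambda>t. norm (lift_op (T t) F - F)) \<longlongrightarrow> 0) (at_right 0)" by (simp add: tendsto_cong)
  then show "((\<lambda>t. lift_op (T t) F) \<longlongrightarrow> F) (at_right 0)" by (simp add: LIM_zero_iff tendsto_norm_zero_iff)
qed

text \<open>The lifted semigroup is constant in the other summands, so its generator vanishes there:
  \<open>G\<close> must lie in the chosen summand, whereas the other components of \<open>F\<close>
  are free.\<close>

lemma gen_lift:
  assumes T: "C0_semigroup V n T"
  shows "(F, G) \<in> gen (\<lambda>t. lift_op (T t)) \<longleftrightarrow>
    (prj V n F, prj V n G) \<in> generator_graph V n T \<and> G = emb V n (prj V n G)"
proof -
  let ?f = "prj V n F" and ?g = "prj V n G"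
  let ?d = "\<lambda>t. (1 / t) *\<^sub>R (T t ?f - ?f)"
  have b: "bounded_op V n V n (T t)" if "t \<ge> 0" for t using T that by (simp add: C0_semigroup_def)
  have ev: "\<forall>\<^sub>F t in at_right 0. ?d t \<in> V \<and> (1 / t) *\<^sub>R (lift_op (T t) F - F) = emb V n (?d t)"
    using eventually_at_right_less
  proof eventually_elim
    case (elim t)
    then have t: "t \<ge> 0" by simp
    note Tf = bounded_opD(1)[OF b[OF t] prj_in[of F]]
    show ?case
      by (auto simp: lift_op_apply[OF b[OF t]] emb_scale emb_diff diff_closed Tf prj_in scaleR_closed)
  qed
  show ?thesis
  proof
    assume "(F, G) \<in> gen (\<lambda>t. lift_op (T t))"
    then have lim: "((\<lambda>t. (1 / t) *\<^sub>R (lift_op (T t) F - F)) \<longlongrightarrow> G) (at_right 0)" by (simp add: gen_def)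
    then have nlim: "((\<lambda>t. norm ((1 / t) *\<^sub>R (lift_op (T t) F - F) - G)) \<longlongrightarrow> 0) (at_right 0)"
      by (simp add: LIM_zero_iff tendsto_norm_zero_iff)
    have "((\<lambda>t. n (?d t - ?g)) \<longlongrightarrow> 0) (at_right 0)"
    proof (rule tendsto_sandwich[OF _ _ tendsto_const nlim])
      show "\<forall>\<^sub>F t in at_right 0. 0 \<le> n (?d t - ?g)"
        using ev by eventually_elim (use complete_norm diff_closed prj_in in \<open>auto simp: complete_norm_def\<close>)
      show "\<forall>\<^sub>F t in at_right 0. n (?d t - ?g) \<le> norm ((1 / t) *\<^sub>R (lift_op (T t) F - F) - G)"
        using ev
      proof eventually_elim
        case (elim t)
        then show ?case using norm_prj_le[of "emb V n (?d t) - G"] by (simp add: prj_diff prj_emb)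
      qed
    qed
    then have g: "(?f, ?g) \<in> generator_graph V n T" by (simp add: generator_graph_def prj_in)
    have "((\<lambda>t. norm ((1 / t) *\<^sub>R (lift_op (T t) F - F) - emb V n ?g)) \<longlongrightarrow> 0) (at_right 0)"
    proof (rule Lim_transform_eventually)
      show "((\<lambda>t. n (?d t - ?g)) \<longlongrightarrow> 0) (at_right 0)" by fact
      show "\<forall>\<^sub>F t in at_right 0. n (?d t - ?g) = norm ((1 / t) *\<^sub>R (lift_op (T t) F - F) - emb V n ?g)"
        using ev by eventually_elim (simp add: emb_diff[symmetric] prj_in norm_emb diff_closed)
    qed
    then have "((\<lambda>t. (1 / t) *\<^sub>R (lift_op (T t) F - F)) \<longlongrightarrow> emb V n ?g) (at_right 0)"
      by (simp add: LIM_zero_iff tendsto_norm_zero_iff)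
    with lim have "G = emb V n ?g" by (rule tendsto_unique[OF trivial_limit_at_right_real])
    with g show "(?f, ?g) \<in> generator_graph V n T \<and> G = emb V n ?g" by simp
  next
    assume a: "(?f, ?g) \<in> generator_graph V n T \<and> G = emb V n ?g"
    then have "((\<lambda>t. n (?d t - ?g)) \<longlongrightarrow> 0) (at_right 0)" by (simp add: generator_graph_def)
    then have "((\<lambda>t. norm ((1 / t) *\<^sub>R (lift_op (T t) F - F) - emb V n ?g)) \<longlongrightarrow> 0) (at_right 0)"
    proof (rule Lim_transform_eventually)
      show "\<forall>\<^sub>F t in at_right 0. n (?d t - ?g) = norm ((1 / t) *\<^sub>R (lift_op (T t) F - F) - emb V n ?g)"
        using ev by eventually_elim (simp add: emb_diff[symmetric] prj_in norm_emb diff_closed)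
    qed
    then have "((\<lambda>t. (1 / t) *\<^sub>R (lift_op (T t) F - F)) \<longlongrightarrow> emb V n ?g) (at_right 0)"
      by (simp add: LIM_zero_iff tendsto_norm_zero_iff)
    then show "(F, G) \<in> gen (\<lambda>t. lift_op (T t))" using a by (simp add: gen_def)
  qed
qed

lemma gen_lift_emb:
  assumes T: "C0_semigroup V n T" and "(v, w) \<in> generator_graph V n T"
  shows "(emb V n v, emb V n w) \<in> gen (\<lambda>t. lift_op (T t))"
  using assms(2) by (auto simp: gen_lift[OF T] prj_emb generator_graph_def)

lemma generator_graph_apply:
  assumes T: "C0_semigroup V n T" and vw: "(v, w) \<in> generator_graph V n T" and t: "t \<ge> 0"
  shows "(T t v, T t w) \<in> generator_graph V n T"
proof -
  interpret S: semigroup "\<lambda>t. lift_op (T t)" by unfold_locales (rule strong_semigroup_lift[OF T])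
  have b: "bounded_op V n V n (T t)" using T t by (simp add: C0_semigroup_def)
  have V: "v \<in> V" "w \<in> V" using vw by (auto simp: generator_graph_def)
  have "(lift_op (T t) (emb V n v), lift_op (T t) (emb V n w)) \<in> gen (\<lambda>t. lift_op (T t))"
    by (rule S.gen_apply[OF gen_lift_emb[OF T vw] t])
  then show ?thesis using V by (simp add: gen_lift[OF T] lift_op_emb[OF b] prj_emb bounded_opD[OF b])
qed

lemma bounded_linear_comp_prj:
  fixes \<Lambda> :: "'v \<Rightarrow> 'x::real_normed_vector"
  assumes add: "\<And>u v. u \<in> V \<Longrightarrow> v \<in> V \<Longrightarrow> \<Lambda> (u + v) = \<Lambda> u + \<Lambda> v"
    and scale: "\<And>c v. v \<in> V \<Longrightarrow> \<Lambda> (c *\<^sub>R v) = c *\<^sub>R \<Lambda> v"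
    and bound: "\<And>v. v \<in> V \<Longrightarrow> norm (\<Lambda> v) \<le> C * n v"
  shows "bounded_linear (\<lambda>F. \<Lambda> (prj V n F))"
proof (rule bounded_linear_intro[where K = "\<bar>C\<bar>"])
  fix F
  have "C * n (prj V n F) \<le> \<bar>C\<bar> * norm F"
    using complete_norm prj_in norm_prj_le by (intro mult_mono) (auto simp: complete_norm_def)
  then show "norm (\<Lambda> (prj V n F)) \<le> norm F * \<bar>C\<bar>"
    using bound[OF prj_in, of F] by (simp add: mult.commute)
qed (simp_all add: prj_add prj_scale add scale prj_in)

text \<open>Composed with the projection, a bounded functional on the carrier becomes bounded linear
  on the whole sum, where orbits in the domain are differentiable.\<close>

lemma functional_has_vector_derivative:
  fixes \<Lambda> :: "'v \<Rightarrow> 'x::real_normed_vector"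
  assumes T: "C0_semigroup V n T" and vw: "(v, w) \<in> generator_graph V n T" and t: "t \<ge> 0"
    and add: "\<And>u v. u \<in> V \<Longrightarrow> v \<in> V \<Longrightarrow> \<Lambda> (u + v) = \<Lambda> u + \<Lambda> v"
    and scale: "\<And>c v. v \<in> V \<Longrightarrow> \<Lambda> (c *\<^sub>R v) = c *\<^sub>R \<Lambda> v"
    and bound: "\<And>v. v \<in> V \<Longrightarrow> norm (\<Lambda> v) \<le> C * n v"
  shows "((\<lambda>t. \<Lambda> (T t v)) has_vector_derivative \<Lambda> (T t w)) (at t within {0..})"
proof -
  interpret S: semigroup "\<lambda>t. lift_op (T t)" by unfold_locales (rule strong_semigroup_lift[OF T])
  have b: "bounded_op V n V n (T t)" if "t \<ge> 0" for t using T that by (simp add: C0_semigroup_def)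
  have V: "v \<in> V" "w \<in> V" using vw by (auto simp: generator_graph_def)
  have eq: "\<Lambda> (prj V n (lift_op (T s) (emb V n z))) = \<Lambda> (T s z)" if "s \<ge> 0" "z \<in> V" for s z
    using that by (simp add: lift_op_emb[OF b] prj_emb bounded_opD[OF b])
  have "((\<lambda>t. lift_op (T t) (emb V n v)) has_vector_derivative lift_op (T t) (emb V n w)) (at t within {0..})"
    by (rule S.has_vector_derivative_gen[OF gen_lift_emb[OF T vw] t])
  from bounded_linear.has_vector_derivative[OF bounded_linear_comp_prj[OF add scale bound] this]
  have "((\<lambda>t. \<Lambda> (prj V n (lift_op (T t) (emb V n v)))) has_vector_derivative \<Lambda> (T t w)) (at t within {0..})"
    using t V by (simp add: eq)
  then show ?thesis by (rule has_vector_derivative_transform[rotated 2]) (use t V eq in auto)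
qed

lemma carrier_norm_continuous_on:
  assumes T: "C0_semigroup V n T" and v: "v \<in> V" and s: "s \<ge> 0"
  shows "((\<lambda>t. n (T t v - T s v)) \<longlongrightarrow> 0) (at s within {0..})"
proof -
  interpret S: semigroup "\<lambda>t. lift_op (T t)" by unfold_locales (rule strong_semigroup_lift[OF T])
  have b: "bounded_op V n V n (T t)" if "t \<ge> 0" for t using T that by (simp add: C0_semigroup_def)
  have "((\<lambda>t. lift_op (T t) (emb V n v)) \<longlongrightarrow> lift_op (T s) (emb V n v)) (at s within {0..})"
    using S.continuous_on_apply[of "emb V n v"] s by (simp add: continuous_on)
  then have "((\<lambda>t. norm (lift_op (T t) (emb V n v) - lift_op (T s) (emb V n v))) \<longlongrightarrow> 0) (at s within {0..})"
    by (simp add: LIM_zero_iff tendsto_norm_zero_iff)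
  then show ?thesis
  proof (rule Lim_transform_eventually)
    show "\<forall>\<^sub>F t in at s within {0..}. norm (lift_op (T t) (emb V n v) - lift_op (T s) (emb V n v)) = n (T t v - T s v)"
      unfolding eventually_at_filter
    proof (rule always_eventually, intro allI impI)
      fix t :: real assume "t \<in> {0..}"
      then have t: "t \<ge> 0" by simp
      note Tt = bounded_opD(1)[OF b[OF t] v] and Ts = bounded_opD(1)[OF b[OF s] v]
      show "norm (lift_op (T t) (emb V n v) - lift_op (T s) (emb V n v)) = n (T t v - T s v)"
        using t s v by (simp add: lift_op_emb[OF b] emb_diff[symmetric] Tt Ts norm_emb diff_closed)
    qed
  qed
qed

text \<open>The perturbation theorem is applied in the sum and read off in the summand. Two things
  have to be recovered: that the perturbed semigroup leaves the summand invariant, and that it is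
  complex linear there. Both follow from its commuting with the operators \<open>M c\<close>
  below.\<close>

theorem generates_perturbation:
  assumes gS: "generates V n D A0 S"
    and BV: "\<And>v. v \<in> D \<Longrightarrow> B v \<in> V"
    and B_add: "\<And>u v. u \<in> D \<Longrightarrow> v \<in> D \<Longrightarrow> B (u + v) = B u + B v"
    and B_scale: "\<And>c v. v \<in> D \<Longrightarrow> B (c *\<^sub>C v) = c *\<^sub>C B v"
    and B_bound: "\<And>v. v \<in> D \<Longrightarrow> n (B v) \<le> C * (n v + n (A0 v))"
    and int: "\<alpha> > 0" "q < 1" "\<And>v. v \<in> D \<Longrightarrow> integral {0..\<alpha>} (\<lambda>s. n (B (S s v))) \<le> q * n v" and "0 \<le> q"
  shows "\<exists>U. generates V n D (\<lambda>v. A0 v + B v) U"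
proof -
  have S: "C0_semigroup V n S" and gr: "generator_graph V n S = {(v, A0 v) | v. v \<in> D}"
    using gS by (auto simp: generates_def)
  have grI: "(v, w) \<in> generator_graph V n S \<longleftrightarrow> v \<in> D \<and> w = A0 v" for v w by (auto simp: gr)
  have DV: "v \<in> V" "A0 v \<in> V" if "v \<in> D" for v
    using grI[of v "A0 v"] that by (auto simp: generator_graph_def)
  define S' where "S' t = lift_op (S t)" for t
  have sS: "strong_semigroup S'" unfolding S'_def[abs_def] by (rule strong_semigroup_lift[OF S])
  have b: "bounded_op V n V n (S t)" if "t \<ge> 0" for t using S that by (simp add: C0_semigroup_def)
  have genS: "(F, G) \<in> gen S' \<longleftrightarrow> prj V n F \<in> D \<and> G = emb V n (A0 (prj V n F))" for F G
    unfolding S'_def[abs_def] gen_lift[OF S] grI using DV prj_emb by metis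
  have DomS: "F \<in> Domain (gen S') \<longleftrightarrow> prj V n F \<in> D" for F by (auto simp: genS)
  define B' where "B' F = emb V n (B (prj V n F))" for F
  have D_add: "u + v \<in> D" if "u \<in> D" "v \<in> D" for u v
  proof -
    have "emb V n u + emb V n v \<in> Domain (gen S')"
      using that DV by (intro subspace_add[OF subspace_Domain_gen]) (auto simp: DomS prj_emb)
    then show ?thesis using that DV by (simp add: DomS prj_add prj_emb)
  qed
  \<comment> \<open>The difference quotients are real, but every \<open>S t\<close> is complex
    linear, so complex multiples of a convergent quotient converge too.\<close>
  have D_scale: "c *\<^sub>C v \<in> D" and A_scale: "A0 (c *\<^sub>C v) = c *\<^sub>C A0 v" if v: "v \<in> D" for c v
  proof -
    have lim: "((\<lambda>t. n ((1 / t) *\<^sub>R (S t v - v) - A0 v)) \<longlongrightarrow> 0) (at_right 0)"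
      using grI[of v "A0 v"] v by (simp add: generator_graph_def)
    have "((\<lambda>t. cmod c * n ((1 / t) *\<^sub>R (S t v - v) - A0 v)) \<longlongrightarrow> 0) (at_right 0)"
      using tendsto_mult[OF tendsto_const lim] by simp
    moreover have "\<forall>\<^sub>F t in at_right 0. cmod c * n ((1 / t) *\<^sub>R (S t v - v) - A0 v)
        = n ((1 / t) *\<^sub>R (S t (c *\<^sub>C v) - c *\<^sub>C v) - c *\<^sub>C A0 v)"
      using eventually_at_right_less
    proof eventually_elim
      case (elim t)
      then have t: "t \<ge> 0" by simp
      have cd: "c *\<^sub>C (x - y) = c *\<^sub>C x - c *\<^sub>C y" for x y :: 'v
        using scaleC_add_right[of c "x - y" y] by simp
      have cr: "c *\<^sub>C (r *\<^sub>R x) = r *\<^sub>R (c *\<^sub>C x)" for r and x :: 'v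
        by (simp add: scaleR_eq_scaleC scaleC_scaleC mult.commute)
      have "c *\<^sub>C ((1 / t) *\<^sub>R (S t v - v) - A0 v) = (1 / t) *\<^sub>R (S t (c *\<^sub>C v) - c *\<^sub>C v) - c *\<^sub>C A0 v"
        using DV[OF v] bounded_opD(3)[OF b[OF t]] by (simp only: cd cr)
      then show ?case using DV[OF v] bounded_opD[OF b[OF t]]
        by (simp add: norm_scaleC_carrier[symmetric] diff_closed scaleR_closed)
    qed
    ultimately have "((\<lambda>t. n ((1 / t) *\<^sub>R (S t (c *\<^sub>C v) - c *\<^sub>C v) - c *\<^sub>C A0 v)) \<longlongrightarrow> 0) (at_right 0)"
      by (rule Lim_transform_eventually)
    then have "(c *\<^sub>C v, c *\<^sub>C A0 v) \<in> generator_graph V n S"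
      using DV[OF v] by (simp add: generator_graph_def scaleC_closed)
    then show "c *\<^sub>C v \<in> D" "A0 (c *\<^sub>C v) = c *\<^sub>C A0 v" by (simp_all add: grI)
  qed
  interpret G: graph_bounded S' B' "\<bar>C\<bar>"
  proof unfold_locales
    fix F G
    show "B' (F + G) = B' F + B' G" if "F \<in> Domain (gen S')" "G \<in> Domain (gen S')"
      using that by (simp add: DomS B'_def prj_add B_add emb_add BV)
    show "B' (c *\<^sub>R F) = c *\<^sub>R B' F" if "F \<in> Domain (gen S')" for c
      using that by (simp add: DomS B'_def prj_scale emb_scale BV scaleR_eq_scaleC[of c "prj V n F"] B_scale)
        (simp add: scaleR_eq_scaleC[symmetric] emb_scale BV)
    assume "(F, G) \<in> gen S'"
    then have F: "prj V n F \<in> D" "G = emb V n (A0 (prj V n F))" by (auto simp: genS)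
    have "norm (B' F) \<le> C * (n (prj V n F) + n (A0 (prj V n F)))"
      using B_bound[OF F(1)] by (simp add: B'_def norm_emb BV F)
    also have "\<dots> \<le> \<bar>C\<bar> * (norm F + norm G)"
      using F DV norm_prj_le[of F] complete_norm
      by (intro mult_mono add_mono add_nonneg_nonneg) (auto simp: norm_emb complete_norm_def)
    finally show "norm (B' F) \<le> \<bar>C\<bar> * (norm F + norm G)" .
  qed (rule sS)
  have int': "integral {0..\<alpha>} (\<lambda>s. norm (B' (S' s F))) \<le> q * norm F" if "F \<in> Domain (gen S')" for F
  proof -
    have F: "prj V n F \<in> D" using that by (simp add: DomS)
    have SD: "S s (prj V n F) \<in> D" if "s \<ge> 0" for s
      using generator_graph_apply[OF S, of "prj V n F" "A0 (prj V n F)" s] F that by (simp add: grI)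
    have "integral {0..\<alpha>} (\<lambda>s. norm (B' (S' s F))) = integral {0..\<alpha>} (\<lambda>s. n (B (S s (prj V n F))))"
      by (rule integral_cong) (simp add: B'_def S'_def prj_lift_op[OF b] norm_emb BV SD)
    also have "\<dots> \<le> q * n (prj V n F)" by (rule int(3)[OF F])
    also have "\<dots> \<le> q * norm F" using \<open>0 \<le> q\<close> by (intro mult_left_mono norm_prj_le)
    finally show ?thesis .
  qed
  obtain u where u: "strong_semigroup u"
    and genu: "gen u = {(F, G + B' F) | F G. (F, G) \<in> gen S'}"
    and comm': "\<forall>P. (\<forall>t\<ge>0. S' t o\<^sub>L P = P o\<^sub>L S' t) \<longrightarrow>
      (\<forall>F\<in>Domain (gen S'). P F \<in> Domain (gen S') \<and> B' (P F) = P (B' F)) \<longrightarrow> (\<forall>t\<ge>0. u t o\<^sub>L P = P o\<^sub>L u t)"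
  proof -
    have "\<exists>u. strong_semigroup u \<and> gen u = {(F, G + B' F) | F G. (F, G) \<in> gen S'} \<and>
      (\<forall>P. (\<forall>t\<ge>0. S' t o\<^sub>L P = P o\<^sub>L S' t) \<longrightarrow>
      (\<forall>F\<in>Domain (gen S'). P F \<in> Domain (gen S') \<and> B' (P F) = P (B' F)) \<longrightarrow> (\<forall>t\<ge>0. u t o\<^sub>L P = P o\<^sub>L u t))"
      by (rule G.miyadera_perturbation[OF int(1,2) int'])
    then show ?thesis by (elim exE conjE) (rule that)
  qed
  have comm: "u t o\<^sub>L P = P o\<^sub>L u t" if "\<forall>t\<ge>0. S' t o\<^sub>L P = P o\<^sub>L S' t"
    "\<forall>F\<in>Domain (gen S'). P F \<in> Domain (gen S') \<and> B' (P F) = P (B' F)" "t \<ge> 0" for P t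
    using comm'[THEN spec, THEN mp, THEN mp, OF that(1,2)] that(3) by simp
  interpret u: semigroup u by unfold_locales (rule u)
  \<comment> \<open>Multiplication by \<open>c\<close> in the summand and 0 on the others; it
    commutes with the lifted semigroup and with the perturbation.\<close>
  define M where "M c = Blinfun (\<lambda>F. emb V n (c *\<^sub>C prj V n F))" for c
  have M: "M c F = emb V n (c *\<^sub>C prj V n F)" for c F
  proof -
    have sc: "c *\<^sub>C r *\<^sub>R x = r *\<^sub>R c *\<^sub>C x" for r and x :: 'v
      by (simp add: scaleR_eq_scaleC scaleC_scaleC mult.commute)
    have "bounded_linear (\<lambda>F. emb V n (c *\<^sub>C prj V n F))"
      by (rule bounded_linear_intro[where K = "cmod c"])
        (simp_all add: prj_add scaleC_add_right emb_add prj_in scaleC_closed prj_scale sc emb_scale norm_emb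
          norm_scaleC_carrier mult_right_mono norm_prj_le mult.commute[of "cmod c"])
    then show ?thesis by (simp add: M_def bounded_linear_Blinfun_apply)
  qed
  have uM: "u t (M c F) = M c (u t F)" if "t \<ge> 0" for t c F
  proof -
    have "u t o\<^sub>L M c = M c o\<^sub>L u t"
    proof (rule comm)
      show "\<forall>t\<ge>0. S' t o\<^sub>L M c = M c o\<^sub>L S' t"
        by (auto intro!: blinfun_eqI simp: S'_def M lift_op_emb[OF b] scaleC_closed prj_in prj_lift_op[OF b]
            bounded_opD[OF b])
      show "\<forall>F\<in>Domain (gen S'). M c F \<in> Domain (gen S') \<and> B' (M c F) = M c (B' F)"
        by (auto simp: DomS M prj_emb scaleC_closed prj_in D_scale B'_def B_scale BV)
    qed fact
    then show ?thesis by (metis blinfun_apply_blinfun_compose)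
  qed
  have one: "1 *\<^sub>C x = x" for x :: 'v using scaleC_of_real[of 1 x] by simp
  define U where "U t v = prj V n (u t (emb V n v))" for t v
  have UV: "U t v \<in> V" for t v by (simp add: U_def prj_in)
  \<comment> \<open>\<open>M 1\<close> is the projection onto the summand; commuting with it means
    that \<open>u t\<close> maps the summand into itself.\<close>
  have embU: "emb V n (U t v) = u t (emb V n v)" if "t \<ge> 0" "v \<in> V" for t v
    using uM[of t 1 "emb V n v"] that by (simp add: M one prj_emb U_def)
  have bU: "bounded_op V n V n (U t)" if t: "t \<ge> 0" for t
    unfolding bounded_op_def
  proof (intro conjI ballI allI)
    show "\<exists>C. \<forall>v\<in>V. n (U t v) \<le> C * n v"
    proof (intro exI ballI)
      show "n (U t v) \<le> norm (u t) * n v" if "v \<in> V" for v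
        using norm_blinfun[of "u t" "emb V n v"] that t by (simp add: embU[symmetric] norm_emb UV)
    qed
    show "U t (x + y) = U t x + U t y" if "x \<in> V" "y \<in> V" for x y
      using that by (simp add: U_def emb_add blinfun.bilinear_simps prj_add)
    show "U t (c *\<^sub>C v) = c *\<^sub>C U t v" if "v \<in> V" for c v
      using uM[OF t, of c "emb V n v"] that t
      by (simp add: M prj_emb U_def scaleC_closed prj_in)
  qed (rule UV)
  have nU: "n (U t v - w) = norm (u t (emb V n v) - emb V n w)" if "t \<ge> 0" "v \<in> V" "w \<in> V" for t v w
    using that by (simp add: embU[symmetric] emb_diff[symmetric] UV norm_emb diff_closed)
  have C0U: "C0_semigroup V n U"
    unfolding C0_semigroup_def
  proof (intro conjI allI impI ballI bU)
    show "U 0 v = v" if "v \<in> V" for v using that by (simp add: U_def prj_emb)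
    show "U (s + t) v = U s (U t v)" if "0 \<le> s" "0 \<le> t" "v \<in> V" for s t v
      using that by (simp add: U_def[of s "U t v"] embU u.plus_apply[symmetric]) (simp add: U_def)
    fix v assume v: "v \<in> V"
    have "((\<lambda>t. norm (u t (emb V n v) - emb V n v)) \<longlongrightarrow> 0) (at_right 0)"
      using u.tendsto_at_0[of "emb V n v"] by (simp add: LIM_zero_iff tendsto_norm_zero_iff)
    then show "((\<lambda>t. n (U t v - v)) \<longlongrightarrow> 0) (at_right 0)"
    proof (rule Lim_transform_eventually)
      show "\<forall>\<^sub>F t in at_right 0. norm (u t (emb V n v) - emb V n v) = n (U t v - v)"
        using eventually_at_right_less by eventually_elim (use nU v in simp)
    qed
  qed
  have graphU: "(v, w) \<in> generator_graph V n U \<longleftrightarrow> (emb V n v, emb V n w) \<in> gen u" if v: "v \<in> V" and w: "w \<in> V" for v w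
  proof -
    have "\<forall>\<^sub>F t in at_right 0. n ((1 / t) *\<^sub>R (U t v - v) - w) = norm ((1 / t) *\<^sub>R (u t (emb V n v) - emb V n v) - emb V n w)"
      using eventually_at_right_less
    proof eventually_elim
      case (elim t)
      have "emb V n ((1 / t) *\<^sub>R (U t v - v) - w) = (1 / t) *\<^sub>R (u t (emb V n v) - emb V n v) - emb V n w"
        using elim v w by (simp add: emb_diff emb_scale UV diff_closed scaleR_closed embU)
      then show ?case using v w by (metis norm_emb UV diff_closed scaleR_closed)
    qed
    then show ?thesis
      unfolding generator_graph_def gen_def using v w
      by (simp add: tendsto_cong) (simp add: LIM_zero_iff tendsto_norm_zero_iff)
  qed
  have "generator_graph V n U = {(v, A0 v + B v) | v. v \<in> D}"
  proof (intro set_eqI iffI)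
    fix p assume p: "p \<in> generator_graph V n U"
    then obtain v w where vw: "p = (v, w)" "v \<in> V" "w \<in> V" by (auto simp: generator_graph_def)
    then have "(emb V n v, emb V n w) \<in> gen u" using p graphU by simp
    then have "v \<in> D" "emb V n w = emb V n (A0 v) + emb V n (B v)"
      using vw by (auto simp: genu genS prj_emb B'_def)
    then have "w = A0 v + B v" using vw DV BV by (simp add: emb_add[symmetric] emb_inject add_closed)
    then show "p \<in> {(v, A0 v + B v) | v. v \<in> D}" using vw \<open>v \<in> D\<close> by auto
  next
    fix p assume "p \<in> {(v, A0 v + B v) | v. v \<in> D}"
    then obtain v where v: "p = (v, A0 v + B v)" "v \<in> D" by auto
    have "(emb V n v, emb V n (A0 v) + B' (emb V n v)) \<in> gen u"
      using v DV by (auto simp: genu genS prj_emb)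
    then have "(emb V n v, emb V n (A0 v + B v)) \<in> gen u"
      using v DV BV by (simp add: B'_def prj_emb emb_add)
    then show "p \<in> generator_graph V n U" using graphU v DV BV by (simp add: add_closed)
  qed
  then show ?thesis using C0U by (auto simp: generates_def)
qed

end

section \<open>Strong measurability on the real line\<close>

text \<open>Lebesgue measure is a multiple of its image under an affine bijection, so preimages of
  null sets are null.\<close>

lemma AE_lebesgue_affine:
  fixes c :: real
  assumes P: "AE x in lebesgue. P x" and c: "c \<noteq> 0"
  shows "AE x in lebesgue. P (t + c * x)"
proof -
  obtain N where N: "N \<in> null_sets lebesgue" "{x. \<not> P x} \<subseteq> N"
    using P by (auto simp: eventually_ae_filter)
  have T: "(\<lambda>x. t + c * x) \<in> lebesgue \<rightarrow>\<^sub>M lebesgue"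
    using lebesgue_affine_measurable[where c = "\<lambda>x::real. c"] c by simp
  have "0 = emeasure (density (distr lebesgue lebesgue (\<lambda>x. t + c * x)) (\<lambda>_. ennreal \<bar>c\<bar>)) N"
    using N lebesgue_real_affine[OF c, of t] by auto
  also have "\<dots> = ennreal \<bar>c\<bar> * emeasure lebesgue ((\<lambda>x. t + c * x) -` N)"
  proof -
    have NS: "N \<in> sets lebesgue" using N by auto
    have "emeasure (density (distr lebesgue lebesgue (\<lambda>x. t + c * x)) (\<lambda>_. ennreal \<bar>c\<bar>)) N
        = ennreal \<bar>c\<bar> * emeasure (distr lebesgue lebesgue (\<lambda>x. t + c * x)) N"
      by (rule emeasure_density_const) (use NS in simp)
    then show ?thesis using emeasure_distr[OF T NS] by simp
  qed
  finally have "emeasure lebesgue ((\<lambda>x. t + c * x) -` N) = 0" using c by auto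
  moreover have "(\<lambda>x. t + c * x) -` N \<in> sets lebesgue"
    using measurable_sets[OF T, of N] N by auto
  ultimately have "(\<lambda>x. t + c * x) -` N \<in> null_sets lebesgue" by auto
  then show ?thesis
    unfolding eventually_ae_filter by (rule bexI[rotated]) (use N in auto)
qed

lemma strongly_measurable_compose2:
  fixes h :: "'a::real_normed_vector \<Rightarrow> 'b::real_normed_vector \<Rightarrow> 'c::real_normed_vector"
  assumes f: "strongly_measurable M f" and g: "strongly_measurable M g"
    and h: "\<And>x y. isCont (\<lambda>(x, y). h x y) (x, y)"
  shows "strongly_measurable M (\<lambda>x. h (f x) (g x))"
proof -
  obtain s where s: "\<And>i. simple_function M (s i)" "AE x in M. (\<lambda>i::nat. s i x) \<longlonglongrightarrow> f x"
    using f by (auto simp: strongly_measurable_def)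
  obtain r where r: "\<And>i. simple_function M (r i)" "AE x in M. (\<lambda>i::nat. r i x) \<longlonglongrightarrow> g x"
    using g by (auto simp: strongly_measurable_def)
  have "AE x in M. (\<lambda>i. h (s i x) (r i x)) \<longlonglongrightarrow> h (f x) (g x)"
    using s(2) r(2)
  proof eventually_elim
    case (elim x)
    then have "(\<lambda>i. (s i x, r i x)) \<longlonglongrightarrow> (f x, g x)" by (rule tendsto_Pair)
    from isCont_tendsto_compose[OF h this] show ?case by simp
  qed
  moreover have "simple_function M (\<lambda>x. h (s i x) (r i x))" for i
    using simple_function_compose2[OF s(1) r(1)] .
  ultimately show ?thesis
    unfolding strongly_measurable_def by (intro exI[of _ "\<lambda>i x. h (s i x) (r i x)"]) simp
qed

lemma strongly_measurable_compose:
  fixes h :: "'a::real_normed_vector \<Rightarrow> 'b::real_normed_vector"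
  assumes f: "strongly_measurable M f" and h: "\<And>x. isCont h x"
  shows "strongly_measurable M (\<lambda>x. h (f x))"
proof -
  have "isCont (\<lambda>(x, y::'a). h x) (x, y)" for x y
    using isCont_o2[OF isCont_fst[OF continuous_ident] h, of "(x, y)"] by (simp add: case_prod_unfold)
  then show ?thesis by (rule strongly_measurable_compose2[OF f f])
qed

lemma strongly_measurable_add:
  "strongly_measurable M f \<Longrightarrow> strongly_measurable M g \<Longrightarrow> strongly_measurable M (\<lambda>x. f x + g x)"
  by (rule strongly_measurable_compose2) (auto simp: case_prod_unfold intro!: continuous_intros)

lemma strongly_measurable_diff:
  "strongly_measurable M f \<Longrightarrow> strongly_measurable M g \<Longrightarrow> strongly_measurable M (\<lambda>x. f x - g x)"
  by (rule strongly_measurable_compose2) (auto simp: case_prod_unfold intro!: continuous_intros)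

lemma strongly_measurable_scaleR:
  "strongly_measurable M f \<Longrightarrow> strongly_measurable M (\<lambda>x. c *\<^sub>R f x)"
  by (rule strongly_measurable_compose) (auto intro!: continuous_intros)

lemma strongly_measurable_const [simp]: "strongly_measurable M (\<lambda>x. c)"
  unfolding strongly_measurable_def by (intro exI[of _ "\<lambda>_ _. c"]) auto

lemma strongly_measurable_simple: "simple_function M f \<Longrightarrow> strongly_measurable M f"
  unfolding strongly_measurable_def by (intro exI[of _ "\<lambda>_. f"]) auto

lemma strongly_measurable_cong_AE:
  assumes f: "strongly_measurable M f" and eq: "AE x in M. f x = g x"
  shows "strongly_measurable M g"
proof -
  obtain s where s: "\<And>i. simple_function M (s i)" "AE x in M. (\<lambda>i::nat. s i x) \<longlonglongrightarrow> f x"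
    using f by (auto simp: strongly_measurable_def)
  have "AE x in M. (\<lambda>i. s i x) \<longlonglongrightarrow> g x" using s(2) eq by eventually_elim simp
  then show ?thesis using s by (auto simp: strongly_measurable_def)
qed

lemma strongly_measurable_If:
  assumes f: "strongly_measurable M f" and g: "strongly_measurable M g" and S: "S \<inter> space M \<in> sets M"
  shows "strongly_measurable M (\<lambda>x. if x \<in> S then f x else g x)"
proof -
  obtain s where s: "\<And>i. simple_function M (s i)" "AE x in M. (\<lambda>i::nat. s i x) \<longlonglongrightarrow> f x"
    using f by (auto simp: strongly_measurable_def)
  obtain r where r: "\<And>i. simple_function M (r i)" "AE x in M. (\<lambda>i::nat. r i x) \<longlonglongrightarrow> g x"
    using g by (auto simp: strongly_measurable_def)
  have "AE x in M. (\<lambda>i. if x \<in> S then s i x else r i x) \<longlonglongrightarrow> (if x \<in> S then f x else g x)"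
    using s(2) r(2) by eventually_elim auto
  moreover have "simple_function M (\<lambda>x. if x \<in> S then s i x else r i x)" for i
    using simple_function_If_set[OF s(1) r(1) S] .
  ultimately show ?thesis
    unfolding strongly_measurable_def by (intro exI[of _ "\<lambda>i x. if x \<in> S then s i x else r i x"]) simp
qed

lemma strongly_measurable_affine:
  fixes f :: "real \<Rightarrow> 'a::real_normed_vector"
  assumes f: "strongly_measurable lebesgue f" and c: "c \<noteq> 0"
  shows "strongly_measurable lebesgue (\<lambda>x. f (t + c * x))"
proof -
  have T: "(\<lambda>x. t + c * x) \<in> lebesgue \<rightarrow>\<^sub>M lebesgue"
    using lebesgue_affine_measurable[where c = "\<lambda>x::real. c"] c by simp
  obtain s where s: "\<And>i. simple_function lebesgue (s i)" "AE x in lebesgue. (\<lambda>i::nat. s i x) \<longlonglongrightarrow> f x"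
    using f by (auto simp: strongly_measurable_def)
  have "AE x in lebesgue. (\<lambda>i. s i (t + c * x)) \<longlonglongrightarrow> f (t + c * x)"
    by (rule AE_lebesgue_affine[OF s(2) c])
  moreover have "simple_function lebesgue (\<lambda>x. s i (t + c * x))" for i
    by (rule simple_function_comp[OF T s(1)])
  ultimately show ?thesis
    unfolding strongly_measurable_def by (intro exI[of _ "\<lambda>i x. s i (t + c * x)"]) simp
qed

lemma simple_function_restrict:
  assumes "simple_function lebesgue s"
  shows "simple_function (lebesgue_on S) s"
proof -
  have "finite (s ` S)"
    by (rule finite_subset[OF image_mono[OF subset_UNIV] simple_functionD(1)[OF assms, simplified]])
  moreover have "s -` {y} \<inter> S \<in> sets (lebesgue_on S)" for y
    using simple_functionD(2)[OF assms, of "{y}"] by (auto simp: sets_restrict_space Int_commute)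
  ultimately show ?thesis by (simp add: simple_function_def)
qed

text \<open>Moves functions on \<open>S\<close> to the whole line, where translations can be
  formed.\<close>

lemma strongly_measurable_restrict_iff:
  fixes f :: "real \<Rightarrow> 'a::real_normed_vector"
  assumes S: "S \<in> sets lebesgue"
  shows "strongly_measurable (lebesgue_on S) f \<longleftrightarrow> strongly_measurable lebesgue (\<lambda>s. if s \<in> S then f s else 0)"
proof
  assume "strongly_measurable (lebesgue_on S) f"
  then obtain s where s: "\<And>i. simple_function (lebesgue_on S) (s i)"
    "AE x in lebesgue_on S. (\<lambda>i::nat. s i x) \<longlonglongrightarrow> f x"
    by (auto simp: strongly_measurable_def)
  have "simple_function lebesgue (\<lambda>x. if x \<in> S then s i x else 0)" for i
    unfolding simple_function_def
  proof (intro conjI ballI)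
    have "finite (s i ` S)" using simple_functionD(1)[OF s(1)[of i]] by simp
    then have "finite (insert 0 (s i ` S))" by simp
    then show "finite ((\<lambda>x. if x \<in> S then s i x else 0) ` space lebesgue)" by (rule finite_subset[rotated]) auto
    fix y
    have "s i -` {y} \<inter> S \<in> sets lebesgue"
      using simple_functionD(2)[OF s(1)[of i], of "{y}"] S by (auto simp: sets_restrict_space)
    moreover have "(\<lambda>x. if x \<in> S then s i x else 0) -` {y} \<inter> space lebesgue =
        (s i -` {y} \<inter> S) \<union> (if y = 0 then - S else {})" by (auto split: if_splits)
    ultimately show "(\<lambda>x. if x \<in> S then s i x else 0) -` {y} \<inter> space lebesgue \<in> sets lebesgue"
      using S by (auto simp: Compl_in_sets_lebesgue)
  qed
  moreover have "AE x in lebesgue. (\<lambda>i. if x \<in> S then s i x else 0) \<longlonglongrightarrow> (if x \<in> S then f x else 0)"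
    using s(2) S by (subst (asm) AE_restrict_space_iff) auto
  ultimately show "strongly_measurable lebesgue (\<lambda>s. if s \<in> S then f s else 0)"
    unfolding strongly_measurable_def by (intro exI[of _ "\<lambda>i x. if x \<in> S then s i x else 0"]) simp
next
  assume "strongly_measurable lebesgue (\<lambda>s. if s \<in> S then f s else 0)"
  then obtain s where s: "\<And>i. simple_function lebesgue (s i)"
    "AE x in lebesgue. (\<lambda>i::nat. s i x) \<longlonglongrightarrow> (if x \<in> S then f x else 0)"
    by (auto simp: strongly_measurable_def)
  have "AE x in lebesgue_on S. (\<lambda>i. s i x) \<longlonglongrightarrow> f x"
    using S s(2) by (subst AE_restrict_space_iff) (auto elim: eventually_mono)
  then show "strongly_measurable (lebesgue_on S) f"
    using simple_function_restrict[OF s(1)] by (auto simp: strongly_measurable_def)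
qed

lemma strongly_measurable_norm:
  fixes f :: "real \<Rightarrow> 'a::real_normed_vector"
  assumes "strongly_measurable lebesgue f"
  shows "(\<lambda>x. norm (f x - c)) \<in> borel_measurable lebesgue"
proof -
  obtain s where s: "\<And>i. simple_function lebesgue (s i)" "AE x in lebesgue. (\<lambda>i::nat. s i x) \<longlonglongrightarrow> f x"
    using assms by (auto simp: strongly_measurable_def)
  have m: "(\<lambda>x. norm (s i x - c)) \<in> borel_measurable lebesgue" for i
    by (rule borel_measurable_simple_function[OF simple_function_compose1[OF s(1), of "\<lambda>v. norm (v - c)"]])
  have "(\<lambda>x. lim (\<lambda>i. norm (s i x - c))) \<in> borel_measurable lebesgue"
    by (rule borel_measurable_lim_metric) (rule m)
  moreover have "AE x in lebesgue. lim (\<lambda>i. norm (s i x - c)) = norm (f x - c)"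
    using s(2)
  proof eventually_elim
    case (elim x)
    then show ?case by (intro limI tendsto_intros)
  qed
  ultimately show ?thesis by (rule borel_measurable_AE)
qed

lemma strongly_measurable_norm0:
  fixes f :: "real \<Rightarrow> 'a::real_normed_vector"
  shows "strongly_measurable lebesgue f \<Longrightarrow> (\<lambda>x. norm (f x)) \<in> borel_measurable lebesgue"
  using strongly_measurable_norm[of f 0] by simp

lemma strongly_measurable_separable:
  fixes f :: "real \<Rightarrow> 'a::real_normed_vector"
  assumes "strongly_measurable lebesgue f"
  shows "\<exists>Q. countable Q \<and> (AE x in lebesgue. f x \<in> closure Q)"
proof -
  obtain s where s: "\<And>i. simple_function lebesgue (s i)" "AE x in lebesgue. (\<lambda>i::nat. s i x) \<longlonglongrightarrow> f x"
    using assms by (auto simp: strongly_measurable_def)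
  have "countable (\<Union>i. range (s i))"
    using simple_functionD(1)[OF s(1)] by (intro countable_UN) (auto intro: countable_finite)
  moreover have "AE x in lebesgue. f x \<in> closure (\<Union>i. range (s i))"
    using s(2)
  proof eventually_elim
    case (elim x)
    then show ?case
      unfolding closure_sequential by (intro exI[of _ "\<lambda>i. s i x"]) auto
  qed
  ultimately show ?thesis by blast
qed

text \<open>Pettis: a function with separable range is approximated by always picking the nearest of
  finitely many points of a countable dense set. Starting from the point \<open>0\<close> makes the
  approximations dominated by \<open>2 * norm (f x)\<close>.\<close>

lemma pettis_approximation:
  fixes f :: "real \<Rightarrow> 'a::real_normed_vector"
  assumes m: "\<And>c. (\<lambda>x. norm (f x - c)) \<in> borel_measurable lebesgue"
    and Q: "countable Q" "AE x in lebesgue. f x \<in> closure Q"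
  obtains s where "\<And>i::nat. simple_function lebesgue (s i)" "AE x in lebesgue. (\<lambda>i. s i x) \<longlonglongrightarrow> f x"
    "\<And>i x. norm (f x - s i x) \<le> norm (f x)"
proof -
  define q where "q = (\<lambda>n. case n of 0 \<Rightarrow> 0 | Suc k \<Rightarrow> from_nat_into (insert 0 Q) k)"
  have "range q = insert 0 Q"
  proof -
    have r: "range (from_nat_into (insert 0 Q)) = insert 0 Q" using Q(1) by (intro range_from_nat_into) auto
    have "q (Suc k) = from_nat_into (insert 0 Q) k" for k by (simp add: q_def)
    then have "range (from_nat_into (insert 0 Q)) \<subseteq> range q" by (metis image_subsetI rangeI)
    moreover have "q n \<in> insert 0 Q" for n
    proof (cases n)
      case (Suc k)
      then show ?thesis using r rangeI[of "from_nat_into (insert 0 Q)" k] by (simp add: q_def)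
    qed (simp add: q_def)
    then have "range q \<subseteq> insert 0 Q" by blast
    ultimately show ?thesis using r by auto
  qed
  then have cl: "closure Q \<subseteq> closure (range q)" by (auto intro!: closure_mono)
  define s where "s = rec_nat (\<lambda>x. 0) (\<lambda>n s x. if norm (f x - q (Suc n)) < norm (f x - s x) then q (Suc n) else s x)"
  have s0: "s 0 x = 0" for x by (simp add: s_def)
  have sS: "s (Suc n) x = (if norm (f x - q (Suc n)) < norm (f x - s n x) then q (Suc n) else s n x)" for n x
    by (simp add: s_def)
  have q0: "q 0 = 0" by (simp add: q_def)
  have sm: "simple_function lebesgue (s n) \<and> (\<lambda>x. norm (f x - s n x)) \<in> borel_measurable lebesgue" for n
  proof (induction n)
    case 0
    then show ?case using m[of 0] by (simp add: s0[abs_def] fun_eq_iff s0)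
  next
    case (Suc n)
    have [measurable]: "(\<lambda>x. norm (f x - s n x)) \<in> borel_measurable lebesgue"
      "(\<lambda>x. norm (f x - q (Suc n))) \<in> borel_measurable lebesgue" using Suc m by auto
    have "simple_function lebesgue (\<lambda>x. if norm (f x - q (Suc n)) < norm (f x - s n x) then q (Suc n) else s n x)"
      by (rule simple_function_If) (use Suc borel_measurable_less[of "\<lambda>x. norm (f x - q (Suc n))" lebesgue "\<lambda>x. norm (f x - s n x)"] m in auto)
    then have 1: "simple_function lebesgue (s (Suc n))" by (simp add: sS[abs_def])
    have "norm (f x - s (Suc n) x) = min (norm (f x - q (Suc n))) (norm (f x - s n x))" for x
      by (auto simp: sS)
    then have "(\<lambda>x. norm (f x - s (Suc n) x)) \<in> borel_measurable lebesgue" by simp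
    with 1 show ?case by simp
  qed
  have le: "norm (f x - s n x) \<le> norm (f x - q k)" if "k \<le> n" for n k x
    using that
  proof (induction n)
    case (Suc n)
    then show ?case by (cases "k = Suc n") (auto simp: sS)
  qed (simp add: s0 q0)
  show thesis
  proof
    show "simple_function lebesgue (s i)" for i using sm by simp
    show "norm (f x - s i x) \<le> norm (f x)" for i x using le[of 0 i x] by (simp add: q0)
    show "AE x in lebesgue. (\<lambda>i. s i x) \<longlonglongrightarrow> f x"
      using Q(2)
    proof eventually_elim
      case (elim x)
      show ?case
      proof (rule LIMSEQ_I)
        fix e :: real assume "e > 0"
        moreover have "f x \<in> closure (range q)" using elim cl by blast
        ultimately have "\<exists>y\<in>range q. dist y (f x) < e" unfolding closure_approachable by blast
        then obtain k where "dist (q k) (f x) < e" by blast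
        then have "norm (s n x - f x) < e" if "n \<ge> k" for n
          using le[OF that, of x] by (simp add: dist_norm norm_minus_commute)
        then show "\<exists>N. \<forall>n\<ge>N. norm (s n x - f x) < e" by blast
      qed
    qed
  qed
qed

lemma strongly_measurable_pettis:
  fixes f :: "real \<Rightarrow> 'a::real_normed_vector"
  assumes "\<And>c. (\<lambda>x. norm (f x - c)) \<in> borel_measurable lebesgue"
    and "countable Q" "AE x in lebesgue. f x \<in> closure Q"
  shows "strongly_measurable lebesgue f"
  using pettis_approximation[OF assms] unfolding strongly_measurable_def by metis

lemma strongly_measurable_approximation:
  fixes f :: "real \<Rightarrow> 'a::real_normed_vector"
  assumes "strongly_measurable lebesgue f"
  obtains s where "\<And>i::nat. simple_function lebesgue (s i)" "AE x in lebesgue. (\<lambda>i. s i x) \<longlonglongrightarrow> f x"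
    "\<And>i x. norm (f x - s i x) \<le> norm (f x)"
proof -
  obtain Q where "countable Q" "AE x in lebesgue. f x \<in> closure Q"
    using strongly_measurable_separable[OF assms] by blast
  from pettis_approximation[OF strongly_measurable_norm[OF assms] this] show thesis using that .
qed

text \<open>By Pettis: the countable sets whose closures almost carry the ranges of the
  \<open>g k\<close> have a countable union that serves for the limit, and the functions norm (f -
  c) are limits of measurable ones.\<close>

lemma strongly_measurable_limit:
  fixes f :: "real \<Rightarrow> 'a::real_normed_vector"
  assumes g: "\<And>k::nat. strongly_measurable lebesgue (g k)" and lim: "AE x in lebesgue. (\<lambda>k. g k x) \<longlonglongrightarrow> f x"
  shows "strongly_measurable lebesgue f"
proof -
  have "\<forall>k. \<exists>Q. countable Q \<and> (AE x in lebesgue. g k x \<in> closure Q)"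
    using strongly_measurable_separable[OF g] by blast
  then obtain Q where Q: "\<And>k. countable (Q k)" "\<And>k. AE x in lebesgue. g k x \<in> closure (Q k)" by metis
  have "AE x in lebesgue. \<forall>k. g k x \<in> closure (Q k)" using Q(2) by (simp add: AE_all_countable)
  then have "AE x in lebesgue. f x \<in> closure (\<Union>k. Q k)"
    using lim
  proof eventually_elim
    case (elim x)
    have "g k x \<in> closure (\<Union>k. Q k)" for k
      using elim(1) closure_mono[of "Q k" "\<Union>k. Q k"] by blast
    from closed_sequentially[OF closed_closure this elim(2)] show ?case .
  qed
  moreover have "(\<lambda>x. norm (f x - c)) \<in> borel_measurable lebesgue" for c
  proof (rule borel_measurable_AE)
    show "(\<lambda>x. lim (\<lambda>k. norm (g k x - c))) \<in> borel_measurable lebesgue"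
      by (rule borel_measurable_lim_metric) (rule strongly_measurable_norm[OF g])
    show "AE x in lebesgue. lim (\<lambda>k. norm (g k x - c)) = norm (f x - c)"
      using lim by eventually_elim (intro limI tendsto_intros)
  qed
  moreover have "countable (\<Union>k. Q k)" using Q(1) by simp
  ultimately show ?thesis by (intro strongly_measurable_pettis)
qed

text \<open>The image of the rationals is countable and dense in the range, so Pettis
  applies.\<close>

lemma strongly_measurable_continuous:
  fixes f :: "real \<Rightarrow> 'a::real_normed_vector"
  assumes f: "continuous_on UNIV f"
  shows "strongly_measurable lebesgue f"
proof (rule strongly_measurable_pettis)
  have "continuous_on UNIV (\<lambda>x. norm (f x - c))" for c by (intro continuous_intros f)
  then show "(\<lambda>x. norm (f x - c)) \<in> borel_measurable lebesgue" for c
    by (intro measurable_completion) (simp add: borel_measurable_continuous_onI)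
  show "countable (f ` \<rat>)" by (simp add: countable_rat)
  have "f ` closure \<rat> \<subseteq> closure (f ` \<rat>)"
    by (rule image_closure_subset[OF continuous_on_subset[OF f]]) (auto simp: closure_subset)
  then show "AE x in lebesgue. f x \<in> closure (f ` \<rat>)" by (auto simp: Rats_closure_real)
qed

lemma strongly_measurable_continuous_on:
  fixes f :: "real \<Rightarrow> 'a::real_normed_vector"
  assumes f: "continuous_on {a..b} f"
  shows "strongly_measurable (lebesgue_on {a..b}) f"
proof (cases "a \<le> b")
  case True
  \<comment> \<open>Clamping the argument to [a, b] extends \<open>f\<close> continuously to the
    line.\<close>
  have "continuous_on UNIV (\<lambda>x. f (max a (min b x)))"
    by (rule continuous_on_compose2[OF f]) (use True in \<open>auto intro!: continuous_intros\<close>)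
  then have "strongly_measurable lebesgue (\<lambda>x. if x \<in> {a..b} then f (max a (min b x)) else 0)"
    by (intro strongly_measurable_If strongly_measurable_continuous) auto
  then have "strongly_measurable lebesgue (\<lambda>x. if x \<in> {a..b} then f x else 0)"
    by (rule strongly_measurable_cong_AE) auto
  then show ?thesis by (simp add: strongly_measurable_restrict_iff)
next
  case False
  then show ?thesis by (simp add: strongly_measurable_restrict_iff)
qed

section \<open>The strong integral over an interval is a Henstock--Kurzweil integral\<close>

lemma emeasure_lebesgue_on_Icc_finite: "emeasure (lebesgue_on {a..b::real}) X < \<infinity>"
proof -
  have "emeasure (lebesgue_on {a..b}) X \<le> emeasure (lebesgue_on {a..b}) (space (lebesgue_on {a..b}))"
    by (rule emeasure_space)
  also have "\<dots> = emeasure lborel {a..b}" by (simp add: emeasure_restrict_space)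
  also have "\<dots> < \<infinity>" by (cases "a \<le> b") auto
  finally show ?thesis .
qed

lemma has_integral_simple:
  fixes s :: "real \<Rightarrow> 'a::banach"
  assumes s: "Bochner_Integration.simple_bochner_integrable (lebesgue_on {a..b}) s"
  shows "(s has_integral Bochner_Integration.simple_bochner_integral (lebesgue_on {a..b}) s) {a..b}"
proof -
  let ?M = "lebesgue_on {a..b}"
  have sf: "simple_function ?M s" using s by (simp add: simple_bochner_integrable.simps)
  have fin: "finite (s ` {a..b})" using simple_functionD(1)[OF sf] by simp
  have *: "((\<lambda>x. \<Sum>y\<in>s ` {a..b}. indicator {x \<in> {a..b}. s x = y} x *\<^sub>R y) has_integral
      (\<Sum>y\<in>s ` {a..b}. measure ?M {x \<in> {a..b}. s x = y} *\<^sub>R y)) {a..b}"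
  proof (intro has_integral_sum fin has_integral_scaleR_left)
    fix y
    have "{x \<in> {a..b}. s x = y} \<in> sets ?M"
      using simple_functionD(2)[OF sf, of "{y}"] by (simp add: vimage_def Int_def conj_commute)
    then have "integrable ?M (indicat_real {x \<in> {a..b}. s x = y})"
      by (rule integrable_real_indicator) (rule emeasure_lebesgue_on_Icc_finite)
    from has_integral_integral_lebesgue_on[OF this]
    have "(indicat_real {x \<in> {a..b}. s x = y} has_integral measure ?M ({x \<in> {a..b}. s x = y} \<inter> space ?M)) {a..b}"
      by simp
    moreover have "{x \<in> {a..b}. s x = y} \<inter> space ?M = {x \<in> {a..b}. s x = y}" by auto
    ultimately show "(indicat_real {x \<in> {a..b}. s x = y} has_integral measure ?M {x \<in> {a..b}. s x = y}) {a..b}"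
      by simp
  qed
  have **: "(\<Sum>y\<in>s ` {a..b}. indicator {x \<in> {a..b}. s x = y} x *\<^sub>R y) = s x" if "x \<in> {a..b}" for x
  proof -
    have "(\<Sum>y\<in>s ` {a..b}. indicator {x \<in> {a..b}. s x = y} x *\<^sub>R y) = (\<Sum>y\<in>s ` {a..b}. if y = s x then y else 0)"
      by (rule sum.cong) (use that in \<open>auto simp: indicator_def\<close>)
    then show ?thesis using that fin by simp
  qed
  have "Bochner_Integration.simple_bochner_integral ?M s =
      (\<Sum>y\<in>s ` {a..b}. measure ?M {x \<in> {a..b}. s x = y} *\<^sub>R y)"
    by (simp only: simple_bochner_integral_def space_lebesgue_on)
  then show ?thesis using has_integral_eq[OF ** *] by simp
qed

lemma nn_integral_restrict_has_integral:
  fixes g :: "real \<Rightarrow> real"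
  assumes m: "g \<in> borel_measurable (lebesgue_on {a..b})" and nn: "\<And>x. 0 \<le> g x"
    and lt: "(\<integral>\<^sup>+x. ennreal (g x) \<partial>lebesgue_on {a..b}) < ennreal e"
  shows "\<exists>J<e. (g has_integral J) {a..b}"
proof -
  have i: "integrable (lebesgue_on {a..b}) g"
    using nn by (intro integrableI_nonneg m AE_I2 less_trans[OF lt]) auto
  have "ennreal (integral\<^sup>L (lebesgue_on {a..b}) g) < ennreal e"
    using lt nn_integral_eq_integral[OF i] nn by simp
  then have "integral\<^sup>L (lebesgue_on {a..b}) g < e"
    using nn by (subst (asm) ennreal_less_iff) auto
  then show ?thesis using has_integral_integral_lebesgue_on[OF i] by auto
qed

lemma strongly_measurable_restrict_norm:
  fixes f :: "real \<Rightarrow> 'a::real_normed_vector"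
  assumes f: "strongly_measurable (lebesgue_on {a..b}) f"
  shows "(\<lambda>x. norm (f x)) \<in> borel_measurable (lebesgue_on {a..b})"
proof -
  have "(\<lambda>x. norm (if x \<in> {a..b} then f x else 0)) \<in> borel_measurable lebesgue"
    using f by (intro strongly_measurable_norm0) (simp add: strongly_measurable_restrict_iff)
  then have "(\<lambda>x. norm (if x \<in> {a..b} then f x else 0)) \<in> borel_measurable (lebesgue_on {a..b})"
    by (rule measurable_restrict_space1)
  then show ?thesis by (rule measurable_cong[THEN iffD1, rotated]) auto
qed

text \<open>Riemann sums are compared directly: those of \<open>f\<close> differ from those of a
  simple function by at most the Riemann sums of the real function norm (f - s), which are
  controlled by its small integral. This works in every Banach space.\<close>

lemma has_integral_if_has_strong_integral:
  fixes f :: "real \<Rightarrow> 'a::banach"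
  assumes "has_strong_integral (lebesgue_on {a..b}) f I"
  shows "(f has_integral I) {a..b}"
proof -
  let ?M = "lebesgue_on {a..b}"
  obtain s where f: "strongly_measurable ?M f"
    and s: "\<And>i::nat. Bochner_Integration.simple_bochner_integrable ?M (s i)"
    and lim: "(\<lambda>i. \<integral>\<^sup>+x. ennreal (norm (f x - s i x)) \<partial>?M) \<longlonglongrightarrow> 0"
    and limI: "(\<lambda>i. Bochner_Integration.simple_bochner_integral ?M (s i)) \<longlonglongrightarrow> I"
    using assms unfolding has_strong_integral_def by blast
  have "(f has_integral I) (cbox a b)"
    unfolding has_integral
  proof (intro allI impI)
    \<comment> \<open>Budget: the Riemann sums of norm (f - s i) stay below J + e/4 < e/2; those of
      \<open>s i\<close> are within e/4 of its integral, which is within e/4 of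
      \<open>I\<close>.\<close>
    fix e :: real assume e: "e > 0"
    have "\<forall>\<^sub>F i in sequentially. (\<integral>\<^sup>+x. ennreal (norm (f x - s i x)) \<partial>?M) < ennreal (e / 4)"
      using e by (intro order_tendstoD(2)[OF lim]) simp
    moreover have "\<forall>\<^sub>F i in sequentially. norm (Bochner_Integration.simple_bochner_integral ?M (s i) - I) < e / 4"
      using e tendstoD[OF limI, of "e / 4"] by (simp add: dist_norm)
    ultimately have "\<forall>\<^sub>F i in sequentially. (\<integral>\<^sup>+x. ennreal (norm (f x - s i x)) \<partial>?M) < ennreal (e / 4)
        \<and> norm (Bochner_Integration.simple_bochner_integral ?M (s i) - I) < e / 4"
      by eventually_elim simp
    then obtain i where i1: "(\<integral>\<^sup>+x. ennreal (norm (f x - s i x)) \<partial>?M) < ennreal (e / 4)"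
      and i2: "norm (Bochner_Integration.simple_bochner_integral ?M (s i) - I) < e / 4"
      using eventually_happens'[OF sequentially_bot] by blast
    let ?I = "Bochner_Integration.simple_bochner_integral ?M (s i)"
    have "simple_function ?M (s i)" using s by (simp add: simple_bochner_integrable.simps)
    then have "(\<lambda>x. norm (f x - s i x)) \<in> borel_measurable ?M"
      by (intro strongly_measurable_restrict_norm strongly_measurable_diff f strongly_measurable_simple)
    from nn_integral_restrict_has_integral[OF this _ i1] obtain J
      where J: "J < e / 4" "((\<lambda>x. norm (f x - s i x)) has_integral J) (cbox a b)" by auto
    have e4: "e / 4 > 0" using e by simp
    obtain g1 where g1: "gauge g1" "\<And>D. D tagged_division_of cbox a b \<Longrightarrow> g1 fine D \<Longrightarrow>
        norm ((\<Sum>(x, k)\<in>D. measure lborel k *\<^sub>R norm (f x - s i x)) - J) < e / 4"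
      using J(2)[unfolded has_integral, THEN spec, THEN mp, OF e4]
      by (elim exE conjE) (rule that, assumption, simp)
    obtain g2 where g2: "gauge g2" "\<And>D. D tagged_division_of cbox a b \<Longrightarrow> g2 fine D \<Longrightarrow>
        norm ((\<Sum>(x, k)\<in>D. measure lborel k *\<^sub>R s i x) - ?I) < e / 4"
      using has_integral_simple[OF s[of i], folded box_real, unfolded has_integral, THEN spec, THEN mp, OF e4]
      by (elim exE conjE) (rule that, assumption, simp)
    show "\<exists>\<gamma>. gauge \<gamma> \<and> (\<forall>D. D tagged_division_of cbox a b \<and> \<gamma> fine D \<longrightarrow>
        norm ((\<Sum>(x, k)\<in>D. measure lborel k *\<^sub>R f x) - I) < e)"
    proof (intro exI[of _ "\<lambda>x. g1 x \<inter> g2 x"] conjI allI impI gauge_Int g1(1) g2(1))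
      fix D assume D: "D tagged_division_of cbox a b \<and> (\<lambda>x. g1 x \<inter> g2 x) fine D"
      then have fine: "g1 fine D" "g2 fine D" by (auto simp: fine_Int)
      have "norm ((\<Sum>(x, k)\<in>D. measure lborel k *\<^sub>R f x) - (\<Sum>(x, k)\<in>D. measure lborel k *\<^sub>R s i x))
          = norm (\<Sum>(x, k)\<in>D. measure lborel k *\<^sub>R (f x - s i x))"
        by (simp add: sum_subtractf[symmetric] case_prod_unfold scaleR_diff_right)
      also have "\<dots> \<le> (\<Sum>(x, k)\<in>D. measure lborel k *\<^sub>R norm (f x - s i x))"
        by (rule order_trans[OF norm_sum]) (auto simp: case_prod_unfold intro!: sum_mono)
      also have "\<dots> < J + e / 4" using abs_ge_self[of "(\<Sum>(x, k)\<in>D. measure lborel k *\<^sub>R norm (f x - s i x)) - J"]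
          g1(2)[OF conjunct1[OF D] fine(1)] unfolding real_norm_def by linarith
      also have "\<dots> < e / 2" using J by simp
      finally have 1: "norm ((\<Sum>(x, k)\<in>D. measure lborel k *\<^sub>R f x) - (\<Sum>(x, k)\<in>D. measure lborel k *\<^sub>R s i x)) < e / 2" .
      have 2: "norm ((\<Sum>(x, k)\<in>D. measure lborel k *\<^sub>R s i x) - ?I) < e / 4" using g2(2)[of D] D fine by simp
      have tri: "norm (F - I) \<le> norm (F - G) + (norm (G - A) + norm (A - I))" for F G A :: 'a
        using norm_triangle_ineq[of "F - G" "G - I"] norm_triangle_ineq[of "G - A" "A - I"] by simp
      have "norm ((\<Sum>(x, k)\<in>D. measure lborel k *\<^sub>R f x) - I) < e / 2 + (e / 4 + e / 4)"
        by (rule le_less_trans[OF tri add_strict_mono[OF 1 add_strict_mono[OF 2 i2]]])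
      then show "norm ((\<Sum>(x, k)\<in>D. measure lborel k *\<^sub>R f x) - I) < e" by simp
    qed
  qed
  then show ?thesis by simp
qed

text \<open>Every strong integral is a Henstock-Kurzweil integral, and the latter is unique, so the
  description defining \<open>strong_integral\<close> is met by exactly one value.\<close>

lemma strong_integral_eq:
  fixes f :: "real \<Rightarrow> 'a::banach"
  assumes "strong_integrable (lebesgue_on {a..b}) f"
  shows "f integrable_on {a..b}" "strong_integral (lebesgue_on {a..b}) f = integral {a..b} f"
proof -
  obtain I where I: "has_strong_integral (lebesgue_on {a..b}) f I" using assms by (auto simp: strong_integrable_def)
  note hI = has_integral_if_has_strong_integral[OF I]
  show "f integrable_on {a..b}" using hI by auto
  have "(THE I. has_strong_integral (lebesgue_on {a..b}) f I) = I"
  proof (rule the_equality)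
    show "J = I" if "has_strong_integral (lebesgue_on {a..b}) f J" for J
      using has_integral_unique[OF has_integral_if_has_strong_integral[OF that] hI] .
  qed (rule I)
  then show "strong_integral (lebesgue_on {a..b}) f = integral {a..b} f"
    using hI by (simp add: strong_integral_def integral_unique)
qed

text \<open>Bochner's criterion. For simple approximations with errors dominated by norm f,
  dominated convergence of the real functions norm (f - s i) gives convergence in L^1. The integrals
  are Cauchy because s i - s j is bounded by the sum of two such errors.\<close>

lemma strong_integrableI:
  fixes f :: "real \<Rightarrow> 'a::banach"
  assumes f: "strongly_measurable (lebesgue_on {a..b}) f"
    and int: "integrable (lebesgue_on {a..b}) (\<lambda>x. norm (f x))"
  shows "strong_integrable (lebesgue_on {a..b}) f"
proof -
  let ?M = "lebesgue_on {a..b}" and ?f = "\<lambda>x. if x \<in> {a..b} then f x else 0"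
  have "strongly_measurable lebesgue ?f" using f by (simp add: strongly_measurable_restrict_iff)
  then obtain s where s: "\<And>i::nat. simple_function lebesgue (s i)" "AE x in lebesgue. (\<lambda>i. s i x) \<longlonglongrightarrow> ?f x"
    "\<And>i x. norm (?f x - s i x) \<le> norm (?f x)" by (rule strongly_measurable_approximation) blast
  have sM: "simple_function ?M (s i)" for i by (rule simple_function_restrict[OF s(1)])
  have sb: "Bochner_Integration.simple_bochner_integrable ?M (s i)" for i
  proof (rule simple_bochner_integrable.intros[OF sM])
    show "emeasure ?M {y \<in> space ?M. s i y \<noteq> 0} \<noteq> \<infinity>"
      using emeasure_lebesgue_on_Icc_finite[of a b "{y \<in> space ?M. s i y \<noteq> 0}"] by simp
  qed
  have lim: "AE x in ?M. (\<lambda>i. s i x) \<longlonglongrightarrow> f x"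
    using s(2) by (subst AE_restrict_space_iff) (auto elim: eventually_mono)
  have m: "(\<lambda>x. norm (f x - s i x)) \<in> borel_measurable ?M" for i
    by (intro strongly_measurable_restrict_norm strongly_measurable_diff f strongly_measurable_simple sM)
  have bd: "AE x in ?M. norm (norm (f x - s i x)) \<le> norm (f x)" for i
    by (rule AE_I2) (use s(3)[of _ i] in \<open>force split: if_splits\<close>)
  have lim0: "AE x in ?M. (\<lambda>i. norm (f x - s i x)) \<longlonglongrightarrow> 0"
    using lim
  proof eventually_elim
    case (elim x)
    have "(\<lambda>i. norm (f x - s i x)) \<longlonglongrightarrow> norm (f x - f x)" by (intro tendsto_intros elim)
    then show ?case by simp
  qed
  have i: "integrable ?M (\<lambda>x. norm (f x - s i x))" for i
    using integrable_dominated_convergence2[OF _ m int lim0 bd] by simp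
  have "(\<lambda>i. integral\<^sup>L ?M (\<lambda>x. norm (f x - s i x))) \<longlonglongrightarrow> integral\<^sup>L ?M (\<lambda>x. 0)"
    by (rule integral_dominated_convergence[OF _ m int lim0 bd]) simp
  then have I0: "(\<lambda>i. integral\<^sup>L ?M (\<lambda>x. norm (f x - s i x))) \<longlonglongrightarrow> 0" by simp
  have nn: "(\<integral>\<^sup>+x. ennreal (norm (f x - s i x)) \<partial>?M) = ennreal (integral\<^sup>L ?M (\<lambda>x. norm (f x - s i x)))" for i
    by (rule nn_integral_eq_integral[OF i]) simp
  have "(\<lambda>i. \<integral>\<^sup>+x. ennreal (norm (f x - s i x)) \<partial>?M) \<longlonglongrightarrow> 0"
    using tendsto_ennrealI[OF I0] by (simp add: nn)
  moreover have "convergent (\<lambda>i. Bochner_Integration.simple_bochner_integral ?M (s i))"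
    unfolding Cauchy_convergent_iff[symmetric]
  proof (rule CauchyI)
    fix e :: real assume "e > 0"
    then obtain N where N: "\<And>i. i \<ge> N \<Longrightarrow> integral\<^sup>L ?M (\<lambda>x. norm (f x - s i x)) < e / 2"
      using order_tendstoD(2)[OF I0, of "e / 2"] by (auto simp: eventually_sequentially)
    have "norm (Bochner_Integration.simple_bochner_integral ?M (s i) - Bochner_Integration.simple_bochner_integral ?M (s j)) < e"
      if "i \<ge> N" "j \<ge> N" for i j
    proof -
      have h: "((\<lambda>x. s i x - s j x) has_integral Bochner_Integration.simple_bochner_integral ?M (s i) - Bochner_Integration.simple_bochner_integral ?M (s j)) {a..b}"
        by (intro has_integral_diff has_integral_simple sb)
      have h': "((\<lambda>x. norm (f x - s i x) + norm (f x - s j x)) has_integral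
          integral\<^sup>L ?M (\<lambda>x. norm (f x - s i x)) + integral\<^sup>L ?M (\<lambda>x. norm (f x - s j x))) {a..b}"
        by (intro has_integral_add has_integral_integral_lebesgue_on i) auto
      have "norm (integral {a..b} (\<lambda>x. s i x - s j x)) \<le> integral {a..b} (\<lambda>x. norm (f x - s i x) + norm (f x - s j x))"
      proof (rule integral_norm_bound_integral)
        show "norm (s i x - s j x) \<le> norm (f x - s i x) + norm (f x - s j x)" for x
          using norm_triangle_ineq4[of "f x - s j x" "f x - s i x"] by simp
      qed (use h h' in auto)
      then show ?thesis using h h' N[OF that(1)] N[OF that(2)] by (simp add: integral_unique)
    qed
    then show "\<exists>M. \<forall>m\<ge>M. \<forall>n\<ge>M. norm (Bochner_Integration.simple_bochner_integral ?M (s m) - Bochner_Integration.simple_bochner_integral ?M (s n)) < e"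
      by blast
  qed
  ultimately show ?thesis
    using f sb unfolding strong_integrable_def has_strong_integral_def convergent_def by blast
qed

lemma strong_integrable_continuous:
  fixes f :: "real \<Rightarrow> 'a::banach"
  assumes f: "continuous_on {a..b} f"
  shows "strong_integrable (lebesgue_on {a..b}) f"
proof (rule strong_integrableI)
  show "strongly_measurable (lebesgue_on {a..b}) f" by (rule strongly_measurable_continuous_on[OF f])
  have "continuous_on {a..b} (\<lambda>x. norm (f x))" by (intro continuous_intros f)
  then show "integrable (lebesgue_on {a..b}) (\<lambda>x. norm (f x))"
    by (metis absolutely_integrable_continuous_real absolutely_integrable_imp_integrable sets_lebesgue_on_refl
        lmeasurable_cbox fmeasurableD box_real(2))
qed

lemma strong_integrable_cong_AE:
  fixes f g :: "real \<Rightarrow> 'a::banach"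
  assumes f: "strong_integrable (lebesgue_on {a..b}) f" and eq: "AE x in lebesgue. x \<in> {a..b} \<longrightarrow> f x = g x"
  shows "strong_integrable (lebesgue_on {a..b}) g"
    and "strong_integral (lebesgue_on {a..b}) g = strong_integral (lebesgue_on {a..b}) f"
proof -
  have eq': "AE x in lebesgue_on {a..b}. f x = g x" using eq by (subst AE_restrict_space_iff) auto
  have "has_strong_integral (lebesgue_on {a..b}) g I" if I: "has_strong_integral (lebesgue_on {a..b}) f I" for I
  proof -
    have "(\<integral>\<^sup>+x. ennreal (norm (g x - s x)) \<partial>lebesgue_on {a..b}) = (\<integral>\<^sup>+x. ennreal (norm (f x - s x)) \<partial>lebesgue_on {a..b})" for s
      by (rule nn_integral_cong_AE) (use eq' in \<open>auto elim: eventually_mono\<close>)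
    then show ?thesis using I strongly_measurable_cong_AE[OF _ eq'] by (simp add: has_strong_integral_def)
  qed
  moreover obtain I where I: "has_strong_integral (lebesgue_on {a..b}) f I" using f by (auto simp: strong_integrable_def)
  ultimately have "has_strong_integral (lebesgue_on {a..b}) g I" by simp
  then show g: "strong_integrable (lebesgue_on {a..b}) g" by (auto simp: strong_integrable_def)
  have "integral {a..b} g = I" "integral {a..b} f = I"
    using \<open>has_strong_integral (lebesgue_on {a..b}) g I\<close> I has_integral_if_has_strong_integral integral_unique by blast+
  then show "strong_integral (lebesgue_on {a..b}) g = strong_integral (lebesgue_on {a..b}) f"
    using strong_integral_eq(2)[OF f] strong_integral_eq(2)[OF g] by simp
qed

section \<open>\<open>p\<close>-integrable functions on the real line\<close>

text \<open>Convexity of t^p at the points a / l and b / m with the weights \<open>l\<close> and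
  \<open>m\<close>. Minkowski's inequality follows with weights proportional to the two
  norms.\<close>

lemma powr_add_le_weighted:
  fixes a b :: real
  assumes p: "1 \<le> p" and a: "0 \<le> a" and b: "0 \<le> b" and l: "0 < l" "0 < m" "l + m = 1"
  shows "(a + b) powr p \<le> l powr (1 - p) * a powr p + m powr (1 - p) * b powr p"
proof -
  have one: "1 \<le> x powr (1 - p)" if "0 < x" "x < 1" for x :: real
    using that p powr_mono'[of "1 - p" 0 x] by simp
  consider "a = 0" | "b = 0" | "a > 0" "b > 0" using a b by fastforce
  then show ?thesis
  proof cases
    case 1
    then show ?thesis using mult_right_mono[OF one[of m], of "b powr p"] l p by simp
  next
    case 2
    then show ?thesis using mult_right_mono[OF one[of l], of "a powr p"] l p by simp
  next
    case 3
    have lm: "1 - m = l" using l by simp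
    have "((1 - m) *\<^sub>R (a / l) + m *\<^sub>R (b / m)) powr p \<le> (1 - m) * (a / l) powr p + m * (b / m) powr p"
      by (rule convex_onD[OF powr_convex[OF p]]) (use l 3 in auto)
    then have "(l *\<^sub>R (a / l) + m *\<^sub>R (b / m)) powr p \<le> l * (a / l) powr p + m * (b / m) powr p"
      by (simp only: lm)
    moreover have "x * (y / x) powr p = x powr (1 - p) * y powr p" if "x > 0" "y > 0" for x y :: real
      using that by (simp add: powr_divide powr_diff)
    ultimately show ?thesis using l 3 by simp
  qed
qed

text \<open>Hoelder's inequality up to the factor 2: integrate g <= l + l^(1 - p) g^p and choose the
  level \<open>l\<close> that makes both terms equal.\<close>

lemma holder_interval:
  fixes g :: "real \<Rightarrow> real"
  assumes p: "1 < p" and ab: "a < b" and nn: "\<And>x. x \<in> {a..b} \<Longrightarrow> 0 \<le> g x"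
    and I: "(g has_integral I) {a..b}" and J: "((\<lambda>x. g x powr p) has_integral J) {a..b}"
    and \<mu>: "J \<le> \<mu> powr p" "0 \<le> \<mu>"
  shows "I \<le> 2 * (b - a) powr (1 - 1 / p) * \<mu>"
\<comment> \<open>The level has to be positive, so \<mu>, which may be 0, is replaced by a larger
  \<nu>.\<close>
proof (rule dense_ge)
  define c where "c = (b - a) powr (1 - 1 / p)"
  have c: "c > 0" using ab by (simp add: c_def)
  fix z assume z: "2 * (b - a) powr (1 - 1 / p) * \<mu> < z"
  define \<nu> where "\<nu> = z / (2 * c)"
  have \<nu>: "\<mu> < \<nu>" using z c by (simp add: \<nu>_def c_def[symmetric] field_simps)
  then have \<nu>0: "\<nu> > 0" using \<mu> by simp
  define l where "l = \<nu> * (b - a) powr (- 1 / p)"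
  have l: "l > 0" using \<nu>0 ab by (simp add: l_def)
  have "I \<le> l * (b - a) + l powr (1 - p) * J"
  proof (rule has_integral_le[OF I])
    show "((\<lambda>x. l + l powr (1 - p) * g x powr p) has_integral l * (b - a) + l powr (1 - p) * J) {a..b}"
      using has_integral_const_real[of l a b] ab by (intro has_integral_add has_integral_mult_right J) (simp add: mult.commute)
    fix x assume x: "x \<in> {a..b}"
    show "g x \<le> l + l powr (1 - p) * g x powr p"
    proof (cases "g x \<le> l")
      case True
      then show ?thesis using l by (simp add: add_increasing2)
    next
      case False
      then have "g x > 0" using l by simp
      have "1 = l powr (1 - p) * l powr (p - 1)" using l by (simp add: powr_add[symmetric])
      also have "\<dots> \<le> l powr (1 - p) * g x powr (p - 1)"
        using False l p by (intro mult_left_mono powr_mono2) auto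
      finally have "g x * 1 \<le> g x * (l powr (1 - p) * g x powr (p - 1))"
        using \<open>g x > 0\<close> by (intro mult_left_mono) auto
      also have "\<dots> = l powr (1 - p) * g x powr p"
        using \<open>g x > 0\<close> powr_add[of "g x" 1 "p - 1"] by simp
      finally show ?thesis using l by simp
    qed
  qed
  also have "\<dots> \<le> l * (b - a) + l powr (1 - p) * \<nu> powr p"
    using \<mu> \<nu> p by (intro add_left_mono mult_left_mono order_trans[OF \<mu>(1)] powr_mono2) auto
  also have "l * (b - a) = c * \<nu>"
    using ab powr_add[of "b - a" "- 1 / p" 1] by (simp add: l_def c_def)
  also have "l powr (1 - p) * \<nu> powr p = c * \<nu>"
  proof -
    have "l powr (1 - p) = \<nu> powr (1 - p) * (b - a) powr (1 - 1 / p)"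
    proof -
      have "- 1 / p * (1 - p) = 1 - 1 / p" using p by (simp add: field_simps)
      then show ?thesis using \<nu>0 ab by (simp add: l_def powr_mult powr_powr)
    qed
    moreover have "\<nu> powr (1 - p) * \<nu> powr p = \<nu>" using \<nu>0 by (simp add: powr_add[symmetric])
    ultimately show ?thesis by (simp add: c_def mult_ac)
  qed
  also have "c * \<nu> + c * \<nu> = z" using c by (simp add: \<nu>_def)
  finally show "I \<le> z" .
qed

text \<open>Always on the whole line: functions on an interval enter through their extension by
  zero, so that translations and completeness are treated once for both intervals.\<close>

definition Lfun :: "real \<Rightarrow> (real \<Rightarrow> 'a::real_normed_vector) \<Rightarrow> bool"
  where "Lfun p f \<longleftrightarrow> strongly_measurable lebesgue f \<and> integrable lebesgue (\<lambda>x. norm (f x) powr p)"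

definition Np :: "real \<Rightarrow> (real \<Rightarrow> 'a::real_normed_vector) \<Rightarrow> real"
  where "Np p f = (\<integral>x. norm (f x) powr p \<partial>lebesgue) powr (1 / p)"

lemma strongly_measurable_norm_powr:
  fixes f :: "real \<Rightarrow> 'a::real_normed_vector"
  shows "strongly_measurable lebesgue f \<Longrightarrow> (\<lambda>x. norm (f x) powr p) \<in> borel_measurable lebesgue"
  by (intro powr_real_measurable strongly_measurable_norm0) auto

lemma Np_cong_AE:
  assumes f: "strongly_measurable lebesgue f" and eq: "AE x in lebesgue. f x = g x"
  shows "Np p f = Np p g"
proof -
  have "integral\<^sup>L lebesgue (\<lambda>x. norm (f x) powr p) = integral\<^sup>L lebesgue (\<lambda>x. norm (g x) powr p)"
    by (rule integral_cong_AE)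
      (use eq strongly_measurable_norm_powr f strongly_measurable_cong_AE[OF f eq] in \<open>auto elim: eventually_mono\<close>)
  then show ?thesis by (simp add: Np_def)
qed

lemma Lfun_cong_AE:
  assumes f: "Lfun p f" and eq: "AE x in lebesgue. f x = g x"
  shows "Lfun p g"
proof -
  have sf: "strongly_measurable lebesgue f" using f by (simp add: Lfun_def)
  have sg: "strongly_measurable lebesgue g" by (rule strongly_measurable_cong_AE[OF sf eq])
  have "integrable lebesgue (\<lambda>x. norm (g x) powr p)"
    by (rule integrable_cong_AE_imp[of _ "\<lambda>x. norm (f x) powr p"])
      (use eq f strongly_measurable_norm_powr sg in \<open>auto simp: Lfun_def elim: eventually_mono\<close>)
  then show ?thesis using sg by (simp add: Lfun_def)
qed

lemma Np_nonneg [simp]: "0 \<le> Np p f"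
  by (simp add: Np_def)

locale exponent =
  fixes p :: real
  assumes p: "1 < p"
begin

lemma Np_powr: "Np p f powr p = (\<integral>x. norm (f x) powr p \<partial>lebesgue)"
  using p by (simp add: Np_def powr_powr)

lemma Np_le_if: "(\<integral>x. norm (f x) powr p \<partial>lebesgue) \<le> C powr p \<Longrightarrow> 0 \<le> C \<Longrightarrow> Np p f \<le> C"
  using p powr_mono2[of "1 / p" "\<integral>x. norm (f x) powr p \<partial>lebesgue" "C powr p"]
  by (simp add: Np_def powr_powr)

lemma Lfun_dominated:
  fixes f :: "real \<Rightarrow> 'a::real_normed_vector" and g :: "real \<Rightarrow> 'b::real_normed_vector"
  assumes f: "strongly_measurable lebesgue f" and g: "Lfun p g"
    and le: "AE x in lebesgue. norm (f x) \<le> norm (g x)"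
  shows "Lfun p f" "Np p f \<le> Np p g"
proof -
  have le': "AE x in lebesgue. norm (f x) powr p \<le> norm (g x) powr p"
    using le p by (auto elim!: eventually_mono intro: powr_mono2)
  have int: "integrable lebesgue (\<lambda>x. norm (f x) powr p)"
    by (rule Bochner_Integration.integrable_bound[where f = "\<lambda>x. norm (g x) powr p"])
      (use g le' strongly_measurable_norm_powr f in \<open>auto simp: Lfun_def\<close>)
  then show "Lfun p f" using f by (simp add: Lfun_def)
  have "(\<integral>x. norm (f x) powr p \<partial>lebesgue) \<le> (\<integral>x. norm (g x) powr p \<partial>lebesgue)"
    by (rule integral_mono_AE[OF int _ le']) (use g in \<open>simp add: Lfun_def\<close>)
  then show "Np p f \<le> Np p g" unfolding Np_def using p by (intro powr_mono2) auto
qed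

lemma Lfun_scaled:
  assumes f: "Lfun p f" and h: "strongly_measurable lebesgue h" and eq: "\<And>x. norm (h x) = c * norm (f x)" and c: "0 \<le> c"
  shows "Lfun p h" "Np p h = c * Np p f"
proof -
  have e: "norm (h x) powr p = c powr p * norm (f x) powr p" for x
    using c by (simp add: eq powr_mult)
  show "Lfun p h" using f h by (simp add: Lfun_def e)
  show "Np p h = c * Np p f"
    using c p by (simp add: Np_def e powr_mult powr_powr)
qed

lemma Lfun_scaleR: "Lfun p f \<Longrightarrow> Lfun p (\<lambda>x. c *\<^sub>R f x)"
  and Np_scaleR: "Lfun p f \<Longrightarrow> Np p (\<lambda>x. c *\<^sub>R f x) = \<bar>c\<bar> * Np p f"
  using Lfun_scaled[of f "\<lambda>x. c *\<^sub>R f x" "\<bar>c\<bar>"] by (auto simp: Lfun_def intro: strongly_measurable_scaleR)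

lemma Lfun_add:
  assumes f: "Lfun p f" and g: "Lfun p g"
  shows "Lfun p (\<lambda>x. f x + g x)" "Np p (\<lambda>x. f x + g x) \<le> Np p f + Np p g"
proof -
  have sm: "strongly_measurable lebesgue (\<lambda>x. f x + g x)"
    using f g by (simp add: Lfun_def strongly_measurable_add)
  have If: "integrable lebesgue (\<lambda>x. norm (f x) powr p)" and Ig: "integrable lebesgue (\<lambda>x. norm (g x) powr p)"
    using f g by (auto simp: Lfun_def)
  have le: "norm (f x + g x) powr p \<le> l powr (1 - p) * norm (f x) powr p + m powr (1 - p) * norm (g x) powr p"
    if "0 < l" "0 < m" "l + m = 1" for l m x
    using powr_mono2[OF _ _ norm_triangle_ineq, of p "f x" "g x"]
      powr_add_le_weighted[of p "norm (f x)" "norm (g x)" l m] p that by simp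
  have int: "integrable lebesgue (\<lambda>x. norm (f x + g x) powr p)"
    by (rule Bochner_Integration.integrable_bound[where f = "\<lambda>x. (1/2) powr (1 - p) * norm (f x) powr p + (1/2) powr (1 - p) * norm (g x) powr p"])
      (use If Ig le[of "1/2" "1/2"] strongly_measurable_norm_powr[OF sm] in auto)
  then show "Lfun p (\<lambda>x. f x + g x)" using sm by (simp add: Lfun_def)
  show "Np p (\<lambda>x. f x + g x) \<le> Np p f + Np p g"
  proof (rule field_le_epsilon)
    fix e :: real assume e: "0 < e"
    \<comment> \<open>The norms are enlarged by e / 2 so that the weights A / (A + B) and B / (A +
      B) are positive even if a norm is 0.\<close>
    define A where "A = Np p f + e / 2"
    define B where "B = Np p g + e / 2"
    have A: "A > 0" and B: "B > 0" using e by (auto simp: A_def B_def intro: add_nonneg_pos)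
    let ?l = "A / (A + B)" and ?m = "B / (A + B)"
    have lm: "0 < ?l" "0 < ?m" "?l + ?m = 1" using A B by (auto simp: add_divide_distrib[symmetric])
    have fA: "(\<integral>x. norm (f x) powr p \<partial>lebesgue) \<le> A powr p"
      unfolding Np_powr[symmetric] using p e by (intro powr_mono2) (auto simp: A_def)
    have gB: "(\<integral>x. norm (g x) powr p \<partial>lebesgue) \<le> B powr p"
      unfolding Np_powr[symmetric] using p e by (intro powr_mono2) (auto simp: B_def)
    have "(\<integral>x. norm (f x + g x) powr p \<partial>lebesgue)
        \<le> (\<integral>x. ?l powr (1 - p) * norm (f x) powr p + ?m powr (1 - p) * norm (g x) powr p \<partial>lebesgue)"
      by (rule integral_mono[OF int]) (use If Ig le[OF lm] in auto)
    also have "\<dots> = ?l powr (1 - p) * (\<integral>x. norm (f x) powr p \<partial>lebesgue) + ?m powr (1 - p) * (\<integral>x. norm (g x) powr p \<partial>lebesgue)"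
      using If Ig by simp
    also have "\<dots> \<le> ?l powr (1 - p) * A powr p + ?m powr (1 - p) * B powr p"
      by (intro add_mono mult_left_mono fA gB) auto
    also have "\<dots> = (A + B) powr (p - 1) * (A powr (1 - p) * A powr p) + (A + B) powr (p - 1) * (B powr (1 - p) * B powr p)"
    proof -
      have "(A + B) powr (p - 1) = 1 / (A + B) powr (1 - p)"
        using powr_minus_divide[of "A + B" "1 - p"] by simp
      then show ?thesis using A B by (simp add: powr_divide)
    qed
    also have "\<dots> = (A + B) powr (p - 1) * (A + B) powr 1"
      using A B by (simp add: powr_add[symmetric] algebra_simps)
    also have "\<dots> = (A + B) powr p" by (simp only: powr_add[symmetric]) simp
    finally have "Np p (\<lambda>x. f x + g x) \<le> A + B" using A B by (intro Np_le_if) auto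
    then show "Np p (\<lambda>x. f x + g x) \<le> Np p f + Np p g + e" by (simp add: A_def B_def)
  qed
qed

lemma Lfun_diff:
  assumes f: "Lfun p f" and g: "Lfun p g"
  shows "Lfun p (\<lambda>x. f x - g x)" "Np p (\<lambda>x. f x - g x) \<le> Np p f + Np p g"
  using Lfun_add[OF f Lfun_scaleR[OF g, of "-1"]] Np_scaleR[OF g, of "-1"] by auto

lemma Np_eq_0_AE:
  assumes f: "Lfun p f" and "Np p f = 0"
  shows "AE x in lebesgue. f x = 0"
proof -
  have "(\<integral>x. norm (f x) powr p \<partial>lebesgue) = 0" using Np_powr[of f] assms p by simp
  then have "AE x in lebesgue. norm (f x) powr p = 0"
    using f by (subst (asm) integral_nonneg_eq_0_iff_AE) (auto simp: Lfun_def)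
  then show ?thesis by eventually_elim simp
qed

lemma Lfun_zero [simp]: "Lfun p (\<lambda>x. 0)" and Np_zero [simp]: "Np p (\<lambda>x. 0) = 0"
  using p by (auto simp: Lfun_def Np_def)

lemma Lfun_affine:
  fixes f :: "real \<Rightarrow> 'a::real_normed_vector"
  assumes "Lfun p f"
  shows "Lfun p (\<lambda>x. f (t + x))" "Np p (\<lambda>x. f (t + x)) = Np p f"
proof -
  have "strongly_measurable lebesgue (\<lambda>x. f (t + 1 * x))"
    using assms by (intro strongly_measurable_affine) (auto simp: Lfun_def)
  moreover have "integrable lebesgue (\<lambda>x. norm (f (t + 1 * x)) powr p)"
    using assms by (intro lebesgue_integrable_real_affine[of "\<lambda>x. norm (f x) powr p"]) (auto simp: Lfun_def)
  ultimately show "Lfun p (\<lambda>x. f (t + x))" by (simp add: Lfun_def)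
  show "Np p (\<lambda>x. f (t + x)) = Np p f"
    using lebesgue_integral_real_affine[of 1 "\<lambda>x. norm (f x) powr p" t] by (simp add: Np_def)
qed

lemma Lfun_restrict:
  fixes f :: "real \<Rightarrow> 'a::real_normed_vector"
  assumes f: "Lfun p f" and S: "S \<in> sets lebesgue"
  shows "Lfun p (\<lambda>x. if x \<in> S then f x else 0)" "Np p (\<lambda>x. if x \<in> S then f x else 0) \<le> Np p f"
proof -
  have "strongly_measurable lebesgue (\<lambda>x. if x \<in> S then f x else 0)"
    using f S by (intro strongly_measurable_If) (auto simp: Lfun_def)
  from Lfun_dominated[OF this f] show "Lfun p (\<lambda>x. if x \<in> S then f x else 0)"
    "Np p (\<lambda>x. if x \<in> S then f x else 0) \<le> Np p f" by auto
qed

text \<open>Fatou's lemma for the real functions norm (g k)^p; the strong measurability of the limit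
  comes from Pettis.\<close>

lemma fatou_Np:
  assumes g: "\<And>k::nat. Lfun p (g k)" and C: "\<And>k. Np p (g k) \<le> C" and lim: "AE x in lebesgue. (\<lambda>k. g k x) \<longlonglongrightarrow> f x"
  shows "Lfun p f" "Np p f \<le> C"
proof -
  have C0: "0 \<le> C" using order_trans[OF Np_nonneg C[of 0]] .
  have sm: "strongly_measurable lebesgue f"
    by (rule strongly_measurable_limit[OF _ lim]) (use g in \<open>simp add: Lfun_def\<close>)
  have i: "(\<integral>\<^sup>+x. ennreal (norm (g k x) powr p) \<partial>lebesgue) \<le> ennreal (C powr p)" for k
  proof -
    have "(\<integral>\<^sup>+x. ennreal (norm (g k x) powr p) \<partial>lebesgue) = ennreal (Np p (g k) powr p)"
      unfolding Np_powr using g[of k] by (intro nn_integral_eq_integral) (auto simp: Lfun_def)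
    also have "\<dots> \<le> ennreal (C powr p)" using p C by (intro ennreal_leI powr_mono2) auto
    finally show ?thesis .
  qed
  have "(\<integral>\<^sup>+x. ennreal (norm (f x) powr p) \<partial>lebesgue) = (\<integral>\<^sup>+x. liminf (\<lambda>k. ennreal (norm (g k x) powr p)) \<partial>lebesgue)"
  proof (rule nn_integral_cong_AE)
    show "AE x in lebesgue. ennreal (norm (f x) powr p) = liminf (\<lambda>k. ennreal (norm (g k x) powr p))"
      using lim
    proof eventually_elim
      case (elim x)
      have "(\<lambda>k. ennreal (norm (g k x) powr p)) \<longlonglongrightarrow> ennreal (norm (f x) powr p)"
        using p by (intro tendsto_ennrealI tendsto_powr' tendsto_norm elim tendsto_const) auto
      from lim_imp_Liminf[OF sequentially_bot this] show ?case by (rule sym)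
    qed
  qed
  also have "\<dots> \<le> liminf (\<lambda>k. \<integral>\<^sup>+x. ennreal (norm (g k x) powr p) \<partial>lebesgue)"
    by (rule nn_integral_liminf) (use strongly_measurable_norm_powr g in \<open>auto simp: Lfun_def\<close>)
  also have "\<dots> \<le> ennreal (C powr p)"
    by (rule Liminf_le) (use i in auto)
  finally have le: "(\<integral>\<^sup>+x. ennreal (norm (f x) powr p) \<partial>lebesgue) \<le> ennreal (C powr p)" .
  have int: "integrable lebesgue (\<lambda>x. norm (f x) powr p)"
    by (rule integrableI_nonneg) (use le strongly_measurable_norm_powr[OF sm] in \<open>auto simp: less_top intro: le_less_trans\<close>)
  then show "Lfun p f" using sm by (simp add: Lfun_def)
  have "ennreal (\<integral>x. norm (f x) powr p \<partial>lebesgue) \<le> ennreal (C powr p)"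
    using le nn_integral_eq_integral[OF int] by simp
  then show "Np p f \<le> C" using C0 by (intro Np_le_if) auto
qed

text \<open>The functions (2^k norm (F (k + 1) - F k))^p have integrals at most 2^(-k). So their sum
  is finite almost everywhere; there the terms are eventually below 1, and the increments are
  bounded by 2^(-k).\<close>

lemma AE_convergent_if_fast:
  fixes F :: "nat \<Rightarrow> real \<Rightarrow> 'a::banach"
  assumes F: "\<And>k. Lfun p (F k)" and fast: "\<And>k. Np p (\<lambda>x. F (Suc k) x - F k x) \<le> (1 / 4) ^ k"
  shows "AE x in lebesgue. convergent (\<lambda>k. F k x)"
proof -
  define h where "h k x = (2 ^ k * norm (F (Suc k) x - F k x)) powr p" for k x
  have L: "Lfun p (\<lambda>x. F (Suc k) x - F k x)" for k by (rule Lfun_diff[OF F F])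
  have hm: "(\<lambda>x. ennreal (h k x)) \<in> borel_measurable lebesgue" for k
    unfolding h_def powr_mult using strongly_measurable_norm_powr[of "\<lambda>x. F (Suc k) x - F k x" p] L[of k]
    by (auto simp: Lfun_def powr_mult)
  have hi: "(\<integral>\<^sup>+x. ennreal (h k x) \<partial>lebesgue) \<le> ennreal ((1 / 2) ^ k)" for k
  proof -
    have "(\<integral>\<^sup>+x. ennreal (h k x) \<partial>lebesgue) = ennreal (\<integral>x. h k x \<partial>lebesgue)"
      by (rule nn_integral_eq_integral) (use L[of k] in \<open>auto simp: h_def powr_mult Lfun_def\<close>)
    also have "(\<integral>x. h k x \<partial>lebesgue) = (2 ^ k) powr p * Np p (\<lambda>x. F (Suc k) x - F k x) powr p"
      by (simp add: h_def powr_mult Np_powr)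
    also have "\<dots> = (2 ^ k * Np p (\<lambda>x. F (Suc k) x - F k x)) powr p" by (simp add: powr_mult)
    also have "\<dots> \<le> ((1 / 2) ^ k) powr p"
    proof (rule powr_mono2)
      have "2 ^ k * Np p (\<lambda>x. F (Suc k) x - F k x) \<le> 2 ^ k * (1 / 4) ^ k" by (intro mult_left_mono fast) auto
      also have "\<dots> = (1 / 2) ^ k" by (simp add: power_mult_distrib[symmetric])
      finally show "2 ^ k * Np p (\<lambda>x. F (Suc k) x - F k x) \<le> (1 / 2) ^ k" .
    qed (use p in auto)
    also have "\<dots> \<le> ((1 / 2) ^ k) powr 1"
      using p by (intro powr_mono') (auto simp: power_le_one)
    finally show ?thesis by (simp add: ennreal_leI)
  qed
  have "(\<integral>\<^sup>+x. (\<Sum>k. ennreal (h k x)) \<partial>lebesgue) = (\<Sum>k. \<integral>\<^sup>+x. ennreal (h k x) \<partial>lebesgue)"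
    by (rule nn_integral_suminf) (rule hm)
  also have "\<dots> \<le> (\<Sum>k. ennreal ((1 / 2) ^ k))" by (intro suminf_le hi) auto
  also have "\<dots> = ennreal (\<Sum>k. (1 / 2) ^ k)" by (rule suminf_ennreal2) (auto intro: summable_geometric)
  also have "\<dots> < \<infinity>" by simp
  finally have "(\<integral>\<^sup>+x. (\<Sum>k. ennreal (h k x)) \<partial>lebesgue) \<noteq> \<infinity>" by simp
  then have "AE x in lebesgue. (\<Sum>k. ennreal (h k x)) \<noteq> \<infinity>"
    by (intro nn_integral_PInf_AE borel_measurable_suminf_order) (rule hm)
  then show ?thesis
  proof eventually_elim
    case (elim x)
    then have "summable (\<lambda>k. h k x)" by (intro summable_suminf_not_top) (auto simp: h_def)
    then have "(\<lambda>k. h k x) \<longlonglongrightarrow> 0" by (rule summable_LIMSEQ_zero)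
    then have "\<forall>\<^sub>F k in sequentially. h k x < 1" by (rule order_tendstoD) simp
    then obtain N where N: "\<And>k. k \<ge> N \<Longrightarrow> h k x < 1" by (auto simp: eventually_sequentially)
    have nb: "norm (F (Suc k) x - F k x) \<le> (1 / 2) ^ k" if "k \<ge> N" for k
    proof (rule ccontr)
      assume "\<not> ?thesis"
      then have "2 ^ k * (1 / 2) ^ k \<le> 2 ^ k * norm (F (Suc k) x - F k x)" by (intro mult_left_mono) auto
      then have "1 \<le> 2 ^ k * norm (F (Suc k) x - F k x)" by (simp add: power_mult_distrib[symmetric])
      then have "1 \<le> h k x" unfolding h_def using p ge_one_powr_ge_zero by simp
      then show False using N[OF that] by simp
    qed
    have "summable (\<lambda>k. (1 / 2 :: real) ^ k)" by (rule summable_geometric) simp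
    from summable_comparison_test'[OF this nb] have "summable (\<lambda>k. F (Suc k) x - F k x)" .
    then have "convergent (\<lambda>n. \<Sum>k<n. F (Suc k) x - F k x)" by (simp add: summable_iff_convergent)
    then have "convergent (\<lambda>n. F n x - F 0 x)" using sum_lessThan_telescope[of "\<lambda>k. F k x"] by simp
    then have "convergent (\<lambda>n. (F n x - F 0 x) + F 0 x)" by (rule convergent_add) (rule convergent_const)
    then show ?case by simp
  qed
qed

text \<open>A fast subsequence converges almost everywhere, and Fatou's lemma turns the Cauchy
  condition into norm convergence to that limit. The subsequence is part of the conclusion because
  the support of the limit is read off from it.\<close>

lemma riesz_fischer:
  fixes F :: "nat \<Rightarrow> real \<Rightarrow> 'a::banach"
  assumes F: "\<And>k. Lfun p (F k)" and C: "\<And>e. e > 0 \<Longrightarrow> \<exists>N. \<forall>i\<ge>N. \<forall>j\<ge>N. Np p (\<lambda>x. F i x - F j x) < e"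
  obtains f r where "Lfun p f" "(\<lambda>n. Np p (\<lambda>x. F n x - f x)) \<longlonglongrightarrow> 0"
    "strict_mono (r :: nat \<Rightarrow> nat)" "AE x in lebesgue. (\<lambda>k. F (r k) x) \<longlonglongrightarrow> f x"
proof -
  have "\<forall>k. \<exists>N. \<forall>i\<ge>N. \<forall>j\<ge>N. Np p (\<lambda>x. F i x - F j x) < (1 / 4) ^ k" by (intro allI C) simp
  then obtain N where N: "\<And>k i j. i \<ge> N k \<Longrightarrow> j \<ge> N k \<Longrightarrow> Np p (\<lambda>x. F i x - F j x) < (1 / 4) ^ k" by metis
  define r where "r = rec_nat (N 0) (\<lambda>k rk. max (Suc rk) (N (Suc k)))"
  have rS: "r (Suc k) = max (Suc (r k)) (N (Suc k))" for k by (simp add: r_def)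
  have rm: "strict_mono r" by (rule strict_monoI_Suc) (simp add: rS less_max_iff_disj)
  have rN: "r k \<ge> N k" for k by (cases k) (auto simp: rS, simp add: r_def)
  have "AE x in lebesgue. convergent (\<lambda>k. F (r k) x)"
  proof (rule AE_convergent_if_fast[OF F])
    fix k
    have "r (Suc k) \<ge> N k" using rN[of k] rS[of k] by simp
    then show "Np p (\<lambda>x. F (r (Suc k)) x - F (r k) x) \<le> (1 / 4) ^ k"
      using N[OF _ rN[of k]] by (intro less_imp_le) auto
  qed
  then have lim: "AE x in lebesgue. (\<lambda>k. F (r k) x) \<longlonglongrightarrow> lim (\<lambda>k. F (r k) x)"
    by eventually_elim (simp add: convergent_LIMSEQ_iff)
  define f where "f x = lim (\<lambda>k. F (r k) x)" for x
  have diff: "Lfun p (\<lambda>x. F n x - f x) \<and> Np p (\<lambda>x. F n x - f x) \<le> (1 / 4) ^ k" if "n \<ge> N k" for n k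
  proof -
    have g: "Lfun p (\<lambda>x. F n x - F (r (j + k)) x)" for j by (rule Lfun_diff[OF F F])
    have b: "Np p (\<lambda>x. F n x - F (r (j + k)) x) \<le> (1 / 4) ^ k" for j
    proof -
      have "r (j + k) \<ge> N k"
        using strict_mono_less_eq[OF rm, of k "j + k"] rN[of k] by simp
      then show ?thesis using N[OF that] by (intro less_imp_le) auto
    qed
    have "AE x in lebesgue. (\<lambda>j. F n x - F (r (j + k)) x) \<longlonglongrightarrow> F n x - f x"
      using lim
    proof eventually_elim
      case (elim x)
      have "(\<lambda>j. F (r (j + k)) x) \<longlonglongrightarrow> f x" unfolding f_def by (rule LIMSEQ_ignore_initial_segment[OF elim])
      then show ?case by (intro tendsto_intros)
    qed
    from fatou_Np[OF g b this] show ?thesis by simp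
  qed
  have "Lfun p (\<lambda>x. F (N 0) x - (F (N 0) x - f x))" by (rule Lfun_diff[OF F]) (use diff in blast)
  then have Lf: "Lfun p f" by simp
  have "(\<lambda>n. Np p (\<lambda>x. F n x - f x)) \<longlonglongrightarrow> 0"
  proof (rule LIMSEQ_I)
    fix e :: real assume "e > 0"
    then obtain k where "(1 / 4) ^ k < e" using real_arch_pow_inv[of e "1 / 4"] by auto
    then show "\<exists>M. \<forall>n\<ge>M. norm (Np p (\<lambda>x. F n x - f x) - 0) < e"
      using diff by (intro exI[of _ "N k"]) (auto intro: le_less_trans)
  qed
  then show thesis using that Lf rm lim unfolding f_def by blast
qed

text \<open>Local integrability comes from t <= 1 + t^p, the quantitative bound from Hoelder's
  inequality.\<close>

lemma Lfun_interval:
  fixes f :: "real \<Rightarrow> 'a::banach"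
  assumes f: "Lfun p f"
  shows "strong_integrable (lebesgue_on {a..b}) f" "f integrable_on {a..b}"
    "(\<lambda>x. norm (f x)) integrable_on {a..b}"
    "a < b \<Longrightarrow> integral {a..b} (\<lambda>x. norm (f x)) \<le> 2 * (b - a) powr (1 - 1 / p) * Np p f"
proof -
  have sm: "strongly_measurable lebesgue f" using f by (simp add: Lfun_def)
  have "strongly_measurable lebesgue (\<lambda>x. if x \<in> {a..b} then f x else 0)"
    using Lfun_restrict(1)[OF f, of "{a..b}"] by (simp add: Lfun_def)
  then have sm': "strongly_measurable (lebesgue_on {a..b}) f" by (simp add: strongly_measurable_restrict_iff)
  have ip: "integrable (lebesgue_on {a..b}) (\<lambda>x. norm (f x) powr p)"
  proof -
    have "integrable lebesgue (\<lambda>x. indicator {a..b} x *\<^sub>R (norm (f x) powr p))"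
      by (rule integrable_mult_indicator) (use f in \<open>auto simp: Lfun_def\<close>)
    then show ?thesis by (subst integrable_restrict_space) auto
  qed
  have i1: "integrable (lebesgue_on {a..b}) (\<lambda>x. norm (f x))"
  proof (rule Bochner_Integration.integrable_bound)
    show "integrable (lebesgue_on {a..b}) (\<lambda>x. 1 + norm (f x) powr p)"
      by (intro Bochner_Integration.integrable_add ip)
        (simp add: finite_measure.integrable_const finite_measure_lebesgue_on)
    show "(\<lambda>x. norm (f x)) \<in> borel_measurable (lebesgue_on {a..b})" by (rule strongly_measurable_restrict_norm[OF sm'])
    show "AE x in lebesgue_on {a..b}. norm (norm (f x)) \<le> norm (1 + norm (f x) powr p)"
    proof (rule AE_I2)
      fix x
      show "norm (norm (f x)) \<le> norm (1 + norm (f x) powr p)"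
      proof (cases "norm (f x) \<le> 1")
        case False
        then have "norm (f x) powr 1 \<le> norm (f x) powr p" using p by (intro powr_mono) auto
        then show ?thesis by simp
      qed (simp add: add_increasing2)
    qed
  qed
  show si: "strong_integrable (lebesgue_on {a..b}) f" by (rule strong_integrableI[OF sm' i1])
  show "f integrable_on {a..b}" by (rule strong_integral_eq(1)[OF si])
  have h1: "((\<lambda>x. norm (f x)) has_integral integral\<^sup>L (lebesgue_on {a..b}) (\<lambda>x. norm (f x))) {a..b}"
    by (rule has_integral_integral_lebesgue_on[OF i1]) simp
  then show "(\<lambda>x. norm (f x)) integrable_on {a..b}" by auto
  have h2: "((\<lambda>x. norm (f x) powr p) has_integral integral\<^sup>L (lebesgue_on {a..b}) (\<lambda>x. norm (f x) powr p)) {a..b}"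
    by (rule has_integral_integral_lebesgue_on[OF ip]) simp
  have "integral\<^sup>L (lebesgue_on {a..b}) (\<lambda>x. norm (f x) powr p) \<le> Np p f powr p"
  proof -
    have "integral\<^sup>L (lebesgue_on {a..b}) (\<lambda>x. norm (f x) powr p) = (\<integral>x. indicator {a..b} x *\<^sub>R (norm (f x) powr p) \<partial>lebesgue)"
      by (rule integral_restrict_space) simp
    also have "\<dots> \<le> (\<integral>x. norm (f x) powr p \<partial>lebesgue)"
    proof (rule integral_mono)
      show "integrable lebesgue (\<lambda>x. indicator {a..b} x *\<^sub>R (norm (f x) powr p))"
        by (rule integrable_mult_indicator) (use f in \<open>auto simp: Lfun_def\<close>)
    qed (use f in \<open>auto simp: Lfun_def indicator_def\<close>)
    finally show ?thesis by (simp add: Np_powr)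
  qed
  then show "integral {a..b} (\<lambda>x. norm (f x)) \<le> 2 * (b - a) powr (1 - 1 / p) * Np p f" if "a < b"
    using holder_interval[OF p that _ h1 h2] h1 by (simp add: integral_unique)
qed

end

section \<open>Density of continuous functions\<close>

definition compactly_supported :: "(real \<Rightarrow> 'a::real_normed_vector) \<Rightarrow> bool"
  where "compactly_supported g \<longleftrightarrow> continuous_on UNIV g \<and> (\<exists>n::nat. \<forall>x. x \<notin> {- real n..real n} \<longrightarrow> g x = 0)"

context exponent
begin

lemma Lfun_indicator:
  fixes c :: "'a::real_normed_vector"
  assumes A: "A \<in> lmeasurable"
  shows "Lfun p (\<lambda>x::real. indicator A x *\<^sub>R c)" "Np p (\<lambda>x. indicator A x *\<^sub>R c) = measure lebesgue A powr (1 / p) * norm c"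
proof -
  have AS: "A \<in> sets lebesgue" using A by blast
  have e: "norm (indicator A x *\<^sub>R c) powr p = indicator A x * norm c powr p" for x
    using p by (auto simp: indicator_def)
  have "strongly_measurable lebesgue (\<lambda>x. if x \<in> A then c else 0)"
    by (rule strongly_measurable_If) (use AS in auto)
  moreover have "(\<lambda>x. if x \<in> A then c else 0) = (\<lambda>x. indicator A x *\<^sub>R c)" by (auto simp: indicator_def)
  ultimately show "Lfun p (\<lambda>x::real. indicator A x *\<^sub>R c)"
    unfolding Lfun_def e using A by (auto intro!: integrable_mult_left integrable_real_indicator simp: fmeasurable_def)
  have "(\<integral>x. indicator A x * norm c powr p \<partial>lebesgue) = measure lebesgue A * norm c powr p"
    using A by simp
  then show "Np p (\<lambda>x. indicator A x *\<^sub>R c) = measure lebesgue A powr (1 / p) * norm c"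
    unfolding Np_def e using p by (simp add: powr_mult powr_powr)
qed

lemma Lfun_bounded_support:
  fixes g :: "real \<Rightarrow> 'a::real_normed_vector"
  assumes g: "strongly_measurable lebesgue g" and b: "\<And>x. norm (g x) \<le> C" and z: "\<And>x. x \<notin> {a..b} \<Longrightarrow> g x = 0" and ab: "a \<le> b"
  shows "Lfun p g" "Np p g \<le> (b - a) powr (1 / p) * C"
proof -
  have C: "0 \<le> C" using order_trans[OF norm_ge_zero b] .
  have le: "AE x in lebesgue. norm (g x) \<le> norm (indicator {a..b} x *\<^sub>R C)"
    using b z C by (intro AE_I2) (auto simp: indicator_def)
  note L = Lfun_indicator[of "{a..b}" C]
  show "Lfun p g" by (rule Lfun_dominated[OF g L(1) le]) simp
  have "Np p g \<le> Np p (\<lambda>x. indicator {a..b} x *\<^sub>R C)" by (rule Lfun_dominated[OF g L(1) le]) simp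
  also have "\<dots> = (b - a) powr (1 / p) * C" using L(2) C ab by simp
  finally show "Np p g \<le> (b - a) powr (1 / p) * C" .
qed

lemma Lfun_compactly_supported:
  assumes "compactly_supported g" shows "Lfun p g"
proof -
  obtain n :: nat where g: "continuous_on UNIV g" "\<And>x. x \<notin> {- real n..real n} \<Longrightarrow> g x = 0"
    using assms by (auto simp: compactly_supported_def)
  have "compact (g ` {- real n..real n})"
    by (intro compact_continuous_image continuous_on_subset[OF g(1)]) auto
  then obtain C where C: "\<And>x. x \<in> {- real n..real n} \<Longrightarrow> norm (g x) \<le> C"
    by (meson bounded_iff compact_imp_bounded imageI)
  have "norm (g x) \<le> max C 0" for x using C[of x] g(2)[of x] by (cases "x \<in> {- real n..real n}") auto
  then show ?thesis by (rule Lfun_bounded_support(1)[OF strongly_measurable_continuous[OF g(1)] _ g(2)]) auto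
qed

definition approximable :: "(real \<Rightarrow> 'a::real_normed_vector) \<Rightarrow> bool"
  where "approximable f \<longleftrightarrow> Lfun p f \<and> (\<forall>e>0. \<exists>g. compactly_supported g \<and> Np p (\<lambda>x. f x - g x) < e)"

lemma approximable_limit:
  assumes f: "Lfun p f" and h: "\<And>e. e > 0 \<Longrightarrow> \<exists>h. approximable h \<and> Np p (\<lambda>x. f x - h x) < e"
  shows "approximable f"
  unfolding approximable_def
proof (intro conjI f allI impI)
  fix e :: real assume e: "e > 0"
  obtain h where h1: "approximable h" "Np p (\<lambda>x. f x - h x) < e / 2" using h[of "e / 2"] e by auto
  obtain g where g: "compactly_supported g" "Np p (\<lambda>x. h x - g x) < e / 2"
    using h1(1) e unfolding approximable_def by (metis half_gt_zero)
  have "Np p (\<lambda>x. (f x - h x) + (h x - g x)) \<le> Np p (\<lambda>x. f x - h x) + Np p (\<lambda>x. h x - g x)"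
  proof -
    have Lh: "Lfun p h" using h1(1) by (simp add: approximable_def)
    show ?thesis
      by (rule Lfun_add(2)[OF Lfun_diff(1)[OF f Lh] Lfun_diff(1)[OF Lh Lfun_compactly_supported[OF g(1)]]])
  qed
  then have "Np p (\<lambda>x. f x - g x) < e" using h1(2) g(2) by simp
  then show "\<exists>g. compactly_supported g \<and> Np p (\<lambda>x. f x - g x) < e" using g by blast
qed

lemma compactly_supported_add:
  assumes "compactly_supported f" "compactly_supported g"
  shows "compactly_supported (\<lambda>x. f x + g x)"
proof -
  obtain m n where f: "continuous_on UNIV f" "\<And>x. x \<notin> {- real m..real m} \<Longrightarrow> f x = 0"
    and g: "continuous_on UNIV g" "\<And>x. x \<notin> {- real n..real n} \<Longrightarrow> g x = 0"
    using assms unfolding compactly_supported_def by blast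
  have "f x + g x = 0" if "x \<notin> {- real (max m n)..real (max m n)}" for x
  proof -
    have "real m \<le> real (max m n)" "real n \<le> real (max m n)" by simp_all
    then have "x \<notin> {- real m..real m}" "x \<notin> {- real n..real n}" using that by fastforce+
    then show ?thesis using f(2) g(2) by simp
  qed
  then show ?thesis using f g unfolding compactly_supported_def by (blast intro: continuous_intros)
qed

lemma approximable_add:
  assumes f: "approximable f" and g: "approximable g"
  shows "approximable (\<lambda>x. f x + g x)"
  unfolding approximable_def
proof (intro conjI allI impI)
  have L: "Lfun p f" "Lfun p g" using f g by (auto simp: approximable_def)
  show "Lfun p (\<lambda>x. f x + g x)" by (rule Lfun_add[OF L])
  fix e :: real assume e: "e > 0"
  obtain f' where f': "compactly_supported f'" "Np p (\<lambda>x. f x - f' x) < e / 2"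
    using f e unfolding approximable_def by (metis half_gt_zero)
  obtain g' where g': "compactly_supported g'" "Np p (\<lambda>x. g x - g' x) < e / 2"
    using g e unfolding approximable_def by (metis half_gt_zero)
  have "Np p (\<lambda>x. (f x - f' x) + (g x - g' x)) \<le> Np p (\<lambda>x. f x - f' x) + Np p (\<lambda>x. g x - g' x)"
    by (intro Lfun_add Lfun_diff L Lfun_compactly_supported f' g')
  moreover have "(\<lambda>x. (f x - f' x) + (g x - g' x)) = (\<lambda>x. f x + g x - (f' x + g' x))" by auto
  ultimately have "Np p (\<lambda>x. f x + g x - (f' x + g' x)) < e" using f'(2) g'(2) by simp
  then show "\<exists>h. compactly_supported h \<and> Np p (\<lambda>x. f x + g x - h x) < e"
    using compactly_supported_add[OF f'(1) g'(1)] by blast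
qed

lemma approximable_zero: "approximable (\<lambda>x. 0 :: 'a::real_normed_vector)"
  unfolding approximable_def
proof (intro conjI allI impI)
  show "\<exists>g. compactly_supported g \<and> Np p (\<lambda>x. (0::'a) - g x) < e" if "e > 0" for e
    by (rule exI[of _ "\<lambda>_. 0"]) (use that in \<open>auto simp: compactly_supported_def\<close>)
qed simp

lemma approximable_sum:
  "finite I \<Longrightarrow> (\<And>i. i \<in> I \<Longrightarrow> approximable (f i)) \<Longrightarrow> approximable (\<lambda>x. \<Sum>i\<in>I. f i x)"
  by (induction I rule: finite_induct) (auto simp: approximable_zero approximable_add)

lemma approximable_indicator:
  fixes c :: "'a::real_normed_vector"
  assumes A: "A \<in> sets lebesgue" "A \<subseteq> {- real n..real n}"
  shows "approximable (\<lambda>x. indicator A x *\<^sub>R c)"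
proof -
  have Al: "A \<in> lmeasurable"
    by (rule fmeasurableI2[of "{- real n..real n}"]) (use A in auto)
  have "\<exists>g. compactly_supported g \<and> Np p (\<lambda>x. indicator A x *\<^sub>R c - g x) < e" if e: "e > 0" for e
  proof -
    \<comment> \<open>Chosen with (2 d)^(1/p) = e / (norm c + 1): the continuous approximation
      deviates from the indicator only on \<open>D\<close>, whose measure is below 2 d.\<close>
    define d where "d = (e / (norm c + 1)) powr p / 2"
    have c1: "norm c + 1 > 0" by (simp add: add_nonneg_pos)
    have d: "d > 0" using e c1 by (simp add: d_def)
    obtain U where U: "open U" "A \<subseteq> U" "U - A \<in> lmeasurable" "emeasure lebesgue (U - A) < ennreal d"
      using sets_lebesgue_outer_open[OF A(1) d] by blast
    obtain K where K: "closed K" "K \<subseteq> A" "A - K \<in> lmeasurable" "emeasure lebesgue (A - K) < ennreal d"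
      using sets_lebesgue_inner_closed[OF A(1) d] by blast
    \<comment> \<open>The bounded neighbourhood gives the Urysohn function compact support.\<close>
    define W where "W = U \<inter> {- real n - 1<..<real n + 1}"
    have W: "open W" "A \<subseteq> W" using U A by (auto simp: W_def)
    define D where "D = (U - A) \<union> (A - K)"
    have D: "D \<in> lmeasurable" unfolding D_def using U K by (intro fmeasurable.Un) auto
    have "emeasure lebesgue D \<le> emeasure lebesgue (U - A) + emeasure lebesgue (A - K)"
      unfolding D_def using U K by (intro emeasure_subadditive) auto
    also have "\<dots> < ennreal d + ennreal d" using U(4) K(4) by (rule add_strict_mono)
    also have "\<dots> = ennreal (2 * d)" using d by (simp add: ennreal_plus[symmetric] del: ennreal_plus)
    finally have "ennreal (measure lebesgue D) < ennreal (2 * d)" using D by (simp add: emeasure_eq_measure2)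
    then have mD: "measure lebesgue D < 2 * d" by (simp add: ennreal_less_iff)
    obtain \<phi> :: "real \<Rightarrow> real" where \<phi>: "continuous_on UNIV \<phi>" "\<And>x. \<phi> x \<in> closed_segment 1 0"
      "\<And>x. x \<in> K \<Longrightarrow> \<phi> x = 1" "\<And>x. x \<in> - W \<Longrightarrow> \<phi> x = 0"
    proof (rule Urysohn[of K "- W" "1::real" "0::real"])
      show "closed (- W)" using W(1) by (simp add: closed_Compl)
      show "K \<inter> - W = {}" using K(2) W(2) by auto
    qed (use K(1) that in auto)
    have \<phi>01: "0 \<le> \<phi> x" "\<phi> x \<le> 1" for x using \<phi>(2)[of x] by (auto simp: closed_segment_eq_real_ivl)
    have g: "compactly_supported (\<lambda>x. \<phi> x *\<^sub>R c)"
      unfolding compactly_supported_def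
      using \<phi>(1,4) by (intro conjI exI[of _ "Suc n"]) (auto intro!: continuous_intros simp: W_def)
    have le: "norm (indicator A x *\<^sub>R c - \<phi> x *\<^sub>R c) \<le> norm (indicator D x *\<^sub>R c)" for x
    proof -
      have "\<bar>indicator A x - \<phi> x\<bar> \<le> indicator D x"
        using \<phi>01[of x] \<phi>(3,4)[of x] K(2) W(2) by (auto simp: indicator_def D_def W_def)
      then have "norm ((indicator A x - \<phi> x) *\<^sub>R c) \<le> norm ((indicator D x :: real) *\<^sub>R c)"
        using mult_right_mono[OF _ norm_ge_zero[of c], of "\<bar>indicator A x - \<phi> x\<bar>" "indicator D x"] by simp
      then show ?thesis by (simp only: scaleR_diff_left)
    qed
    have "Np p (\<lambda>x. indicator A x *\<^sub>R c - \<phi> x *\<^sub>R c) \<le> Np p (\<lambda>x. indicator D x *\<^sub>R c)"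
      using Lfun_diff(1)[OF Lfun_indicator(1)[OF Al, of c] Lfun_compactly_supported[OF g]] le
      by (intro Lfun_dominated(2) Lfun_indicator D) (auto simp: Lfun_def)
    also have "\<dots> = measure lebesgue D powr (1 / p) * norm c" by (rule Lfun_indicator(2)[OF D])
    also have "\<dots> \<le> (2 * d) powr (1 / p) * norm c"
      using mD p by (intro mult_right_mono powr_mono2) auto
    also have "\<dots> = e / (norm c + 1) * norm c"
      using p e c1 by (simp add: d_def powr_powr)
    also have "\<dots> < e"
    proof -
      have "e * norm c < e * (norm c + 1)" using e by simp
      then show ?thesis using c1 by (simp add: divide_less_eq)
    qed
    finally show ?thesis using g by blast
  qed
  then show ?thesis using Lfun_indicator(1)[OF Al] by (auto simp: approximable_def)
qed

lemma approximable_simple: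
  fixes s :: "real \<Rightarrow> 'a::real_normed_vector"
  assumes s: "simple_function lebesgue s"
  shows "approximable (\<lambda>x. if x \<in> {- real n..real n} then s x else 0)"
proof -
  have fin: "finite (range s)" using simple_functionD(1)[OF s] by simp
  have "approximable (\<lambda>x. \<Sum>y\<in>range s. indicator (s -` {y} \<inter> {- real n..real n}) x *\<^sub>R y)"
  proof (rule approximable_sum[OF fin], rule approximable_indicator)
    fix y
    show "s -` {y} \<inter> {- real n..real n} \<in> sets lebesgue"
      using simple_functionD(2)[OF s, of "{y}"] by (intro sets.Int) auto
  qed auto
  moreover have "(\<Sum>y\<in>range s. indicator (s -` {y} \<inter> {- real n..real n}) x *\<^sub>R y) = (if x \<in> {- real n..real n} then s x else 0)" for x
  proof -
    have "(\<Sum>y\<in>range s. indicator (s -` {y} \<inter> {- real n..real n}) x *\<^sub>R y)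
        = (\<Sum>y\<in>range s. if y = s x then (if x \<in> {- real n..real n} then s x else 0) else 0)"
      by (rule sum.cong) (auto simp: indicator_def)
    then show ?thesis using fin by simp
  qed
  ultimately show ?thesis by simp
qed

text \<open>Simple approximations cut off to [-i, i] converge almost everywhere with an error of at
  most norm f, so dominated convergence gives convergence in the p-norm.\<close>

lemma approximable_Lfun:
  fixes f :: "real \<Rightarrow> 'a::real_normed_vector"
  assumes f: "Lfun p f"
  shows "approximable f"
proof (rule approximable_limit[OF f])
  fix e :: real assume e: "e > 0"
  have smf: "strongly_measurable lebesgue f" using f by (simp add: Lfun_def)
  obtain s where s: "\<And>i::nat. simple_function lebesgue (s i)" "AE x in lebesgue. (\<lambda>i. s i x) \<longlonglongrightarrow> f x"
    "\<And>i x. norm (f x - s i x) \<le> norm (f x)" using strongly_measurable_approximation[OF smf] by blast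
  define g where "g i x = (if x \<in> {- real i..real i} then s i x else 0)" for i x
  have sm: "strongly_measurable lebesgue (\<lambda>x. f x - g i x)" for i
    unfolding g_def by (intro strongly_measurable_diff smf strongly_measurable_If strongly_measurable_simple s) auto
  have "(\<lambda>i. \<integral>x. norm (f x - g i x) powr p \<partial>lebesgue) \<longlonglongrightarrow> (\<integral>x. 0 \<partial>(lebesgue :: real measure))"
  proof (rule integral_dominated_convergence[where w = "\<lambda>x. norm (f x) powr p"])
    show "(\<lambda>x. norm (f x - g i x) powr p) \<in> borel_measurable lebesgue" for i
      by (rule strongly_measurable_norm_powr[OF sm])
    show "integrable lebesgue (\<lambda>x. norm (f x) powr p)" using f by (simp add: Lfun_def)
    show "AE x in lebesgue. (\<lambda>i. norm (f x - g i x) powr p) \<longlonglongrightarrow> 0"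
      using s(2)
    proof eventually_elim
      case (elim x)
      obtain N :: nat where N: "\<bar>x\<bar> \<le> real N" using real_arch_simple by blast
      have "\<forall>\<^sub>F i in sequentially. s i x = g i x"
        using eventually_ge_at_top[of N] by eventually_elim (use N in \<open>auto simp: g_def abs_le_iff\<close>)
      then have "(\<lambda>i. g i x) \<longlonglongrightarrow> f x" using elim by (rule Lim_transform_eventually[rotated])
      then have "(\<lambda>i. norm (f x - g i x) powr p) \<longlonglongrightarrow> norm (f x - f x) powr p"
        using p by (intro tendsto_powr' tendsto_norm tendsto_diff tendsto_const) auto
      then show ?case using p by simp
    qed
    show "AE x in lebesgue. norm (norm (f x - g i x) powr p) \<le> norm (f x) powr p" for i
      using s(3) p by (intro AE_I2) (auto simp: g_def intro!: powr_mono2)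
  qed auto
  then have "(\<lambda>i. \<integral>x. norm (f x - g i x) powr p \<partial>lebesgue) \<longlonglongrightarrow> 0" by simp
  moreover have "e powr p > 0" using e by simp
  ultimately have "\<forall>\<^sub>F i in sequentially. (\<integral>x. norm (f x - g i x) powr p \<partial>lebesgue) < (e / 2) powr p"
    using e by (intro order_tendstoD) auto
  then obtain i where "(\<integral>x. norm (f x - g i x) powr p \<partial>lebesgue) < (e / 2) powr p"
    using eventually_happens'[OF sequentially_bot] by blast
  then have "Np p (\<lambda>x. f x - g i x) \<le> e / 2" using e by (intro Np_le_if) auto
  then have "Np p (\<lambda>x. f x - g i x) < e" using e by simp
  moreover have "approximable (g i)" unfolding g_def using approximable_simple[OF s(1)] by simp
  ultimately show "\<exists>h. approximable h \<and> Np p (\<lambda>x. f x - h x) < e" by blast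
qed

text \<open>For compactly supported \<open>g\<close> this is uniform continuity. In general
  \<open>f\<close> and its translate are replaced by \<open>g\<close> and its translate at the same
  cost, because translations preserve the norm.\<close>

lemma translation_continuous:
  fixes f :: "real \<Rightarrow> 'a::real_normed_vector"
  assumes f: "Lfun p f" and e: "e > 0"
  shows "\<exists>d>0. \<forall>t. \<bar>t\<bar> < d \<longrightarrow> Np p (\<lambda>x. f (t + x) - f x) < e"
proof -
  obtain g where g: "compactly_supported g" "Np p (\<lambda>x. f x - g x) < e / 4"
    using approximable_Lfun[OF f] e unfolding approximable_def by (metis zero_less_divide_iff zero_less_numeral)
  obtain n :: nat where gc: "continuous_on UNIV g" and gz: "\<And>x. x \<notin> {- real n..real n} \<Longrightarrow> g x = 0"
    using g by (auto simp: compactly_supported_def)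
  \<comment> \<open>For |t| < 1 the difference of \<open>g\<close> and its translate lives on an
    interval of length 2 (n + 2), so the pointwise bound \<open>c\<close> gives e / 4 in
    norm.\<close>
  define c where "c = e / (4 * (2 * (real n + 2)) powr (1 / p))"
  have c: "c > 0" using e by (simp add: c_def)
  have "uniformly_continuous_on {- real n - 2..real n + 2} g"
    by (intro compact_uniformly_continuous continuous_on_subset[OF gc]) auto
  then obtain d where d: "d > 0" "\<And>x y. x \<in> {- real n - 2..real n + 2} \<Longrightarrow> y \<in> {- real n - 2..real n + 2} \<Longrightarrow> dist y x < d \<Longrightarrow> dist (g y) (g x) < c"
    using c unfolding uniformly_continuous_on_def by metis
  have Lg: "Lfun p g" by (rule Lfun_compactly_supported[OF g(1)])
  have "Np p (\<lambda>x. f (t + x) - f x) < e" if t: "\<bar>t\<bar> < min d 1" for t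
  proof -
    have Ld: "Lfun p (\<lambda>x. g (t + x) - g x)" by (intro Lfun_diff Lfun_affine Lg)
    have "Np p (\<lambda>x. g (t + x) - g x) \<le> ((real n + 2) - (- real n - 2)) powr (1 / p) * c"
    proof (rule Lfun_bounded_support(2))
      show "strongly_measurable lebesgue (\<lambda>x. g (t + x) - g x)" using Ld by (simp add: Lfun_def)
      show "norm (g (t + x) - g x) \<le> c" for x
      proof (cases "x \<in> {- real n - 1..real n + 1}")
        case True
        then have "dist (g (t + x)) (g x) < c" using t by (intro d(2)) (auto simp: dist_real_def abs_less_iff)
        then show ?thesis by (simp add: dist_norm)
      next
        case False
        then have "g (t + x) = 0" "g x = 0" using t by (auto intro!: gz simp: abs_less_iff)
        then show ?thesis using c by simp
      qed
      show "g (t + x) - g x = 0" if "x \<notin> {- real n - 2..real n + 2}" for x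
      proof -
        have "g (t + x) = 0" "g x = 0" using t that by (auto intro!: gz simp: abs_less_iff)
        then show ?thesis by simp
      qed
    qed auto
    also have "((real n + 2) - (- real n - 2)) powr (1 / p) * c = e / 4"
      by (simp add: c_def algebra_simps)
    finally have 1: "Np p (\<lambda>x. g (t + x) - g x) \<le> e / 4" .
    have 2: "Np p (\<lambda>x. f (t + x) - g (t + x)) < e / 4"
      using Lfun_affine(2)[OF Lfun_diff(1)[OF f Lg], of t] g(2) by simp
    have "Np p (\<lambda>x. (f (t + x) - g (t + x)) + ((g (t + x) - g x) - (f x - g x)))
        \<le> Np p (\<lambda>x. f (t + x) - g (t + x)) + Np p (\<lambda>x. (g (t + x) - g x) - (f x - g x))"
      by (intro Lfun_add(2) Lfun_diff Lfun_affine f Lg)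
    also have "Np p (\<lambda>x. (g (t + x) - g x) - (f x - g x)) \<le> Np p (\<lambda>x. g (t + x) - g x) + Np p (\<lambda>x. f x - g x)"
      by (intro Lfun_diff(2) Lfun_diff(1) Lfun_affine f Lg)
    finally have "Np p (\<lambda>x. (f (t + x) - g (t + x)) + ((g (t + x) - g x) - (f x - g x))) < e"
      using 1 2 g(2) e by simp
    then show ?thesis by (simp add: algebra_simps)
  qed
  then show ?thesis using d(1) by (intro exI[of _ "min d 1"]) auto
qed

text \<open>Let \<open>g\<close> be continuous and close to \<open>H\<close>. On a short interval
  \<open>g\<close> is nearly constant, so the integral of norm g is close to the norm of the
  integral of \<open>g\<close>, which equals that of g - H. Gluing short intervals bounds the
  integral of norm g by that of norm (H - g) plus e / 2; hence norm H has integral at most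
  e.\<close>

lemma AE_zero_if_integrals_zero:
  fixes H :: "real \<Rightarrow> 'a::banach"
  assumes H: "Lfun p H" and z: "\<And>a b. s \<le> a \<Longrightarrow> a \<le> b \<Longrightarrow> b \<le> t \<Longrightarrow> integral {a..b} H = 0" and st: "s < t"
  shows "AE x in lebesgue. x \<in> {s..t} \<longrightarrow> H x = 0"
proof -
  have "integral {s..t} (\<lambda>x. norm (H x)) \<le> 0"
  proof (rule field_le_epsilon)
    fix e :: real assume e: "e > 0"
    define K where "K = 2 * (t - s) powr (1 - 1 / p)"
    have K: "K > 0" using st by (simp add: K_def)
    define d where "d = e / (4 * (t - s))"
    have d: "d > 0" using e st by (simp add: d_def)
    obtain g where g: "compactly_supported g" "Np p (\<lambda>x. H x - g x) < e / (4 * K)"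
      using approximable_Lfun[OF H] e K unfolding approximable_def by (metis divide_pos_pos mult_pos_pos zero_less_numeral)
    have gc: "continuous_on UNIV g" using g by (simp add: compactly_supported_def)
    have Lg: "Lfun p g" by (rule Lfun_compactly_supported[OF g(1)])
    have Ld: "Lfun p (\<lambda>x. H x - g x)" by (rule Lfun_diff[OF H Lg])
    note iH = Lfun_interval(2)[OF H] and ig = Lfun_interval(2)[OF Lg] and iN = Lfun_interval(3)[OF Ld]
      and ing = Lfun_interval(3)[OF Lg] and inH = Lfun_interval(3)[OF H]
    \<comment> \<open>The error is proportional to the length of the interval, so the estimate adds
      up over adjacent intervals, as the gluing principle \<open>Bolzano\<close> requires.\<close>
    define P where "P a b \<longleftrightarrow> (s \<le> a \<and> a \<le> b \<and> b \<le> t \<longrightarrow>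
      integral {a..b} (\<lambda>x. norm (g x)) \<le> integral {a..b} (\<lambda>x. norm (H x - g x)) + 2 * d * (b - a))" for a b
    have "P s t"
      using less_imp_le[OF st]
    proof (induction rule: Bolzano)
      case (trans a b c)
      show ?case
        unfolding P_def
      proof
        assume ac: "s \<le> a \<and> a \<le> c \<and> c \<le> t"
        have e1: "integral {a..c} (\<lambda>x. norm (g x)) = integral {a..b} (\<lambda>x. norm (g x)) + integral {b..c} (\<lambda>x. norm (g x))"
          using trans by (intro Henstock_Kurzweil_Integration.integral_combine[symmetric] ing)
        have e2: "integral {a..c} (\<lambda>x. norm (H x - g x)) = integral {a..b} (\<lambda>x. norm (H x - g x)) + integral {b..c} (\<lambda>x. norm (H x - g x))"
          using trans by (intro Henstock_Kurzweil_Integration.integral_combine[symmetric] iN)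
        have "P a b" "P b c" using trans by auto
        then show "integral {a..c} (\<lambda>x. norm (g x)) \<le> integral {a..c} (\<lambda>x. norm (H x - g x)) + 2 * d * (c - a)"
          unfolding P_def e1 e2 using ac trans by (auto simp: algebra_simps)
      qed
    next
      case (local x)
      obtain r where r: "r > 0" "\<And>y. dist y x < r \<Longrightarrow> dist (g y) (g x) < d"
        using gc d unfolding continuous_on_iff by (metis UNIV_I)
      have "P a b" if ab: "a \<le> x" "x \<le> b" "b - a < r" for a b
        unfolding P_def
      proof
        assume s: "s \<le> a \<and> a \<le> b \<and> b \<le> t"
        have gx: "norm (g y - g x) \<le> d" if "y \<in> {a..b}" for y
          using r(2)[of y] that ab by (auto simp: dist_norm less_imp_le)
        have "integral {a..b} (\<lambda>y. norm (g y)) \<le> integral {a..b} (\<lambda>y. norm (g x) + d)"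
        proof (rule integral_le[OF ing])
          show "norm (g y) \<le> norm (g x) + d" if "y \<in> {a..b}" for y
            using gx[OF that] norm_triangle_ineq2[of "g y" "g x"] by simp
        qed auto
        also have "\<dots> = (b - a) * (norm (g x) + d)" using s by simp
        finally have I1: "integral {a..b} (\<lambda>y. norm (g y)) \<le> (b - a) * (norm (g x) + d)" .
        have "(b - a) * norm (g x) = norm (integral {a..b} (\<lambda>y. g x))" using s by simp
        also have "integral {a..b} (\<lambda>y. g x) = integral {a..b} (\<lambda>y. (g x - g y) - (H y - g y)) "
        proof -
          have "integral {a..b} (\<lambda>y. (g x - g y) - (H y - g y)) = integral {a..b} (\<lambda>y. g x - H y)" by simp
          also have "\<dots> = integral {a..b} (\<lambda>y. g x) - integral {a..b} H"
            by (intro Henstock_Kurzweil_Integration.integral_diff iH) auto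
          finally show ?thesis using z[of a b] s by simp
        qed
        also have "norm \<dots> \<le> integral {a..b} (\<lambda>y. d + norm (H y - g y))"
        proof (rule integral_norm_bound_integral)
          show "(\<lambda>y. g x - g y - (H y - g y)) integrable_on {a..b}"
            by (intro Henstock_Kurzweil_Integration.integrable_diff ig iH integrable_const_ivl)
          show "(\<lambda>y. d + norm (H y - g y)) integrable_on {a..b}"
            by (intro Henstock_Kurzweil_Integration.integrable_add iN integrable_const_ivl)
          show "norm (g x - g y - (H y - g y)) \<le> d + norm (H y - g y)" if "y \<in> {a..b}" for y
            using gx[OF that] norm_triangle_ineq4[of "g x - g y" "H y - g y"] by (simp add: norm_minus_commute)
        qed
        also have "\<dots> = d * (b - a) + integral {a..b} (\<lambda>y. norm (H y - g y))"
          using s by (subst Henstock_Kurzweil_Integration.integral_add[OF _ iN]) auto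
        finally show "integral {a..b} (\<lambda>x. norm (g x)) \<le> integral {a..b} (\<lambda>x. norm (H x - g x)) + 2 * d * (b - a)"
          using I1 by (simp add: algebra_simps)
      qed
      then show ?case using r(1) by blast
    qed
    then have 1: "integral {s..t} (\<lambda>x. norm (g x)) \<le> integral {s..t} (\<lambda>x. norm (H x - g x)) + e / 2"
    proof -
      have "2 * d * (t - s) = e / 2" using st by (simp only: d_def) (simp add: field_simps)
      then show ?thesis using \<open>P s t\<close> st by (simp add: P_def)
    qed
    have "integral {s..t} (\<lambda>x. norm (H x - g x)) \<le> K * Np p (\<lambda>x. H x - g x)"
      unfolding K_def by (rule Lfun_interval(4)[OF Ld st])
    also have "\<dots> \<le> K * (e / (4 * K))" using g(2) K by (intro mult_left_mono) auto
    also have "\<dots> = e / 4" using K by simp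
    finally have 2: "integral {s..t} (\<lambda>x. norm (H x - g x)) \<le> e / 4" .
    have "integral {s..t} (\<lambda>x. norm (H x)) \<le> integral {s..t} (\<lambda>x. norm (H x - g x) + norm (g x))"
      by (rule integral_le[OF inH Henstock_Kurzweil_Integration.integrable_add[OF iN ing]])
        (metis diff_add_cancel norm_triangle_ineq)
    also have "\<dots> = integral {s..t} (\<lambda>x. norm (H x - g x)) + integral {s..t} (\<lambda>x. norm (g x))"
      by (rule Henstock_Kurzweil_Integration.integral_add[OF iN ing])
    finally show "integral {s..t} (\<lambda>x. norm (H x)) \<le> 0 + e" using 1 2 by simp
  qed
  moreover have "0 \<le> integral {s..t} (\<lambda>x. norm (H x))" by (rule Henstock_Kurzweil_Integration.integral_nonneg[OF Lfun_interval(3)[OF H]]) simp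
  ultimately have "((\<lambda>x. norm (H x)) has_integral 0) {s..t}"
    using Lfun_interval(3)[OF H] by (simp add: has_integral_iff)
  then have "(\<integral>\<^sup>+x. ennreal (norm (H x)) * indicator {s..t} x \<partial>lebesgue) = 0"
    using nn_integral_has_integral_lebesgue'[of "{s..t}" "\<lambda>x. norm (H x)" 0] by (simp add: nn_integral_completion)
  moreover have m: "(\<lambda>x. norm (H x)) \<in> borel_measurable lebesgue"
    using H by (intro strongly_measurable_norm0) (simp add: Lfun_def)
  have "(\<lambda>x. ennreal (norm (H x)) * indicator {s..t} x) \<in> borel_measurable lebesgue"
    by (intro borel_measurable_times_ennreal measurable_compose[OF m measurable_ennreal] borel_measurable_indicator) simp
  ultimately have "AE x in lebesgue. ennreal (norm (H x)) * indicator {s..t} x = 0"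
    by (subst (asm) nn_integral_0_iff_AE) auto
  then show ?thesis by eventually_elim (auto simp: indicator_def split: if_splits)
qed

end

section \<open>The carriers \<open>L\<^sup>p(S, X)\<close>\<close>

lemma rep_abs_aefun: "AE x in lebesgue. rep_aefun (abs_aefun f) x = f x"
proof -
  have "abs_aefun (rep_aefun (abs_aefun f)) = abs_aefun f" by (rule Quotient3_abs_rep[OF Quotient3_aefun])
  then show ?thesis by (simp add: aefun.abs_eq_iff)
qed

lemma abs_rep_aefun: "abs_aefun (rep_aefun F) = F"
  by (rule Quotient3_abs_rep[OF Quotient3_aefun])

lemma aefun_eqI: "AE x in lebesgue. rep_aefun F x = rep_aefun G x \<Longrightarrow> F = G"
  using abs_rep_aefun[of F] abs_rep_aefun[of G] aefun.abs_eq_iff[of "rep_aefun F" "rep_aefun G"] by simp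

lemma rep_plus: "AE x in lebesgue. rep_aefun (F + G) x = rep_aefun F x + rep_aefun G x"
  using rep_abs_aefun[of "\<lambda>x. rep_aefun F x + rep_aefun G x"]
    plus_aefun.abs_eq[of "rep_aefun F" "rep_aefun G"] by (simp add: abs_rep_aefun)

lemma rep_minus: "AE x in lebesgue. rep_aefun (F - G) x = rep_aefun F x - rep_aefun G x"
  using rep_abs_aefun[of "\<lambda>x. rep_aefun F x - rep_aefun G x"]
    minus_aefun.abs_eq[of "rep_aefun F" "rep_aefun G"] by (simp add: abs_rep_aefun)

lemma rep_scaleR: "AE x in lebesgue. rep_aefun (c *\<^sub>R F) x = c *\<^sub>R rep_aefun F x"
  using rep_abs_aefun[of "\<lambda>x. c *\<^sub>R rep_aefun F x"] scaleR_aefun.abs_eq[of c "rep_aefun F"] by (simp add: abs_rep_aefun)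

lemma rep_scaleC: "AE x in lebesgue. rep_aefun (c *\<^sub>C F) x = c *\<^sub>C rep_aefun F x"
  using rep_abs_aefun[of "\<lambda>x. c *\<^sub>C rep_aefun F x"] scaleC_aefun.abs_eq[of c "rep_aefun F"] by (simp add: abs_rep_aefun)

lemma rep_zero: "AE x in lebesgue. rep_aefun 0 x = 0"
  using rep_abs_aefun[of "\<lambda>x. 0"] by (simp add: zero_aefun_def)

lemma rep_class_on: "AE x in lebesgue. rep_aefun (class_on S f) x = (if x \<in> S then f x else 0)"
  unfolding class_on_def by (rule rep_abs_aefun)

lemma class_on_eq_iff: "class_on S f = class_on S g \<longleftrightarrow> (AE x in lebesgue. x \<in> S \<longrightarrow> f x = g x)"
proof -
  have "class_on S f = class_on S g \<longleftrightarrow> (AE x in lebesgue. (if x \<in> S then f x else 0) = (if x \<in> S then g x else 0))"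
    unfolding class_on_def by (rule aefun.abs_eq_iff)
  also have "\<dots> \<longleftrightarrow> (AE x in lebesgue. x \<in> S \<longrightarrow> f x = g x)"
    by (rule iffI; erule eventually_mono; auto)
  finally show ?thesis .
qed

lemma integral_cong_AE_on:
  fixes f g :: "real \<Rightarrow> 'a::banach"
  assumes "AE x in lebesgue. x \<in> {a..b} \<longrightarrow> f x = g x"
  shows "integral {a..b} f = integral {a..b} g"
proof -
  obtain N where N: "N \<in> null_sets lebesgue" "{x. \<not> (x \<in> {a..b} \<longrightarrow> f x = g x)} \<subseteq> N"
    using assms by (auto simp: eventually_ae_filter)
  show ?thesis by (rule integral_spike[of N]) (use N in \<open>auto simp: negligible_iff_null_sets\<close>)
qed

lemma AE_lebesgue_ex_between:
  assumes "AE x in lebesgue. P x" "a < b"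
  shows "\<exists>x. a < x \<and> x < b \<and> P (x::real)"
proof (rule ccontr)
  assume n: "\<not> ?thesis"
  obtain N where N: "N \<in> null_sets lebesgue" "{x. \<not> P x} \<subseteq> N"
    using assms(1) by (auto simp: eventually_ae_filter)
  have "{a<..<b} \<subseteq> N" using n N by auto
  then have "emeasure lebesgue {a<..<b} \<le> emeasure lebesgue N" using N by (intro emeasure_mono) auto
  then show False using N assms(2) by auto
qed

lemma bounded_linear_scaleC: "bounded_linear (\<lambda>x::'a::complex_banach. c *\<^sub>C x)"
proof (rule bounded_linear_intro[where K = "cmod c"])
  show "c *\<^sub>C (r *\<^sub>R x) = r *\<^sub>R (c *\<^sub>C x)" for r and x :: 'a
    by (simp add: scaleC_of_real[symmetric] scaleC_scaleC mult.commute)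
qed (simp_all add: scaleC_add_right norm_scaleC mult.commute)

lemma bounded_bilinear_scaleC: "bounded_bilinear (\<lambda>c (x::'a::complex_banach). c *\<^sub>C x)"
proof
  fix a a' :: complex and b b' :: 'a and r :: real
  show "(r *\<^sub>R a) *\<^sub>C b = r *\<^sub>R (a *\<^sub>C b)"
    by (simp add: scaleC_of_real[symmetric] scaleC_scaleC scaleR_conv_of_real)
  show "a *\<^sub>C (r *\<^sub>R b) = r *\<^sub>R (a *\<^sub>C b)"
    by (simp add: scaleC_of_real[symmetric] scaleC_scaleC mult.commute)
  show "\<exists>K. \<forall>a (b::'a). norm (a *\<^sub>C b) \<le> norm a * norm b * K"
    by (intro exI[of _ 1]) (simp add: norm_scaleC)
qed (simp_all add: scaleC_add_right scaleC_add_left)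

lemma complete_norm_limit:
  fixes x :: "nat \<Rightarrow> 'v::real_vector"
  assumes "complete_norm V n" "\<forall>i. x i \<in> V" "\<forall>e>0. \<exists>N. \<forall>i\<ge>N. \<forall>j\<ge>N. n (x i - x j) < e"
  shows "\<exists>l\<in>V. (\<lambda>i. n (x i - l)) \<longlonglongrightarrow> 0"
  using assms unfolding complete_norm_def by blast

lemma complex_carrier_UNIV: "complex_carrier UNIV (norm :: 'a::complex_banach \<Rightarrow> real)"
proof
  have "\<exists>l. (\<lambda>i. norm (x i - l)) \<longlonglongrightarrow> 0" if "\<forall>e>0. \<exists>N. \<forall>i\<ge>N. \<forall>j\<ge>N. norm (x i - x j) < e" for x :: "nat \<Rightarrow> 'a"
  proof -
    have "Cauchy x" using that by (simp add: Cauchy_def dist_norm)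
    then obtain l where "x \<longlonglongrightarrow> l" by (auto simp: Cauchy_convergent_iff convergent_def)
    then show ?thesis by (auto simp: LIM_zero_iff tendsto_norm_zero_iff)
  qed
  note lim = this
  show "complete_norm UNIV (norm :: 'a \<Rightarrow> real)"
    unfolding complete_norm_def
  proof (intro conjI ballI allI impI)
    show "\<exists>l\<in>UNIV. (\<lambda>i. norm (x i - l)) \<longlonglongrightarrow> 0"
      if "\<forall>e>0. \<exists>N. \<forall>i\<ge>N. \<forall>j\<ge>N. norm (x i - x j) < e" for x :: "nat \<Rightarrow> 'a"
      using lim[OF that] by simp
  qed (simp_all add: norm_triangle_ineq)
qed (auto simp: norm_scaleC)

lemma complex_carrier_prod:
  assumes 1: "complex_carrier V m" and 2: "complex_carrier W n"
  shows "complex_carrier (V \<times> W) (\<lambda>z. m (fst z) + n (snd z))"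
proof
  have c1: "complete_norm V m" and c2: "complete_norm W n" using 1 2 by (auto simp: complex_carrier_def)
  have sub: "subspace V" "subspace W" using c1 c2 by (auto simp: complete_norm_def)
  have pos: "v \<in> V \<Longrightarrow> 0 \<le> m v" "w \<in> W \<Longrightarrow> 0 \<le> n w" for v w using c1 c2 by (auto simp: complete_norm_def)
  show "complete_norm (V \<times> W) (\<lambda>z. m (fst z) + n (snd z))"
    unfolding complete_norm_def
  proof (intro conjI ballI allI impI)
    show "subspace (V \<times> W)" by (rule subspace_Times[OF sub])
    show "0 \<le> m (fst v) + n (snd v)" if "v \<in> V \<times> W" for v using that pos by auto
    show "v = 0" if "v \<in> V \<times> W" "m (fst v) + n (snd v) = 0" for v
    proof -
      have "m (fst v) = 0" "n (snd v) = 0" using that pos(1)[of "fst v"] pos(2)[of "snd v"] by auto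
      then show ?thesis using that c1 c2 by (auto simp: complete_norm_def prod_eq_iff)
    qed
    show "m (fst (u + v)) + n (snd (u + v)) \<le> m (fst u) + n (snd u) + (m (fst v) + n (snd v))"
      if "u \<in> V \<times> W" "v \<in> V \<times> W" for u v
    proof -
      have "m (fst u + fst v) \<le> m (fst u) + m (fst v)" "n (snd u + snd v) \<le> n (snd u) + n (snd v)"
        using that c1 c2 by (auto simp: complete_norm_def)
      then show ?thesis by simp
    qed
    show "m (fst (c *\<^sub>R v)) + n (snd (c *\<^sub>R v)) = \<bar>c\<bar> * (m (fst v) + n (snd v))" if "v \<in> V \<times> W" for c v
      using that c1 c2 by (auto simp: complete_norm_def algebra_simps)
    fix x :: "nat \<Rightarrow> 'a \<times> 'b"
    assume x: "\<forall>i. x i \<in> V \<times> W" and C: "\<forall>e>0. \<exists>N. \<forall>i\<ge>N. \<forall>j\<ge>N. m (fst (x i - x j)) + n (snd (x i - x j)) < e"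
    have p: "0 \<le> m (fst (x i) - fst (x j))" "0 \<le> n (snd (x i) - snd (x j))" for i j
      using x by (auto intro!: pos subspace_diff sub simp: mem_Times_iff)
    have le: "m (fst (x i) - fst (x j)) \<le> m (fst (x i - x j)) + n (snd (x i - x j))"
      "n (snd (x i) - snd (x j)) \<le> m (fst (x i - x j)) + n (snd (x i - x j))" for i j
      using p[of i j] by auto
    have C1: "\<forall>e>0. \<exists>N. \<forall>i\<ge>N. \<forall>j\<ge>N. m (fst (x i) - fst (x j)) < e"
      using C le_less_trans[OF le(1)] by meson
    have C2: "\<forall>e>0. \<exists>N. \<forall>i\<ge>N. \<forall>j\<ge>N. n (snd (x i) - snd (x j)) < e"
      using C le_less_trans[OF le(2)] by meson
    have V: "\<forall>i. fst (x i) \<in> V" "\<forall>i. snd (x i) \<in> W" using x by (auto simp: mem_Times_iff)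
    obtain l k where l: "l \<in> V" "(\<lambda>i. m (fst (x i) - l)) \<longlonglongrightarrow> 0" and k: "k \<in> W" "(\<lambda>i. n (snd (x i) - k)) \<longlonglongrightarrow> 0"
      using complete_norm_limit[OF c1 V(1) C1] complete_norm_limit[OF c2 V(2) C2] by blast
    then show "\<exists>l\<in>V \<times> W. (\<lambda>i. m (fst (x i - l)) + n (snd (x i - l))) \<longlonglongrightarrow> 0"
      using tendsto_add[OF l(2) k(2)] by (intro bexI[of _ "(l, k)"]) auto
  qed
  show "c *\<^sub>C v \<in> V \<times> W" "m (fst (c *\<^sub>C v)) + n (snd (c *\<^sub>C v)) = cmod c * (m (fst v) + n (snd v))" if "v \<in> V \<times> W" for v c
    using that complex_carrier.scaleC_closed[OF 1] complex_carrier.scaleC_closed[OF 2]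
      complex_carrier.norm_scaleC_carrier[OF 1] complex_carrier.norm_scaleC_carrier[OF 2]
    by (simp_all add: scaleC_prod_def mem_Times_iff distrib_left)
qed

context exponent
begin

text \<open>Reduces the carrier to functions on the line, where the norm inequalities and
  completeness are available.\<close>

lemma Lp_iff:
  assumes S: "S \<in> sets lebesgue"
  shows "F \<in> Lp p S \<longleftrightarrow> Lfun p (rep_aefun F) \<and> (AE x in lebesgue. x \<notin> S \<longrightarrow> rep_aefun F x = 0)"
proof
  assume "F \<in> Lp p S"
  then obtain f where f: "F = class_on S f" "strongly_measurable (lebesgue_on S) f"
    "(\<integral>\<^sup>+s. ennreal (norm (f s) powr p) \<partial>lebesgue_on S) < \<infinity>" by (auto simp: Lp_def)
  let ?g = "\<lambda>x. if x \<in> S then f x else 0"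
  have sm: "strongly_measurable lebesgue ?g" using f(2) S by (simp add: strongly_measurable_restrict_iff)
  have "(\<integral>\<^sup>+s. ennreal (norm (?g s) powr p) \<partial>lebesgue) = (\<integral>\<^sup>+s. ennreal (norm (f s) powr p) * indicator S s \<partial>lebesgue)"
    using p by (intro nn_integral_cong) (auto simp: indicator_def)
  also have "\<dots> < \<infinity>" using f(3) S by (simp add: nn_integral_restrict_space)
  finally have "Lfun p ?g"
    unfolding Lfun_def using sm strongly_measurable_norm_powr[OF sm] by (auto intro: integrableI_nonneg)
  moreover have eq: "AE x in lebesgue. ?g x = rep_aefun F x"
    using rep_class_on[of S f] f(1) by (auto elim: eventually_mono)
  ultimately have "Lfun p (rep_aefun F)" by (rule Lfun_cong_AE)
  moreover have "AE x in lebesgue. x \<notin> S \<longrightarrow> rep_aefun F x = 0"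
    using eq by eventually_elim (auto split: if_splits)
  ultimately show "Lfun p (rep_aefun F) \<and> (AE x in lebesgue. x \<notin> S \<longrightarrow> rep_aefun F x = 0)" by simp
next
  assume F: "Lfun p (rep_aefun F) \<and> (AE x in lebesgue. x \<notin> S \<longrightarrow> rep_aefun F x = 0)"
  have "AE x in lebesgue. rep_aefun (class_on S (rep_aefun F)) x = rep_aefun F x"
    using rep_class_on[of S "rep_aefun F"] conjunct2[OF F] by eventually_elim auto
  from aefun_eqI[OF this] have eq: "F = class_on S (rep_aefun F)" by (rule sym)
  have L: "Lfun p (\<lambda>x. if x \<in> S then rep_aefun F x else 0)" using F S by (simp add: Lfun_restrict)
  have "(\<integral>\<^sup>+s. ennreal (norm (rep_aefun F s) powr p) \<partial>lebesgue_on S)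
      = (\<integral>\<^sup>+s. ennreal (norm (if s \<in> S then rep_aefun F s else 0) powr p) \<partial>lebesgue)"
    using S p by (simp add: nn_integral_restrict_space) (auto intro!: nn_integral_cong simp: indicator_def)
  also have "\<dots> < \<infinity>"
    using L nn_integral_eq_integral[of lebesgue "\<lambda>s. norm (if s \<in> S then rep_aefun F s else 0) powr p"]
    by (simp add: Lfun_def)
  finally show "F \<in> Lp p S"
    unfolding Lp_def using eq L S by (auto simp: Lfun_def strongly_measurable_restrict_iff)
qed

lemma Lp_norm_eq: "Lp_norm p F = Np p (rep_aefun F)"
  by (simp add: Lp_norm_def Np_def)

lemma Lp_norm_nonneg [simp]: "0 \<le> Lp_norm p F"
  by (simp add: Lp_norm_eq)

lemma class_on_Lp:
  assumes S: "S \<in> sets lebesgue" and L: "Lfun p (\<lambda>x. if x \<in> S then f x else 0)"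
  shows "class_on S f \<in> Lp p S" "Lp_norm p (class_on S f) = Np p (\<lambda>x. if x \<in> S then f x else 0)"
proof -
  have eq: "AE x in lebesgue. (if x \<in> S then f x else 0) = rep_aefun (class_on S f) x"
    using rep_class_on[of S f] by (auto elim: eventually_mono)
  have "AE x in lebesgue. x \<notin> S \<longrightarrow> rep_aefun (class_on S f) x = 0"
    using eq by eventually_elim (auto split: if_splits)
  then show "class_on S f \<in> Lp p S" using Lfun_cong_AE[OF L eq] by (simp add: Lp_iff[OF S])
  show "Lp_norm p (class_on S f) = Np p (\<lambda>x. if x \<in> S then f x else 0)"
    unfolding Lp_norm_eq by (rule Np_cong_AE[symmetric, OF _ eq]) (use L in \<open>simp add: Lfun_def\<close>)
qed

lemma complex_carrier_Lp:
  assumes S: "S \<in> sets lebesgue"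
  shows "complex_carrier (Lp p S :: 'a::complex_banach aefun set) (Lp_norm p)"
proof
  have sc: "c *\<^sub>C F \<in> Lp p S \<and> Lp_norm p (c *\<^sub>C F) = cmod c * Lp_norm p F" if F: "F \<in> Lp p S" for c and F :: "'a aefun"
  proof -
    have sm: "strongly_measurable lebesgue (\<lambda>x. c *\<^sub>C rep_aefun F x)"
      using F by (intro strongly_measurable_compose[of _ _ "\<lambda>x. c *\<^sub>C x"])
        (auto simp: Lp_iff[OF S] Lfun_def linear_continuous_at bounded_linear_scaleC)
    have L: "Lfun p (\<lambda>x. c *\<^sub>C rep_aefun F x)" "Np p (\<lambda>x. c *\<^sub>C rep_aefun F x) = cmod c * Np p (rep_aefun F)"
      using F by (auto intro!: Lfun_scaled[OF _ sm] simp: Lp_iff[OF S] norm_scaleC)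
    have eq: "AE x in lebesgue. c *\<^sub>C rep_aefun F x = rep_aefun (c *\<^sub>C F) x"
      using rep_scaleC[of c F] by (auto elim: eventually_mono)
    have c0: "c *\<^sub>C (0 :: 'a) = 0" using norm_scaleC[of c "0 :: 'a"] by simp
    have "AE x in lebesgue. x \<notin> S \<longrightarrow> rep_aefun F x = 0" using F by (simp add: Lp_iff[OF S])
    then have "AE x in lebesgue. x \<notin> S \<longrightarrow> rep_aefun (c *\<^sub>C F) x = 0"
      using eq by eventually_elim (auto simp: c0)
    then show ?thesis using Lfun_cong_AE[OF L(1) eq] L(2) Np_cong_AE[OF sm eq] by (simp add: Lp_iff[OF S] Lp_norm_eq)
  qed
  then show "c *\<^sub>C F \<in> Lp p S" "Lp_norm p (c *\<^sub>C F) = cmod c * Lp_norm p F" if "F \<in> Lp p S" for c and F :: "'a aefun"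
    using that by auto
  have scR: "c *\<^sub>R F \<in> Lp p S \<and> Lp_norm p (c *\<^sub>R F) = \<bar>c\<bar> * Lp_norm p F" if "F \<in> Lp p S" for c and F :: "'a aefun"
    using sc[OF that, of "complex_of_real c"] by (simp add: scaleC_of_real)
  have add: "F + G \<in> Lp p S \<and> Lp_norm p (F + G) \<le> Lp_norm p F + Lp_norm p G" if F: "F \<in> Lp p S" and G: "G \<in> Lp p S" for F G :: "'a aefun"
  proof -
    have LF: "Lfun p (rep_aefun F)" and LG: "Lfun p (rep_aefun G)" using F G by (auto simp: Lp_iff[OF S])
    note L = Lfun_add[OF LF LG]
    have eq: "AE x in lebesgue. rep_aefun F x + rep_aefun G x = rep_aefun (F + G) x"
      using rep_plus[of F G] by (auto elim: eventually_mono)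
    have "AE x in lebesgue. x \<notin> S \<longrightarrow> rep_aefun F x = 0" "AE x in lebesgue. x \<notin> S \<longrightarrow> rep_aefun G x = 0"
      using F G by (auto simp: Lp_iff[OF S])
    then have "AE x in lebesgue. x \<notin> S \<longrightarrow> rep_aefun (F + G) x = 0" using eq by eventually_elim auto
    moreover have "Np p (\<lambda>x. rep_aefun F x + rep_aefun G x) = Np p (rep_aefun (F + G))"
      by (rule Np_cong_AE[OF _ eq]) (use L in \<open>simp add: Lfun_def\<close>)
    ultimately show ?thesis using Lfun_cong_AE[OF L(1) eq] L(2) by (simp add: Lp_iff[OF S] Lp_norm_eq)
  qed
  have zero: "(0 :: 'a aefun) \<in> Lp p S"
  proof -
    have "AE x in lebesgue. 0 = rep_aefun (0 :: 'a aefun) x" using rep_zero by (auto elim: eventually_mono)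
    from Lfun_cong_AE[OF Lfun_zero this] show ?thesis
      using rep_zero[where 'a = 'a] by (auto simp: Lp_iff[OF S] elim: eventually_mono)
  qed
  show "complete_norm (Lp p S :: 'a aefun set) (Lp_norm p)"
    unfolding complete_norm_def
  proof (intro conjI ballI allI impI)
    show "subspace (Lp p S :: 'a aefun set)" unfolding subspace_def using zero add scR by auto
    show "F = 0" if "F \<in> Lp p S" "Lp_norm p F = 0" for F :: "'a aefun"
    proof (rule aefun_eqI)
      have "AE x in lebesgue. rep_aefun F x = 0" using that by (intro Np_eq_0_AE) (auto simp: Lp_iff[OF S] Lp_norm_eq)
      then show "AE x in lebesgue. rep_aefun F x = rep_aefun 0 x" using rep_zero by eventually_elim simp
    qed
    fix x :: "nat \<Rightarrow> 'a aefun"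
    assume x: "\<forall>i. x i \<in> Lp p S" and C: "\<forall>e>0. \<exists>N. \<forall>i\<ge>N. \<forall>j\<ge>N. Lp_norm p (x i - x j) < e"
    have Lx: "Lfun p (rep_aefun (x i))" for i using x by (simp add: Lp_iff[OF S])
    have nd: "Lp_norm p (x i - H) = Np p (\<lambda>s. rep_aefun (x i) s - h s)"
      if h: "Lfun p h" "AE s in lebesgue. rep_aefun H s = h s" for i H h
      unfolding Lp_norm_eq
    proof (rule Np_cong_AE[symmetric])
      show "strongly_measurable lebesgue (\<lambda>s. rep_aefun (x i) s - h s)"
        using Lfun_diff(1)[OF Lx h(1)] by (simp add: Lfun_def)
      show "AE s in lebesgue. rep_aefun (x i) s - h s = rep_aefun (x i - H) s"
        using rep_minus[of "x i" H] h(2) by eventually_elim simp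
    qed
    have "Lp_norm p (x i - x j) = Np p (\<lambda>s. rep_aefun (x i) s - rep_aefun (x j) s)" for i j
      by (rule nd[OF Lx]) simp
    then have C': "\<exists>N. \<forall>i\<ge>N. \<forall>j\<ge>N. Np p (\<lambda>s. rep_aefun (x i) s - rep_aefun (x j) s) < e" if "e > 0" for e
      using C that by simp
    obtain f r where f: "Lfun p f" "(\<lambda>n. Np p (\<lambda>s. rep_aefun (x n) s - f s)) \<longlonglongrightarrow> 0"
      and r: "AE s in lebesgue. (\<lambda>k. rep_aefun (x (r k)) s) \<longlonglongrightarrow> f s"
      by (rule riesz_fischer[OF Lx C']) (assumption | blast)+
    have eq: "AE s in lebesgue. f s = rep_aefun (abs_aefun f) s" using rep_abs_aefun[of f] by (auto elim: eventually_mono)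
    \<comment> \<open>The subsequence that converges almost everywhere passes the vanishing outside
      \<open>S\<close> on to the limit.\<close>
    have "AE s in lebesgue. \<forall>k. s \<notin> S \<longrightarrow> rep_aefun (x (r k)) s = 0"
      by (subst AE_all_countable) (use x in \<open>simp add: Lp_iff[OF S]\<close>)
    then have "AE s in lebesgue. s \<notin> S \<longrightarrow> rep_aefun (abs_aefun f) s = 0"
      using r eq
    proof eventually_elim
      case (elim s)
      show ?case
      proof
        assume "s \<notin> S"
        then have "(\<lambda>k. 0) \<longlonglongrightarrow> f s" using elim by simp
        then show "rep_aefun (abs_aefun f) s = 0" using elim(3) LIMSEQ_unique[OF tendsto_const] by metis
      qed
    qed
    then have "abs_aefun f \<in> Lp p S" using Lfun_cong_AE[OF f(1) eq] by (simp add: Lp_iff[OF S])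
    moreover have "(\<lambda>n. Lp_norm p (x n - abs_aefun f)) \<longlonglongrightarrow> 0"
      using f(2) nd[OF f(1) rep_abs_aefun] by simp
    ultimately show "\<exists>l\<in>Lp p S. (\<lambda>i. Lp_norm p (x i - l)) \<longlonglongrightarrow> 0" by blast
  qed (use add scR in auto)
qed

lemma complex_carrier_state: "complex_carrier (state_space p :: ('a::complex_banach \<times> 'a aefun \<times> 'a aefun) set) (state_norm p)"
proof -
  have "state_norm p = (\<lambda>z :: 'a \<times> 'a aefun \<times> 'a aefun. norm (fst z) + ((\<lambda>z. Lp_norm p (fst z) + Lp_norm p (snd z)) (snd z)))"
    by (auto simp: state_norm_def fun_eq_iff)
  then show ?thesis
    using complex_carrier_prod[OF complex_carrier_UNIV
        complex_carrier_prod[OF complex_carrier_Lp[of "{-1..0}"] complex_carrier_Lp[of "{0..}"]]]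
    by (simp add: state_space_def)
qed

end

section \<open>The spaces \<open>W\<^sup>1\<^sup>,\<^sup>p(S, X)\<close>\<close>

text \<open>Covers [-1, 0] and [0, \<infinity>) at once: statements that hold almost everywhere can
  be proved on one compact interval at a time, and nondegenerate intervals rule out isolated
  points.\<close>

locale sobolev = exponent +
  fixes S :: "real set"
  assumes cover: "\<exists>a b :: nat \<Rightarrow> real. (\<forall>n. a n < b n) \<and> S = (\<Union>n. {a n..b n})"
    and convex: "s \<in> S \<Longrightarrow> t \<in> S \<Longrightarrow> {s..t} \<subseteq> S"
begin

lemma S_meas: "S \<in> sets lebesgue"
  using cover by auto

lemma S_nontrivial: "x \<in> S \<Longrightarrow> \<exists>c\<in>S. c \<noteq> x"
  using cover by (metis UN_iff atLeastAtMost_iff less_imp_le less_irrefl order_refl UNIV_I)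

sublocale Lp: complex_carrier "Lp p S :: 'a::complex_banach aefun set" "Lp_norm p"
  by (rule complex_carrier_Lp[OF S_meas])

lemma rep_Lfun: "G \<in> Lp p S \<Longrightarrow> Lfun p (rep_aefun G)"
  by (simp add: Lp_iff[OF S_meas])

lemma rep_integral:
  fixes G :: "'a::banach aefun"
  assumes "G \<in> Lp p S"
  shows "strong_integral (lebesgue_on {s..t}) (rep_aefun G) = integral {s..t} (rep_aefun G)"
  by (rule strong_integral_eq(2)[OF Lfun_interval(1)[OF rep_Lfun[OF assms]]])

lemma W1p_rep_iff:
  fixes G :: "'a::banach aefun"
  shows "W1p_rep p S F f G \<longleftrightarrow> F = class_on S f \<and> G \<in> Lp p S \<and>
    (\<forall>s\<in>S. \<forall>t\<in>S. s \<le> t \<longrightarrow> f t - f s = integral {s..t} (rep_aefun G))"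
  unfolding W1p_rep_def by (auto simp: rep_integral)

lemma W1p_rep_bound:
  fixes G :: "'a::banach aefun"
  assumes r: "W1p_rep p S F f G" and st: "s \<in> S" "t \<in> S"
  shows "norm (f t - f s) \<le> 2 * \<bar>t - s\<bar> powr (1 - 1 / p) * Lp_norm p G"
proof -
  have G: "G \<in> Lp p S" using r by (simp add: W1p_rep_iff)
  note L = rep_Lfun[OF G]
  have *: "norm (f t - f s) \<le> 2 * (t - s) powr (1 - 1 / p) * Lp_norm p G" if "s \<in> S" "t \<in> S" "s < t" for s t
  proof -
    have "f t - f s = integral {s..t} (rep_aefun G)" using r that by (simp add: W1p_rep_iff)
    also have "norm \<dots> \<le> integral {s..t} (\<lambda>x. norm (rep_aefun G x))"
      by (rule integral_norm_bound_integral) (use Lfun_interval(2,3)[OF L] in auto)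
    also have "\<dots> \<le> 2 * (t - s) powr (1 - 1 / p) * Lp_norm p G"
      unfolding Lp_norm_eq by (rule Lfun_interval(4)[OF L that(3)])
    finally show ?thesis .
  qed
  show ?thesis
    using *[of s t] *[of t s] st by (cases s t rule: linorder_cases) (auto simp: norm_minus_commute)
qed

lemma W1p_rep_continuous:
  fixes G :: "'a::banach aefun"
  assumes r: "W1p_rep p S F f G"
  shows "continuous_on S f"
  unfolding continuous_on
proof
  fix s assume s: "s \<in> S"
  have "((\<lambda>t. f t - f s) \<longlongrightarrow> 0) (at s within S)"
  proof (rule Lim_null_comparison)
    show "\<forall>\<^sub>F t in at s within S. norm (f t - f s) \<le> 2 * \<bar>t - s\<bar> powr (1 - 1 / p) * Lp_norm p G"
      unfolding eventually_at_filter using W1p_rep_bound[OF r s] by (intro always_eventually) auto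
    have "((\<lambda>t. 2 * \<bar>t - s\<bar> powr (1 - 1 / p) * Lp_norm p G) \<longlongrightarrow> 2 * \<bar>s - s\<bar> powr (1 - 1 / p) * Lp_norm p G) (at s within S)"
      using p by (intro tendsto_mult tendsto_const tendsto_powr' tendsto_rabs tendsto_diff tendsto_ident_at) auto
    then show "((\<lambda>t. 2 * \<bar>t - s\<bar> powr (1 - 1 / p) * Lp_norm p G) \<longlongrightarrow> 0) (at s within S)" using p by simp
  qed
  then show "(f \<longlongrightarrow> f s) (at s within S)" by (rule LIM_zero_cancel)
qed

text \<open>No point of \<open>S\<close> is isolated: on one side of \<open>x\<close> a whole
  interval lies in \<open>S\<close>, and by continuity the functions would differ on all of
  it.\<close>

lemma continuous_eq_if_AE_eq:
  fixes f g :: "real \<Rightarrow> 'a::banach"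
  assumes f: "continuous_on S f" and g: "continuous_on S g"
    and eq: "AE x in lebesgue. x \<in> S \<longrightarrow> f x = g x" and x: "x \<in> S"
  shows "f x = g x"
proof (rule ccontr)
  assume ne: "f x \<noteq> g x"
  obtain c where c: "c \<in> S" "c \<noteq> x" using S_nontrivial[OF x] by auto
  have "continuous_on S (\<lambda>y. norm (f y - g y))" by (intro continuous_intros f g)
  moreover have "norm (f x - g x) > 0" using ne by simp
  ultimately obtain d where d: "d > 0" "\<And>y. y \<in> S \<Longrightarrow> dist y x < d \<Longrightarrow> dist (norm (f y - g y)) (norm (f x - g x)) < norm (f x - g x)"
    using x unfolding continuous_on_iff by metis
  define a where "a = (if c < x then max c (x - d) else x)"
  define b where "b = (if c < x then x else min c (x + d))"
  have ab: "a < b" using c d by (auto simp: a_def b_def)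
  obtain y where y: "a < y" "y < b" "y \<in> S \<longrightarrow> f y = g y" using AE_lebesgue_ex_between[OF eq ab] by auto
  have "y \<in> S" using y(1,2) convex[OF c(1) x] convex[OF x c(1)] c(2) by (auto simp: a_def b_def split: if_splits)
  moreover have "dist y x < d" using y(1,2) by (auto simp: a_def b_def dist_real_def split: if_splits)
  ultimately show False using d(2)[of y] y(3) by simp
qed

text \<open>Justifies the descriptions in \<open>W1p_eval\<close> and \<open>W1p_deriv\<close>. The
  representatives agree by continuity; then \<open>G\<close> and \<open>G'\<close> have equal
  integrals over all intervals in \<open>S\<close> and agree almost everywhere.\<close>

lemma W1p_rep_unique:
  fixes G G' :: "'a::banach aefun"
  assumes r: "W1p_rep p S F f G" and r': "W1p_rep p S F f' G'"
  shows "x \<in> S \<Longrightarrow> f x = f' x" "G = G'"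
proof -
  have "class_on S f = class_on S f'" using r r' by (auto simp: W1p_rep_iff)
  then have ff: "f x = f' x" if "x \<in> S" for x
    using continuous_eq_if_AE_eq[OF W1p_rep_continuous[OF r] W1p_rep_continuous[OF r'] _ that] by (simp add: class_on_eq_iff)
  then show "x \<in> S \<Longrightarrow> f x = f' x" .
  have G: "G \<in> Lp p S" "G' \<in> Lp p S" using r r' by (auto simp: W1p_rep_iff)
  note L = rep_Lfun[OF G(1)] rep_Lfun[OF G(2)]
  let ?H = "\<lambda>x. rep_aefun G x - rep_aefun G' x"
  have LH: "Lfun p ?H" by (rule Lfun_diff(1)[OF L])
  obtain a b :: "nat \<Rightarrow> real" where ab: "\<And>n. a n < b n" "S = (\<Union>n. {a n..b n})" using cover by auto
  have "AE x in lebesgue. x \<in> {a n..b n} \<longrightarrow> ?H x = 0" for n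
  proof (rule AE_zero_if_integrals_zero[OF LH _ ab(1)])
    fix s t assume st: "a n \<le> s" "s \<le> t" "t \<le> b n"
    then have "s \<in> {a n..b n}" "t \<in> {a n..b n}" by auto
    then have S: "s \<in> S" "t \<in> S" using ab(2) by blast+
    have "integral {s..t} ?H = integral {s..t} (rep_aefun G) - integral {s..t} (rep_aefun G')"
      by (intro Henstock_Kurzweil_Integration.integral_diff Lfun_interval(2) L)
    also have "\<dots> = (f t - f s) - (f' t - f' s)" using r r' S st by (simp add: W1p_rep_iff)
    finally show "integral {s..t} ?H = 0" using ff S by simp
  qed
  then have "AE x in lebesgue. \<forall>n. x \<in> {a n..b n} \<longrightarrow> ?H x = 0" by (subst AE_all_countable) blast
  moreover have "AE x in lebesgue. x \<notin> S \<longrightarrow> rep_aefun G x = 0" "AE x in lebesgue. x \<notin> S \<longrightarrow> rep_aefun G' x = 0"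
    using G by (auto simp: Lp_iff[OF S_meas])
  ultimately have "AE x in lebesgue. rep_aefun G x = rep_aefun G' x"
  proof eventually_elim
    case (elim x)
    then show ?case by (cases "x \<in> S") (auto simp: ab(2))
  qed
  then show "G = G'" by (rule aefun_eqI)
qed

lemma W1p_rep_eval:
  fixes G :: "'a::banach aefun"
  assumes r: "W1p_rep p S F f G"
  shows "x \<in> S \<Longrightarrow> W1p_eval p S F x = f x" "W1p_deriv p S F = G"
proof -
  show "W1p_eval p S F x = f x" if "x \<in> S"
    unfolding W1p_eval_def
  proof (rule the_equality)
    show "\<exists>f' G. W1p_rep p S F f' G \<and> f x = f' x" using r by blast
    show "y = f x" if "\<exists>f G. W1p_rep p S F f G \<and> y = f x" for y
      using that W1p_rep_unique(1)[OF _ r \<open>x \<in> S\<close>] by blast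
  qed
  show "W1p_deriv p S F = G"
    unfolding W1p_deriv_def
  proof (rule the_equality)
    show "\<exists>f. W1p_rep p S F f G" using r by blast
    show "H = G" if "\<exists>f. W1p_rep p S F f H" for H
      using that W1p_rep_unique(2)[OF _ r] by blast
  qed
qed

lemma W1p_repI:
  fixes F :: "'a::banach aefun"
  assumes "F \<in> W1p p S"
  shows "W1p_rep p S F (W1p_eval p S F) (W1p_deriv p S F)"
proof -
  obtain f G where r: "W1p_rep p S F f G" using assms by (auto simp: W1p_def)
  have "class_on S (W1p_eval p S F) = class_on S f"
    using W1p_rep_eval(1)[OF r] by (simp add: class_on_eq_iff)
  then show ?thesis using r W1p_rep_eval[OF r] by (simp add: W1p_rep_iff)
qed

lemma W1p_rep_add:
  fixes F F' :: "'a::complex_banach aefun"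
  assumes r: "W1p_rep p S F f G" and r': "W1p_rep p S F' f' G'"
  shows "W1p_rep p S (F + F') (\<lambda>x. f x + f' x) (G + G')"
  unfolding W1p_rep_iff
proof (intro conjI ballI impI)
  have G: "G \<in> Lp p S" "G' \<in> Lp p S" using r r' by (auto simp: W1p_rep_iff)
  then show "G + G' \<in> Lp p S" by (rule Lp.add_closed)
  have F: "F = class_on S f" "F' = class_on S f'" using r r' by (auto simp: W1p_rep_iff)
  show "F + F' = class_on S (\<lambda>x. f x + f' x)"
  proof (rule aefun_eqI)
    show "AE x in lebesgue. rep_aefun (F + F') x = rep_aefun (class_on S (\<lambda>x. f x + f' x)) x"
      using rep_plus[of F F'] rep_class_on[of S f] rep_class_on[of S f'] rep_class_on[of S "\<lambda>x. f x + f' x"]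
      unfolding F by eventually_elim auto
  qed
  fix s t assume st: "s \<in> S" "t \<in> S" "s \<le> t"
  have e1: "f t - f s = integral {s..t} (rep_aefun G)" and e2: "f' t - f' s = integral {s..t} (rep_aefun G')"
    using r r' st by (simp_all add: W1p_rep_iff)
  have "integral {s..t} (rep_aefun (G + G')) = integral {s..t} (\<lambda>x. rep_aefun G x + rep_aefun G' x)"
    by (rule integral_cong_AE_on) (use rep_plus[of G G'] in \<open>auto elim: eventually_mono\<close>)
  also have "\<dots> = integral {s..t} (rep_aefun G) + integral {s..t} (rep_aefun G')"
    by (intro Henstock_Kurzweil_Integration.integral_add Lfun_interval(2) rep_Lfun G)
  finally show "f t + f' t - (f s + f' s) = integral {s..t} (rep_aefun (G + G'))"
    using e1 e2 by (simp only: add_diff_add)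
qed

lemma W1p_rep_scaleC:
  fixes F :: "'a::complex_banach aefun"
  assumes r: "W1p_rep p S F f G"
  shows "W1p_rep p S (c *\<^sub>C F) (\<lambda>x. c *\<^sub>C f x) (c *\<^sub>C G)"
  unfolding W1p_rep_iff
proof (intro conjI ballI impI)
  interpret c: bounded_linear "\<lambda>x::'a. c *\<^sub>C x" by (rule bounded_linear_scaleC)
  have G: "G \<in> Lp p S" using r by (auto simp: W1p_rep_iff)
  then show "c *\<^sub>C G \<in> Lp p S" by (rule Lp.scaleC_closed)
  have F: "F = class_on S f" using r by (auto simp: W1p_rep_iff)
  show "c *\<^sub>C F = class_on S (\<lambda>x. c *\<^sub>C f x)"
  proof (rule aefun_eqI)
    show "AE x in lebesgue. rep_aefun (c *\<^sub>C F) x = rep_aefun (class_on S (\<lambda>x. c *\<^sub>C f x)) x"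
      using rep_scaleC[of c F] rep_class_on[of S f] rep_class_on[of S "\<lambda>x. c *\<^sub>C f x"]
      unfolding F by eventually_elim (auto simp: c.zero)
  qed
  fix s t assume st: "s \<in> S" "t \<in> S" "s \<le> t"
  have "integral {s..t} (rep_aefun (c *\<^sub>C G)) = integral {s..t} ((\<lambda>x. c *\<^sub>C x) \<circ> rep_aefun G)"
    by (rule integral_cong_AE_on) (use rep_scaleC[of c G] in \<open>auto elim: eventually_mono\<close>)
  also have "\<dots> = c *\<^sub>C integral {s..t} (rep_aefun G)"
    by (rule integral_linear[OF Lfun_interval(2)[OF rep_Lfun[OF G]] c.bounded_linear])
  finally show "c *\<^sub>C f t - c *\<^sub>C f s = integral {s..t} (rep_aefun (c *\<^sub>C G))"
    using r st by (simp add: W1p_rep_iff c.diff[symmetric])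
qed

lemma W1p_Lp: "F \<in> W1p p S \<Longrightarrow> F \<in> Lp p S"
  by (simp add: W1p_def)

lemma W1p_deriv_Lp: "F \<in> W1p p S \<Longrightarrow> W1p_deriv p S F \<in> Lp p S" for F :: "'a::banach aefun"
  using W1p_repI[of F] by (simp add: W1p_rep_iff)

lemma W1p_memI: "F \<in> Lp p S \<Longrightarrow> W1p_rep p S F f G \<Longrightarrow> F \<in> W1p p S"
  by (auto simp: W1p_def)

lemma W1p_add:
  fixes F F' :: "'a::complex_banach aefun"
  assumes "F \<in> W1p p S" "F' \<in> W1p p S"
  shows "F + F' \<in> W1p p S" "W1p_deriv p S (F + F') = W1p_deriv p S F + W1p_deriv p S F'"
    "x \<in> S \<Longrightarrow> W1p_eval p S (F + F') x = W1p_eval p S F x + W1p_eval p S F' x"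
  using W1p_rep_add[OF W1p_repI[OF assms(1)] W1p_repI[OF assms(2)]] assms
  by (auto intro: W1p_memI Lp.add_closed W1p_Lp dest: W1p_rep_eval)

lemma W1p_scaleC:
  fixes F :: "'a::complex_banach aefun"
  assumes "F \<in> W1p p S"
  shows "c *\<^sub>C F \<in> W1p p S" "W1p_deriv p S (c *\<^sub>C F) = c *\<^sub>C W1p_deriv p S F"
    "x \<in> S \<Longrightarrow> W1p_eval p S (c *\<^sub>C F) x = c *\<^sub>C W1p_eval p S F x"
  using W1p_rep_scaleC[OF W1p_repI[OF assms], of c] assms
  by (auto intro: W1p_memI Lp.scaleC_closed W1p_Lp dest: W1p_rep_eval)

lemma W1p_zero:
  fixes F :: "'a::complex_banach aefun"
  shows "(0 :: 'a aefun) \<in> W1p p S" "x \<in> S \<Longrightarrow> W1p_eval p S (0 :: 'a aefun) x = 0"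
proof -
  have "W1p_rep p S (0 :: 'a aefun) (\<lambda>x. 0) 0"
    unfolding W1p_rep_iff
  proof (intro conjI ballI impI)
    show "(0 :: 'a aefun) = class_on S (\<lambda>x. 0)"
      by (rule aefun_eqI) (use rep_zero[where 'a = 'a] rep_class_on[of S "\<lambda>x. 0 :: 'a"] in eventually_elim, auto)
    show "(0 :: 'a aefun) \<in> Lp p S" by (rule Lp.zero_closed)
    show "(0 :: 'a) - 0 = integral {s..t} (rep_aefun 0)" for s t
    proof -
      have "AE x in lebesgue. x \<in> {s..t} \<longrightarrow> rep_aefun (0 :: 'a aefun) x = 0"
        using rep_zero[where 'a = 'a] by eventually_elim simp
      from integral_cong_AE_on[OF this] show ?thesis by simp
    qed
  qed
  then show "(0 :: 'a aefun) \<in> W1p p S" "x \<in> S \<Longrightarrow> W1p_eval p S (0 :: 'a aefun) x = 0"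
    using W1p_memI[OF Lp.zero_closed] W1p_rep_eval(1) by blast+
qed

text \<open>a^p + b^p <= (a + b)^p. This converts boundedness of \<open>L\<close> and
  \<open>K\<close> into the sum norms in which graph norms are measured.\<close>

lemma W1p_norm_le: "W1p_norm p S F \<le> Lp_norm p F + Lp_norm p (W1p_deriv p S F)"
proof -
  let ?a = "Lp_norm p F" and ?b = "Lp_norm p (W1p_deriv p S F)"
  have "?a powr p + ?b powr p \<le> (?a + ?b) powr p"
  proof -
    have e: "x powr p = x * x powr (p - 1)" if "0 \<le> x" for x :: real
      using that powr_mult_base[of x "p - 1"] by simp
    have "?a powr p + ?b powr p = ?a * ?a powr (p - 1) + ?b * ?b powr (p - 1)" by (simp add: e)
    also have "\<dots> \<le> ?a * (?a + ?b) powr (p - 1) + ?b * (?a + ?b) powr (p - 1)"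
      using p by (intro add_mono mult_left_mono powr_mono2) auto
    also have "\<dots> = (?a + ?b) powr p" by (simp add: e distrib_right)
    finally show ?thesis .
  qed
  then have "W1p_norm p S F \<le> ((?a + ?b) powr p) powr (1 / p)"
    unfolding W1p_norm_def using p by (intro powr_mono2) auto
  also have "\<dots> = ?a + ?b" using p by (simp add: powr_powr)
  finally show ?thesis .
qed

text \<open>A trace estimate: on a unit interval the value at \<open>t\<close> exceeds the other
  values by at most twice the norm of the derivative, and the average of norm f is at most twice the
  norm of \<open>F\<close>.\<close>

lemma W1p_eval_bound:
  fixes F :: "'a::banach aefun"
  assumes F: "F \<in> W1p p S" and J: "{c..c + 1} \<subseteq> S" and t: "t \<in> {c..c + 1}"
  shows "norm (W1p_eval p S F t) \<le> 2 * (Lp_norm p F + Lp_norm p (W1p_deriv p S F))"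
proof -
  let ?f = "W1p_eval p S F" and ?G = "W1p_deriv p S F"
  note r = W1p_repI[OF F]
  have bd: "norm (?f t) - 2 * Lp_norm p ?G \<le> norm (?f x)" if x: "x \<in> {c..c + 1}" for x
  proof -
    have "norm (?f t - ?f x) \<le> 2 * \<bar>t - x\<bar> powr (1 - 1 / p) * Lp_norm p ?G"
      by (rule W1p_rep_bound[OF r]) (use x t J in auto)
    also have "\<dots> \<le> 2 * 1 * Lp_norm p ?G"
    proof (intro mult_right_mono mult_left_mono)
      have "\<bar>t - x\<bar> powr (1 - 1 / p) \<le> 1 powr (1 - 1 / p)"
        using x t p by (intro powr_mono2) auto
      then show "\<bar>t - x\<bar> powr (1 - 1 / p) \<le> 1" by simp
    qed auto
    finally show ?thesis using norm_triangle_ineq2[of "?f t" "?f x"] by simp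
  qed
  have LF: "Lfun p (rep_aefun F)" using W1p_Lp[OF F] by (rule rep_Lfun)
  have eq: "AE x in lebesgue. x \<in> {c..c + 1} \<longrightarrow> norm (rep_aefun F x) = norm (?f x)"
  proof -
    have "F = class_on S ?f" using r by (simp add: W1p_rep_iff)
    then show ?thesis using rep_class_on[of S ?f] J by (auto elim!: eventually_mono)
  qed
  have "continuous_on {c..c + 1} ?f" using W1p_rep_continuous[OF r] J by (rule continuous_on_subset)
  then have ci: "(\<lambda>x. norm (?f x)) integrable_on {c..c + 1}"
    by (intro integrable_continuous_real continuous_intros)
  have "norm (?f t) - 2 * Lp_norm p ?G = integral {c..c + 1} (\<lambda>x. norm (?f t) - 2 * Lp_norm p ?G)" by simp
  also have "\<dots> \<le> integral {c..c + 1} (\<lambda>x. norm (?f x))"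
    by (rule integral_le[OF _ ci bd]) auto
  also have "\<dots> = integral {c..c + 1} (\<lambda>x. norm (rep_aefun F x))" by (rule integral_cong_AE_on[symmetric, OF eq])
  also have "\<dots> \<le> 2 * (c + 1 - c) powr (1 - 1 / p) * Lp_norm p F"
    unfolding Lp_norm_eq by (rule Lfun_interval(4)[OF LF]) simp
  finally show ?thesis by simp
qed

end

section \<open>Generators tested by functionals\<close>

context complex_carrier
begin

definition functional :: "('v \<Rightarrow> 'x::real_normed_vector) \<Rightarrow> bool"
  where "functional \<Lambda> \<longleftrightarrow> (\<forall>u\<in>V. \<forall>v\<in>V. \<Lambda> (u + v) = \<Lambda> u + \<Lambda> v) \<and>
    (\<forall>c. \<forall>v\<in>V. \<Lambda> (c *\<^sub>R v) = c *\<^sub>R \<Lambda> v) \<and> (\<exists>C. \<forall>v\<in>V. norm (\<Lambda> v) \<le> C * n v)"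

lemma functional_bounded_linear: "functional \<Lambda> \<Longrightarrow> bounded_linear (\<lambda>F. \<Lambda> (prj V n F))"
  unfolding functional_def by (elim conjE exE) (rule bounded_linear_comp_prj; blast)

lemma functional_derivative:
  assumes "C0_semigroup V n T" "(v, w) \<in> generator_graph V n T" "t \<ge> 0" "functional \<Lambda>"
  shows "((\<lambda>t. \<Lambda> (T t v)) has_vector_derivative \<Lambda> (T t w)) (at t within {0..})"
  using assms(4) unfolding functional_def
  by (elim conjE exE) (rule functional_has_vector_derivative[OF assms(1,2,3)]; blast)

lemma functional_integral:
  fixes \<Lambda> :: "'v \<Rightarrow> 'x::banach"
  assumes T: "C0_semigroup V n T" and vw: "(v, w) \<in> generator_graph V n T" and t: "t \<ge> 0" and \<Lambda>: "functional \<Lambda>"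
  shows "\<Lambda> (T t v) - \<Lambda> v = integral {0..t} (\<lambda>s. \<Lambda> (T s w))"
proof -
  have "((\<lambda>s. \<Lambda> (T s w)) has_integral \<Lambda> (T t v) - \<Lambda> (T 0 v)) {0..t}"
    using has_vector_derivative_within_subset[OF functional_derivative[OF T vw _ \<Lambda>]]
    by (intro fundamental_theorem_of_calculus t) auto
  moreover have "T 0 v = v" using T vw by (auto simp: C0_semigroup_def generator_graph_def)
  ultimately show ?thesis by (simp add: integral_unique)
qed

text \<open>The integrated generator identity is an equation between vectors of the carrier. Bounded
  functionals commute with its integral, so a separating set of them decides it.\<close>

lemma generator_graph_if_functionals:
  fixes Ls :: "('v \<Rightarrow> 'x::banach) set"
  assumes T: "C0_semigroup V n T" and v: "v \<in> V" and w: "w \<in> V" and Ls: "\<And>\<Lambda>. \<Lambda> \<in> Ls \<Longrightarrow> functional \<Lambda>"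
    and sep: "\<And>z. z \<in> V \<Longrightarrow> (\<And>\<Lambda>. \<Lambda> \<in> Ls \<Longrightarrow> \<Lambda> z = 0) \<Longrightarrow> z = 0"
    and eq: "\<And>\<Lambda> t. \<Lambda> \<in> Ls \<Longrightarrow> t > 0 \<Longrightarrow> \<Lambda> (T t v) - \<Lambda> v = integral {0..t} (\<lambda>s. \<Lambda> (T s w))"
  shows "(v, w) \<in> generator_graph V n T"
proof -
  interpret S: semigroup "\<lambda>t. lift_op (T t)" by unfold_locales (rule strong_semigroup_lift[OF T])
  have b: "bounded_op V n V n (T t)" if "t \<ge> 0" for t using T that by (simp add: C0_semigroup_def)
  have TV: "T t z \<in> V" if "t \<ge> 0" "z \<in> V" for t z using bounded_opD(1)[OF b] that by simp
  have "(emb V n v, emb V n w) \<in> gen (\<lambda>t. lift_op (T t))"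
  proof (rule S.gen_if_integral)
    fix t :: real assume t: "0 < t" "t < 1"
    let ?f = "\<lambda>s. lift_op (T s) (emb V n w)"
    have int: "?f integrable_on {0..t}"
      by (rule integrable_continuous_real, rule continuous_on_subset[OF S.continuous_on_apply]) auto
    let ?I = "integral {0..t} ?f"
    have pf: "prj V n (?f s) = T s w" "?f s = emb V n (T s w)" if "s \<ge> 0" for s
      using that w by (simp_all add: lift_op_emb[OF b] prj_emb TV)
    \<comment> \<open>The projection onto the summand fixes the orbit, hence also its integral,
      which therefore comes from a vector of the carrier.\<close>
    have "bounded_linear (\<lambda>F. emb V n (prj V n F))"
      by (rule bounded_linear_intro[where K = 1])
        (simp_all add: prj_add prj_scale emb_add emb_scale prj_in norm_emb norm_prj_le)
    from integral_linear[OF int this]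
    have "emb V n (prj V n ?I) = integral {0..t} (\<lambda>s. emb V n (prj V n (?f s)))" by (simp add: o_def)
    also have "\<dots> = ?I"
      by (rule integral_cong) (use w in \<open>simp add: pf prj_emb TV\<close>)
    finally have eI: "emb V n (prj V n ?I) = ?I" .
    have "prj V n ?I - (T t v - v) = 0"
    proof (rule sep)
      show "prj V n ?I - (T t v - v) \<in> V" using t v by (intro diff_closed prj_in TV) auto
      fix \<Lambda> assume \<Lambda>: "\<Lambda> \<in> Ls"
      have \<Lambda>d: "\<Lambda> (x - y) = \<Lambda> x - \<Lambda> y" if "x \<in> V" "y \<in> V" for x y
      proof -
        have "\<Lambda> (x + (-1) *\<^sub>R y) = \<Lambda> x + \<Lambda> ((-1) *\<^sub>R y)"
          using Ls[OF \<Lambda>] that scaleR_closed[OF that(2), of "-1"] unfolding functional_def by blast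
        also have "\<Lambda> ((-1) *\<^sub>R y) = (-1) *\<^sub>R \<Lambda> y" using Ls[OF \<Lambda>] that unfolding functional_def by blast
        finally show ?thesis by simp
      qed
      have "\<Lambda> (prj V n ?I) = integral {0..t} (\<lambda>s. \<Lambda> (prj V n (?f s)))"
        using integral_linear[OF int functional_bounded_linear[OF Ls[OF \<Lambda>]]] by (simp add: o_def)
      also have "\<dots> = integral {0..t} (\<lambda>s. \<Lambda> (T s w))" by (rule integral_cong) (use w in \<open>simp add: pf prj_emb TV\<close>)
      also have "\<dots> = \<Lambda> (T t v) - \<Lambda> v" using eq[OF \<Lambda> t(1)] by simp
      finally show "\<Lambda> (prj V n ?I - (T t v - v)) = 0"
        using t v by (simp add: \<Lambda>d prj_in TV diff_closed)
    qed
    then have "?I = emb V n (T t v - v)" using eI by simp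
    then show "?I = lift_op (T t) (emb V n v) - emb V n v" using t v by (simp add: lift_op_emb[OF b] emb_diff TV)
  qed
  then show ?thesis using gen_lift[OF T] v w by (simp add: prj_emb)
qed

end

section \<open>Integral identities\<close>

text \<open>Both sides equal the integral over [c, c + t] minus the one over [a, a + t].\<close>

lemma integral_shift_swap:
  fixes u :: "real \<Rightarrow> 'a::banach"
  assumes u: "continuous_on {a..c + t} u" and ac: "a \<le> c" and t: "0 \<le> t"
  shows "integral {0..t} (\<lambda>s. u (c + s) - u (a + s)) = integral {a + t..c + t} u - integral {a..c} u"
proof -
  have int: "u integrable_on {x..y}" if "a \<le> x" "y \<le> c + t" for x y
    by (rule integrable_continuous_real, rule continuous_on_subset[OF u]) (use that in auto)
  have sh: "((\<lambda>s. u (x + s)) has_integral integral {x..x + t} u) {0..t}" if "a \<le> x" "x \<le> c" for x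
    using has_integral_shift_Icc_real[of u x "integral {x..x + t} u" 0 t] int[OF that(1), of "x + t"] that(2)
    by (simp add: o_def has_integral_integral[symmetric] add.commute)
  have 1: "integral {0..t} (\<lambda>s. u (c + s) - u (a + s)) = integral {c..c + t} u - integral {a..a + t} u"
    by (rule integral_unique) (intro has_integral_diff sh, use ac in auto)
  have 2: "integral {a..c} u + integral {c..c + t} u = integral {a..c + t} u"
    using ac t by (intro Henstock_Kurzweil_Integration.integral_combine int) auto
  have 3: "integral {a..a + t} u + integral {a + t..c + t} u = integral {a..c + t} u"
    using ac t by (intro Henstock_Kurzweil_Integration.integral_combine int) auto
  have "q - r = z - y" if "y + q = s" "r + z = s" for y q r z s :: 'a
  proof -
    have "q = s - y" "r = s - z" using that by (simp_all add: eq_diff_eq add.commute)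
    then show ?thesis by simp
  qed
  from this[OF 2 3] show ?thesis unfolding 1 .
qed

text \<open>Cauchy's functional equation on a half-line. Averaging E (x + t) = E x + E t over t in
  [0, 1] expresses \<open>E\<close> through its own primitive, so \<open>E\<close> is
  differentiable, and its derivative E (1 + y) - E y is the constant \<open>E 1\<close>.\<close>

lemma additive_continuous_linear:
  fixes E :: "real \<Rightarrow> 'a::banach"
  assumes cont: "\<And>b. continuous_on {0..b} E" and add: "\<And>x t. 0 \<le> x \<Longrightarrow> 0 \<le> t \<Longrightarrow> E (x + t) = E x + E t" and x: "0 \<le> x"
  shows "E x = x *\<^sub>R E 1"
proof -
  have int: "E integrable_on {a..b}" if "0 \<le> a" for a b
    by (rule integrable_continuous_real, rule continuous_on_subset[OF cont[of b]]) (use that in auto)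
  define P where "P x = integral {0..x} E" for x
  have EP: "E x = P (x + 1) - P x - P 1" if x: "0 \<le> x" for x
  proof -
    have "P (x + 1) - P x = integral {x..x + 1} E"
      unfolding P_def using x Henstock_Kurzweil_Integration.integral_combine[of 0 x "x + 1" E] int[of 0 "x + 1"] by (simp add: algebra_simps)
    also have "\<dots> = integral {0..1} (\<lambda>t. E (x + t))"
      using integral_shift_Icc_real[of 0 1 E x] by (simp add: o_def add.commute)
    also have "\<dots> = integral {0..1} (\<lambda>t. E x + E t)" by (rule integral_cong) (use x add in auto)
    also have "\<dots> = E x + P 1" unfolding P_def using int[of 0 1] by (subst Henstock_Kurzweil_Integration.integral_add) auto
    finally show ?thesis by simp
  qed
  have dP: "(P has_vector_derivative E y) (at y within {0..b})" if "y \<in> {0..b}" for y b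
    unfolding P_def by (rule integral_has_vector_derivative[OF cont that])
  have "((\<lambda>_. E 1) has_integral E x - E 0) {0..x}"
  proof (rule fundamental_theorem_of_calculus[OF x])
    fix y assume y: "y \<in> {0..x}"
    have "(P has_vector_derivative E (y + 1)) (at (y + 1) within (\<lambda>y. y + 1) ` {0..x})"
      by (rule has_vector_derivative_within_subset[OF dP[of "y + 1" "x + 1"]]) (use y in auto)
    moreover have "((\<lambda>y. y + 1) has_vector_derivative 1) (at y within {0..x})"
      using has_vector_derivative_add[OF has_vector_derivative_id has_vector_derivative_const[of 1]] by simp
    ultimately have "((\<lambda>y. P (y + 1)) has_vector_derivative E (y + 1)) (at y within {0..x})"
      using vector_diff_chain_within[of "\<lambda>y. y + 1" 1 y "{0..x}" P "E (y + 1)"] by (simp add: o_def)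
    from has_vector_derivative_diff[OF has_vector_derivative_diff[OF this dP[OF y]] has_vector_derivative_const[of "P 1"]]
    have "((\<lambda>y. P (y + 1) - P y - P 1) has_vector_derivative E (1 + y) - E y - 0) (at y within {0..x})"
      by (simp add: add.commute)
    moreover have "E (1 + y) - E y - 0 = E 1" using add[of 1 y] y by simp
    ultimately show "(E has_vector_derivative E 1) (at y within {0..x})"
      using y EP by (intro has_vector_derivative_transform[of y "{0..x}" E "\<lambda>y. P (y + 1) - P y - P 1"]) auto
  qed
  moreover have "E 0 = 0" using add[of 0 0] by simp
  moreover have "((\<lambda>_. E 1) has_integral x *\<^sub>R E 1) {0..x}" using has_integral_const_real[of "E 1" 0 x] x by simp
  ultimately show ?thesis using has_integral_unique[of "\<lambda>_. E 1" "E x - E 0" "{0..x}" "x *\<^sub>R E 1"] by simp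
qed

section \<open>The unperturbed flow\<close>

lemma (in exponent) Lfun_continuous_on:
  fixes f :: "real \<Rightarrow> 'a::real_normed_vector"
  assumes f: "continuous_on {a..b} f" and ab: "a \<le> b" and C: "\<And>x. x \<in> {a..b} \<Longrightarrow> norm (f x) \<le> C"
  shows "Lfun p (\<lambda>x. if x \<in> {a..b} then f x else 0)" "Np p (\<lambda>x. if x \<in> {a..b} then f x else 0) \<le> (b - a) powr (1 / p) * C"
proof -
  have sm: "strongly_measurable lebesgue (\<lambda>x. if x \<in> {a..b} then f x else 0)"
    using strongly_measurable_continuous_on[OF f] by (simp add: strongly_measurable_restrict_iff)
  have C0: "0 \<le> C" using order_trans[OF norm_ge_zero C[of a]] ab by simp
  have b: "norm (if x \<in> {a..b} then f x else 0) \<le> C" for x using C C0 by auto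
  show "Lfun p (\<lambda>x. if x \<in> {a..b} then f x else 0)" "Np p (\<lambda>x. if x \<in> {a..b} then f x else 0) \<le> (b - a) powr (1 / p) * C"
    by (rule Lfun_bounded_support[OF sm b _ ab]; auto)+
qed

locale delay_flow = exponent p for p :: real +
  fixes DA :: "'a::complex_banach set" and A :: "'a \<Rightarrow> 'a" and T :: "real \<Rightarrow> 'a \<Rightarrow> 'a"
  assumes genT: "generates UNIV norm DA A T"
begin

sublocale I: sobolev p "{-1..0}"
proof unfold_locales
  show "\<exists>a b :: nat \<Rightarrow> real. (\<forall>n. a n < b n) \<and> {-1..0} = (\<Union>n. {a n..b n})"
    by (intro exI[of _ "\<lambda>_. -1"] exI[of _ "\<lambda>_. 0"]) auto
qed auto

sublocale R: sobolev p "{0..}"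
proof unfold_locales
  have "x \<in> (\<Union>n. {0..real n + 1})" if "0 \<le> x" for x :: real
  proof -
    obtain n where "x \<le> real n" using real_arch_simple[of x] by blast
    then have "x \<in> {0..real n + 1}" using that by simp
    then show ?thesis by blast
  qed
  then show "\<exists>a b :: nat \<Rightarrow> real. (\<forall>n. a n < b n) \<and> {0..} = (\<Union>n. {a n..b n})"
    by (intro exI[of _ "\<lambda>_. 0"] exI[of _ "\<lambda>n. real n + 1"]) auto
qed auto

sublocale V: complex_carrier "state_space p :: ('a \<times> 'a aefun \<times> 'a aefun) set" "state_norm p"
  by (rule complex_carrier_state)

interpretation X: complex_carrier "UNIV :: 'a set" norm by (rule complex_carrier_UNIV)

lemma T_C0: "C0_semigroup UNIV norm T" and T_graph: "generator_graph UNIV norm T = {(v, A v) | v. v \<in> DA}"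
  using genT by (auto simp: generates_def)

lemma T_bounded_op: "t \<ge> 0 \<Longrightarrow> bounded_op UNIV norm UNIV norm (T t)"
  using T_C0 by (simp add: C0_semigroup_def)

lemmas T_add = X.bounded_opD(2)[OF T_bounded_op, simplified]
  and T_scaleC = X.bounded_opD(3)[OF T_bounded_op, simplified]
  and T_scaleR = X.bounded_opD(4)[OF T_bounded_op, simplified]

lemma T_bounded_linear: "t \<ge> 0 \<Longrightarrow> bounded_linear (T t)"
proof -
  assume t: "t \<ge> 0"
  obtain C where "\<And>x. norm (T t x) \<le> C * norm x" using X.bounded_opD(5)[OF T_bounded_op[OF t]] by auto
  then show ?thesis by (intro bounded_linear_intro[where K = C]) (auto simp: T_add T_scaleR t mult.commute)
qed

definition TT :: "real \<Rightarrow> 'a \<Rightarrow>\<^sub>L 'a" where "TT t = Blinfun (T t)"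

lemma TT_apply: "t \<ge> 0 \<Longrightarrow> TT t x = T t x"
  by (simp add: TT_def bounded_linear_Blinfun_apply T_bounded_linear)

lemma T_0: "T 0 x = x" and T_plus: "s \<ge> 0 \<Longrightarrow> t \<ge> 0 \<Longrightarrow> T (s + t) x = T s (T t x)"
  using T_C0 by (auto simp: C0_semigroup_def)

lemma strong_semigroup_TT: "strong_semigroup TT"
  unfolding strong_semigroup_def
proof (intro conjI allI impI)
  show "TT 0 = id_blinfun" by (rule blinfun_eqI) (simp add: TT_apply T_0)
  show "TT (s + t) = TT s o\<^sub>L TT t" if "0 \<le> s" "0 \<le> t" for s t
    using that by (intro blinfun_eqI) (simp add: TT_apply T_plus)
  fix v
  have "((\<lambda>t. norm (T t v - v)) \<longlongrightarrow> 0) (at_right 0)" using T_C0 by (simp add: C0_semigroup_def)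
  then have "((\<lambda>t. T t v) \<longlongrightarrow> v) (at_right 0)" by (simp add: LIM_zero_iff tendsto_norm_zero_iff)
  moreover have "\<forall>\<^sub>F t in at_right 0. T t v = TT t v"
    using eventually_at_right_less by eventually_elim (simp add: TT_apply)
  ultimately show "((\<lambda>t. TT t v) \<longlongrightarrow> v) (at_right 0)" by (rule Lim_transform_eventually)
qed

sublocale TT: semigroup TT by unfold_locales (rule strong_semigroup_TT)

lemma gen_TT: "(x, y) \<in> gen TT \<longleftrightarrow> x \<in> DA \<and> y = A x"
proof -
  have ev: "\<forall>\<^sub>F t in at_right 0. (1 / t) *\<^sub>R (TT t x - x) = (1 / t) *\<^sub>R (T t x - x)"
    using eventually_at_right_less by eventually_elim (simp add: TT_apply)
  have "(x, y) \<in> gen TT \<longleftrightarrow> ((\<lambda>t. (1 / t) *\<^sub>R (T t x - x)) \<longlongrightarrow> y) (at_right 0)"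
    unfolding gen_def using tendsto_cong[OF ev] by simp
  also have "\<dots> \<longleftrightarrow> (x, y) \<in> generator_graph UNIV norm T"
    by (simp add: generator_graph_def tendsto_norm_zero_iff LIM_zero_iff)
  also have "\<dots> \<longleftrightarrow> x \<in> DA \<and> y = A x" by (auto simp: T_graph)
  finally show ?thesis .
qed

lemma T_continuous: "continuous_on {0..} (\<lambda>t. T t x)"
  by (rule continuous_on_eq[OF TT.continuous_on_apply[of x]]) (simp add: TT_apply)

text \<open>\<open>W y \<psi>\<close> prolongs the history \<open>\<psi>\<close> by the orbit of \<open>y\<close>, so that the unperturbed flow is a
  translation of \<open>W\<close>.\<close>

definition W :: "'a \<Rightarrow> 'a aefun \<Rightarrow> real \<Rightarrow> 'a"
  where "W y \<psi> r = (if r \<le> 0 then rep_aefun \<psi> r else T r y)"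

definition flow :: "real \<Rightarrow> 'a \<times> 'a aefun \<times> 'a aefun \<Rightarrow> 'a \<times> 'a aefun \<times> 'a aefun"
  where "flow t v = (T t (fst v), class_on {-1..0} (\<lambda>\<theta>. W (fst v) (fst (snd v)) (t + \<theta>)),
    class_on {0..} (\<lambda>s. rep_aefun (snd (snd v)) (t + s)))"

text \<open>Identifies the argument of the operator in condition (M) with the second component of
  the flow, so that (M) becomes an estimate along flow orbits.\<close>

lemma history_shift_eq:
  assumes "t \<ge> 0"
  shows "semigroup_history T t y + nilpotent_shift t \<psi> = class_on {-1..0} (\<lambda>\<theta>. W y \<psi> (t + \<theta>))"
proof (rule aefun_eqI)
  show "AE x in lebesgue. rep_aefun (semigroup_history T t y + nilpotent_shift t \<psi>) x =
      rep_aefun (class_on {-1..0} (\<lambda>\<theta>. W y \<psi> (t + \<theta>))) x"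
    using rep_plus[of "semigroup_history T t y" "nilpotent_shift t \<psi>"]
      rep_class_on[of "{-1..0}" "\<lambda>\<tau>. if - t < \<tau> then T (t + \<tau>) y else 0"]
      rep_class_on[of "{-1..0}" "\<lambda>\<theta>. if t + \<theta> \<le> 0 then rep_aefun \<psi> (t + \<theta>) else 0"]
      rep_class_on[of "{-1..0}" "\<lambda>\<theta>. W y \<psi> (t + \<theta>)"]
    unfolding semigroup_history_def nilpotent_shift_def
    by eventually_elim (auto simp: W_def)
qed

text \<open>The orbit in \<open>W\<close> may grow, so it is cut off at \<open>c\<close> to obtain a
  p-integrable function; up to time \<open>c\<close> the window [-1, 0] does not see the
  cut.\<close>

definition Wc :: "real \<Rightarrow> 'a \<Rightarrow> 'a aefun \<Rightarrow> real \<Rightarrow> 'a"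
  where "Wc c y \<psi> r = (if r \<in> {-1..c} then W y \<psi> r else 0)"

lemma Lfun_Wc:
  assumes \<psi>: "\<psi> \<in> Lp p {-1..0}" and c: "0 \<le> c"
  shows "Lfun p (Wc c y \<psi>)"
    and "(\<And>r. r \<in> {0..c} \<Longrightarrow> norm (TT r) \<le> M) \<Longrightarrow> Np p (Wc c y \<psi>) \<le> Lp_norm p \<psi> + c powr (1 / p) * (M * norm y)"
proof -
  let ?f = "\<lambda>r. if r \<in> {-1..0} then rep_aefun \<psi> r else 0" and ?g = "\<lambda>r. if r \<in> {0..c} then T r y else 0"
  have f: "Lfun p ?f" "Np p ?f \<le> Lp_norm p \<psi>"
    unfolding Lp_norm_eq by (rule Lfun_restrict[OF I.rep_Lfun[OF \<psi>]], simp)+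
  have gc: "continuous_on {0..c} (\<lambda>r. T r y)" by (rule continuous_on_subset[OF T_continuous]) auto
  have gb: "norm (T r y) \<le> M * norm y" if "\<And>r. r \<in> {0..c} \<Longrightarrow> norm (TT r) \<le> M" "r \<in> {0..c}" for r M
    using that(2) norm_blinfun[of "TT r" y] mult_right_mono[OF that(1)[OF that(2)], of "norm y"] by (simp add: TT_apply)
  obtain M0 where M0: "\<forall>r\<in>{0..c}. norm (TT r) \<le> M0" using TT.bounded_on by auto
  have g: "Lfun p ?g" by (rule Lfun_continuous_on(1)[OF gc c gb[of M0]]) (use M0 in auto)
  \<comment> \<open>At 0 both pieces contribute, whereas \<open>W\<close> takes the history there;
    this single point is a null set.\<close>
  have ae: "AE r in lebesgue. ?f r + ?g r = Wc c y \<psi> r"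
  proof -
    have "AE r in lebesgue. r \<notin> {0::real}" by (rule AE_not_in) auto
    then show ?thesis by eventually_elim (use c in \<open>auto simp: Wc_def W_def\<close>)
  qed
  show "Lfun p (Wc c y \<psi>)" by (rule Lfun_cong_AE[OF Lfun_add(1)[OF f(1) g] ae])
  assume M: "\<And>r. r \<in> {0..c} \<Longrightarrow> norm (TT r) \<le> M"
  have "Np p (Wc c y \<psi>) = Np p (\<lambda>r. ?f r + ?g r)"
    by (rule Np_cong_AE[symmetric, OF _ ae]) (use Lfun_add(1)[OF f(1) g] in \<open>simp add: Lfun_def\<close>)
  also have "\<dots> \<le> Np p ?f + Np p ?g" by (rule Lfun_add(2)[OF f(1) g])
  also have "\<dots> \<le> Lp_norm p \<psi> + (c - 0) powr (1 / p) * (M * norm y)"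
    by (rule add_mono[OF f(2) Lfun_continuous_on(2)[OF gc c gb[OF M]]])
  finally show "Np p (Wc c y \<psi>) \<le> Lp_norm p \<psi> + c powr (1 / p) * (M * norm y)" by simp
qed

lemma restrict_W_shift:
  assumes "0 \<le> t" "t \<le> c"
  shows "(if \<theta> \<in> {-1..0} then W y \<psi> (t + \<theta>) else 0) = (if \<theta> \<in> {-1..0} then Wc c y \<psi> (t + \<theta>) else 0)"
  using assms by (auto simp: Wc_def)

lemma flow_second:
  assumes \<psi>: "\<psi> \<in> Lp p {-1..0}" and t: "0 \<le> t"
  shows "class_on {-1..0} (\<lambda>\<theta>. W y \<psi> (t + \<theta>)) \<in> Lp p {-1..0}"
    "Lp_norm p (class_on {-1..0} (\<lambda>\<theta>. W y \<psi> (t + \<theta>))) \<le> Np p (Wc t y \<psi>)"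
proof -
  have eq: "(\<lambda>\<theta>. if \<theta> \<in> {-1..0} then W y \<psi> (t + \<theta>) else 0) = (\<lambda>\<theta>. if \<theta> \<in> {-1..0} then Wc t y \<psi> (t + \<theta>) else 0)"
    using restrict_W_shift[OF t order_refl] by blast
  note L = Lfun_restrict[OF Lfun_affine(1)[OF Lfun_Wc(1)[OF \<psi> t]] I.S_meas, of y t]
  show "class_on {-1..0} (\<lambda>\<theta>. W y \<psi> (t + \<theta>)) \<in> Lp p {-1..0}"
    by (rule class_on_Lp(1)[OF I.S_meas]) (unfold eq, rule L)
  have "Lp_norm p (class_on {-1..0} (\<lambda>\<theta>. W y \<psi> (t + \<theta>))) = Np p (\<lambda>\<theta>. if \<theta> \<in> {-1..0} then Wc t y \<psi> (t + \<theta>) else 0)"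
    using class_on_Lp(2)[OF I.S_meas, of "\<lambda>\<theta>. W y \<psi> (t + \<theta>)"] L(1) unfolding eq by simp
  also have "\<dots> \<le> Np p (\<lambda>\<theta>. Wc t y \<psi> (t + \<theta>))" by (rule L(2))
  also have "\<dots> = Np p (Wc t y \<psi>)" by (rule Lfun_affine(2)[OF Lfun_Wc(1)[OF \<psi> t]])
  finally show "Lp_norm p (class_on {-1..0} (\<lambda>\<theta>. W y \<psi> (t + \<theta>))) \<le> Np p (Wc t y \<psi>)" .
qed

lemma flow_third:
  assumes h: "h \<in> Lp p {0..}"
  shows "class_on {0..} (\<lambda>s. rep_aefun h (t + s)) \<in> Lp p {0..}"
    "Lp_norm p (class_on {0..} (\<lambda>s. rep_aefun h (t + s))) \<le> Lp_norm p h"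
proof -
  note L = Lfun_restrict[OF Lfun_affine(1)[OF R.rep_Lfun[OF h]] R.S_meas, of t]
  show "class_on {0..} (\<lambda>s. rep_aefun h (t + s)) \<in> Lp p {0..}" by (rule class_on_Lp(1)[OF R.S_meas L(1)])
  have "Lp_norm p (class_on {0..} (\<lambda>s. rep_aefun h (t + s))) \<le> Np p (\<lambda>s. rep_aefun h (t + s))"
    unfolding class_on_Lp(2)[OF R.S_meas L(1)] by (rule L(2))
  then show "Lp_norm p (class_on {0..} (\<lambda>s. rep_aefun h (t + s))) \<le> Lp_norm p h"
    unfolding Lp_norm_eq by (simp add: Lfun_affine(2)[OF R.rep_Lfun[OF h]])
qed

lemma state_space_iff: "v \<in> state_space p \<longleftrightarrow> fst (snd v) \<in> Lp p {-1..0} \<and> snd (snd v) \<in> Lp p {0..}"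
  by (auto simp: state_space_def mem_Times_iff)

lemma state_norm_eq: "state_norm p v = norm (fst v) + Lp_norm p (fst (snd v)) + Lp_norm p (snd (snd v))"
  by (simp add: state_norm_def case_prod_unfold)

lemma AE_shift: "AE x in lebesgue. P x \<Longrightarrow> AE x in lebesgue. P (t + x)" for t :: real
  using AE_lebesgue_affine[of P 1 t] by simp

lemma flow_bounded_op:
  assumes t: "0 \<le> t"
  shows "bounded_op (state_space p) (state_norm p) (state_space p) (state_norm p) (flow t)"
  unfolding bounded_op_def
proof (intro conjI ballI allI)
  show "flow t v \<in> state_space p" if "v \<in> state_space p" for v
    unfolding state_space_iff flow_def using that[unfolded state_space_iff] t by (auto intro!: flow_second(1) flow_third(1))
  show "flow t (u + v) = flow t u + flow t v" for u v
  proof -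
    have "class_on {-1..0} (\<lambda>\<theta>. W (fst u + fst v) (fst (snd u) + fst (snd v)) (t + \<theta>)) =
        class_on {-1..0} (\<lambda>\<theta>. W (fst u) (fst (snd u)) (t + \<theta>)) + class_on {-1..0} (\<lambda>\<theta>. W (fst v) (fst (snd v)) (t + \<theta>))"
    proof (rule aefun_eqI)
      show "AE x in lebesgue. rep_aefun (class_on {-1..0} (\<lambda>\<theta>. W (fst u + fst v) (fst (snd u) + fst (snd v)) (t + \<theta>))) x =
        rep_aefun (class_on {-1..0} (\<lambda>\<theta>. W (fst u) (fst (snd u)) (t + \<theta>)) + class_on {-1..0} (\<lambda>\<theta>. W (fst v) (fst (snd v)) (t + \<theta>))) x"
        using rep_class_on[of "{-1..0}" "\<lambda>\<theta>. W (fst u + fst v) (fst (snd u) + fst (snd v)) (t + \<theta>)"]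
          rep_class_on[of "{-1..0}" "\<lambda>\<theta>. W (fst u) (fst (snd u)) (t + \<theta>)"]
          rep_class_on[of "{-1..0}" "\<lambda>\<theta>. W (fst v) (fst (snd v)) (t + \<theta>)"]
          rep_plus[of "class_on {-1..0} (\<lambda>\<theta>. W (fst u) (fst (snd u)) (t + \<theta>))" "class_on {-1..0} (\<lambda>\<theta>. W (fst v) (fst (snd v)) (t + \<theta>))"]
          AE_shift[OF rep_plus[of "fst (snd u)" "fst (snd v)"], of t]
        by eventually_elim (auto simp: W_def T_add)
    qed
    moreover have "class_on {0..} (\<lambda>s. rep_aefun (snd (snd u) + snd (snd v)) (t + s)) =
        class_on {0..} (\<lambda>s. rep_aefun (snd (snd u)) (t + s)) + class_on {0..} (\<lambda>s. rep_aefun (snd (snd v)) (t + s))"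
    proof (rule aefun_eqI)
      show "AE x in lebesgue. rep_aefun (class_on {0..} (\<lambda>s. rep_aefun (snd (snd u) + snd (snd v)) (t + s))) x =
          rep_aefun (class_on {0..} (\<lambda>s. rep_aefun (snd (snd u)) (t + s)) + class_on {0..} (\<lambda>s. rep_aefun (snd (snd v)) (t + s))) x"
        using rep_class_on[of "{0..}" "\<lambda>s. rep_aefun (snd (snd u) + snd (snd v)) (t + s)"]
          rep_class_on[of "{0..}" "\<lambda>s. rep_aefun (snd (snd u)) (t + s)"]
          rep_class_on[of "{0..}" "\<lambda>s. rep_aefun (snd (snd v)) (t + s)"]
          rep_plus[of "class_on {0..} (\<lambda>s. rep_aefun (snd (snd u)) (t + s))" "class_on {0..} (\<lambda>s. rep_aefun (snd (snd v)) (t + s))"]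
          AE_shift[OF rep_plus[of "snd (snd u)" "snd (snd v)"], of t]
        by eventually_elim auto
    qed
    ultimately show ?thesis using t by (simp add: flow_def T_add plus_prod_def)
  qed
  show "flow t (c *\<^sub>C v) = c *\<^sub>C flow t v" for c v
  proof -
    have c0: "c *\<^sub>C (0 :: 'a) = 0" using norm_scaleC[of c "0 :: 'a"] by simp
    have "class_on {-1..0} (\<lambda>\<theta>. W (c *\<^sub>C fst v) (c *\<^sub>C fst (snd v)) (t + \<theta>)) = c *\<^sub>C class_on {-1..0} (\<lambda>\<theta>. W (fst v) (fst (snd v)) (t + \<theta>))"
    proof (rule aefun_eqI)
      show "AE x in lebesgue. rep_aefun (class_on {-1..0} (\<lambda>\<theta>. W (c *\<^sub>C fst v) (c *\<^sub>C fst (snd v)) (t + \<theta>))) x =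
          rep_aefun (c *\<^sub>C class_on {-1..0} (\<lambda>\<theta>. W (fst v) (fst (snd v)) (t + \<theta>))) x"
        using rep_class_on[of "{-1..0}" "\<lambda>\<theta>. W (c *\<^sub>C fst v) (c *\<^sub>C fst (snd v)) (t + \<theta>)"]
          rep_class_on[of "{-1..0}" "\<lambda>\<theta>. W (fst v) (fst (snd v)) (t + \<theta>)"]
          rep_scaleC[of c "class_on {-1..0} (\<lambda>\<theta>. W (fst v) (fst (snd v)) (t + \<theta>))"]
          AE_shift[OF rep_scaleC[of c "fst (snd v)"], of t]
        by eventually_elim (auto simp: W_def T_scaleC c0)
    qed
    moreover have "class_on {0..} (\<lambda>s. rep_aefun (c *\<^sub>C snd (snd v)) (t + s)) = c *\<^sub>C class_on {0..} (\<lambda>s. rep_aefun (snd (snd v)) (t + s))"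
    proof (rule aefun_eqI)
      show "AE x in lebesgue. rep_aefun (class_on {0..} (\<lambda>s. rep_aefun (c *\<^sub>C snd (snd v)) (t + s))) x =
          rep_aefun (c *\<^sub>C class_on {0..} (\<lambda>s. rep_aefun (snd (snd v)) (t + s))) x"
        using rep_class_on[of "{0..}" "\<lambda>s. rep_aefun (c *\<^sub>C snd (snd v)) (t + s)"]
          rep_class_on[of "{0..}" "\<lambda>s. rep_aefun (snd (snd v)) (t + s)"]
          rep_scaleC[of c "class_on {0..} (\<lambda>s. rep_aefun (snd (snd v)) (t + s))"]
          AE_shift[OF rep_scaleC[of c "snd (snd v)"], of t]
        by eventually_elim (auto simp: c0)
    qed
    ultimately show ?thesis using t by (simp add: flow_def T_scaleC scaleC_prod_def)
  qed
  obtain M where M: "M \<ge> 1" "\<forall>r\<in>{0..t}. norm (TT r) \<le> M" using TT.bounded_on by auto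
  show "\<exists>C. \<forall>v\<in>state_space p. state_norm p (flow t v) \<le> C * state_norm p v"
  proof (intro exI ballI)
    fix v :: "'a \<times> 'a aefun \<times> 'a aefun" assume v: "v \<in> state_space p"
    have v': "fst (snd v) \<in> Lp p {-1..0}" "snd (snd v) \<in> Lp p {0..}" using v by (auto simp: state_space_iff)
    have 1: "norm (T t (fst v)) \<le> M * norm (fst v)"
      using norm_blinfun[of "TT t" "fst v"] mult_right_mono[of "norm (TT t)" M "norm (fst v)"] M t by (simp add: TT_apply)
    have 2: "Lp_norm p (class_on {-1..0} (\<lambda>\<theta>. W (fst v) (fst (snd v)) (t + \<theta>))) \<le> Lp_norm p (fst (snd v)) + t powr (1 / p) * (M * norm (fst v))"
      using flow_second(2)[OF v'(1) t, of "fst v"] Lfun_Wc(2)[OF v'(1) t, of M "fst v"] M by auto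
    note 3 = flow_third(2)[OF v'(2), of t]
    have "state_norm p (flow t v) \<le> M * norm (fst v) + (Lp_norm p (fst (snd v)) + t powr (1 / p) * (M * norm (fst v))) + Lp_norm p (snd (snd v))"
      unfolding state_norm_eq by (simp add: flow_def) (use 1 2 3 in linarith)
    also have "\<dots> \<le> (M + t powr (1 / p) * M) * state_norm p v"
    proof -
      have "1 \<le> M + t powr (1 / p) * M" using M by (simp add: add_increasing2)
      from mult_right_mono[OF this, of "Lp_norm p (fst (snd v))"] mult_right_mono[OF this, of "Lp_norm p (snd (snd v))"]
      show ?thesis unfolding state_norm_eq by (simp add: algebra_simps)
    qed
    finally show "state_norm p (flow t v) \<le> (M + t powr (1 / p) * M) * state_norm p v" .
  qed
qed

text \<open>For t < 1 the shifted window stays in [-1, 1], so strong continuity of the second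
  component is that of translations of \<open>Wc 1\<close>; for the third it is that of translations
  of its representative.\<close>

lemma flow_C0: "C0_semigroup (state_space p) (state_norm p) flow"
  unfolding C0_semigroup_def
proof (intro conjI allI impI ballI flow_bounded_op)
  show "flow 0 v = v" if v: "v \<in> state_space p" for v
  proof -
    have v': "fst (snd v) \<in> Lp p {-1..0}" "snd (snd v) \<in> Lp p {0..}" using v by (auto simp: state_space_iff)
    have "class_on {-1..0} (\<lambda>\<theta>. W (fst v) (fst (snd v)) (0 + \<theta>)) = fst (snd v)"
    proof (rule aefun_eqI)
      show "AE x in lebesgue. rep_aefun (class_on {-1..0} (\<lambda>\<theta>. W (fst v) (fst (snd v)) (0 + \<theta>))) x = rep_aefun (fst (snd v)) x"
        using rep_class_on[of "{-1..0}" "\<lambda>\<theta>. W (fst v) (fst (snd v)) (0 + \<theta>)"]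
          v'(1)[unfolded Lp_iff[OF I.S_meas], THEN conjunct2]
        by eventually_elim (auto simp: W_def)
    qed
    moreover have "class_on {0..} (\<lambda>s. rep_aefun (snd (snd v)) (0 + s)) = snd (snd v)"
    proof (rule aefun_eqI)
      show "AE x in lebesgue. rep_aefun (class_on {0..} (\<lambda>s. rep_aefun (snd (snd v)) (0 + s))) x = rep_aefun (snd (snd v)) x"
        using rep_class_on[of "{0..}" "\<lambda>s. rep_aefun (snd (snd v)) (0 + s)"]
          v'(2)[unfolded Lp_iff[OF R.S_meas], THEN conjunct2]
        by eventually_elim auto
    qed
    ultimately show ?thesis by (simp add: flow_def T_0)
  qed
  show "flow (s + t) v = flow s (flow t v)" if st: "0 \<le> s" "0 \<le> t" for s t v
  proof -
    have "class_on {-1..0} (\<lambda>\<theta>. W (fst v) (fst (snd v)) (s + t + \<theta>)) =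
        class_on {-1..0} (\<lambda>\<theta>. W (T t (fst v)) (class_on {-1..0} (\<lambda>\<theta>. W (fst v) (fst (snd v)) (t + \<theta>))) (s + \<theta>))"
      unfolding class_on_eq_iff
      using AE_shift[OF rep_class_on[of "{-1..0}" "\<lambda>\<theta>. W (fst v) (fst (snd v)) (t + \<theta>)"], of s]
    proof eventually_elim
      case (elim \<theta>)
      show ?case
      proof
        assume \<theta>: "\<theta> \<in> {-1..0}"
        show "W (fst v) (fst (snd v)) (s + t + \<theta>) = W (T t (fst v)) (class_on {-1..0} (\<lambda>\<theta>. W (fst v) (fst (snd v)) (t + \<theta>))) (s + \<theta>)"
        proof (cases "s + \<theta> \<le> 0")
          case True
          then show ?thesis using elim \<theta> st by (simp add: W_def algebra_simps)
        next
          case False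
          then show ?thesis using st T_plus[of "s + \<theta>" t "fst v"] by (simp add: W_def algebra_simps)
        qed
      qed
    qed
    moreover have "class_on {0..} (\<lambda>r. rep_aefun (snd (snd v)) (s + t + r)) =
        class_on {0..} (\<lambda>r. rep_aefun (class_on {0..} (\<lambda>s. rep_aefun (snd (snd v)) (t + s))) (s + r))"
      unfolding class_on_eq_iff
      using AE_shift[OF rep_class_on[of "{0..}" "\<lambda>s. rep_aefun (snd (snd v)) (t + s)"], of s]
      by eventually_elim (use st in \<open>auto simp: algebra_simps\<close>)
    ultimately show ?thesis using st by (simp add: flow_def T_plus)
  qed
  fix v :: "'a \<times> 'a aefun \<times> 'a aefun" assume v: "v \<in> state_space p"
  have v': "fst (snd v) \<in> Lp p {-1..0}" "snd (snd v) \<in> Lp p {0..}" using v by (auto simp: state_space_iff)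
  let ?w = "Wc 1 (fst v) (fst (snd v))" and ?h = "rep_aefun (snd (snd v))"
  have Lw: "Lfun p ?w" by (rule Lfun_Wc(1)[OF v'(1)]) simp
  have Lh: "Lfun p ?h" by (rule R.rep_Lfun[OF v'(2)])
  have bd: "state_norm p (flow t v - v) \<le> norm (TT t (fst v) - fst v) + Np p (\<lambda>x. ?w (t + x) - ?w x) + Np p (\<lambda>x. ?h (t + x) - ?h x)"
    if t: "0 < t" "t < 1" for t
  proof -
    have "Lp_norm p (class_on {-1..0} (\<lambda>\<theta>. W (fst v) (fst (snd v)) (t + \<theta>)) - fst (snd v)) \<le> Np p (\<lambda>x. ?w (t + x) - ?w x)"
    proof -
      note L = Lfun_restrict[OF Lfun_diff(1)[OF Lfun_affine(1)[OF Lw] Lw] I.S_meas, of t]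
      have "Np p (\<lambda>x. if x \<in> {-1..0} then ?w (t + x) - ?w x else 0) =
        Np p (rep_aefun (class_on {-1..0} (\<lambda>\<theta>. W (fst v) (fst (snd v)) (t + \<theta>)) - fst (snd v)))"
      proof (rule Np_cong_AE)
        show "strongly_measurable lebesgue (\<lambda>x. if x \<in> {-1..0} then ?w (t + x) - ?w x else 0)"
          using L(1) by (simp add: Lfun_def)
        show "AE x in lebesgue. (if x \<in> {-1..0} then ?w (t + x) - ?w x else 0) =
          rep_aefun (class_on {-1..0} (\<lambda>\<theta>. W (fst v) (fst (snd v)) (t + \<theta>)) - fst (snd v)) x"
          using rep_minus[of "class_on {-1..0} (\<lambda>\<theta>. W (fst v) (fst (snd v)) (t + \<theta>))" "fst (snd v)"]
            rep_class_on[of "{-1..0}" "\<lambda>\<theta>. W (fst v) (fst (snd v)) (t + \<theta>)"]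
            v'(1)[unfolded Lp_iff[OF I.S_meas], THEN conjunct2]
        proof eventually_elim
          case (elim x)
          show ?case
          proof (cases "x \<in> {-1..0}")
            case True
            then have "?w (t + x) = W (fst v) (fst (snd v)) (t + x)" "?w x = rep_aefun (fst (snd v)) x"
              using t by (auto simp: Wc_def W_def)
            then show ?thesis using elim True by simp
          next
            case False
            show ?thesis using elim False unfolding if_not_P[OF False] by auto
          qed
        qed
      qed
      then show ?thesis using L(2) by (simp add: Lp_norm_eq)
    qed
    moreover have "Lp_norm p (class_on {0..} (\<lambda>s. ?h (t + s)) - snd (snd v)) \<le> Np p (\<lambda>x. ?h (t + x) - ?h x)"
    proof -
      note L = Lfun_restrict[OF Lfun_diff(1)[OF Lfun_affine(1)[OF Lh] Lh] R.S_meas, of t]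
      have "Np p (\<lambda>x. if x \<in> {0..} then ?h (t + x) - ?h x else 0) = Np p (rep_aefun (class_on {0..} (\<lambda>s. ?h (t + s)) - snd (snd v)))"
      proof (rule Np_cong_AE)
        show "strongly_measurable lebesgue (\<lambda>x. if x \<in> {0..} then ?h (t + x) - ?h x else 0)"
          using L(1) by (simp add: Lfun_def)
        show "AE x in lebesgue. (if x \<in> {0..} then ?h (t + x) - ?h x else 0) = rep_aefun (class_on {0..} (\<lambda>s. ?h (t + s)) - snd (snd v)) x"
          using rep_minus[of "class_on {0..} (\<lambda>s. ?h (t + s))" "snd (snd v)"] rep_class_on[of "{0..}" "\<lambda>s. ?h (t + s)"]
            v'(2)[unfolded Lp_iff[OF R.S_meas], THEN conjunct2]
          by eventually_elim auto
      qed
      then show ?thesis using L(2) by (simp add: Lp_norm_eq)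
    qed
    ultimately show ?thesis using t by (simp add: state_norm_eq flow_def TT_apply)
  qed
  show "((\<lambda>t. state_norm p (flow t v - v)) \<longlongrightarrow> 0) (at_right 0)"
  proof (rule tendstoI)
    fix e :: real assume e: "e > 0"
    have "((\<lambda>t. norm (TT t (fst v) - fst v)) \<longlongrightarrow> 0) (at_right 0)"
      using TT.tendsto_at_0[of "fst v"] by (simp add: LIM_zero_iff tendsto_norm_zero_iff)
    then have 1: "\<forall>\<^sub>F t in at_right 0. norm (TT t (fst v) - fst v) < e / 3" using e by (intro order_tendstoD) auto
    obtain d2 where d2: "d2 > 0" "\<And>t. \<bar>t\<bar> < d2 \<Longrightarrow> Np p (\<lambda>x. ?w (t + x) - ?w x) < e / 3"
      using translation_continuous[OF Lw, of "e / 3"] e by auto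
    obtain d3 where d3: "d3 > 0" "\<And>t. \<bar>t\<bar> < d3 \<Longrightarrow> Np p (\<lambda>x. ?h (t + x) - ?h x) < e / 3"
      using translation_continuous[OF Lh, of "e / 3"] e by auto
    have "\<forall>\<^sub>F t in at_right 0. t < min 1 (min d2 d3)"
      using d2 d3 by (intro eventually_at_rightI[of 0 "min 1 (min d2 d3)"]) auto
    with 1 eventually_at_right_less[of 0] show "\<forall>\<^sub>F t in at_right 0. dist (state_norm p (flow t v - v)) 0 < e"
    proof eventually_elim
      case (elim t)
      have "state_norm p (flow t v - v) < e" using bd[of t] elim d2(2)[of t] d3(2)[of t] by auto
      moreover have "0 \<le> state_norm p (flow t v - v)" unfolding state_norm_eq by simp
      ultimately show ?case by (simp add: dist_real_def)
    qed
  qed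
qed

end

section \<open>Recognising L^p classes by their integrals over intervals\<close>

context sobolev
begin

lemma rep_integral_add:
  fixes F G :: "'a::complex_banach aefun"
  assumes "F \<in> Lp p S" "G \<in> Lp p S"
  shows "integral {a..c} (rep_aefun (F + G)) = integral {a..c} (rep_aefun F) + integral {a..c} (rep_aefun G)"
proof -
  have "integral {a..c} (rep_aefun (F + G)) = integral {a..c} (\<lambda>x. rep_aefun F x + rep_aefun G x)"
    by (rule integral_cong_AE_on) (use rep_plus[of F G] in \<open>auto elim: eventually_mono\<close>)
  then show ?thesis
    by (simp add: Henstock_Kurzweil_Integration.integral_add Lfun_interval(2)[OF rep_Lfun[OF assms(1)]] Lfun_interval(2)[OF rep_Lfun[OF assms(2)]])
qed

lemma rep_integral_scaleR: "integral {a..c} (rep_aefun (r *\<^sub>R F)) = r *\<^sub>R integral {a..c} (rep_aefun F)"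
  for F :: "'a::complex_banach aefun"
proof -
  have "integral {a..c} (rep_aefun (r *\<^sub>R F)) = integral {a..c} (\<lambda>x. r *\<^sub>R rep_aefun F x)"
    by (rule integral_cong_AE_on) (use rep_scaleR[of r F] in \<open>auto elim: eventually_mono\<close>)
  then show ?thesis by simp
qed

lemma rep_integral_bound:
  fixes F :: "'a::complex_banach aefun"
  assumes F: "F \<in> Lp p S" and ac: "a \<le> c"
  shows "norm (integral {a..c} (rep_aefun F)) \<le> 2 * (c - a) powr (1 - 1 / p) * Lp_norm p F"
proof (cases "a = c")
  case False
  have "norm (integral {a..c} (rep_aefun F)) \<le> integral {a..c} (\<lambda>x. norm (rep_aefun F x))"
    by (intro integral_norm_bound_integral Lfun_interval(2,3)[OF rep_Lfun[OF F]]) simp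
  then show ?thesis using Lfun_interval(4)[OF rep_Lfun[OF F], of a c] False ac by (simp add: Lp_norm_eq)
qed simp

text \<open>On each compact interval of the cover \<open>f\<close> is bounded, so its restriction is
  p-integrable on the line, and the difference has vanishing integrals.\<close>

lemma Lp_eq_class_on_if_integrals:
  fixes F :: "'a::complex_banach aefun"
  assumes F: "F \<in> Lp p S" and f: "\<And>a c. {a..c} \<subseteq> S \<Longrightarrow> continuous_on {a..c} f"
    and eq: "\<And>a c. a \<le> c \<Longrightarrow> {a..c} \<subseteq> S \<Longrightarrow> integral {a..c} (rep_aefun F) = integral {a..c} f"
  shows "F = class_on S f"
proof -
  obtain a b :: "nat \<Rightarrow> real" where ab: "\<And>n. a n < b n" and S: "S = (\<Union>n. {a n..b n})" using cover by auto
  have "AE x in lebesgue. x \<in> {a n..b n} \<longrightarrow> rep_aefun F x = f x" for n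
  proof -
    let ?g = "\<lambda>x. if x \<in> {a n..b n} then f x else 0"
    have sub: "{a n..b n} \<subseteq> S" using S by auto
    have cf: "continuous_on {a n..b n} f" by (rule f[OF sub])
    obtain C where "\<And>x. x \<in> {a n..b n} \<Longrightarrow> norm (f x) \<le> C"
      using compact_imp_bounded[OF compact_continuous_image[OF cf compact_Icc]] unfolding bounded_iff by blast
    then have g: "Lfun p ?g" by (rule Lfun_continuous_on(1)[OF cf less_imp_le[OF ab]])
    have "AE x in lebesgue. x \<in> {a n..b n} \<longrightarrow> rep_aefun F x - ?g x = 0"
    proof (rule AE_zero_if_integrals_zero[OF Lfun_diff(1)[OF rep_Lfun[OF F] g] _ ab])
      fix x y assume xy: "a n \<le> x" "x \<le> y" "y \<le> b n"
      have "integral {x..y} ?g = integral {x..y} f" by (rule integral_cong) (use xy in auto)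
      then show "integral {x..y} (\<lambda>z. rep_aefun F z - ?g z) = 0"
        using eq[OF xy(2)] order_trans[OF _ sub, of "{x..y}"] xy
        by (subst Henstock_Kurzweil_Integration.integral_diff[OF Lfun_interval(2)[OF rep_Lfun[OF F]] Lfun_interval(2)[OF g]]) auto
    qed
    then show ?thesis by (rule eventually_mono) auto
  qed
  then have "AE x in lebesgue. \<forall>n. x \<in> {a n..b n} \<longrightarrow> rep_aefun F x = f x" by (subst AE_all_countable) blast
  then have "AE x in lebesgue. rep_aefun F x = rep_aefun (class_on S f) x"
    using rep_class_on[of S f] F[unfolded Lp_iff[OF S_meas], THEN conjunct2]
  proof eventually_elim
    case (elim x)
    show ?case
    proof (cases "x \<in> S")
      case True
      then obtain n where "x \<in> {a n..b n}" using S by blast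
      then have "rep_aefun F x = f x" using elim by blast
      then show ?thesis using elim True by simp
    qed (use elim in simp)
  qed
  then show ?thesis by (rule aefun_eqI)
qed

lemma Lp_zero_if_integrals_zero:
  fixes F :: "'a::complex_banach aefun"
  assumes F: "F \<in> Lp p S" and eq: "\<And>a c. a \<le> c \<Longrightarrow> {a..c} \<subseteq> S \<Longrightarrow> integral {a..c} (rep_aefun F) = 0"
  shows "F = 0"
proof -
  have "F = class_on S (\<lambda>_. 0)" using eq by (intro Lp_eq_class_on_if_integrals[OF F]) auto
  also have "\<dots> = 0"
    by (rule aefun_eqI) (use rep_class_on[of S "\<lambda>_. 0 :: 'a"] rep_zero in \<open>eventually_elim, simp\<close>)
  finally show ?thesis .
qed

end

section \<open>Testing the flow by functionals and identifying its generator\<close>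

context delay_flow
begin

definition second :: "real \<Rightarrow> real \<Rightarrow> 'a \<times> 'a aefun \<times> 'a aefun \<Rightarrow> 'a"
  where "second a c v = integral {a..c} (rep_aefun (fst (snd v)))"

definition third :: "real \<Rightarrow> real \<Rightarrow> 'a \<times> 'a aefun \<times> 'a aefun \<Rightarrow> 'a"
  where "third a c v = integral {a..c} (rep_aefun (snd (snd v)))"

lemma state_norm_ge: "norm (fst v) \<le> state_norm p v" "Lp_norm p (fst (snd v)) \<le> state_norm p v"
    "Lp_norm p (snd (snd v)) \<le> state_norm p v"
  for v :: "'a \<times> 'a aefun \<times> 'a aefun"
  by (simp_all add: state_norm_eq)

lemma functional_fst: "V.functional fst"
  unfolding V.functional_def by (auto simp: state_norm_eq intro!: exI[of _ 1])

lemma functional_second: "a \<le> c \<Longrightarrow> V.functional (second a c)"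
  unfolding V.functional_def
proof (intro conjI ballI allI exI)
  fix u v :: "'a \<times> 'a aefun \<times> 'a aefun" assume uv: "u \<in> state_space p" "v \<in> state_space p"
  show "second a c (u + v) = second a c u + second a c v"
    unfolding second_def fst_add snd_add using uv by (intro I.rep_integral_add) (auto simp: state_space_iff)
next
  fix r and v :: "'a \<times> 'a aefun \<times> 'a aefun"
  show "second a c (r *\<^sub>R v) = r *\<^sub>R second a c v" by (simp add: second_def I.rep_integral_scaleR)
next
  fix v :: "'a \<times> 'a aefun \<times> 'a aefun" assume ac: "a \<le> c" and v: "v \<in> state_space p"
  show "norm (second a c v) \<le> (2 * (c - a) powr (1 - 1 / p)) * state_norm p v"
    unfolding second_def using v
    by (intro order_trans[OF I.rep_integral_bound[OF _ ac]] mult_left_mono state_norm_ge) (auto simp: state_space_iff)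
qed

lemma functional_third: "a \<le> c \<Longrightarrow> V.functional (third a c)"
  unfolding V.functional_def
proof (intro conjI ballI allI exI)
  fix u v :: "'a \<times> 'a aefun \<times> 'a aefun" assume uv: "u \<in> state_space p" "v \<in> state_space p"
  show "third a c (u + v) = third a c u + third a c v"
    unfolding third_def fst_add snd_add using uv by (intro R.rep_integral_add) (auto simp: state_space_iff)
next
  fix r and v :: "'a \<times> 'a aefun \<times> 'a aefun"
  show "third a c (r *\<^sub>R v) = r *\<^sub>R third a c v" by (simp add: third_def R.rep_integral_scaleR)
next
  fix v :: "'a \<times> 'a aefun \<times> 'a aefun" assume ac: "a \<le> c" and v: "v \<in> state_space p"
  show "norm (third a c v) \<le> (2 * (c - a) powr (1 - 1 / p)) * state_norm p v"
    unfolding third_def using v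
    by (intro order_trans[OF R.rep_integral_bound[OF _ ac]] mult_left_mono state_norm_ge) (auto simp: state_space_iff)
qed

text \<open>Integrals over windows, unlike point evaluations, are bounded on L^p, and there are
  enough of them to separate its elements.\<close>

definition tests :: "('a \<times> 'a aefun \<times> 'a aefun \<Rightarrow> 'a) set"
  where "tests = {fst} \<union> {second a c | a c. - 1 \<le> a \<and> a \<le> c \<and> c \<le> 0} \<union> {third a c | a c. 0 \<le> a \<and> a \<le> c}"

lemma tests_functional: "\<Lambda> \<in> tests \<Longrightarrow> V.functional \<Lambda>"
  by (auto simp: tests_def functional_fst functional_second functional_third)

lemma tests_separate:
  assumes z: "z \<in> state_space p" and 0: "\<And>\<Lambda>. \<Lambda> \<in> tests \<Longrightarrow> \<Lambda> z = 0"
  shows "z = 0"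
proof -
  have "fst z = 0" by (rule 0) (simp add: tests_def)
  moreover have "fst (snd z) = 0"
  proof (rule I.Lp_zero_if_integrals_zero)
    show "fst (snd z) \<in> Lp p {-1..0}" using z by (simp add: state_space_iff)
    fix a c :: real assume "a \<le> c" "{a..c} \<subseteq> {-1..0}"
    then show "integral {a..c} (rep_aefun (fst (snd z))) = 0" using 0[of "second a c"] by (auto simp: tests_def second_def)
  qed
  moreover have "snd (snd z) = 0"
  proof (rule R.Lp_zero_if_integrals_zero)
    show "snd (snd z) \<in> Lp p {0..}" using z by (simp add: state_space_iff)
    fix a c :: real assume "a \<le> c" "{a..c} \<subseteq> {0..}"
    then show "integral {a..c} (rep_aefun (snd (snd z))) = 0" using 0[of "third a c"] by (auto simp: tests_def third_def)
  qed
  ultimately show ?thesis by (simp add: prod_eq_iff)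
qed

lemma W_integrable: "\<psi> \<in> Lp p {-1..0} \<Longrightarrow> - 1 \<le> a \<Longrightarrow> W y \<psi> integrable_on {a..c}"
proof -
  assume \<psi>: "\<psi> \<in> Lp p {-1..0}" and a: "- 1 \<le> a"
  show ?thesis
    by (rule integrable_eq[OF Lfun_interval(2)[OF Lfun_Wc(1)[OF \<psi>, of "max 0 c" y]]]) (use a in \<open>auto simp: Wc_def\<close>)
qed

lemma second_flow:
  assumes "- 1 \<le> a" "c \<le> 0"
  shows "second a c (flow s v) = integral {a + s..c + s} (W (fst v) (fst (snd v)))"
proof -
  have "second a c (flow s v) = integral {a..c} (\<lambda>\<theta>. W (fst v) (fst (snd v)) (s + \<theta>))"
    unfolding second_def flow_def fst_conv snd_conv
    by (rule integral_cong_AE_on, rule eventually_mono[OF rep_class_on[of "{-1..0}" "\<lambda>\<theta>. W (fst v) (fst (snd v)) (s + \<theta>)"]]) (use assms in auto)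
  then show ?thesis using integral_shift_Icc_real[of a c "W (fst v) (fst (snd v))" s] by (simp add: o_def)
qed

lemma third_flow:
  assumes "0 \<le> a"
  shows "third a c (flow s v) = integral {a + s..c + s} (rep_aefun (snd (snd v)))"
proof -
  have "third a c (flow s v) = integral {a..c} (\<lambda>\<theta>. rep_aefun (snd (snd v)) (s + \<theta>))"
    unfolding third_def flow_def fst_conv snd_conv
    by (rule integral_cong_AE_on, rule eventually_mono[OF rep_class_on[of "{0..}" "\<lambda>\<theta>. rep_aefun (snd (snd v)) (s + \<theta>)"]]) (use assms in auto)
  then show ?thesis using integral_shift_Icc_real[of a c "rep_aefun (snd (snd v))" s] by (simp add: o_def)
qed

text \<open>If \<open>y' = A y\<close>, this primitive of \<open>W y' \<psi>'\<close> coincides with the orbit of \<open>y\<close> on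
  \<open>[0, \<infinity>)\<close>.\<close>

definition prim :: "'a \<Rightarrow> 'a \<Rightarrow> 'a aefun \<Rightarrow> real \<Rightarrow> 'a"
  where "prim y y' \<psi>' r = y + (integral {-1..r} (W y' \<psi>') - integral {-1..0} (W y' \<psi>'))"

lemma
  assumes \<psi>': "\<psi>' \<in> Lp p {-1..0}"
  shows prim_diff: "- 1 \<le> a \<Longrightarrow> a \<le> c \<Longrightarrow> prim y y' \<psi>' c - prim y y' \<psi>' a = integral {a..c} (W y' \<psi>')"
    and prim_continuous: "- 1 \<le> a \<Longrightarrow> continuous_on {a..c} (prim y y' \<psi>')"
    and prim_0: "prim y y' \<psi>' 0 = y"
    and prim_nonneg: "(y, y') \<in> gen TT \<Longrightarrow> 0 \<le> r \<Longrightarrow> prim y y' \<psi>' r = T r y"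
proof -
  note int = W_integrable[OF \<psi>']
  show diff: "prim y y' \<psi>' c - prim y y' \<psi>' a = integral {a..c} (W y' \<psi>')" if "- 1 \<le> a" "a \<le> c" for a c
    using Henstock_Kurzweil_Integration.integral_combine[OF that int] by (simp add: prim_def algebra_simps)
  have "continuous_on {-1..c} (prim y y' \<psi>')"
    unfolding prim_def by (intro continuous_intros indefinite_integral_continuous_1 int) auto
  then show "- 1 \<le> a \<Longrightarrow> continuous_on {a..c} (prim y y' \<psi>')" by (rule continuous_on_subset) auto
  show 0: "prim y y' \<psi>' 0 = y" by (simp add: prim_def)
  assume g: "(y, y') \<in> gen TT" and r: "0 \<le> r"
  have "integral {0..r} (W y' \<psi>') = integral {0..r} (\<lambda>s. TT s y')"
  proof (rule integral_cong_AE_on)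
    have "AE x in lebesgue. x \<notin> {0::real}" by (rule AE_not_in) auto
    then show "AE x in lebesgue. x \<in> {0..r} \<longrightarrow> W y' \<psi>' x = TT x y'" by eventually_elim (auto simp: W_def TT_apply)
  qed
  then show "prim y y' \<psi>' r = T r y" using diff[of 0 r] r TT.integral_gen[OF g r] 0 by (simp add: TT_apply algebra_simps)
qed

lemma integral_second_flow:
  assumes w: "fst (snd w) \<in> Lp p {-1..0}" and ac: "- 1 \<le> a" "a \<le> c" "c \<le> 0" and t: "0 \<le> t"
  shows "integral {0..t} (\<lambda>s. second a c (flow s w)) =
    integral {a + t..c + t} (prim y (fst w) (fst (snd w))) - integral {a..c} (prim y (fst w) (fst (snd w)))"
proof -
  let ?u = "prim y (fst w) (fst (snd w))"
  have "integral {0..t} (\<lambda>s. second a c (flow s w)) = integral {0..t} (\<lambda>s. ?u (c + s) - ?u (a + s))"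
    by (rule integral_cong) (use ac in \<open>simp add: second_flow prim_diff[OF w]\<close>)
  also have "\<dots> = integral {a + t..c + t} ?u - integral {a..c} ?u"
    by (rule integral_shift_swap[OF prim_continuous[OF w]]) (use ac t in auto)
  finally show ?thesis .
qed

text \<open>Both sides say that \<psi> is the class of the primitive
  \<open>prim y y' \<psi>'\<close>. The test identity shows this at t = 1: the window [a + 1, c + 1]
  lies in [0, 1], where \<open>W y \<psi>\<close> and the primitive are almost everywhere the orbit
  of \<open>y\<close>, so the integrals over [a, c] must agree as well.\<close>

lemma second_identity_iff:
  assumes \<psi>: "\<psi> \<in> Lp p {-1..0}" "\<psi>' \<in> Lp p {-1..0}" and g: "(y, y') \<in> gen TT"
  shows "(\<forall>a c t. - 1 \<le> a \<and> a \<le> c \<and> c \<le> 0 \<and> 0 < t \<longrightarrow> second a c (flow t (y, \<psi>, h)) - second a c (y, \<psi>, h) =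
      integral {0..t} (\<lambda>s. second a c (flow s (y', \<psi>', h')))) \<longleftrightarrow>
    \<psi> \<in> W1p p {-1..0} \<and> W1p_eval p {-1..0} \<psi> 0 = y \<and> W1p_deriv p {-1..0} \<psi> = \<psi>'" (is "?L \<longleftrightarrow> ?R")
proof -
  let ?u = "prim y y' \<psi>'"
  note I2 = integral_second_flow[of "(y', \<psi>', h')", simplified, OF \<psi>(2), where y = y]
  have ac: "- 1 \<le> a" "c \<le> 0" if "{a..c} \<subseteq> {-1..0}" "a \<le> c" for a c :: real using that by auto
  have iff: "?L \<longleftrightarrow> \<psi> = class_on {-1..0} ?u"
  proof
    assume L: ?L
    show "\<psi> = class_on {-1..0} ?u"
    proof (rule I.Lp_eq_class_on_if_integrals[OF \<psi>(1)])
      show "continuous_on {a..c} ?u" if "{a..c} \<subseteq> {-1..0}" for a c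
      proof (cases "a \<le> c")
        case True then show ?thesis using ac[OF that] by (intro prim_continuous[OF \<psi>(2)]) auto
      qed simp
      fix a c :: real assume "a \<le> c" "{a..c} \<subseteq> {-1..0}"
      then have *: "- 1 \<le> a" "a \<le> c" "c \<le> 0" by auto
      have "integral {a + 1..c + 1} (W y \<psi>) = integral {a + 1..c + 1} ?u"
      proof (rule integral_cong_AE_on)
        have "AE x in lebesgue. x \<notin> {0::real}" by (rule AE_not_in) auto
        then show "AE x in lebesgue. x \<in> {a + 1..c + 1} \<longrightarrow> W y \<psi> x = ?u x"
          by eventually_elim (use * prim_nonneg[OF \<psi>(2) g] in \<open>auto simp: W_def\<close>)
      qed
      moreover have "second a c (flow 1 (y, \<psi>, h)) - second a c (y, \<psi>, h) = integral {0..1} (\<lambda>s. second a c (flow s (y', \<psi>', h')))"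
        using L * by auto
      ultimately show "integral {a..c} (rep_aefun \<psi>) = integral {a..c} ?u"
        using * I2[of a c 1] by (simp add: second_flow) (simp add: second_def)
    qed
  next
    assume eq: "\<psi> = class_on {-1..0} ?u"
    have ae: "AE x in lebesgue. x \<in> {-1..0} \<longrightarrow> rep_aefun \<psi> x = ?u x"
      unfolding eq using rep_class_on[of "{-1..0}" ?u] by eventually_elim auto
    have W: "integral {a..c} (W y \<psi>) = integral {a..c} ?u" if "- 1 \<le> a" for a c
      by (rule integral_cong_AE_on, rule eventually_mono[OF ae]) (use prim_nonneg[OF \<psi>(2) g] that in \<open>auto simp: W_def\<close>)
    have s: "second a c (y, \<psi>, h) = integral {a..c} ?u" if "- 1 \<le> a" "c \<le> 0" for a c
      unfolding second_def fst_conv snd_conv by (rule integral_cong_AE_on, rule eventually_mono[OF ae]) (use that in auto)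
    show ?L using I2 by (auto simp: second_flow W s)
  qed
  have pd: "?u t - ?u s = integral {s..t} (rep_aefun \<psi>')" if "s \<in> {-1..0}" "t \<in> {-1..0}" "s \<le> t" for s t
  proof -
    have "integral {s..t} (W y' \<psi>') = integral {s..t} (rep_aefun \<psi>')" by (rule integral_cong) (use that in \<open>auto simp: W_def\<close>)
    then show ?thesis using prim_diff[OF \<psi>(2), of s t] that by simp
  qed
  show ?thesis unfolding iff
  proof
    assume "\<psi> = class_on {-1..0} ?u"
    then have r: "W1p_rep p {-1..0} \<psi> ?u \<psi>'" using pd \<psi> by (simp add: I.W1p_rep_iff)
    show ?R using I.W1p_rep_eval[OF r] I.W1p_memI[OF \<psi>(1) r] prim_0[OF \<psi>(2)] by simp
  next
    assume R: ?R
    have r: "W1p_rep p {-1..0} \<psi> (W1p_eval p {-1..0} \<psi>) \<psi>'" using I.W1p_repI[of \<psi>] R by simp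
    have "W1p_eval p {-1..0} \<psi> x = ?u x" if "x \<in> {-1..0}" for x
    proof -
      have "W1p_eval p {-1..0} \<psi> 0 - W1p_eval p {-1..0} \<psi> x = integral {x..0} (rep_aefun \<psi>')"
        using r that by (simp add: I.W1p_rep_iff)
      then show ?thesis using pd[of x 0] that R prim_0[OF \<psi>(2), of y y'] by (simp add: algebra_simps)
    qed
    then have "class_on {-1..0} (W1p_eval p {-1..0} \<psi>) = class_on {-1..0} ?u" by (simp add: class_on_eq_iff)
    then show "\<psi> = class_on {-1..0} ?u" using r by (simp add: I.W1p_rep_iff)
  qed
qed

text \<open>Here no part of \<open>h\<close> is known in advance, so it is determined up to a
  constant only. With \<open>P\<close> a primitive of \<open>h'\<close>, the test identity says that
  the integrals of h - P over windows are invariant under translation. The primitive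
  \<open>E\<close> of h - P is then additive, hence linear, and h - P is the constant
  \<open>E 1\<close>.\<close>

lemma third_identity_iff:
  assumes h: "h \<in> Lp p {0..}" "h' \<in> Lp p {0..}"
  shows "(\<forall>a c t. 0 \<le> a \<and> a \<le> c \<and> 0 < t \<longrightarrow> third a c (flow t (y, \<psi>, h)) - third a c (y, \<psi>, h) =
      integral {0..t} (\<lambda>s. third a c (flow s (y', \<psi>', h')))) \<longleftrightarrow>
    h \<in> W1p p {0..} \<and> W1p_deriv p {0..} h = h'" (is "?L \<longleftrightarrow> ?R")
proof -
  define P where "P x = integral {0..x} (rep_aefun h')" for x
  note int = Lfun_interval(2)[OF R.rep_Lfun[OF h(1)]] and int' = Lfun_interval(2)[OF R.rep_Lfun[OF h(2)]]
  have P: "P c - P a = integral {a..c} (rep_aefun h')" if "0 \<le> a" "a \<le> c" for a c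
    using Henstock_Kurzweil_Integration.integral_combine[OF that int'] by (simp add: P_def algebra_simps)
  have cP: "continuous_on {a..c} P" if "0 \<le> a" for a c
    using indefinite_integral_continuous_1[OF int', of 0 c] unfolding P_def[abs_def]
    by (rule continuous_on_subset) (use that in auto)
  have cPi: "P integrable_on {a..c}" if "0 \<le> a" for a c by (rule integrable_continuous_real[OF cP[OF that]])
  have I3: "integral {0..t} (\<lambda>s. third a c (flow s (y', \<psi>', h'))) = integral {a + t..c + t} u - integral {a..c} u"
    if *: "0 \<le> a" "a \<le> c" "0 \<le> t" and u: "u = (\<lambda>x. P x + k)" for a c t u k
  proof -
    have "integral {0..t} (\<lambda>s. third a c (flow s (y', \<psi>', h'))) = integral {0..t} (\<lambda>s. u (c + s) - u (a + s))"
      by (rule integral_cong) (use * in \<open>simp add: third_flow P u\<close>)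
    also have "\<dots> = integral {a + t..c + t} u - integral {a..c} u"
      by (rule integral_shift_swap) (use * cP in \<open>auto simp: u intro!: continuous_intros\<close>)
    finally show ?thesis .
  qed
  show ?thesis
  proof
    assume L: ?L
    define E where "E x = integral {0..x} (\<lambda>r. rep_aefun h r - P r)" for x
    have eint: "(\<lambda>r. rep_aefun h r - P r) integrable_on {a..c}" if "0 \<le> a" for a c
      by (intro Henstock_Kurzweil_Integration.integrable_diff int cPi that)
    have Ed: "E c - E a = integral {a..c} (\<lambda>r. rep_aefun h r - P r)" if "0 \<le> a" "a \<le> c" for a c
      using Henstock_Kurzweil_Integration.integral_combine[OF that eint] by (simp add: E_def algebra_simps)
    have "E (x + t) = E x + E t" if "0 \<le> x" "0 \<le> t" for x t
    proof (cases "t = 0")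
      case False
      then have "third 0 x (flow t (y, \<psi>, h)) - third 0 x (y, \<psi>, h) = integral {0..t} (\<lambda>s. third 0 x (flow s (y', \<psi>', h')))"
        using L that by auto
      then have "integral {t..x + t} (rep_aefun h) - integral {0..x} (rep_aefun h) = integral {t..x + t} P - integral {0..x} P"
        using I3[of 0 x t P 0] that by (simp add: third_flow) (simp add: third_def)
      moreover have "integral {t..x + t} (\<lambda>r. rep_aefun h r - P r) = integral {t..x + t} (rep_aefun h) - integral {t..x + t} P"
        "integral {0..x} (\<lambda>r. rep_aefun h r - P r) = integral {0..x} (rep_aefun h) - integral {0..x} P"
        using that by (intro Henstock_Kurzweil_Integration.integral_diff int cPi; simp)+
      moreover have "a' - b' = c' - d'" if "a' - c' = b' - d'" for a' b' c' d' :: 'a using that by (simp add: algebra_simps)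
      ultimately have "integral {t..x + t} (\<lambda>r. rep_aefun h r - P r) = integral {0..x} (\<lambda>r. rep_aefun h r - P r)" by metis
      then have "E (x + t) - E t = E x - E 0" using Ed[of t "x + t"] Ed[of 0 x] that by simp
      then show ?thesis by (simp add: E_def algebra_simps)
    qed (simp add: E_def)
    moreover have "continuous_on {0..b} E" for b
      using indefinite_integral_continuous_1[OF eint, of 0 b] by (simp add: E_def[abs_def])
    ultimately have lin: "E x = x *\<^sub>R E 1" if "0 \<le> x" for x using that by (intro additive_continuous_linear) auto
    let ?f = "\<lambda>x. P x + E 1"
    have "h = class_on {0..} ?f"
    proof (rule R.Lp_eq_class_on_if_integrals[OF h(1)])
      show "continuous_on {a..c} ?f" if "{a..c} \<subseteq> {0..}" for a c
      proof (cases "a \<le> c")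
        case True
        then have "0 \<le> a" using that by auto
        then show ?thesis by (intro continuous_intros cP)
      qed simp
      fix a c :: real assume ac: "a \<le> c" "{a..c} \<subseteq> {0..}"
      then have a: "0 \<le> a" by auto
      have "integral {a..c} (\<lambda>r. rep_aefun h r - P r) = (c - a) *\<^sub>R E 1"
        using Ed[OF a ac(1)] lin[of c] lin[of a] a ac(1) by (simp add: scaleR_diff_left)
      moreover have "integral {a..c} (\<lambda>r. rep_aefun h r - P r) = integral {a..c} (rep_aefun h) - integral {a..c} P"
        by (intro Henstock_Kurzweil_Integration.integral_diff int cPi a)
      moreover have "integral {a..c} ?f = integral {a..c} P + (c - a) *\<^sub>R E 1"
        using ac(1) by (subst Henstock_Kurzweil_Integration.integral_add[OF cPi[OF a]]) auto
      ultimately show "integral {a..c} (rep_aefun h) = integral {a..c} ?f" by (metis add.commute diff_add_cancel)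
    qed
    then have r: "W1p_rep p {0..} h ?f h'" using P h by (simp add: R.W1p_rep_iff)
    show ?R using R.W1p_rep_eval[OF r] R.W1p_memI[OF h(1) r] by simp
  next
    assume R: ?R
    let ?f = "W1p_eval p {0..} h"
    have r: "W1p_rep p {0..} h ?f h'" using R.W1p_repI[of h] R by simp
    define k where "k = ?f 0"
    have f: "?f x = P x + k" if "0 \<le> x" for x
      using r[unfolded R.W1p_rep_iff, THEN conjunct2, THEN conjunct2, rule_format, of 0 x] that
      unfolding P_def diff_eq_eq k_def by simp
    have "h = class_on {0..} ?f" using r unfolding R.W1p_rep_iff by blast
    also have "\<dots> = class_on {0..} (\<lambda>x. P x + k)" unfolding class_on_eq_iff using f by (intro AE_I2) auto
    finally have hc: "h = class_on {0..} (\<lambda>x. P x + k)" .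
    have ae: "AE x in lebesgue. x \<in> {0..} \<longrightarrow> rep_aefun h x = P x + k"
      using rep_class_on[of "{0..}" "\<lambda>x. P x + k", folded hc] by (rule eventually_mono) simp
    have s: "integral {a..c} (rep_aefun h) = integral {a..c} (\<lambda>x. P x + k)" if "0 \<le> a" for a c
      by (rule integral_cong_AE_on, rule eventually_mono[OF ae]) (use that in auto)
    have s': "third a c (flow t (y, \<psi>, h)) = integral {a + t..c + t} (\<lambda>x. P x + k)" if "0 \<le> a" "0 < t" for a c t
      using s[of "a + t" "c + t"] that by (simp add: third_flow)
    have s'': "third a c (y, \<psi>, h) = integral {a..c} (\<lambda>x. P x + k)" if "0 \<le> a" for a c
      using s[of a c] that by (simp add: third_def)
    show ?L
    proof (intro allI impI, elim conjE)
      fix a c t :: real assume "0 \<le> a" "a \<le> c" "0 < t"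
      then show "third a c (flow t (y, \<psi>, h)) - third a c (y, \<psi>, h) = integral {0..t} (\<lambda>s. third a c (flow s (y', \<psi>', h')))"
        using I3[OF _ _ _ refl, of a c t k] s' s'' by simp
    qed
  qed
qed

definition free_op :: "'a \<times> 'a aefun \<times> 'a aefun \<Rightarrow> 'a \<times> 'a aefun \<times> 'a aefun"
  where "free_op v = (A (fst v), W1p_deriv p {-1..0} (fst (snd v)), W1p_deriv p {0..} (snd (snd v)))"

text \<open>Membership in the graph is equivalent to the test identities. These decouple into the
  generator of the orbit, the history with its boundary condition at 0, and the left shift.\<close>

lemma generates_flow: "generates (state_space p) (state_norm p) (state_dom p DA) free_op flow"
  unfolding generates_def
proof (intro conjI flow_C0)
  have "(v, w) \<in> generator_graph (state_space p) (state_norm p) flow \<longleftrightarrow> v \<in> state_dom p DA \<and> w = free_op v" for v w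
  proof -
    obtain y \<psi> h y' \<psi>' h' where vw: "v = (y, \<psi>, h)" "w = (y', \<psi>', h')" by (metis prod_cases3)
    have dom: "v \<in> state_space p" "free_op v \<in> state_space p" if "v \<in> state_dom p DA"
      using that by (auto simp: vw state_dom_def state_space_def free_op_def I.W1p_Lp R.W1p_Lp I.W1p_deriv_Lp R.W1p_deriv_Lp)
    have "(v, w) \<in> generator_graph (state_space p) (state_norm p) flow \<longleftrightarrow>
        v \<in> state_space p \<and> w \<in> state_space p \<and> (\<forall>\<Lambda>\<in>tests. \<forall>t>0. \<Lambda> (flow t v) - \<Lambda> v = integral {0..t} (\<lambda>s. \<Lambda> (flow s w)))"
    proof (intro iffI conjI ballI allI impI)
      assume g: "(v, w) \<in> generator_graph (state_space p) (state_norm p) flow"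
      show "v \<in> state_space p" "w \<in> state_space p" using g by (auto simp: generator_graph_def)
      show "\<Lambda> (flow t v) - \<Lambda> v = integral {0..t} (\<lambda>s. \<Lambda> (flow s w))" if "\<Lambda> \<in> tests" "0 < t" for \<Lambda> t
        by (rule V.functional_integral[OF flow_C0 g less_imp_le[OF that(2)] tests_functional[OF that(1)]])
    next
      assume "v \<in> state_space p \<and> w \<in> state_space p \<and> (\<forall>\<Lambda>\<in>tests. \<forall>t>0. \<Lambda> (flow t v) - \<Lambda> v = integral {0..t} (\<lambda>s. \<Lambda> (flow s w)))"
      then show "(v, w) \<in> generator_graph (state_space p) (state_norm p) flow"
        by (intro V.generator_graph_if_functionals[OF flow_C0 _ _ tests_functional tests_separate]) auto
    qed
    also have "\<dots> \<longleftrightarrow> v \<in> state_space p \<and> w \<in> state_space p \<and> (y, y') \<in> gen TT \<and>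
        (\<forall>a c t. - 1 \<le> a \<and> a \<le> c \<and> c \<le> 0 \<and> 0 < t \<longrightarrow> second a c (flow t v) - second a c v = integral {0..t} (\<lambda>s. second a c (flow s w))) \<and>
        (\<forall>a c t. 0 \<le> a \<and> a \<le> c \<and> 0 < t \<longrightarrow> third a c (flow t v) - third a c v = integral {0..t} (\<lambda>s. third a c (flow s w)))"
    proof -
      have "(\<forall>t>0. fst (flow t v) - fst v = integral {0..t} (\<lambda>s. fst (flow s w))) \<longleftrightarrow> (y, y') \<in> gen TT"
      proof -
        have eqs: "integral {0..t} (\<lambda>s. fst (flow s w)) = integral {0..t} (\<lambda>s. TT s y')" "t > 0 \<Longrightarrow> fst (flow t v) = TT t y" for t
          by (rule integral_cong) (simp_all add: flow_def vw TT_apply)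
        show ?thesis
        proof (intro iffI allI impI)
          assume *: "\<forall>t>0. fst (flow t v) - fst v = integral {0..t} (\<lambda>s. fst (flow s w))"
          show "(y, y') \<in> gen TT" by (rule TT.gen_if_integral) (use * eqs in \<open>simp add: vw\<close>)
        next
          fix t :: real assume "(y, y') \<in> gen TT" "0 < t"
          then show "fst (flow t v) - fst v = integral {0..t} (\<lambda>s. fst (flow s w))" using TT.integral_gen[of y y' t] eqs by (simp add: vw)
        qed
      qed
      moreover have "(\<forall>\<Lambda>\<in>tests. Q \<Lambda>) \<longleftrightarrow> Q fst \<and> (\<forall>a c. - 1 \<le> a \<and> a \<le> c \<and> c \<le> 0 \<longrightarrow> Q (second a c)) \<and>
          (\<forall>a c. 0 \<le> a \<and> a \<le> c \<longrightarrow> Q (third a c))" for Q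
        unfolding tests_def by blast
      ultimately show ?thesis by simp blast
    qed
    also have "\<dots> \<longleftrightarrow> v \<in> state_space p \<and> w \<in> state_space p \<and> (y, y') \<in> gen TT \<and>
        (\<psi> \<in> W1p p {-1..0} \<and> W1p_eval p {-1..0} \<psi> 0 = y \<and> W1p_deriv p {-1..0} \<psi> = \<psi>') \<and> (h \<in> W1p p {0..} \<and> W1p_deriv p {0..} h = h')"
      using second_identity_iff[of \<psi> \<psi>' y y' h h'] third_identity_iff[of h h' y \<psi> y' \<psi>'] unfolding vw state_space_iff fst_conv snd_conv by blast
    also have "\<dots> \<longleftrightarrow> v \<in> state_dom p DA \<and> w = free_op v"
      using dom by (auto simp: vw gen_TT state_dom_def free_op_def)
    finally show ?thesis .
  qed
  note iff = this
  have "generator_graph (state_space p) (state_norm p) flow = {(v, w). (v, w) \<in> generator_graph (state_space p) (state_norm p) flow}" by simp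
  also have "\<dots> = {(v, w). v \<in> state_dom p DA \<and> w = free_op v}" unfolding iff ..
  also have "\<dots> = {(v, free_op v) |v. v \<in> state_dom p DA}" by blast
  finally show "generator_graph (state_space p) (state_norm p) flow = {(v, free_op v) |v. v \<in> state_dom p DA}" .
qed

end

section \<open>Functionals that are bounded in the graph norm\<close>

context complex_carrier
begin

text \<open>Meant for quantities such as \<open>L\<close> of the history or h(0), which make sense
  on the domain and are bounded there only together with the derivatives.\<close>

definition graph_functional :: "'v set \<Rightarrow> ('v \<Rightarrow> 'v) \<Rightarrow> ('v \<Rightarrow> 'x::real_normed_vector) \<Rightarrow> bool"
  where "graph_functional D G \<Xi> \<longleftrightarrow> (\<forall>u\<in>D. \<forall>v\<in>D. \<Xi> (u + v) = \<Xi> u + \<Xi> v) \<and>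
    (\<forall>c. \<forall>v\<in>D. \<Xi> (c *\<^sub>R v) = c *\<^sub>R \<Xi> v) \<and> (\<exists>C. \<forall>v\<in>D. norm (\<Xi> v) \<le> C * (n v + n (G v)))"

context
  fixes D and G :: "'v \<Rightarrow> 'v" and T
  assumes gen: "generates V n D G T"
begin

lemma gen_C0: "C0_semigroup V n T" using gen by (simp add: generates_def)

lemma gen_graph_iff: "(v, w) \<in> generator_graph V n T \<longleftrightarrow> v \<in> D \<and> w = G v"
  using gen by (auto simp: generates_def)

lemma gen_dom: "v \<in> D \<Longrightarrow> v \<in> V" "v \<in> D \<Longrightarrow> G v \<in> V"
  using gen_graph_iff[of v "G v"] by (auto simp: generator_graph_def)

lemma gen_orbit: "v \<in> D \<Longrightarrow> t \<ge> 0 \<Longrightarrow> T t v \<in> D" "v \<in> D \<Longrightarrow> t \<ge> 0 \<Longrightarrow> G (T t v) = T t (G v)"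
  using generator_graph_apply[OF gen_C0, of v "G v" t] gen_graph_iff by auto

lemma gen_dom_diff:
  assumes "u \<in> D" "v \<in> D"
  shows "u - v \<in> D" "G (u - v) = G u - G v"
proof -
  have "(emb V n u - emb V n v, emb V n (G u) - emb V n (G v)) \<in> gen (\<lambda>t. lift_op (T t))"
    by (intro gen_diff gen_lift_emb[OF gen_C0]) (use assms gen_graph_iff in auto)
  then have "(u - v, G u - G v) \<in> generator_graph V n T"
    using assms by (simp add: gen_lift[OF gen_C0] prj_diff prj_emb gen_dom)
  then show "u - v \<in> D" "G (u - v) = G u - G v" by (auto simp: gen_graph_iff)
qed

lemma gen_dom_scaleR: "v \<in> D \<Longrightarrow> c *\<^sub>R v \<in> D"
proof -
  assume v: "v \<in> D"
  have "(c *\<^sub>R emb V n v, c *\<^sub>R emb V n (G v)) \<in> gen (\<lambda>t. lift_op (T t))"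
    by (intro gen_scale gen_lift_emb[OF gen_C0]) (use v gen_graph_iff in auto)
  then have "(c *\<^sub>R v, c *\<^sub>R G v) \<in> generator_graph V n T"
    using v by (simp add: gen_lift[OF gen_C0] prj_scale prj_emb gen_dom)
  then show ?thesis by (simp add: gen_graph_iff)
qed

text \<open>An orbit that starts in the domain is continuous in the graph norm, because the
  generator commutes with the semigroup.\<close>

lemma graph_functional_continuous:
  assumes \<Xi>: "graph_functional D G \<Xi>" and v: "v \<in> D"
  shows "continuous_on {0..} (\<lambda>t. \<Xi> (T t v))"
  unfolding continuous_on
proof
  fix s :: real assume s: "s \<in> {0..}"
  obtain C where C: "\<And>v. v \<in> D \<Longrightarrow> norm (\<Xi> v) \<le> C * (n v + n (G v))"
    using \<Xi> unfolding graph_functional_def by blast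
  have diff: "\<Xi> (x - y) = \<Xi> x - \<Xi> y" if "x \<in> D" "y \<in> D" for x y
  proof -
    have "\<Xi> (x + (-1) *\<^sub>R y) = \<Xi> x + \<Xi> ((-1) *\<^sub>R y)" "\<Xi> ((-1) *\<^sub>R y) = (-1) *\<^sub>R \<Xi> y"
      using \<Xi> that gen_dom_scaleR[OF that(2), of "-1"] unfolding graph_functional_def by blast+
    then show ?thesis by simp
  qed
  have "\<forall>\<^sub>F t in at s within {0..}. norm (\<Xi> (T t v) - \<Xi> (T s v)) \<le> C * (n (T t v - T s v) + n (T t (G v) - T s (G v)))"
    unfolding eventually_at_filter
  proof (intro always_eventually allI impI)
    fix t :: real assume "t \<noteq> s" and t: "t \<in> {0..}"
    have "T t v \<in> D" "T s v \<in> D" using gen_orbit v s t by auto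
    then show "norm (\<Xi> (T t v) - \<Xi> (T s v)) \<le> C * (n (T t v - T s v) + n (T t (G v) - T s (G v)))"
      using C[of "T t v - T s v"] gen_dom_diff[of "T t v" "T s v"] gen_orbit(2)[OF v] s t by (simp add: diff)
  qed
  moreover have "((\<lambda>t. C * (n (T t v - T s v) + n (T t (G v) - T s (G v)))) \<longlongrightarrow> C * (0 + 0)) (at s within {0..})"
    by (intro tendsto_intros carrier_norm_continuous_on[OF gen_C0] gen_dom v) (use s in auto)
  ultimately have "((\<lambda>t. \<Xi> (T t v) - \<Xi> (T s v)) \<longlongrightarrow> 0) (at s within {0..})"
    by (intro Lim_null_comparison[of "\<lambda>t. \<Xi> (T t v) - \<Xi> (T s v)"]) simp_all
  then show "((\<lambda>t. \<Xi> (T t v)) \<longlongrightarrow> \<Xi> (T s v)) (at s within {0..})" by (simp add: LIM_zero_iff)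
qed

end

end

lemma scaleC_zero: "c *\<^sub>C (0 :: 'a::complex_vector) = 0"
  using scaleC_add_right[of c 0 "0 :: 'a"] by simp

section \<open>Operators on histories and condition (M) along the flow\<close>

context delay_flow
begin

abbreviation "hist_op \<equiv> bounded_op (W1p p {-1..0}) (W1p_norm p {-1..0}) UNIV (norm :: 'a \<Rightarrow> real)"

lemma hist_opD:
  assumes "hist_op \<Xi>"
  shows "\<phi> \<in> W1p p {-1..0} \<Longrightarrow> \<psi> \<in> W1p p {-1..0} \<Longrightarrow> \<Xi> (\<phi> + \<psi>) = \<Xi> \<phi> + \<Xi> \<psi>"
    "\<psi> \<in> W1p p {-1..0} \<Longrightarrow> \<Xi> (c *\<^sub>C \<psi>) = c *\<^sub>C \<Xi> \<psi>"
    "\<psi> \<in> W1p p {-1..0} \<Longrightarrow> \<Xi> (r *\<^sub>R \<psi>) = r *\<^sub>R \<Xi> \<psi>"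
    "\<exists>C\<ge>0. \<forall>\<psi>\<in>W1p p {-1..0}. norm (\<Xi> \<psi>) \<le> C * (Lp_norm p \<psi> + Lp_norm p (W1p_deriv p {-1..0} \<psi>))"
proof -
  show "\<phi> \<in> W1p p {-1..0} \<Longrightarrow> \<psi> \<in> W1p p {-1..0} \<Longrightarrow> \<Xi> (\<phi> + \<psi>) = \<Xi> \<phi> + \<Xi> \<psi>"
    and sc: "\<psi> \<in> W1p p {-1..0} \<Longrightarrow> \<Xi> (c *\<^sub>C \<psi>) = c *\<^sub>C \<Xi> \<psi>" for c
    using assms by (auto simp: bounded_op_def)
  show "\<psi> \<in> W1p p {-1..0} \<Longrightarrow> \<Xi> (r *\<^sub>R \<psi>) = r *\<^sub>R \<Xi> \<psi>"
    using sc[of "complex_of_real r"] by (simp add: scaleC_of_real)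
  obtain C where C: "\<And>\<psi>. \<psi> \<in> W1p p {-1..0} \<Longrightarrow> norm (\<Xi> \<psi>) \<le> C * W1p_norm p {-1..0} \<psi>"
    using assms unfolding bounded_op_def by blast
  have "norm (\<Xi> \<psi>) \<le> max C 0 * (Lp_norm p \<psi> + Lp_norm p (W1p_deriv p {-1..0} \<psi>))" if "\<psi> \<in> W1p p {-1..0}" for \<psi>
  proof -
    have "C * W1p_norm p {-1..0} \<psi> \<le> max C 0 * W1p_norm p {-1..0} \<psi>"
      by (rule mult_right_mono) (auto simp: W1p_norm_def)
    also have "\<dots> \<le> max C 0 * (Lp_norm p \<psi> + Lp_norm p (W1p_deriv p {-1..0} \<psi>))"
      by (rule mult_left_mono[OF I.W1p_norm_le]) simp
    finally show ?thesis using C[OF that] by simp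
  qed
  then show "\<exists>C\<ge>0. \<forall>\<psi>\<in>W1p p {-1..0}. norm (\<Xi> \<psi>) \<le> C * (Lp_norm p \<psi> + Lp_norm p (W1p_deriv p {-1..0} \<psi>))"
    by (intro exI[of _ "max C 0"]) auto
qed

lemma state_domD:
  assumes "v \<in> state_dom p DA"
  shows "fst v \<in> DA" "fst (snd v) \<in> W1p p {-1..0}" "snd (snd v) \<in> W1p p {0..}" "W1p_eval p {-1..0} (fst (snd v)) 0 = fst v"
  using assms by (auto simp: state_dom_def)

lemma state_dom_deriv_bound:
  "Lp_norm p (W1p_deriv p {-1..0} (fst (snd v))) \<le> state_norm p (free_op v)"
  "Lp_norm p (W1p_deriv p {0..} (snd (snd v))) \<le> state_norm p (free_op v)"
  using state_norm_ge[of "free_op v"] by (simp_all add: free_op_def)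

text \<open>\<open>G\<close> is left open so that the lemma applies to \<open>free_op\<close> and to
  the perturbed operator alike; in both, the derivative of the history is the second
  component.\<close>

lemma hist_graph_functional_if:
  assumes \<Xi>: "hist_op \<Xi>" and D: "\<And>v. v \<in> state_dom p DA \<Longrightarrow> Lp_norm p (W1p_deriv p {-1..0} (fst (snd v))) \<le> state_norm p (G v)"
  shows "V.graph_functional (state_dom p DA) G (\<lambda>v. \<Xi> (fst (snd v)))"
proof -
  obtain C where C: "C \<ge> 0" "\<And>\<psi>. \<psi> \<in> W1p p {-1..0} \<Longrightarrow> norm (\<Xi> \<psi>) \<le> C * (Lp_norm p \<psi> + Lp_norm p (W1p_deriv p {-1..0} \<psi>))"
    using hist_opD(4)[OF \<Xi>] by blast
  have "norm (\<Xi> (fst (snd v))) \<le> C * (state_norm p v + state_norm p (G v))" if "v \<in> state_dom p DA" for v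
    by (rule order_trans[OF C(2)[OF state_domD(2)[OF that]]]) (intro mult_left_mono add_mono state_norm_ge D that C)
  then show ?thesis
    unfolding V.graph_functional_def
    by (intro conjI ballI allI exI[of _ C]) (simp_all add: hist_opD(1,3)[OF \<Xi>] state_domD(2))
qed

lemmas hist_graph_functional = hist_graph_functional_if[OF _ state_dom_deriv_bound(1)]

lemma eval_graph_functional_if:
  assumes D: "\<And>v. v \<in> state_dom p DA \<Longrightarrow> Lp_norm p (W1p_deriv p {0..} (snd (snd v))) \<le> C * (state_norm p v + state_norm p (G v))"
  shows "V.graph_functional (state_dom p DA) G (\<lambda>v. W1p_eval p {0..} (snd (snd v)) 0)"
proof -
  have "norm (W1p_eval p {0..} (snd (snd v)) 0) \<le> (2 * (1 + C)) * (state_norm p v + state_norm p (G v))" if v: "v \<in> state_dom p DA" for v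
  proof -
    have "norm (W1p_eval p {0..} (snd (snd v)) 0) \<le> 2 * (Lp_norm p (snd (snd v)) + Lp_norm p (W1p_deriv p {0..} (snd (snd v))))"
      by (rule R.W1p_eval_bound[OF state_domD(3)[OF v], of 0]) auto
    also have "\<dots> \<le> 2 * ((state_norm p v + state_norm p (G v)) + C * (state_norm p v + state_norm p (G v)))"
      using D[OF v] state_norm_ge(3)[of v] order_trans[OF norm_ge_zero state_norm_ge(1)[of "G v"]] by simp
    finally show ?thesis by (simp add: algebra_simps)
  qed
  moreover have "W1p_eval p {0..} (c *\<^sub>R h) 0 = c *\<^sub>R W1p_eval p {0..} h 0" if "h \<in> W1p p {0..}" for c and h :: "'a aefun"
    using R.W1p_scaleC(3)[OF that, of 0 "complex_of_real c"] by (simp add: scaleC_of_real)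
  ultimately show ?thesis
    unfolding V.graph_functional_def
    by (intro conjI ballI allI exI[of _ "2 * (1 + C)"]) (simp_all add: R.W1p_add(3) state_domD(3))
qed

lemma eval_graph_functional: "V.graph_functional (state_dom p DA) free_op (\<lambda>v. W1p_eval p {0..} (snd (snd v)) 0)"
proof (rule eval_graph_functional_if[where C = 1])
  fix v :: "'a \<times> 'a aefun \<times> 'a aefun"
  show "Lp_norm p (W1p_deriv p {0..} (snd (snd v))) \<le> 1 * (state_norm p v + state_norm p (free_op v))"
    using state_dom_deriv_bound(2)[of v] order_trans[OF norm_ge_zero state_norm_ge(1)[of v]] by simp
qed

text \<open>Along the flow the integrand is continuous, so the nonnegative Lebesgue integral in (M)
  is an ordinary integral.\<close>

lemma M_estimate_integral:
  assumes \<Xi>: "hist_op \<Xi>" and M: "M_estimate p DA T q \<Xi> \<alpha> \<gamma>" and q: "0 < q"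
    and \<gamma>: "0 \<le> \<gamma>" and v: "v \<in> state_dom p DA"
  shows "integral {0..\<alpha>} (\<lambda>s. norm (\<Xi> (fst (snd (flow s v)))) powr q) \<le> (\<gamma> * (norm (fst v) + Lp_norm p (fst (snd v)))) powr q"
proof -
  let ?g = "\<lambda>s. norm (\<Xi> (fst (snd (flow s v)))) powr q" and ?N = "norm (fst v) + Lp_norm p (fst (snd v))"
  have c: "continuous_on {0..\<alpha>} (\<lambda>s. norm (\<Xi> (fst (snd (flow s v)))))"
    by (intro continuous_on_norm continuous_on_subset[OF V.graph_functional_continuous[OF generates_flow hist_graph_functional[OF \<Xi>] v]]) auto
  have "continuous_on {0..\<alpha>} ?g" using q by (intro continuous_on_powr' c continuous_intros) auto
  then have "(?g has_integral integral {0..\<alpha>} ?g) {0..\<alpha>}" by (intro integrable_integral integrable_continuous_real)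
  then have "ennreal (integral {0..\<alpha>} ?g) = (\<integral>\<^sup>+\<tau>\<in>{0..\<alpha>}. ennreal (?g \<tau>) \<partial>lebesgue)"
    unfolding nn_integral_completion by (intro nn_integral_has_integral_lebesgue'[symmetric]) auto
  also have "\<dots> = (\<integral>\<^sup>+\<tau>\<in>{0..\<alpha>}. ennreal (norm (\<Xi> (semigroup_history T \<tau> (fst v) + nilpotent_shift \<tau> (fst (snd v)))) powr q) \<partial>lebesgue)"
    by (rule nn_integral_cong) (auto simp: history_shift_eq flow_def indicator_def)
  also have "\<dots> \<le> ennreal (\<gamma> powr q * ?N powr q)"
    using M state_domD[OF v] unfolding M_estimate_def delay_dom_def by fastforce
  finally have "integral {0..\<alpha>} ?g \<le> \<gamma> powr q * ?N powr q" by simp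
  then show ?thesis using \<gamma> by (simp add: powr_mult)
qed

text \<open>Stated for all small \<alpha>, so that the estimates for \<open>K\<close> and
  \<open>L\<close> can share one \<alpha>. For \<open>p\<close> a bound on a single interval is
  enough: restricted to [0, \<alpha>], Hoelder's inequality adds the factor 2 \<alpha>^(1 - 1/p),
  which tends to 0.\<close>

lemma M_condition_small:
  assumes \<Xi>: "hist_op \<Xi>" and M: "M_condition p DA T q \<Xi>" and q: "q = 1 \<or> q = p" and e: "e > 0"
  shows "\<forall>\<^sub>F \<alpha> in at_right 0. \<forall>v\<in>state_dom p DA.
    integral {0..\<alpha>} (\<lambda>s. norm (\<Xi> (fst (snd (flow s v))))) \<le> e * (norm (fst v) + Lp_norm p (fst (snd v)))"
proof (cases "q = 1")
  case True
  then obtain \<gamma> where \<gamma>: "\<forall>\<^sub>F \<alpha> in at_right 0. \<gamma> \<alpha> \<ge> 0 \<and> M_estimate p DA T 1 \<Xi> \<alpha> (\<gamma> \<alpha>)" "(\<gamma> \<longlongrightarrow> 0) (at_right 0)"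
    using M unfolding M_condition_def by blast
  from \<gamma>(1) order_tendstoD(2)[OF \<gamma>(2) e] show ?thesis
  proof eventually_elim
    case (elim \<alpha>)
    show ?case
    proof
      fix v assume v: "v \<in> state_dom p DA"
      have "integral {0..\<alpha>} (\<lambda>s. norm (\<Xi> (fst (snd (flow s v))))) \<le> \<gamma> \<alpha> * (norm (fst v) + Lp_norm p (fst (snd v)))"
        using M_estimate_integral[OF \<Xi> conjunct2[OF elim(1)] _ conjunct1[OF elim(1)] v] elim(1) by simp
      also have "\<dots> \<le> e * (norm (fst v) + Lp_norm p (fst (snd v)))" using elim by (intro mult_right_mono) auto
      finally show "integral {0..\<alpha>} (\<lambda>s. norm (\<Xi> (fst (snd (flow s v))))) \<le> e * (norm (fst v) + Lp_norm p (fst (snd v)))" .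
    qed
  qed
next
  case False
  then have qp: "q = p" using q by simp
  obtain \<alpha>0 \<gamma> where \<gamma>: "\<alpha>0 > 0" "\<gamma> \<ge> 0" "M_estimate p DA T p \<Xi> \<alpha>0 \<gamma>" using M qp unfolding M_condition_def by blast
  have "((\<lambda>\<alpha>. 2 * \<alpha> powr (1 - 1 / p) * \<gamma>) \<longlongrightarrow> 2 * 0 powr (1 - 1 / p) * \<gamma>) (at_right 0)"
    using p by (intro tendsto_intros tendsto_powr') (auto simp: eventually_at_filter)
  then have "((\<lambda>\<alpha>. 2 * \<alpha> powr (1 - 1 / p) * \<gamma>) \<longlongrightarrow> 0) (at_right 0)" by simp
  moreover have "\<forall>\<^sub>F \<alpha> in at_right 0. \<alpha> < \<alpha>0" using \<gamma>(1) by (intro eventually_at_rightI[of 0 \<alpha>0]) auto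
  ultimately have "\<forall>\<^sub>F \<alpha> in at_right 0. 2 * \<alpha> powr (1 - 1 / p) * \<gamma> < e \<and> 0 < \<alpha> \<and> \<alpha> < \<alpha>0"
    using order_tendstoD(2)[of _ 0 "at_right 0" e] e by (intro eventually_conj eventually_at_right_less) auto
  then
  show ?thesis
  proof eventually_elim
    case (elim \<alpha>)
    show ?case
    proof
      fix v assume v: "v \<in> state_dom p DA"
      let ?g = "\<lambda>s. norm (\<Xi> (fst (snd (flow s v))))" and ?N = "norm (fst v) + Lp_norm p (fst (snd v))"
      have c: "continuous_on {0..b} ?g" for b
        by (intro continuous_on_norm continuous_on_subset[OF V.graph_functional_continuous[OF generates_flow hist_graph_functional[OF \<Xi>] v]]) auto
      have cp: "continuous_on {0..b} (\<lambda>s. ?g s powr p)" for b using p by (intro continuous_on_powr' c continuous_intros) auto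
      have "integral {0..\<alpha>} (\<lambda>s. ?g s powr p) \<le> integral {0..\<alpha>0} (\<lambda>s. ?g s powr p)"
        by (rule integral_subset_le) (use elim \<gamma> integrable_continuous_real[OF cp] in auto)
      also have "\<dots> \<le> (\<gamma> * ?N) powr p" by (rule M_estimate_integral[OF \<Xi> \<gamma>(3) _ \<gamma>(2) v]) (use p in simp)
      finally have "integral {0..\<alpha>} ?g \<le> 2 * (\<alpha> - 0) powr (1 - 1 / p) * (\<gamma> * ?N)"
        using elim \<gamma> by (intro holder_interval[OF p _ _ integrable_integral[OF integrable_continuous_real[OF c]]
          integrable_integral[OF integrable_continuous_real[OF cp]]]) auto
      also have "\<dots> = 2 * \<alpha> powr (1 - 1 / p) * \<gamma> * ?N" by simp
      also have "\<dots> \<le> e * ?N" using elim by (intro mult_right_mono) auto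
      finally show "integral {0..\<alpha>} ?g \<le> e * ?N" .
    qed
  qed
qed

end

section \<open>The perturbation by \<open>K\<close>, \<open>L\<close> and the evaluation at
  0\<close>

locale delay_equation = delay_flow +
  fixes b :: "real \<Rightarrow> complex" and L :: "'a aefun \<Rightarrow> 'a" and K :: "'a aefun \<Rightarrow> 'a"
  assumes b: "class_on {0..} b \<in> W1p p {0..}" and L: "hist_op L" and K: "hist_op K"
begin

definition kernel_norm :: real where "kernel_norm = Lp_norm p (class_on {0..} b)"

definition kernel :: "'a \<Rightarrow> 'a aefun" where "kernel x = class_on {0..} (\<lambda>s. b s *\<^sub>C x)"

lemma kernel_Lp: "kernel x \<in> Lp p {0..}" and kernel_Lp_norm: "Lp_norm p (kernel x) = kernel_norm * norm x"
proof -
  let ?b = "\<lambda>s. if s \<in> {0..} then b s else 0"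
  have "Lfun p (rep_aefun (class_on {0..} b))" by (rule R.rep_Lfun[OF R.W1p_Lp[OF b]])
  then have Lb: "Lfun p ?b" by (rule Lfun_cong_AE) (rule rep_class_on)
  have nb: "kernel_norm = Np p ?b" unfolding kernel_norm_def by (rule class_on_Lp(2)[OF R.S_meas Lb])
  have eq: "(\<lambda>s. if s \<in> {0..} then b s *\<^sub>C x else 0) = (\<lambda>s. ?b s *\<^sub>C x)"
    using scaleC_of_real[of 0 x] by auto
  have "strongly_measurable lebesgue (\<lambda>s. ?b s *\<^sub>C x)"
    by (rule strongly_measurable_compose[of lebesgue ?b "\<lambda>c. c *\<^sub>C x"])
      (use Lb bounded_linear.isCont[OF bounded_bilinear.bounded_linear_left[OF bounded_bilinear_scaleC] continuous_ident] in \<open>auto simp: Lfun_def\<close>)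
  note sc = Lfun_scaled[OF Lb this, of "norm x"]
  have L: "Lfun p (\<lambda>s. if s \<in> {0..} then b s *\<^sub>C x else 0)" unfolding eq by (rule sc(1)) (auto simp: norm_scaleC)
  show "kernel x \<in> Lp p {0..}" unfolding kernel_def by (rule class_on_Lp(1)[OF R.S_meas L])
  have "Lp_norm p (kernel x) = Np p (\<lambda>s. if s \<in> {0..} then b s *\<^sub>C x else 0)"
    unfolding kernel_def by (rule class_on_Lp(2)[OF R.S_meas L])
  also have "\<dots> = norm x * Np p ?b" unfolding eq by (rule sc(2)) (auto simp: norm_scaleC)
  finally show "Lp_norm p (kernel x) = kernel_norm * norm x" using nb by simp
qed

lemma kernel_norm_nonneg: "0 \<le> kernel_norm" by (simp add: kernel_norm_def)

lemma kernel_add: "kernel (x + y) = kernel x + kernel y"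
proof (rule aefun_eqI)
  show "AE s in lebesgue. rep_aefun (kernel (x + y)) s = rep_aefun (kernel x + kernel y) s"
    using rep_class_on[of "{0..}" "\<lambda>s. b s *\<^sub>C (x + y)"] rep_class_on[of "{0..}" "\<lambda>s. b s *\<^sub>C x"]
      rep_class_on[of "{0..}" "\<lambda>s. b s *\<^sub>C y"] rep_plus[of "kernel x" "kernel y"]
    unfolding kernel_def by eventually_elim (simp add: scaleC_add_right)
qed

lemma kernel_scaleC: "kernel (c *\<^sub>C x) = c *\<^sub>C kernel x"
proof (rule aefun_eqI)
  show "AE s in lebesgue. rep_aefun (kernel (c *\<^sub>C x)) s = rep_aefun (c *\<^sub>C kernel x) s"
    using rep_class_on[of "{0..}" "\<lambda>s. b s *\<^sub>C (c *\<^sub>C x)"] rep_class_on[of "{0..}" "\<lambda>s. b s *\<^sub>C x"] rep_scaleC[of c "kernel x"]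
    unfolding kernel_def by eventually_elim (simp add: scaleC_scaleC mult.commute scaleC_zero)
qed

definition pert :: "'a \<times> 'a aefun \<times> 'a aefun \<Rightarrow> 'a \<times> 'a aefun \<times> 'a aefun"
  where "pert v = (K (fst (snd v)) + W1p_eval p {0..} (snd (snd v)) 0, 0, kernel (L (fst (snd v))))"

lemma state_op_eq: "state_op p A b L K = (\<lambda>v. free_op v + pert v)"
  by (rule ext) (simp add: state_op_def free_op_def pert_def kernel_def case_prod_unfold add.commute add.left_commute)

text \<open>Two continuous functions that agree almost everywhere on the half-line agree at 0. So
  evaluation at 0 along the flow runs through the values of \<open>h\<close>.\<close>

lemma eval_flow_third:
  assumes h: "h \<in> W1p p {0..}" and s: "0 \<le> s" and hs: "class_on {0..} (\<lambda>r. rep_aefun h (s + r)) \<in> W1p p {0..}"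
  shows "W1p_eval p {0..} (class_on {0..} (\<lambda>r. rep_aefun h (s + r))) 0 = W1p_eval p {0..} h s"
proof -
  let ?hs = "class_on {0..} (\<lambda>r. rep_aefun h (s + r))" and ?e = "W1p_eval p {0..}"
  note r = R.W1p_repI[OF h] and rs = R.W1p_repI[OF hs]
  have 1: "h = class_on {0..} (?e h)" and 2: "?hs = class_on {0..} (?e ?hs)" using r rs by (simp_all add: W1p_rep_def)
  have ae: "AE x in lebesgue. rep_aefun h x = (if x \<in> {0..} then ?e h x else 0)" using rep_class_on[of "{0..}" "?e h", folded 1] .
  have "?e ?hs 0 = ?e h (s + 0)"
  proof (rule R.continuous_eq_if_AE_eq[of "?e ?hs" "\<lambda>x. ?e h (s + x)"])
    show "continuous_on {0..} (?e ?hs)" by (rule R.W1p_rep_continuous[OF rs])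
    show "continuous_on {0..} (\<lambda>x. ?e h (s + x))"
      by (rule continuous_on_compose2[OF R.W1p_rep_continuous[OF r]]) (use s in \<open>auto intro!: continuous_intros\<close>)
    show "AE x in lebesgue. x \<in> {0..} \<longrightarrow> ?e ?hs x = ?e h (s + x)"
      using AE_shift[OF ae, of s] 2[unfolded class_on_eq_iff] by eventually_elim (use s in auto)
  qed simp
  then show ?thesis by simp
qed

lemma pert_norm: "state_norm p (pert v) = norm (K (fst (snd v)) + W1p_eval p {0..} (snd (snd v)) 0) + kernel_norm * norm (L (fst (snd v)))"
  using I.Lp.norm_scaleC_carrier[OF I.Lp.zero_closed, of 0] by (simp add: pert_def state_norm_eq kernel_Lp_norm scaleC_zero)

text \<open>Each of the three contributions to the perturbation is brought below one quarter of the
  part of the norm that it sees: norm y + norm psi for \<open>K\<close> and for the kernel term,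
  norm h for the evaluation. This gives q = 3/4.\<close>

theorem well_posed_if_M:
  assumes q: "q = 1 \<or> q = p" and mL: "M_condition p DA T q L" and mK: "M_condition p DA T q K"
  shows "well_posed p DA A b L K"
proof -
  let ?D = "state_dom p DA :: ('a \<times> 'a aefun \<times> 'a aefun) set"
  have W: "fst (snd v) \<in> W1p p {-1..0}" "snd (snd v) \<in> W1p p {0..}" if "v \<in> ?D" for v using state_domD[OF that] by auto
  obtain CK where CK: "CK \<ge> 0" "\<And>\<psi>. \<psi> \<in> W1p p {-1..0} \<Longrightarrow> norm (K \<psi>) \<le> CK * (Lp_norm p \<psi> + Lp_norm p (W1p_deriv p {-1..0} \<psi>))"
    using hist_opD(4)[OF K] by blast
  obtain CL where CL: "CL \<ge> 0" "\<And>\<psi>. \<psi> \<in> W1p p {-1..0} \<Longrightarrow> norm (L \<psi>) \<le> CL * (Lp_norm p \<psi> + Lp_norm p (W1p_deriv p {-1..0} \<psi>))"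
    using hist_opD(4)[OF L] by blast
  \<comment> \<open>Makes \<open>kernel_norm * ?eL\<close> at most 1 / 4; the summand 1 keeps the
    divisor positive when the kernel vanishes.\<close>
  let ?eL = "1 / (4 * (kernel_norm + 1))"
  have eL: "?eL > 0" using kernel_norm_nonneg by simp
  have "((\<lambda>\<alpha>. 2 * \<alpha> powr (1 - 1 / p)) \<longlongrightarrow> 2 * 0 powr (1 - 1 / p)) (at_right 0)"
    using p by (intro tendsto_intros tendsto_powr') (auto simp: eventually_at_filter)
  then have "\<forall>\<^sub>F \<alpha> in at_right 0. 2 * \<alpha> powr (1 - 1 / p) < 1 / 4" by (intro order_tendstoD(2)) auto
  from eventually_conj[OF this eventually_conj[OF eventually_at_right_less[of 0]
      eventually_conj[OF M_condition_small[OF K mK q, of "1 / 4"] M_condition_small[OF L mL q eL]]]]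
  obtain \<alpha> where \<alpha>: "2 * \<alpha> powr (1 - 1 / p) < 1 / 4" "0 < \<alpha>"
    and aK: "\<And>v. v \<in> ?D \<Longrightarrow> integral {0..\<alpha>} (\<lambda>s. norm (K (fst (snd (flow s v))))) \<le> 1 / 4 * (norm (fst v) + Lp_norm p (fst (snd v)))"
    and aL: "\<And>v. v \<in> ?D \<Longrightarrow> integral {0..\<alpha>} (\<lambda>s. norm (L (fst (snd (flow s v))))) \<le> ?eL * (norm (fst v) + Lp_norm p (fst (snd v)))"
    using eventually_happens'[OF trivial_limit_at_right_real] by fastforce
  have "\<exists>U. generates (state_space p) (state_norm p) ?D (\<lambda>v. free_op v + pert v) U"
  proof (rule V.generates_perturbation[OF generates_flow, where \<alpha> = \<alpha> and q = "3 / 4" and C = "CK + 2 + kernel_norm * CL"])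
    show "pert v \<in> state_space p" for v using R.Lp.zero_closed I.Lp.zero_closed kernel_Lp by (simp add: state_space_iff pert_def)
    show "pert (u + v) = pert u + pert v" if "u \<in> ?D" "v \<in> ?D" for u v
      using W[OF that(1)] W[OF that(2)] by (simp add: pert_def hist_opD(1)[OF K] hist_opD(1)[OF L] R.W1p_add(3) kernel_add)
    show "pert (c *\<^sub>C v) = c *\<^sub>C pert v" if "v \<in> ?D" for c v
      using W[OF that] by (simp add: pert_def scaleC_prod_def hist_opD(2)[OF K] hist_opD(2)[OF L] R.W1p_scaleC(3) kernel_scaleC scaleC_add_right scaleC_zero)
    show "state_norm p (pert v) \<le> (CK + 2 + kernel_norm * CL) * (state_norm p v + state_norm p (free_op v))" if v: "v \<in> ?D" for v
    proof -
      let ?N = "state_norm p v + state_norm p (free_op v)"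
      have a: "Lp_norm p (fst (snd v)) + Lp_norm p (W1p_deriv p {-1..0} (fst (snd v))) \<le> ?N"
        by (intro add_mono state_norm_ge state_dom_deriv_bound)
      have 1: "norm (K (fst (snd v))) \<le> CK * ?N" by (rule order_trans[OF CK(2)[OF W(1)[OF v]] mult_left_mono[OF a CK(1)]])
      have 2: "norm (L (fst (snd v))) \<le> CL * ?N" by (rule order_trans[OF CL(2)[OF W(1)[OF v]] mult_left_mono[OF a CL(1)]])
      have 3: "norm (W1p_eval p {0..} (snd (snd v)) 0) \<le> 2 * ?N"
        by (rule order_trans[OF R.W1p_eval_bound[OF W(2)[OF v], of 0]])
          (auto intro!: mult_left_mono add_mono state_norm_ge state_dom_deriv_bound)
      show ?thesis
        using norm_triangle_ineq[of "K (fst (snd v))" "W1p_eval p {0..} (snd (snd v)) 0"] 1 3 mult_left_mono[OF 2 kernel_norm_nonneg]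
        unfolding pert_norm by (simp add: algebra_simps)
    qed
    show "integral {0..\<alpha>} (\<lambda>s. state_norm p (pert (flow s v))) \<le> 3 / 4 * state_norm p v" if v: "v \<in> ?D" for v
    proof -
      let ?k = "\<lambda>s. K (fst (snd (flow s v)))" and ?l = "\<lambda>s. L (fst (snd (flow s v)))" and ?h = "\<lambda>s. W1p_eval p {0..} (snd (snd (flow s v))) 0"
      let ?N = "norm (fst v) + Lp_norm p (fst (snd v))"
      note cont = V.graph_functional_continuous[OF generates_flow _ v]
      have c: "continuous_on {0..\<alpha>} ?k" "continuous_on {0..\<alpha>} ?l" "continuous_on {0..\<alpha>} ?h"
        using continuous_on_subset[OF cont[OF hist_graph_functional[OF K]]] continuous_on_subset[OF cont[OF hist_graph_functional[OF L]]]
          continuous_on_subset[OF cont[OF eval_graph_functional]] by auto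
      note i = integrable_continuous_real[OF continuous_on_norm[OF c(1)]] integrable_continuous_real[OF continuous_on_norm[OF c(2)]]
        integrable_continuous_real[OF continuous_on_norm[OF c(3)]]
      \<comment> \<open>Since the value at 0 runs through h(s), this is an integral of norm h over
        [0, \<alpha>], which Hoelder's inequality makes small.\<close>
      have h: "integral {0..\<alpha>} (\<lambda>s. norm (?h s)) \<le> 1 / 4 * Lp_norm p (snd (snd v))"
      proof -
        have hv: "snd (snd v) = class_on {0..} (W1p_eval p {0..} (snd (snd v)))" using R.W1p_repI[OF W(2)[OF v]] by (simp add: W1p_rep_def)
        have "integral {0..\<alpha>} (\<lambda>s. norm (?h s)) = integral {0..\<alpha>} (\<lambda>s. norm (rep_aefun (snd (snd v)) s))"
        proof (rule integral_cong_AE_on)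
          show "AE s in lebesgue. s \<in> {0..\<alpha>} \<longrightarrow> norm (?h s) = norm (rep_aefun (snd (snd v)) s)"
            using rep_class_on[of "{0..}" "W1p_eval p {0..} (snd (snd v))", folded hv]
          proof eventually_elim
            case (elim s)
            show ?case
            proof
              assume s: "s \<in> {0..\<alpha>}"
              have "snd (snd (flow s v)) \<in> W1p p {0..}" by (rule W(2)[OF V.gen_orbit(1)[OF generates_flow v]]) (use s in simp)
              then have "?h s = W1p_eval p {0..} (snd (snd v)) s"
                using eval_flow_third[OF W(2)[OF v], of s] s by (simp add: flow_def)
              then show "norm (?h s) = norm (rep_aefun (snd (snd v)) s)" using elim s by simp
            qed
          qed
        qed
        also have "\<dots> \<le> 2 * (\<alpha> - 0) powr (1 - 1 / p) * Np p (rep_aefun (snd (snd v)))"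
          by (rule Lfun_interval(4)[OF R.rep_Lfun[OF R.W1p_Lp[OF W(2)[OF v]]] \<alpha>(2)])
        also have "\<dots> \<le> 1 / 4 * Lp_norm p (snd (snd v))" unfolding Lp_norm_eq using \<alpha> by (intro mult_right_mono) auto
        finally show ?thesis .
      qed
      have l: "kernel_norm * integral {0..\<alpha>} (\<lambda>s. norm (?l s)) \<le> 1 / 4 * ?N"
      proof -
        have "kernel_norm * integral {0..\<alpha>} (\<lambda>s. norm (?l s)) \<le> kernel_norm * (?eL * ?N)"
          by (rule mult_left_mono[OF aL[OF v] kernel_norm_nonneg])
        also have "\<dots> = (kernel_norm * ?eL) * ?N" by simp
        also have "\<dots> \<le> 1 / 4 * ?N" using kernel_norm_nonneg by (intro mult_right_mono) (auto simp: field_simps)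
        finally show ?thesis .
      qed
      have "integral {0..\<alpha>} (\<lambda>s. state_norm p (pert (flow s v))) \<le> integral {0..\<alpha>} (\<lambda>s. (norm (?k s) + norm (?h s)) + kernel_norm * norm (?l s))"
        unfolding pert_norm
        by (intro integral_le integrable_continuous_real continuous_intros c add_mono norm_triangle_ineq order_refl)
      also have "\<dots> = integral {0..\<alpha>} (\<lambda>s. norm (?k s)) + integral {0..\<alpha>} (\<lambda>s. norm (?h s)) + kernel_norm * integral {0..\<alpha>} (\<lambda>s. norm (?l s))"
        using i integrable_continuous_real[OF continuous_on_mult_left[OF continuous_on_norm[OF c(2)]], of kernel_norm] by (subst Henstock_Kurzweil_Integration.integral_add, simp_all add: Henstock_Kurzweil_Integration.integrable_add
          Henstock_Kurzweil_Integration.integral_add)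
      also have "\<dots> \<le> 3 / 4 * state_norm p v"
      proof -
        have "x + y + z \<le> 3 / 4 * (a + a' + a'')" if "x \<le> 1 / 4 * (a + a')" "y \<le> 1 / 4 * a''" "z \<le> 1 / 4 * (a + a')" "0 \<le> a" "0 \<le> a'" "0 \<le> a''"
          for x y z a a' a'' :: real using that by simp
        from this[OF aK[OF v] h l norm_ge_zero Lp_norm_nonneg Lp_norm_nonneg] show ?thesis unfolding state_norm_eq .
      qed
      finally show ?thesis .
    qed
  qed (use \<alpha> in auto)
  then show ?thesis by (simp add: well_posed_def state_semigroup_def state_op_eq)
qed

end

section \<open>Duhamel's formula for two generators with the same domain\<close>

lemma (in semigroup) duhamel_derivative:
  assumes w: "(w has_vector_derivative w') (at s within {0..t})" and h: "(w s, h) \<in> gen S" and s: "s \<in> {0..t}"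
  shows "((\<lambda>r. S (t - r) (w r)) has_vector_derivative S (t - s) (w' - h)) (at s within {0..t})"
  unfolding has_vector_derivative_def has_derivative_within_alt2
proof (intro conjI allI impI)
  show "bounded_linear (\<lambda>x. x *\<^sub>R S (t - s) (w' - h))" by (rule bounded_linear_scaleR_left)
  fix e :: real assume e: "e > 0"
  obtain M where M: "M \<ge> 1" "\<forall>r\<in>{0..t}. norm (S r) \<le> M" using bounded_on by auto
  have c: "continuous_on {0..t} (\<lambda>r. S (t - r) w')" by (rule continuous_on_compose) (auto intro!: continuous_intros)
  have "((\<lambda>r. t - r) has_vector_derivative -1) (at s within {0..t})"
    using has_vector_derivative_diff[OF has_vector_derivative_const[of t] has_vector_derivative_id] by simp
  moreover have "((\<lambda>r. S r (w s)) has_vector_derivative S (t - s) h) (at (t - s) within (\<lambda>r. t - r) ` {0..t})"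
    by (rule has_vector_derivative_within_subset[OF has_vector_derivative_gen[OF h]]) (use s in auto)
  ultimately have d: "((\<lambda>r. S (t - r) (w s)) has_vector_derivative - S (t - s) h) (at s within {0..t})"
    using vector_diff_chain_within[of "\<lambda>r. t - r" "-1" s "{0..t}" "\<lambda>r. S r (w s)" "S (t - s) h"] by (simp add: o_def)
  have e3: "e / 3 > 0" and e3M: "e / (3 * M) > 0" using e M by simp_all
  from w[unfolded has_vector_derivative_def has_derivative_within_alt2] e3M
  have 1: "\<forall>\<^sub>F r in at s within {0..t}. norm (w r - w s - (r - s) *\<^sub>R w') \<le> e / (3 * M) * norm (r - s)" by blast
  from d[unfolded has_vector_derivative_def has_derivative_within_alt2] e3
  have 2: "\<forall>\<^sub>F r in at s within {0..t}. norm (S (t - r) (w s) - S (t - s) (w s) - (r - s) *\<^sub>R (- S (t - s) h)) \<le> e / 3 * norm (r - s)" by blast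
  have "((\<lambda>r. S (t - r) w') \<longlongrightarrow> S (t - s) w') (at s within {0..t})" using c s by (auto simp: continuous_on)
  from tendstoD[OF this e3]
  have 3: "\<forall>\<^sub>F r in at s within {0..t}. norm (S (t - r) w' - S (t - s) w') < e / 3" by (simp add: dist_norm)
  have 4: "\<forall>\<^sub>F r in at s within {0..t}. r \<in> {0..t}" by (auto simp: eventually_at_filter)
  from 1 2 3 4 show "\<forall>\<^sub>F r in at s within {0..t}.
    norm (S (t - r) (w r) - S (t - s) (w s) - (r - s) *\<^sub>R S (t - s) (w' - h)) \<le> e * norm (r - s)"
  proof eventually_elim
    case (elim r)
    \<comment> \<open>The product rule under strong continuity: the remainder of \<open>w\<close>
      under a bounded family, the continuity of the semigroup at \<open>w'\<close>, and the
      derivative of the orbit of the fixed vector \<open>w s\<close>, which exists because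
      \<open>w s\<close> is in the domain. Each receives e / 3.\<close>
    let ?a = "w r - w s - (r - s) *\<^sub>R w'" and ?c = "S (t - r) (w s) - S (t - s) (w s) - (r - s) *\<^sub>R (- S (t - s) h)"
    let ?b = "S (t - r) w' - S (t - s) w'"
    have "S (t - r) (w r) - S (t - s) (w s) - (r - s) *\<^sub>R S (t - s) (w' - h) = S (t - r) ?a + (r - s) *\<^sub>R ?b + ?c"
      by (simp add: blinfun.diff_right blinfun.scaleR_right scaleR_diff_right)
    also have "norm \<dots> \<le> norm (S (t - r) ?a) + norm ((r - s) *\<^sub>R ?b) + norm ?c"
      by (intro norm_triangle_le add_mono norm_triangle_ineq order_refl)
    also have "norm (S (t - r) ?a) \<le> M * (e / (3 * M) * norm (r - s))"
      by (rule order_trans[OF norm_blinfun], rule mult_mono) (use M elim in auto)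
    also have "M * (e / (3 * M) * norm (r - s)) = e / 3 * norm (r - s)" using M by simp
    also have "norm ((r - s) *\<^sub>R ?b) \<le> e / 3 * norm (r - s)"
      using mult_left_mono[OF less_imp_le[OF elim(3)], of "norm (r - s)"] by (simp add: mult.commute)
    also note elim(2)
    finally show ?case by simp
  qed
qed

text \<open>Differentiate r |-> S (t - r) (T r v) in the sum space. The perturbed orbit stays in the
  common domain, so the terms with \<open>G\<close> cancel, and the term with \<open>B\<close> is
  integrated by the fundamental theorem.\<close>

lemma (in complex_carrier) duhamel:
  fixes \<Lambda> :: "'v \<Rightarrow> 'x::banach"
  assumes gS: "generates V n D G S" and gT: "generates V n D (\<lambda>v. G v + B v) T"
    and \<Lambda>: "functional \<Lambda>" and v: "v \<in> D" and t: "0 \<le> t"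
  shows "((\<lambda>s. \<Lambda> (S (t - s) (B (T s v)))) has_integral \<Lambda> (T t v) - \<Lambda> (S t v)) {0..t}"
proof -
  interpret S: semigroup "\<lambda>t. lift_op (S t)" by unfold_locales (rule strong_semigroup_lift[OF gen_C0[OF gS]])
  interpret T: semigroup "\<lambda>t. lift_op (T t)" by unfold_locales (rule strong_semigroup_lift[OF gen_C0[OF gT]])
  note dS = gen_dom[OF gS] and dT = gen_dom[OF gT] and oT = gen_orbit[OF gT v]
  have bS: "bounded_op V n V n (S t)" "bounded_op V n V n (T t)" if "t \<ge> 0" for t
    using gen_C0[OF gS] gen_C0[OF gT] that by (auto simp: C0_semigroup_def)
  let ?w = "\<lambda>s. lift_op (T s) (emb V n v)" and ?P = "\<lambda>F. \<Lambda> (prj V n F)"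
  interpret P: bounded_linear ?P by (rule functional_bounded_linear[OF \<Lambda>])
  have w: "?w s = emb V n (T s v)" if "s \<ge> 0" for s using lift_op_emb[OF bS(2)[OF that] dS(1)[OF v]] .
  have BV: "B x \<in> V" if "x \<in> D" for x using diff_closed[OF dT(2)[OF that] dS(2)[OF that]] by simp
  have der: "((\<lambda>r. ?P (lift_op (S (t - r)) (?w r))) has_vector_derivative \<Lambda> (S (t - s) (B (T s v)))) (at s within {0..t})"
    if s: "s \<in> {0..t}" for s
  proof -
    have Ts: "T s v \<in> D" and Gs: "G (T s v) + B (T s v) = T s (G v + B v)" using oT[of s] s by auto
    have "(emb V n v, emb V n (G v + B v)) \<in> gen (\<lambda>t. lift_op (T t))"
      by (rule gen_lift_emb[OF gen_C0[OF gT]]) (use gen_graph_iff[OF gT] v in simp)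
    from T.has_vector_derivative_gen[OF this, of s] s
    have dw: "(?w has_vector_derivative emb V n (G (T s v) + B (T s v))) (at s within {0..t})"
      unfolding Gs using lift_op_emb[OF bS(2)[of s] dT(2)[OF v]] by (auto intro: has_vector_derivative_within_subset)
    have "(?w s, emb V n (G (T s v))) \<in> gen (\<lambda>t. lift_op (S t))"
      using w[of s] s gen_lift_emb[OF gen_C0[OF gS], of "T s v" "G (T s v)"] gen_graph_iff[OF gS] Ts by simp
    from bounded_linear.has_vector_derivative[OF P.bounded_linear_axioms S.duhamel_derivative[OF dw this s]]
    have "((\<lambda>r. ?P (lift_op (S (t - r)) (?w r))) has_vector_derivative
        ?P (lift_op (S (t - s)) (emb V n (G (T s v) + B (T s v)) - emb V n (G (T s v))))) (at s within {0..t})" .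
    moreover have "emb V n (G (T s v) + B (T s v)) - emb V n (G (T s v)) = emb V n (B (T s v))"
      by (simp add: emb_add dS(2)[OF Ts] BV[OF Ts])
    ultimately show ?thesis using s by (simp add: prj_lift_op[OF bS(1)] prj_emb BV[OF Ts])
  qed
  have "((\<lambda>s. \<Lambda> (S (t - s) (B (T s v)))) has_integral ?P (lift_op (S (t - t)) (?w t)) - ?P (lift_op (S (t - 0)) (?w 0))) {0..t}"
    by (rule fundamental_theorem_of_calculus[OF t der])
  then show ?thesis
    using t dS(1)[OF v] dS(1)[OF oT(1)[OF t]] by (simp add: w prj_lift_op[OF bS(1)] prj_emb)
qed

text \<open>Both integrands are the derivative of the same primitive, and derivatives within a
  nondegenerate closed interval are unique, also at its ends.\<close>

lemma continuous_eq_if_integrals_eq: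
  fixes f g :: "real \<Rightarrow> 'a::banach"
  assumes f: "continuous_on {x..y} f" and g: "continuous_on {x..y} g" and xy: "x < y"
    and eq: "\<And>c. c \<in> {x..y} \<Longrightarrow> integral {x..c} f = integral {x..c} g" and t: "t \<in> {x..y}"
  shows "f t = g t"
proof -
  have "((\<lambda>c. integral {x..c} g) has_vector_derivative f t) (at t within {x..y})"
    by (rule has_vector_derivative_transform[OF t _ integral_has_vector_derivative[OF f t]]) (simp add: eq)
  then show ?thesis
    using vector_derivative_unique_within_closed_interval[of x y t _ "f t" "g t"] xy t integral_has_vector_derivative[OF g t] by auto
qed

lemma (in sobolev) integral_rep_eval:
  fixes F :: "'a::complex_banach aefun"
  assumes F: "F \<in> W1p p S" and ac: "{a..c} \<subseteq> S"
  shows "integral {a..c} (rep_aefun F) = integral {a..c} (W1p_eval p S F)"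
proof (rule integral_cong_AE_on)
  have 1: "F = class_on S (W1p_eval p S F)" using W1p_repI[OF F] by (simp add: W1p_rep_def)
  show "AE x in lebesgue. x \<in> {a..c} \<longrightarrow> rep_aefun F x = W1p_eval p S F x"
    by (rule eventually_mono[OF rep_class_on[of S "W1p_eval p S F", folded 1]]) (use ac in auto)
qed

section \<open>The three components of an orbit of the perturbed semigroup\<close>

context delay_equation
begin

abbreviation "op \<equiv> (\<lambda>v. free_op v + pert v)"

lemma pert_hist_graph_functional: "hist_op \<Xi> \<Longrightarrow> V.graph_functional (state_dom p DA) op (\<lambda>v. \<Xi> (fst (snd v)))"
proof (rule hist_graph_functional_if, assumption)
  fix v :: "'a \<times> 'a aefun \<times> 'a aefun"
  show "Lp_norm p (W1p_deriv p {-1..0} (fst (snd v))) \<le> state_norm p (op v)"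
    using state_norm_ge(2)[of "op v"] by (simp add: free_op_def pert_def)
qed

text \<open>The third component of \<open>op v\<close> is the derivative of h plus the kernel term,
  so that derivative is estimated by subtraction. The kernel term is bounded in the graph norm
  because the second component of \<open>op v\<close> is the derivative of the history.\<close>

lemma pert_eval_graph_functional: "V.graph_functional (state_dom p DA) op (\<lambda>v. W1p_eval p {0..} (snd (snd v)) 0)"
proof -
  obtain C where C: "C \<ge> 0" "\<And>\<psi>. \<psi> \<in> W1p p {-1..0} \<Longrightarrow> norm (L \<psi>) \<le> C * (Lp_norm p \<psi> + Lp_norm p (W1p_deriv p {-1..0} \<psi>))"
    using hist_opD(4)[OF L] by blast
  show ?thesis
  proof (rule eval_graph_functional_if[where C = "1 + kernel_norm * C"])
    fix v :: "'a \<times> 'a aefun \<times> 'a aefun" assume v: "v \<in> state_dom p DA"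
    let ?h' = "W1p_deriv p {0..} (snd (snd v))" and ?k = "kernel (L (fst (snd v)))" and ?N = "state_norm p v + state_norm p (op v)"
    have "Lp_norm p (fst (snd v)) + Lp_norm p (W1p_deriv p {-1..0} (fst (snd v))) \<le> ?N"
      using state_norm_ge(2)[of v] state_norm_ge(2)[of "op v"] by (simp add: free_op_def pert_def)
    from order_trans[OF C(2)[OF state_domD(2)[OF v]] mult_left_mono[OF this C(1)]]
    have "Lp_norm p ?k \<le> kernel_norm * (C * ?N)" unfolding kernel_Lp_norm by (rule mult_left_mono[OF _ kernel_norm_nonneg])
    moreover have "Lp_norm p ?h' \<le> Lp_norm p (?h' + ?k) + Lp_norm p ?k"
    proof -
      have in': "?h' \<in> Lp p {0..}" using R.W1p_deriv_Lp[OF state_domD(3)[OF v]] .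
      have k': "(-1) *\<^sub>C ?k = - ?k" using scaleC_of_real[of "-1" ?k] by simp
      have "Lp_norm p ((?h' + ?k) + (-1) *\<^sub>C ?k) \<le> Lp_norm p (?h' + ?k) + Lp_norm p ((-1) *\<^sub>C ?k)"
        using R.Lp.complete_norm[unfolded complete_norm_def, THEN conjunct2, THEN conjunct2, THEN conjunct2, THEN conjunct1]
          R.Lp.add_closed[OF in' kernel_Lp] R.Lp.scaleC_closed[OF kernel_Lp] by metis
      then show ?thesis using R.Lp.norm_scaleC_carrier[OF kernel_Lp, of "-1" "L (fst (snd v))"] by (simp add: k')
    qed
    moreover have "Lp_norm p (?h' + ?k) \<le> state_norm p (op v)"
      using state_norm_ge(3)[of "op v"] by (simp add: free_op_def pert_def)
    moreover have "0 \<le> state_norm p v" by (rule order_trans[OF norm_ge_zero state_norm_ge(1)])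
    ultimately have "Lp_norm p ?h' \<le> ?N + kernel_norm * (C * ?N)" by linarith
    then show "Lp_norm p ?h' \<le> (1 + kernel_norm * C) * ?N" by (simp add: distrib_right mult.assoc)
  qed
qed

text \<open>With the continuous representative of \<open>b\<close>, which agrees with it almost
  everywhere, the convolution integrands become continuous.\<close>

definition kern :: "real \<Rightarrow> complex" where "kern = W1p_eval p {0..} (class_on {0..} b)"

lemma kern_continuous: "continuous_on {0..} kern"
  unfolding kern_def by (rule R.W1p_rep_continuous[OF R.W1p_repI[OF b]])

lemma kern_AE: "AE x in lebesgue. x \<in> {0..} \<longrightarrow> b x = kern x"
  using R.W1p_repI[OF b] unfolding W1p_rep_def kern_def class_on_eq_iff by blast

context
  fixes \<T> assumes gT: "generates (state_space p) (state_norm p) (state_dom p DA) op \<T>"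
begin

lemmas orbit = V.gen_orbit(1)[OF gT]
lemmas orbit_W = state_domD[OF orbit]

lemma \<T>_plus: "v \<in> state_dom p DA \<Longrightarrow> 0 \<le> s \<Longrightarrow> 0 \<le> t \<Longrightarrow> \<T> (s + t) v = \<T> s (\<T> t v)"
  using V.gen_C0[OF gT] V.gen_dom(1)[OF gT] by (auto simp: C0_semigroup_def)

text \<open>Over a window that stays in \<open>[-1, 0]\<close> up to time \<open>r\<close>, the Duhamel integrand has no second
  component, so the perturbed semigroup only translates the history there.\<close>

lemma history_transport:
  assumes v: "v \<in> state_dom p DA" and r: "0 \<le> r" "r < 1" and \<theta>: "\<theta> \<in> {-1..-r}"
  shows "W1p_eval p {-1..0} (fst (snd (\<T> r v))) \<theta> = W1p_eval p {-1..0} (fst (snd v)) (\<theta> + r)"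
proof (rule continuous_eq_if_integrals_eq[of "-1" "-r" "W1p_eval p {-1..0} (fst (snd (\<T> r v)))" "\<lambda>\<theta>. W1p_eval p {-1..0} (fst (snd v)) (\<theta> + r)"])
  note W = state_domD(2)[OF v] and Wr = orbit_W(2)[OF v r(1)]
  show "continuous_on {-1..-r} (W1p_eval p {-1..0} (fst (snd (\<T> r v))))"
    by (rule continuous_on_subset[OF I.W1p_rep_continuous[OF I.W1p_repI[OF Wr]]]) (use r in auto)
  show "continuous_on {-1..-r} (\<lambda>\<theta>. W1p_eval p {-1..0} (fst (snd v)) (\<theta> + r))"
    by (rule continuous_on_compose2[OF I.W1p_rep_continuous[OF I.W1p_repI[OF W]]]) (use r in \<open>auto intro!: continuous_intros\<close>)
  fix c assume c: "c \<in> {-1..-r}"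
  have 0: "second (-1) c (flow (r - s) (pert w)) = 0" if s: "s \<in> {0..r}" for s w
  proof -
    have "second (-1) c (flow (r - s) (pert w)) = integral {-1 + (r - s)..c + (r - s)} (W (fst (pert w)) (fst (snd (pert w))))"
      by (rule second_flow) (use c r in auto)
    also have "\<dots> = integral {-1 + (r - s)..c + (r - s)} (\<lambda>_. 0)"
      by (rule integral_cong_AE_on, rule eventually_mono[OF rep_zero]) (use c s in \<open>auto simp: W_def pert_def\<close>)
    finally show ?thesis by simp
  qed
  have "((\<lambda>s. second (-1) c (flow (r - s) (pert (\<T> s v)))) has_integral second (-1) c (\<T> r v) - second (-1) c (flow r v)) {0..r}"
    using c by (intro V.duhamel[OF generates_flow gT functional_second v r(1)]) auto
  then have "((\<lambda>s. 0) has_integral second (-1) c (\<T> r v) - second (-1) c (flow r v)) {0..r}"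
    by (rule has_integral_eq[rotated]) (rule 0)
  then have "second (-1) c (\<T> r v) = second (-1) c (flow r v)" using has_integral_unique[OF has_integral_0] by fastforce
  also have "\<dots> = integral {-1 + r..c + r} (W (fst v) (fst (snd v)))" by (rule second_flow) (use c r in auto)
  also have "\<dots> = integral {-1 + r..c + r} (rep_aefun (fst (snd v)))" by (rule integral_cong) (use c in \<open>auto simp: W_def\<close>)
  also have "\<dots> = integral {-1 + r..c + r} (W1p_eval p {-1..0} (fst (snd v)))" by (rule I.integral_rep_eval[OF W]) (use c r in auto)
  also have "\<dots> = integral {-1..c} (\<lambda>\<theta>. W1p_eval p {-1..0} (fst (snd v)) (\<theta> + r))"
    using integral_shift_Icc_real[of "-1" c "W1p_eval p {-1..0} (fst (snd v))" r] by (simp add: o_def add.commute)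
  finally show "integral {-1..c} (W1p_eval p {-1..0} (fst (snd (\<T> r v)))) = integral {-1..c} (\<lambda>\<theta>. W1p_eval p {-1..0} (fst (snd v)) (\<theta> + r))"
    using I.integral_rep_eval[OF Wr, of "-1" c] c r by (simp add: second_def)
qed (use r \<theta> in auto)

text \<open>By the semigroup law, the history at time t read at \<theta> is the history at time t +
  \<theta> read at 0, and the domain condition makes that the first component. If t + \<theta> < 0,
  the initial history is transported instead.\<close>

lemma history_orbit:
  assumes v: "v \<in> state_dom p DA" and u: "\<And>t. t \<ge> 0 \<Longrightarrow> u t = fst (\<T> t v)"
    and u0: "\<And>\<theta>. \<theta> \<in> {-1..0} \<Longrightarrow> u \<theta> = W1p_eval p {-1..0} (fst (snd v)) \<theta>" and t: "t \<ge> 0"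
  shows "history u t = fst (snd (\<T> t v))"
proof -
  have "history u t = class_on {-1..0} (W1p_eval p {-1..0} (fst (snd (\<T> t v))))"
    unfolding history_def class_on_eq_iff
  proof -
    \<comment> \<open>Transport is available for shifts shorter than 1, so the single point -1 is
      left out.\<close>
    have "AE \<theta> in lebesgue. \<theta> \<notin> {-1::real}" by (rule AE_not_in) auto
    then show "AE \<theta> in lebesgue. \<theta> \<in> {-1..0} \<longrightarrow> u (t + \<theta>) = W1p_eval p {-1..0} (fst (snd (\<T> t v))) \<theta>"
    proof eventually_elim
      case (elim \<theta>)
      show ?case
      proof
        assume \<theta>: "\<theta> \<in> {-1..0}"
        then have \<theta>1: "-1 < \<theta>" using elim by auto
        show "u (t + \<theta>) = W1p_eval p {-1..0} (fst (snd (\<T> t v))) \<theta>"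
        proof (cases "t + \<theta> \<ge> 0")
          case True
          have "\<T> t v = \<T> (- \<theta>) (\<T> (t + \<theta>) v)" using \<T>_plus[OF v, of "- \<theta>" "t + \<theta>"] True \<theta> by simp
          then have "W1p_eval p {-1..0} (fst (snd (\<T> t v))) \<theta> = W1p_eval p {-1..0} (fst (snd (\<T> (t + \<theta>) v))) 0"
            using history_transport[OF orbit[OF v True], of "- \<theta>" \<theta>] \<theta> \<theta>1 by simp
          also have "\<dots> = fst (\<T> (t + \<theta>) v)" by (rule orbit_W(4)[OF v True])
          finally show ?thesis using u[OF True] by simp
        next
          case False
          then show ?thesis using history_transport[OF v t, of \<theta>] u0[of "t + \<theta>"] \<theta> \<theta>1 t by (simp add: add.commute)
        qed
      qed
    qed
  qed
  also have "\<dots> = fst (snd (\<T> t v))" using I.W1p_repI[OF orbit_W(2)[OF v t]] by (simp add: W1p_rep_def)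
  finally show ?thesis .
qed

text \<open>Evaluation at 0 is not bounded in the state norm, so Duhamel's formula is tested with
  integrals over [0, c] first. The unperturbed part vanishes because the third component starts at
  0. After exchanging the integrals, both sides are primitives in \<open>c\<close> of continuous
  functions, which therefore agree at 0.\<close>

lemma eval_third_orbit:
  assumes v: "v \<in> state_dom p DA" "snd (snd v) = 0" and t: "t \<ge> 0"
  shows "W1p_eval p {0..} (snd (snd (\<T> t v))) 0 = integral {0..t} (\<lambda>s. kern (t - s) *\<^sub>C L (fst (snd (\<T> s v))))"
proof -
  let ?l = "\<lambda>s. L (fst (snd (\<T> s v)))"
  let ?J = "\<lambda>r. integral {0..t} (\<lambda>s. kern (t - s + r) *\<^sub>C ?l s)"
  have cl: "continuous_on {0..} ?l" by (rule V.graph_functional_continuous[OF gT pert_hist_graph_functional[OF L] v(1)])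
  have c2: "continuous_on ({0..t} \<times> {0..1}) (\<lambda>z. kern (t - fst z + snd z) *\<^sub>C ?l (fst z))"
    by (rule bounded_bilinear.continuous_on[OF bounded_bilinear_scaleC continuous_on_compose2[OF kern_continuous] continuous_on_compose2[OF cl]])
      (auto intro!: continuous_intros)
  have cJ: "continuous_on {0..1} ?J"
  proof -
    have "continuous_on ({0..1} \<times> cbox 0 t) (\<lambda>(r, s). kern (t - s + r) *\<^sub>C ?l s)"
      unfolding case_prod_unfold
      by (rule bounded_bilinear.continuous_on[OF bounded_bilinear_scaleC continuous_on_compose2[OF kern_continuous] continuous_on_compose2[OF cl]])
        (auto intro!: continuous_intros)
    from integral_continuous_on_param[OF this] show ?thesis by simp
  qed
  have "W1p_eval p {0..} (snd (snd (\<T> t v))) 0 = ?J 0"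
  proof (rule continuous_eq_if_integrals_eq[of 0 1 "W1p_eval p {0..} (snd (snd (\<T> t v)))" ?J])
    note W = orbit_W(3)[OF v(1) t]
    show "continuous_on {0..1} (W1p_eval p {0..} (snd (snd (\<T> t v))))"
      by (rule continuous_on_subset[OF R.W1p_rep_continuous[OF R.W1p_repI[OF W]]]) auto
    fix c :: real assume c: "c \<in> {0..1}"
    have d: "((\<lambda>s. third 0 c (flow (t - s) (pert (\<T> s v)))) has_integral third 0 c (\<T> t v) - third 0 c (flow t v)) {0..t}"
      using c by (intro V.duhamel[OF generates_flow gT functional_third v(1) t]) auto
    have th: "third 0 c (flow (t - s) (pert (\<T> s v))) = integral {0..c} (\<lambda>r. kern (t - s + r) *\<^sub>C ?l s)" if s: "s \<in> {0..t}" for s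
    proof -
      have "third 0 c (flow (t - s) (pert (\<T> s v))) = integral {0 + (t - s)..c + (t - s)} (rep_aefun (kernel (?l s)))"
        using third_flow[of 0 c "t - s" "pert (\<T> s v)"] by (simp add: pert_def)
      also have "\<dots> = integral {0 + (t - s)..c + (t - s)} (\<lambda>r. kern r *\<^sub>C ?l s)"
      proof (rule integral_cong_AE_on)
        show "AE r in lebesgue. r \<in> {0 + (t - s)..c + (t - s)} \<longrightarrow> rep_aefun (kernel (?l s)) r = kern r *\<^sub>C ?l s"
          using kern_AE rep_class_on[of "{0..}" "\<lambda>r. b r *\<^sub>C ?l s"] unfolding kernel_def
          by eventually_elim (use s in auto)
      qed
      also have "\<dots> = integral {0..c} (\<lambda>r. kern (t - s + r) *\<^sub>C ?l s)"
        using integral_shift_Icc_real[of 0 c "\<lambda>r. kern r *\<^sub>C ?l s" "t - s"] by (simp add: o_def)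
      finally show ?thesis .
    qed
    have "third 0 c (flow t v) = integral {0 + t..c + t} (rep_aefun 0)" using third_flow[of 0 c t v] v(2) by simp
    also have "\<dots> = integral {0 + t..c + t} (\<lambda>_. 0)" by (rule integral_cong_AE_on, rule eventually_mono[OF rep_zero]) auto
    finally have "third 0 c (flow t v) = 0" by simp
    with d have "third 0 c (\<T> t v) = integral {0..t} (\<lambda>s. third 0 c (flow (t - s) (pert (\<T> s v))))" by (simp add: integral_unique)
    also have "\<dots> = integral {0..t} (\<lambda>s. integral {0..c} (\<lambda>r. kern (t - s + r) *\<^sub>C ?l s))" by (rule integral_cong) (rule th)
    also have "\<dots> = integral {0..c} (\<lambda>r. integral {0..t} (\<lambda>s. kern (t - s + r) *\<^sub>C ?l s))"
    proof -
      have "continuous_on (cbox (0, 0) (t, c)) (\<lambda>(s, r). kern (t - s + r) *\<^sub>C ?l s)"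
        unfolding case_prod_unfold cbox_Pair_eq by (rule continuous_on_subset[OF c2]) (use c in \<open>auto simp: mem_Times_iff\<close>)
      from integral_swap_continuous[OF this] show ?thesis by simp
    qed
    finally have "integral {0..c} (rep_aefun (snd (snd (\<T> t v)))) = integral {0..c} ?J" by (simp add: third_def)
    then show "integral {0..c} (W1p_eval p {0..} (snd (snd (\<T> t v)))) = integral {0..c} ?J"
      using R.integral_rep_eval[OF W, of 0 c] by simp
  qed (use cJ in auto)
  then show ?thesis by simp
qed

text \<open>The first component of Duhamel's formula. The continuity statements allow splitting its
  integral and later give strong integrability.\<close>

lemma first_orbit:
  assumes v: "v \<in> state_dom p DA" and t: "t \<ge> 0"
  shows "fst (\<T> t v) = T t (fst v) + integral {0..t} (\<lambda>s. T (t - s) (W1p_eval p {0..} (snd (snd (\<T> s v))) 0)) +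
      integral {0..t} (\<lambda>s. T (t - s) (K (fst (snd (\<T> s v)))))"
    and "continuous_on {0..t} (\<lambda>s. T (t - s) (W1p_eval p {0..} (snd (snd (\<T> s v))) 0))"
    and "continuous_on {0..t} (\<lambda>s. T (t - s) (K (fst (snd (\<T> s v)))))"
proof -
  let ?e = "\<lambda>s. W1p_eval p {0..} (snd (snd (\<T> s v))) 0" and ?k = "\<lambda>s. K (fst (snd (\<T> s v)))"
  have c: "continuous_on {0..t} (\<lambda>s. T (t - s) (f s))" if "continuous_on {0..} f" for f
  proof -
    have "continuous_on {0..t} (\<lambda>s. TT (t - s) (f s))"
      by (rule TT.continuous_on_compose) (auto intro!: continuous_intros continuous_on_subset[OF that])
    then show ?thesis by (rule continuous_on_eq) (simp add: TT_apply)
  qed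
  show ce: "continuous_on {0..t} (\<lambda>s. T (t - s) (?e s))"
    by (rule c[OF V.graph_functional_continuous[OF gT pert_eval_graph_functional v]])
  show ck: "continuous_on {0..t} (\<lambda>s. T (t - s) (?k s))"
    by (rule c[OF V.graph_functional_continuous[OF gT pert_hist_graph_functional[OF K] v]])
  have "((\<lambda>s. fst (flow (t - s) (pert (\<T> s v)))) has_integral fst (\<T> t v) - fst (flow t v)) {0..t}"
    by (rule V.duhamel[OF generates_flow gT functional_fst v t])
  then have "fst (\<T> t v) = T t (fst v) + integral {0..t} (\<lambda>s. fst (flow (t - s) (pert (\<T> s v))))"
    by (simp add: flow_def integral_unique)
  also have "integral {0..t} (\<lambda>s. fst (flow (t - s) (pert (\<T> s v)))) = integral {0..t} (\<lambda>s. T (t - s) (?e s) + T (t - s) (?k s))"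
    by (rule integral_cong) (simp add: flow_def pert_def T_add add.commute)
  also have "\<dots> = integral {0..t} (\<lambda>s. T (t - s) (?e s)) + integral {0..t} (\<lambda>s. T (t - s) (?k s))"
    by (intro Henstock_Kurzweil_Integration.integral_add integrable_continuous_real ce ck)
  finally show "fst (\<T> t v) = T t (fst v) + integral {0..t} (\<lambda>s. T (t - s) (?e s)) + integral {0..t} (\<lambda>s. T (t - s) (?k s))"
    by (simp add: add.assoc)
qed

end

text \<open>\<open>\<T>\<close> is an arbitrary semigroup generated by the state operator. The orbit
  lemmas express everything by continuous integrands; the strong integrals over \<open>b\<close> and
  \<open>history u\<close> differ from these on null sets at most.\<close>

theorem solution_formula:
  assumes T: "state_semigroup p DA A b L K \<T>" and x: "x \<in> DA" and \<phi>: "\<phi> \<in> W1p p {-1..0}"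
    and u: "delay_solution p \<T> x \<phi> u" and t: "t \<ge> 0"
  shows "history u t \<in> W1p p {-1..0}"
    and "strong_integrable (lebesgue_on {0..t}) (\<lambda>\<tau>. b (t - \<tau>) *\<^sub>C L (history u \<tau>))"
    and "strong_integrable (lebesgue_on {0..t}) (\<lambda>s. T (t - s)
      (strong_integral (lebesgue_on {0..s}) (\<lambda>\<tau>. b (s - \<tau>) *\<^sub>C L (history u \<tau>))))"
    and "strong_integrable (lebesgue_on {0..t}) (\<lambda>s. T (t - s) (K (history u s)))"
    and "u t = T t x + strong_integral (lebesgue_on {0..t}) (\<lambda>s. T (t - s)
        (strong_integral (lebesgue_on {0..s}) (\<lambda>\<tau>. b (s - \<tau>) *\<^sub>C L (history u \<tau>))))
      + strong_integral (lebesgue_on {0..t}) (\<lambda>s. T (t - s) (K (history u s)))"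
proof -
  let ?v = "(x, \<phi>, 0 :: 'a aefun)"
  have gT: "generates (state_space p) (state_norm p) (state_dom p DA) op \<T>"
    using T by (simp add: state_semigroup_def state_op_eq)
  \<comment> \<open>\<open>delay_solution\<close> prescribes \<open>u 0\<close> twice, as
    \<open>x\<close> and as the value of \<phi> at 0; this puts the initial state into the
    domain.\<close>
  have "W1p_eval p {-1..0} \<phi> 0 = x" using u unfolding delay_solution_def by force
  then have v: "?v \<in> state_dom p DA" using x \<phi> by (simp add: state_dom_def R.W1p_zero)
  have ut: "u t = fst (\<T> t ?v)" if "t \<ge> 0" for t using u that by (simp add: delay_solution_def)
  have hist: "history u t = fst (snd (\<T> t ?v))" if "t \<ge> 0" for t
    by (rule history_orbit[OF gT v ut]) (use u that in \<open>auto simp: delay_solution_def\<close>)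
  show "history u t \<in> W1p p {-1..0}" using orbit_W(2)[OF gT v t] hist[OF t] by simp
  let ?e = "\<lambda>s. W1p_eval p {0..} (snd (snd (\<T> s ?v))) 0"
  have inner: "strong_integrable (lebesgue_on {0..s}) (\<lambda>\<tau>. b (s - \<tau>) *\<^sub>C L (history u \<tau>))"
    "strong_integral (lebesgue_on {0..s}) (\<lambda>\<tau>. b (s - \<tau>) *\<^sub>C L (history u \<tau>)) = ?e s" if s: "s \<ge> 0" for s
  proof -
    let ?f = "\<lambda>\<tau>. kern (s - \<tau>) *\<^sub>C L (fst (snd (\<T> \<tau> ?v)))"
    have "continuous_on {0..s} ?f"
      by (rule bounded_bilinear.continuous_on[OF bounded_bilinear_scaleC continuous_on_compose2[OF kern_continuous]
          continuous_on_subset[OF V.graph_functional_continuous[OF gT pert_hist_graph_functional[OF L] v]]])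
        (auto intro!: continuous_intros)
    then have si: "strong_integrable (lebesgue_on {0..s}) ?f" by (rule strong_integrable_continuous)
    \<comment> \<open>Reflection at \<open>s\<close> preserves null sets, so \<open>b\<close> may be
      exchanged for \<open>kern\<close> inside the convolution.\<close>
    have "AE \<tau> in lebesgue. s - \<tau> \<in> {0..} \<longrightarrow> b (s - \<tau>) = kern (s - \<tau>)"
      using AE_lebesgue_affine[OF kern_AE, of "-1" s] by simp
    then have ae: "AE \<tau> in lebesgue. \<tau> \<in> {0..s} \<longrightarrow> ?f \<tau> = b (s - \<tau>) *\<^sub>C L (history u \<tau>)"
      by eventually_elim (use hist in auto)
    show "strong_integrable (lebesgue_on {0..s}) (\<lambda>\<tau>. b (s - \<tau>) *\<^sub>C L (history u \<tau>))"
      by (rule strong_integrable_cong_AE(1)[OF si ae])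
    show "strong_integral (lebesgue_on {0..s}) (\<lambda>\<tau>. b (s - \<tau>) *\<^sub>C L (history u \<tau>)) = ?e s"
      using strong_integrable_cong_AE(2)[OF si ae] strong_integral_eq(2)[OF si] eval_third_orbit[OF gT v _ s] by simp
  qed
  show "strong_integrable (lebesgue_on {0..t}) (\<lambda>\<tau>. b (t - \<tau>) *\<^sub>C L (history u \<tau>))" by (rule inner(1)[OF t])
  note f = first_orbit[OF gT v t]
  note se = strong_integrable_continuous[OF f(2)] and sk = strong_integrable_continuous[OF f(3)]
  have ae: "AE s in lebesgue. s \<in> {0..t} \<longrightarrow> T (t - s) (?e s) = T (t - s)
      (strong_integral (lebesgue_on {0..s}) (\<lambda>\<tau>. b (s - \<tau>) *\<^sub>C L (history u \<tau>)))"
    by (intro AE_I2) (simp add: inner(2))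
  have ak: "AE s in lebesgue. s \<in> {0..t} \<longrightarrow> T (t - s) (K (fst (snd (\<T> s ?v)))) = T (t - s) (K (history u s))"
    by (intro AE_I2) (simp add: hist)
  show "strong_integrable (lebesgue_on {0..t}) (\<lambda>s. T (t - s)
      (strong_integral (lebesgue_on {0..s}) (\<lambda>\<tau>. b (s - \<tau>) *\<^sub>C L (history u \<tau>))))" by (rule strong_integrable_cong_AE(1)[OF se ae])
  show "strong_integrable (lebesgue_on {0..t}) (\<lambda>s. T (t - s) (K (history u s)))" by (rule strong_integrable_cong_AE(1)[OF sk ak])
  show "u t = T t x + strong_integral (lebesgue_on {0..t}) (\<lambda>s. T (t - s)
        (strong_integral (lebesgue_on {0..s}) (\<lambda>\<tau>. b (s - \<tau>) *\<^sub>C L (history u \<tau>))))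
      + strong_integral (lebesgue_on {0..t}) (\<lambda>s. T (t - s) (K (history u s)))"
    using f(1) ut[OF t] unfolding strong_integrable_cong_AE(2)[OF se ae] strong_integrable_cong_AE(2)[OF sk ak]
      strong_integral_eq(2)[OF se] strong_integral_eq(2)[OF sk] by simp
qed

end

theorem mainTheorem1:
  fixes p :: real
    and A :: "'a::complex_banach \<Rightarrow> 'a" and DA :: "'a set"
    and T :: "real \<Rightarrow> 'a \<Rightarrow> 'a"
    and b :: "real \<Rightarrow> complex"
    and L K :: "'a aefun \<Rightarrow> 'a"
  assumes "1 < p"
    and "generates UNIV norm DA A T"
    and "class_on {0..} b \<in> W1p p {0..}"
    and "bounded_op (W1p p {-1..0}) (W1p_norm p {-1..0}) UNIV norm L"
    and "bounded_op (W1p p {-1..0}) (W1p_norm p {-1..0}) UNIV norm K"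
    and "(M_condition p DA T 1 L \<and> M_condition p DA T 1 K) \<or>
         (M_condition p DA T p L \<and> M_condition p DA T p K)"
  shows "well_posed p DA A b L K \<and>
    (\<forall>\<T>. state_semigroup p DA A b L K \<T> \<longrightarrow>
      (\<forall>x\<in>DA. \<forall>\<phi>\<in>W1p p {-1..0}. \<forall>u. delay_solution p \<T> x \<phi> u \<longrightarrow>
        (\<forall>t\<ge>0. history u t \<in> W1p p {-1..0}) \<and>
        (\<forall>t\<ge>0.
          strong_integrable (lebesgue_on {0..t}) (\<lambda>\<tau>. b (t - \<tau>) *\<^sub>C L (history u \<tau>)) \<and>
          strong_integrable (lebesgue_on {0..t}) (\<lambda>s. T (t - s)
            (strong_integral (lebesgue_on {0..s}) (\<lambda>\<tau>. b (s - \<tau>) *\<^sub>C L (history u \<tau>)))) \<and>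
          strong_integrable (lebesgue_on {0..t}) (\<lambda>s. T (t - s) (K (history u s))) \<and>
          u t = T t x
            + strong_integral (lebesgue_on {0..t}) (\<lambda>s. T (t - s)
                (strong_integral (lebesgue_on {0..s}) (\<lambda>\<tau>. b (s - \<tau>) *\<^sub>C L (history u \<tau>))))
            + strong_integral (lebesgue_on {0..t}) (\<lambda>s. T (t - s) (K (history u s))))))"
proof -
  interpret delay_flow p DA A T by unfold_locales (use assms(1,2) in auto)
  interpret delay_equation p DA A T b L K by unfold_locales (use assms(3-5) in auto)
  have "well_posed p DA A b L K" using assms(6) well_posed_if_M[of 1] well_posed_if_M[of p] by auto
  moreover note solution_formula
  ultimately show ?thesis by (intro conjI allI impI ballI) assumption+
qed

end
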